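(* Let $1<p,q<\infty$ and let $\sigma,w$ be Radon measures on $\mathbb{R}^N$ satisfying the quadratic $\mathscr{A}^*_{p,q}$-condition, i.e. $[\sigma,w]^*_{p,q}<\infty$. Let $\mathscr{T}$ be a collection of dyadic shifts $T^\sigma$ with complexities at most $\kappa$, every one of which is of the specific form $T^\sigma f=\sum_{K\in\mathscr{D}}A_K^\sigma f$ with $$A_K^\sigma f=\sum_{\substack{I,J\in\mathscr{D}:\ I^{(m)}=J^{(n)}=K\\ I\vee J=K}}a_{IJK}\langle f,h_I^J\rangle_\sigma h_J^I .$$ Then $\mathscr{T}$ is $\mathcal{R}$-bounded from $L^p(\sigma)$ into $L^q(w)$ if and only if it satisfies the quadratic testing conditions: there are finite constants $\mathcal{T}^\sigma$ and $\mathcal{T}^w$ such that for every $U\in\{1,2,\dots\}$ and all sequences $(a_u)_{u=1}^U\subset\mathbb{R}$, $(T_u^\sigma)_{u=1}^U\subset\mathscr{T}$ and $(Q_u)_{u=1}^U\subset\mathscr{D}$ (repetitions allowed), $$\Big\|\Big(\sum_{u=1}^U (a_u1_{Q_u}T_u^\sigma 1_{Q_u})^2\Big)^{1/2}\Big\|_{L^q(w)}\le \mathcal{T}^\sigma\Big\|\Big(\sum_{u=1}^U a_u^21_{Q_u}\Big)^{1/2}\Big\|_{L^p(\sigma)}$$ and $$\Big\|\Big(\sum_{u=1}^U (a_u1_{Q_u}T_u^w 1_{Q_u})^2\Big)^{1/2}\Big\|_{L^{p'}(\sigma)}\le \mathcal{T}^w\Big\|\Big(\sum_{u=1}^U a_u^21_{Q_u}\Big)^{1/2}\Big\|_{L^{q'}(w)},$$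 where $T_u^w$ is the formal adjoint of $T_u^\sigma$. In this case, with $\mathcal{T}^\sigma,\mathcal{T}^w$ the best possible constants, $$\mathcal{R}(\mathscr{T})\lesssim(1+\kappa)(\mathcal{T}^\sigma+\mathcal{T}^w)+(1+\kappa)^2[\sigma,w]^*_{p,q},$$ where the implicit constant depends only on $p$, $q$ and $N$.
   Context: All functions are real valued; $p',q'$ are the Hölder conjugate exponents of $p,q$. Dyadic lattice. A dyadic lattice $\mathscr{D}=\bigcup_{k\in\mathbb{Z}}\mathscr{D}_k$ on $\mathbb{R}^N$ is fixed: each $\mathscr{D}_k$ is a disjoint cover of $\mathbb{R}^N$ by cubes of the form $x+[0,2^{-k})^N$, and every cube in $\mathscr{D}_k$ is a union of $2^N$ cubes of $\mathscr{D}_{k+1}$ (its dyadic children). $|Q|$ is the Lebesgue measure of $Q$. For $Q\in\mathscr{D}_k$, $Q^{(0)}=Q$, and for $r\ge1$, $Q^{(r)}$ is the unique cube in $\mathscr{D}_{k-r}$ containing $Q$. $I\vee J$ denotes the smallest cube (if it exists) in $\mathscr{D}$ containing both $I$ and $J$. Haar functions. For an interval $I\subset\mathbb{R}$, $h_I^0:=|I|^{-1/2}1_I$ and $h_I^1:=|I|^{-1/2}(1_{I_l}-1_{I_r})$, with $I_l,I_r$ the left and right halves of $I$. For a cube $Q=I_1\times\dots\times I_N\in\mathscr{D}$ and $\eta\in\{0,1\}^N$, $h_Q^\eta(x):=\prod_{i=1}^N h_{I_i}^{\eta_i}(x_i)$. Any of the functions $h_Q^\eta$, $\eta\in\{0,1\}^N$,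 is called a Haar function related to $Q$. Dyadic shifts. Write $\langle f,g\rangle_\mu=\int fg\,d\mu$. Fix integers $m,n\ge0$. A dyadic shift with parameters $(m,n)$ is an operator $T^\sigma f=\sum_{K\in\mathscr{D}}A_K^\sigma f$, $f\in L^1_{loc}(\sigma)$, where $$A_K^\sigma f=\sum_{I,J\in\mathscr{D}:\ I^{(m)}=J^{(n)}=K}a_{IJK}\langle f,h_I^J\rangle_\sigma h_J^I,$$ $h_I^J$ is some Haar function related to the cube $I$, $h_J^I$ is some Haar function related to the cube $J$ (arbitrary choices, which may depend on the pair $(I,J)$), $a_{IJK}\in\mathbb{R}$ satisfy $|a_{IJK}|\le \sqrt{|I||J|}/|K|$, and only finitely many $K\in\mathscr{D}$ have some non-zero coefficient $a_{IJK}$. Its formal adjoint is $T^w g=\sum_K A_K^w g$, $g\in L^1_{loc}(w)$, with $A_K^wg=\sum_{I^{(m)}=J^{(n)}=K}a_{IJK}\langle g,h_J^I\rangle_w h_I^J$. The complexity of the shift is $\max\{m,n\}$. The specific form in the claim means that in addition only pairs with $I\vee J=K$ (i.e. $I$ and $J$ are contained in different children of $K$) appear in the sums. Different shifts in $\mathscr{T}$ may have different parameters. Quadratic $\mathscr{A}^*_{p,q}$-condition. For each $Q\in\mathscr{D}$ let $Q_1,\dots,Q_{2^N}$ be its dyadic children, in some fixed but arbitrary order (which may differ from cube to cube). $[\sigma,w]^*_{p,q}\in[0,\infty]$ is the best constant such that for all $k,l\in\{1,\dots,2^N\}$ with $k\ne l$ and every collection $\{a_Q\}_{Q\in\mathscr{D}}\subset\mathbb{R}$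 $$\Big\|\Big(\sum_{Q\in\mathscr{D}}\Big(a_Q\frac{\sigma(Q_k)}{|Q_k|}\Big)^21_{Q_l}\Big)^{1/2}\Big\|_{L^q(w)}\le[\sigma,w]^*_{p,q}\Big\|\Big(\sum_{Q\in\mathscr{D}}a_Q^21_{Q_k}\Big)^{1/2}\Big\|_{L^p(\sigma)}.$$ $\mathcal{R}$-boundedness. Let $(\varepsilon_u)_{u\ge1}$ be independent random signs ($\mathbb{P}(\varepsilon_u=\pm1)=1/2$), $\mathbb{E}$ the expectation. A family $\mathscr{T}$ of linear operators from a Banach space $X$ into a Banach space $Y$ is $\mathcal{R}$-bounded if there is a constant $C$ such that $\mathbb{E}\|\sum_{u=1}^U\varepsilon_uT_ux_u\|_Y\le C\,\mathbb{E}\|\sum_{u=1}^U\varepsilon_ux_u\|_X$ for all $U\in\{1,2,\dots\}$, $(T_u)_{u=1}^U\subset\mathscr{T}$, $(x_u)_{u=1}^U\subset X$; the smallest such $C$ is $\mathcal{R}(\mathscr{T})$. Here $X=L^p(\sigma)$, $Y=L^q(w)$. *)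

theory Defs
  imports "HOL-Probability.Probability"
begin

section \<open>Dyadic lattices\<close>

type_synonym 'n point_set = "(real ^ 'n) set"

text \<open>The \<open>k\<close>-th component of a lattice is the generation of cubes of side length \<open>2\<^sup>-\<^sup>k\<close>.\<close>
type_synonym 'n lattice = "int \<Rightarrow> 'n point_set set"

definition cube :: "real ^ 'n \<Rightarrow> real \<Rightarrow> 'n::finite point_set" where
  "cube x l = {y. \<forall>i. x $ i \<le> y $ i \<and> y $ i < x $ i + l}"

definition dyadic_lattice :: "'n::finite lattice \<Rightarrow> bool" where
  "dyadic_lattice D \<longleftrightarrow>
     (\<forall>k. partition_on UNIV (D k) \<and>
          (\<forall>Q\<in>D k. \<exists>x. Q = cube x (2 powi (- k))) \<and>
          (\<forall>Q\<in>D k. \<exists>F\<subseteq>D (k + 1). card F = 2 ^ CARD('n) \<and> Q = \<Union>F))"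

definition cubes :: "'n::finite lattice \<Rightarrow> 'n point_set set" where
  "cubes D = (\<Union>k. D k)"

abbreviation vol :: "'n::finite point_set \<Rightarrow> real" where
  "vol Q \<equiv> measure lborel Q"

definition ancestor :: "'n::finite lattice \<Rightarrow> nat \<Rightarrow> 'n point_set \<Rightarrow> 'n point_set" where
  "ancestor D r Q = (THE R. \<exists>k. Q \<in> D k \<and> R \<in> D (k - int r) \<and> Q \<subseteq> R)"

definition children :: "'n::finite lattice \<Rightarrow> 'n point_set \<Rightarrow> 'n point_set set" where
  "children D Q = {R. \<exists>k. Q \<in> D k \<and> R \<in> D (k + 1) \<and> R \<subseteq> Q}"

text \<open>An enumeration of the dyadic children of every cube, numbered from 1.\<close>
definition child_enumeration ::
    "'n::finite lattice \<Rightarrow> ('n point_set \<Rightarrow> nat \<Rightarrow> 'n point_set) \<Rightarrow> bool" where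
  "child_enumeration D ch \<longleftrightarrow>
     (\<forall>Q\<in>cubes D. bij_betw (ch Q) {1..2 ^ CARD('n)} (children D Q))"

text \<open>\<open>I \<or> J\<close> exists and equals \<open>K\<close>.\<close>
definition is_join :: "'n::finite lattice \<Rightarrow> 'n point_set \<Rightarrow> 'n point_set \<Rightarrow> 'n point_set \<Rightarrow> bool" where
  "is_join D I J K \<longleftrightarrow>
     K \<in> cubes D \<and> I \<subseteq> K \<and> J \<subseteq> K \<and> (\<forall>L\<in>cubes D. I \<subseteq> L \<and> J \<subseteq> L \<longrightarrow> K \<subseteq> L)"


section \<open>Haar functions\<close>

text \<open>\<open>haar1 e a l\<close> is the one-dimensional function \<open>h\<^sub>I\<^sup>e\<close> on the interval \<open>I = [a, a + l)\<close>;
  the superscripts 0 and 1 are coded by \<open>False\<close> and \<open>True\<close>.\<close>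
definition haar1 :: "bool \<Rightarrow> real \<Rightarrow> real \<Rightarrow> real \<Rightarrow> real" where
  "haar1 e a l t =
     (if e then (indicator {a..<a + l / 2} t - indicator {a + l / 2..<a + l} t) / sqrt l
      else indicator {a..<a + l} t / sqrt l)"

definition haar :: "('n \<Rightarrow> bool) \<Rightarrow> real ^ 'n \<Rightarrow> real \<Rightarrow> real ^ 'n::finite \<Rightarrow> real" where
  "haar \<eta> x l y = (\<Prod>i\<in>UNIV. haar1 (\<eta> i) (x $ i) l (y $ i))"

definition haar_related :: "'n::finite point_set \<Rightarrow> (real ^ 'n \<Rightarrow> real) \<Rightarrow> bool" where
  "haar_related Q h \<longleftrightarrow> (\<exists>x l \<eta>. l > 0 \<and> Q = cube x l \<and> h = haar \<eta> x l)"


section \<open>Dyadic shifts\<close>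

text \<open>A shift is given by its parameters \<open>(m, n)\<close>, its coefficients \<open>a\<^sub>I\<^sub>J\<^sub>K\<close> and its Haar
  functions: \<open>haar_in S I J\<close> is \<open>h\<^sub>I\<^sup>J\<close>, related to \<open>I\<close>, and \<open>haar_out S I J\<close> is \<open>h\<^sub>J\<^sup>I\<close>, related
  to \<open>J\<close>. Together with the measures these data determine both the operator and its formal
  adjoint.\<close>
record ('n::finite) shift_data =
  par_m :: nat
  par_n :: nat
  coef :: "(real ^ 'n) set \<Rightarrow> (real ^ 'n) set \<Rightarrow> (real ^ 'n) set \<Rightarrow> real"
  haar_in :: "(real ^ 'n) set \<Rightarrow> (real ^ 'n) set \<Rightarrow> real ^ 'n \<Rightarrow> real"
  haar_out :: "(real ^ 'n) set \<Rightarrow> (real ^ 'n) set \<Rightarrow> real ^ 'n \<Rightarrow> real"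

definition shift_pairs ::
    "'n::finite lattice \<Rightarrow> 'n shift_data \<Rightarrow> 'n point_set \<Rightarrow> ('n point_set \<times> 'n point_set) set" where
  "shift_pairs D S K =
     {(I, J). I \<in> cubes D \<and> J \<in> cubes D \<and>
              ancestor D (par_m S) I = K \<and> ancestor D (par_n S) J = K}"

definition dyadic_shift :: "'n::finite lattice \<Rightarrow> 'n shift_data \<Rightarrow> bool" where
  "dyadic_shift D S \<longleftrightarrow>
     (\<forall>K\<in>cubes D. \<forall>(I, J)\<in>shift_pairs D S K.
        haar_related I (haar_in S I J) \<and> haar_related J (haar_out S I J) \<and>
        \<bar>coef S I J K\<bar> \<le> sqrt (vol I * vol J) / vol K) \<and>
     finite {K\<in>cubes D. \<exists>(I, J)\<in>shift_pairs D S K. coef S I J K \<noteq> 0}"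

text \<open>Only pairs with \<open>I \<or> J = K\<close> contribute to \<open>A\<^sub>K\<close>.\<close>
definition join_form :: "'n::finite lattice \<Rightarrow> 'n shift_data \<Rightarrow> bool" where
  "join_form D S \<longleftrightarrow>
     (\<forall>K\<in>cubes D. \<forall>(I, J)\<in>shift_pairs D S K. coef S I J K \<noteq> 0 \<longrightarrow> is_join D I J K)"

definition complexity :: "'n::finite shift_data \<Rightarrow> nat" where
  "complexity S = max (par_m S) (par_n S)"

definition pairing :: "'a measure \<Rightarrow> ('a \<Rightarrow> real) \<Rightarrow> ('a \<Rightarrow> real) \<Rightarrow> real" where
  "pairing M f g = (LINT x|M. f x * g x)"

definition shift_op ::
    "'n::finite lattice \<Rightarrow> (real ^ 'n) measure \<Rightarrow> 'n shift_data \<Rightarrow> (real ^ 'n \<Rightarrow> real) \<Rightarrow> real ^ 'n \<Rightarrow> real"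
where
  "shift_op D \<sigma> S f x =
     (\<Sum>\<^sub>\<infinity>K\<in>cubes D. \<Sum>(I, J)\<in>shift_pairs D S K.
        coef S I J K * pairing \<sigma> f (haar_in S I J) * haar_out S I J x)"

definition shift_adj ::
    "'n::finite lattice \<Rightarrow> (real ^ 'n) measure \<Rightarrow> 'n shift_data \<Rightarrow> (real ^ 'n \<Rightarrow> real) \<Rightarrow> real ^ 'n \<Rightarrow> real"
where
  "shift_adj D w S g x =
     (\<Sum>\<^sub>\<infinity>K\<in>cubes D. \<Sum>(I, J)\<in>shift_pairs D S K.
        coef S I J K * pairing w g (haar_out S I J) * haar_in S I J x)"


section \<open>Radon measures and Lebesgue norms\<close>

definition radon_measure :: "'a::topological_space measure \<Rightarrow> bool" where
  "radon_measure M \<longleftrightarrow>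
     sets M = sets borel \<and>
     (\<forall>K. compact K \<longrightarrow> emeasure M K < \<infinity>) \<and>
     (\<forall>A\<in>sets borel. emeasure M A = (SUP K\<in>{K. compact K \<and> K \<subseteq> A}. emeasure M K))"

text \<open>Powers with exponent \<open>s > 0\<close> on \<open>[0, \<infinity>]\<close>.\<close>
definition epowr :: "ennreal \<Rightarrow> real \<Rightarrow> ennreal" where
  "epowr x s = (if x = \<infinity> then \<infinity> else ennreal (enn2real x powr s))"

text \<open>The norm, possibly infinite, of a \<open>[0, \<infinity>]\<close>-valued function.\<close>
definition eLp_norm :: "real \<Rightarrow> 'a measure \<Rightarrow> ('a \<Rightarrow> ennreal) \<Rightarrow> ennreal" where
  "eLp_norm p M F = epowr (\<integral>\<^sup>+x. epowr (F x) p \<partial>M) (1 / p)"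

definition Lp_norm :: "real \<Rightarrow> 'a measure \<Rightarrow> ('a \<Rightarrow> real) \<Rightarrow> ennreal" where
  "Lp_norm p M f = eLp_norm p M (\<lambda>x. ennreal \<bar>f x\<bar>)"

text \<open>Elements of the Lebesgue space are represented by functions instead of classes modulo null
  sets; neither the norm nor the class of the image under a shift depends on the representative.\<close>
definition Lp_space :: "real \<Rightarrow> 'a measure \<Rightarrow> ('a \<Rightarrow> real) set" where
  "Lp_space p M = {f \<in> borel_measurable M. Lp_norm p M f < \<infinity>}"

definition conj_exp :: "real \<Rightarrow> real" where
  "conj_exp p = p / (p - 1)"

text \<open>In what follows best constants are infima in \<open>[0, \<infinity>]\<close>. The convention \<open>0 * \<infinity> = 0\<close> has no
  influence on them, since it only concerns the constants \<open>0\<close> and \<open>\<infinity>\<close>.\<close>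


section \<open>The quadratic condition\<close>

definition quad_Astar_bound ::
    "'n::finite lattice \<Rightarrow> ('n point_set \<Rightarrow> nat \<Rightarrow> 'n point_set) \<Rightarrow> real \<Rightarrow> real \<Rightarrow>
     (real ^ 'n) measure \<Rightarrow> (real ^ 'n) measure \<Rightarrow> ennreal \<Rightarrow> bool" where
  "quad_Astar_bound D ch p q \<sigma> w C \<longleftrightarrow>
     (\<forall>k\<in>{1..2 ^ CARD('n)}. \<forall>l\<in>{1..2 ^ CARD('n)}. k \<noteq> l \<longrightarrow>
       (\<forall>a :: 'n point_set \<Rightarrow> real.
          eLp_norm q w (\<lambda>x. epowr (\<Sum>\<^sub>\<infinity>Q\<in>cubes D.
             ennreal ((a Q * (measure \<sigma> (ch Q k) / vol (ch Q k)))\<^sup>2 * indicator (ch Q l) x)) (1 / 2))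
          \<le> C * eLp_norm p \<sigma> (\<lambda>x. epowr (\<Sum>\<^sub>\<infinity>Q\<in>cubes D.
             ennreal ((a Q)\<^sup>2 * indicator (ch Q k) x)) (1 / 2))))"

definition quad_Astar ::
    "'n::finite lattice \<Rightarrow> ('n point_set \<Rightarrow> nat \<Rightarrow> 'n point_set) \<Rightarrow> real \<Rightarrow> real \<Rightarrow>
     (real ^ 'n) measure \<Rightarrow> (real ^ 'n) measure \<Rightarrow> ennreal" where
  "quad_Astar D ch p q \<sigma> w = Inf {C. quad_Astar_bound D ch p q \<sigma> w C}"


section \<open>R-boundedness\<close>

text \<open>Independent random signs \<open>\<epsilon>\<^sub>1, \<dots>, \<epsilon>\<^sub>U\<close>; the value 0 is only taken outside \<open>{1..U}\<close>.\<close>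
definition random_signs :: "nat \<Rightarrow> (nat \<Rightarrow> real) pmf" where
  "random_signs U = Pi_pmf {1..U} 0 (\<lambda>_. pmf_of_set {-1, 1})"

definition R_bound ::
    "real \<Rightarrow> 'a measure \<Rightarrow> real \<Rightarrow> 'b measure \<Rightarrow> (('a \<Rightarrow> real) \<Rightarrow> 'b \<Rightarrow> real) set \<Rightarrow> ennreal \<Rightarrow> bool"
where
  "R_bound p \<sigma> q w \<T> C \<longleftrightarrow>
     (\<forall>U\<ge>1. \<forall>T f. (\<forall>u\<in>{1..U}. T u \<in> \<T> \<and> f u \<in> Lp_space p \<sigma>) \<longrightarrow>
        (\<integral>\<^sup>+\<epsilon>. Lp_norm q w (\<lambda>x. \<Sum>u=1..U. \<epsilon> u * T u (f u) x) \<partial>measure_pmf (random_signs U))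
        \<le> C * (\<integral>\<^sup>+\<epsilon>. Lp_norm p \<sigma> (\<lambda>x. \<Sum>u=1..U. \<epsilon> u * f u x) \<partial>measure_pmf (random_signs U)))"

definition R_bounded ::
    "real \<Rightarrow> 'a measure \<Rightarrow> real \<Rightarrow> 'b measure \<Rightarrow> (('a \<Rightarrow> real) \<Rightarrow> 'b \<Rightarrow> real) set \<Rightarrow> bool" where
  "R_bounded p \<sigma> q w \<T> \<longleftrightarrow> (\<exists>C<\<infinity>. R_bound p \<sigma> q w \<T> C)"

definition R_const ::
    "real \<Rightarrow> 'a measure \<Rightarrow> real \<Rightarrow> 'b measure \<Rightarrow> (('a \<Rightarrow> real) \<Rightarrow> 'b \<Rightarrow> real) set \<Rightarrow> ennreal" where
  "R_const p \<sigma> q w \<T> = Inf {C. R_bound p \<sigma> q w \<T> C}"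


section \<open>Quadratic testing conditions\<close>

text \<open>\<open>op\<close> assigns to every member of the family \<open>\<S>\<close> the operator being tested. The direct
  condition takes it to be \<open>shift_op D \<sigma>\<close> from \<open>(p, \<sigma>)\<close> to \<open>(q, w)\<close>, the dual one \<open>shift_adj D w\<close>
  from \<open>(q', w)\<close> to \<open>(p', \<sigma>)\<close>.\<close>
definition testing_bound ::
    "'n::finite lattice \<Rightarrow> real \<Rightarrow> (real ^ 'n) measure \<Rightarrow> real \<Rightarrow> (real ^ 'n) measure \<Rightarrow>
     ('s \<Rightarrow> (real ^ 'n \<Rightarrow> real) \<Rightarrow> real ^ 'n \<Rightarrow> real) \<Rightarrow> 's set \<Rightarrow> ennreal \<Rightarrow> bool" where
  "testing_bound D p \<mu> q \<nu> op \<S> C \<longleftrightarrow>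
     (\<forall>U\<ge>1. \<forall>(a :: nat \<Rightarrow> real) S Q. (\<forall>u\<in>{1..U}. S u \<in> \<S> \<and> Q u \<in> cubes D) \<longrightarrow>
        Lp_norm q \<nu> (\<lambda>x. sqrt (\<Sum>u=1..U.
          (a u * indicator (Q u) x * op (S u) (indicator (Q u)) x)\<^sup>2))
        \<le> C * Lp_norm p \<mu> (\<lambda>x. sqrt (\<Sum>u=1..U. (a u)\<^sup>2 * indicator (Q u) x)))"

abbreviation direct_testing_bound ::
    "'n::finite lattice \<Rightarrow> real \<Rightarrow> real \<Rightarrow> (real ^ 'n) measure \<Rightarrow> (real ^ 'n) measure \<Rightarrow>
     'n shift_data set \<Rightarrow> ennreal \<Rightarrow> bool" where
  "direct_testing_bound D p q \<sigma> w \<S> C \<equiv> testing_bound D p \<sigma> q w (shift_op D \<sigma>) \<S> C"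

abbreviation dual_testing_bound ::
    "'n::finite lattice \<Rightarrow> real \<Rightarrow> real \<Rightarrow> (real ^ 'n) measure \<Rightarrow> (real ^ 'n) measure \<Rightarrow>
     'n shift_data set \<Rightarrow> ennreal \<Rightarrow> bool" where
  "dual_testing_bound D p q \<sigma> w \<S> C \<equiv>
     testing_bound D (conj_exp q) w (conj_exp p) \<sigma> (shift_adj D w) \<S> C"

definition direct_testing_const ::
    "'n::finite lattice \<Rightarrow> real \<Rightarrow> real \<Rightarrow> (real ^ 'n) measure \<Rightarrow> (real ^ 'n) measure \<Rightarrow>
     'n shift_data set \<Rightarrow> ennreal" where
  "direct_testing_const D p q \<sigma> w \<S> = Inf {C. direct_testing_bound D p q \<sigma> w \<S> C}"

definition dual_testing_const ::
    "'n::finite lattice \<Rightarrow> real \<Rightarrow> real \<Rightarrow> (real ^ 'n) measure \<Rightarrow> (real ^ 'n) measure \<Rightarrow>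
     'n shift_data set \<Rightarrow> ennreal" where
  "dual_testing_const D p q \<sigma> w \<S> = Inf {C. dual_testing_bound D p q \<sigma> w \<S> C}"

end

theory Submission
  imports Defs
begin

text \<open>
  The idea is to reduce everything to a square function estimate for integral operators on a finite
  tree, and to prove that estimate by martingale methods that are insensitive to the measures.

  A shift of complexity \<open>\<kappa>\<close> has a kernel that is a finite sum over cubes \<open>K\<close>, and the pieces of the kernel are
  constant \<open>\<kappa> + 1\<close> generations below \<open>K\<close>. Finitely many shifts and cubes are therefore resolved by finitely many
  generations of cubes inside finitely many top cubes. Functions then only enter through their means over the
  smallest cubes, and the two measures become weights on a finite set of points carrying a tree of
  cells (\<open>shift_op_atoms\<close>). By Khintchine's inequalities, R-boundedness is equivalent to
  the estimate of \<open>(\<Sum>u. (T\<^sub>u f\<^sub>u)\<^sup>2)\<^sup>1\<^sup>/\<^sup>2\<close> by \<open>(\<Sum>u. (f\<^sub>u)\<^sup>2)\<^sup>1\<^sup>/\<^sup>2\<close> in the respective norms.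
  Testing is the special case of multiples of indicators, restricted to the cubes, together with its
  dual.

  For the converse, \<open>\<langle>T\<^sub>u f\<^sub>u, g\<^sub>u\<rangle>\<close> is expanded in martingale differences of \<open>f\<^sub>u\<close> with respect to \<open>\<sigma>\<close>, of
  generation \<open>c\<close>, and of \<open>g\<^sub>u\<close> with respect to \<open>w\<close>, of generation \<open>d\<close>. Let \<open>c \<le> d\<close>; the other half is
  symmetric, with dual testing in place of testing. On
  pairs of points in different cells of generation \<open>c\<close> the kernel is too smooth to see a difference of \<open>g\<^sub>u\<close> with
  \<open>d > c + \<kappa>\<close>, or one of \<open>f\<^sub>u\<close> more than \<open>\<kappa> + 1\<close> generations below the last common cell
  (\<open>nonlocal_far\<close>, \<open>nonlocal_near\<close>). What remains are \<open>(1 + \<kappa>)\<^sup>2\<close> sums over pairs of points in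
  different children of a cube, each bounded by the quadratic condition and the maximal inequality
  (\<open>ring_sum_bound\<close>). On pairs of points in a common cell \<open>Q\<close> of generation \<open>c\<close> the difference of \<open>f\<^sub>u\<close> is constant,
  so \<open>1\<^sub>Q T\<^sub>u 1\<^sub>Q\<close> appears. The \<open>1 + \<kappa>\<close> distances \<open>d - c \<le> \<kappa>\<close> are handled directly by
  testing (\<open>near_local_bound\<close>). For \<open>d > c + \<kappa>\<close> the sum is a paraproduct. There the averages of \<open>f\<^sub>u\<close> are
  distributed over the generations in proportion to the increments of the square of the maximal function of
  \<open>f\<^sub>u\<close>. These increments are admissible testing coefficients with square function at most the maximal
  function, and the remaining factors turn the differences of \<open>g\<^sub>u\<close> into a differentially
  subordinate family (\<open>paraproduct_bound\<close>).

  Two facts about an arbitrary measure on a tree carry the argument, both for families of functions with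
  values in \<open>\<ell>\<^sup>2\<close>: a family whose squared martingale differences are dominated pointwise has dominated
  norm (\<open>differential_subordination\<close>), proved for \<open>p \<le> 2\<close> by comparing the increments of the
  energy with Bregman distances and for \<open>p > 2\<close> by duality, and the maximal inequality
  (\<open>vector_maximal_inequality\<close>), proved by telescoping the norm of the running maximum.
\<close>

section \<open>Convexity inequalities for powers of an energy\<close>

lemma powr_tangent_upper:
  fixes A B r :: real
  assumes "0 < A" "0 \<le> B" "0 < r" "r \<le> 1"
  shows "B powr r \<le> A powr r + r * A powr (r - 1) * (B - A)"
proof (cases "r = 1 \<or> B = 0")
  case True
  then show ?thesis
  proof
    assume "r = 1" then show ?thesis using assms by simp
  next
    assume B: "B = 0"
    have "A powr (r - 1) * A = A powr r" using assms by (simp add: powr_mult_base mult.commute)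
    then have "A powr r + r * A powr (r - 1) * (B - A) = (1 - r) * A powr r"
      using B by (simp add: algebra_simps)
    then show ?thesis using B assms by simp
  qed
next
  case False
  have "B powr r * A powr (1 - r) \<le> r * B + (1 - r) * A"
    using assms False by (intro Youngs_inequality_0) auto
  then have "B powr r * A powr (1 - r) * A powr (r - 1) \<le> (r * B + (1 - r) * A) * A powr (r - 1)"
    by (intro mult_right_mono) auto
  moreover have "A powr (1 - r) * A powr (r - 1) = 1" using assms by (simp add: powr_add[symmetric])
  moreover have "A powr (r - 1) * A = A powr r" using assms by (simp add: powr_mult_base mult.commute)
  moreover have "(r * B + (1 - r) * A) * A powr (r - 1)
      = A * A powr (r - 1) + r * A powr (r - 1) * (B - A)" by (simp add: algebra_simps)
  ultimately show ?thesis by (simp add: mult_ac)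
qed

lemma powr_concave_combination:
  fixes a b r l :: real
  assumes "0 \<le> a" "0 \<le> b" "0 \<le> l" "l \<le> 1" "0 < r" "r \<le> 1"
  shows "l * a powr r + (1 - l) * b powr r \<le> (l * a + (1 - l) * b) powr r"
proof (cases "l * a + (1 - l) * b = 0")
  case True
  have "0 \<le> l * a" "0 \<le> (1 - l) * b" using assms by auto
  then have "l * a = 0" "(1 - l) * b = 0" using True by linarith+
  then have "l * a powr r = 0" "(1 - l) * b powr r = 0" by auto
  then show ?thesis by (simp only: add_0 powr_ge_zero)
next
  case False
  define c where "c = l * a + (1 - l) * b"
  have c: "c > 0" using False assms by (simp add: c_def order_less_le)
  have "l * a powr r + (1 - l) * b powr r
    \<le> l * (c powr r + r * c powr (r - 1) * (a - c)) + (1 - l) * (c powr r + r * c powr (r - 1) * (b - c))"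
    using assms c by (intro add_mono mult_left_mono powr_tangent_upper) auto
  also have "\<dots> = c powr r + r * c powr (r - 1) * (l * a + (1 - l) * b - c)" by (simp add: algebra_simps)
  also have "\<dots> = c powr r" by (simp add: c_def)
  finally show ?thesis by (simp add: c_def)
qed

lemma powr_half_base_nonpos:
  fixes A S e :: real
  assumes "S > 0" "S / 2 \<le> A" "-1 \<le> e" "e \<le> 0"
  shows "A powr e \<le> 2 * S powr e"
proof -
  have "A powr e \<le> (S / 2) powr e" using assms by (intro powr_mono2') auto
  also have "\<dots> = S powr e * 2 powr (- e)" using assms by (simp add: powr_divide powr_minus field_simps)
  also have "\<dots> \<le> S powr e * 2 powr 1" using assms by (intro mult_left_mono powr_mono) auto
  finally show ?thesis by simp
qed

text \<open>With \<open>A\<close>, \<open>B\<close>, \<open>H\<close> the values of \<open>\<bar>a\<bar>\<^sup>2\<close>, \<open>\<langle>a, b\<rangle>\<close>, \<open>\<bar>b\<bar>\<^sup>2\<close> for two vectors \<open>a\<close>, \<open>b\<close>, this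
  is the Bregman distance of \<open>\<bar>a + b\<bar>\<close> from \<open>\<bar>a\<bar>\<close> for the function \<open>z \<mapsto> \<bar>z\<bar>\<close> to the power \<open>2r\<close>, compared with
  the quadratic quantity that it resembles for small \<open>b\<close>. The comparison quantity decreases in \<open>A\<close>,
  which is what makes energies of different martingales comparable. If \<open>H \<le> A\<close>, the tangent at \<open>A\<close>
  of the concave power gives the bound; if \<open>A < H\<close>, all terms are of the size of the power of \<open>H\<close>.\<close>
lemma bregman_upper:
  fixes A B H r :: real
  assumes "0 \<le> A" "0 \<le> H" "B\<^sup>2 \<le> A * H" "1/2 \<le> r" "r \<le> 1"
  shows "(A + 2*B + H) powr r - A powr r - 2*r * A powr (r - 1) * B \<le> 12 * (H * (A + H) powr (r - 1))"
proof -
  have "((A + H)/2)\<^sup>2 - A * H = ((A - H)/2)\<^sup>2" by (simp add: power2_eq_square field_simps)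
  then have "\<bar>B\<bar>\<^sup>2 \<le> ((A + H)/2)\<^sup>2" using assms(3) zero_le_power2[of "(A - H)/2"]
    unfolding power2_abs by linarith
  then have Bm: "\<bar>B\<bar> \<le> (A + H)/2" by (rule power2_le_imp_le) (use assms(1,2) in simp)
  \<comment> \<open>the power \<open>0 powr (r - 1)\<close> is 0, so the degenerate cases are separate\<close>
  consider "H = 0" | "A = 0" "H > 0" | "A > 0" "H > 0" "H \<le> A" | "A > 0" "H > 0" "A < H" using assms by linarith
  then show ?thesis
  proof cases
    case 1 then have "B = 0" using assms by simp
    then show ?thesis using 1 by simp
  next
    case 2 then have "B = 0" using assms by simp
    then show ?thesis using 2 assms by (simp add: powr_mult_base)
  next
    case 3
    have nn: "0 \<le> A + 2*B + H" using Bm by (simp add: abs_le_iff)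
    have "(A + 2*B + H) powr r \<le> A powr r + r * A powr (r - 1) * (A + 2*B + H - A)"
      using 3 assms nn by (intro powr_tangent_upper) auto
    then have "(A + 2*B + H) powr r - A powr r - 2*r * A powr (r - 1) * B \<le> r * (A powr (r - 1) * H)"
      by (simp add: algebra_simps)
    also have "\<dots> \<le> 1 * (A powr (r - 1) * H)" using assms by (intro mult_right_mono) auto
    also have "\<dots> \<le> 2 * (A + H) powr (r - 1) * H"
      using 3 assms by (simp, intro powr_half_base_nonpos) auto
    also have "\<dots> \<le> 12 * (H * (A + H) powr (r - 1))" using 3 by (simp add: mult_ac)
    finally show ?thesis .
  next
    case 4
    have "\<bar>B\<bar> = sqrt (B\<^sup>2)" by simp
    also have "\<dots> \<le> sqrt (A * H)" using assms by (intro real_sqrt_le_mono) auto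
    finally have Bs: "\<bar>B\<bar> \<le> sqrt (A * H)" .
    have "sqrt (A * H) \<le> sqrt (H * H)" using 4 by (intro real_sqrt_le_mono mult_right_mono) auto
    then have BH: "\<bar>B\<bar> \<le> H" using Bs 4 by simp
    have "(A + 2*B + H) powr r \<le> (4 * H) powr r"
    proof (cases "0 \<le> A + 2*B + H")
      case True then show ?thesis using 4 BH assms by (intro powr_mono2) auto
    next
      case False
      then show ?thesis using Bm by (simp add: abs_le_iff)
    qed
    also have "\<dots> = 4 powr r * H powr r" using 4 by (simp add: powr_mult)
    also have "\<dots> \<le> 4 powr 1 * H powr r" using assms by (intro mult_right_mono powr_mono) auto
    finally have t1: "(A + 2*B + H) powr r \<le> 4 * H powr r" by simp
    have "- (2*r * A powr (r - 1) * B) \<le> 2 * r * A powr (r - 1) * \<bar>B\<bar>"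
    proof -
      have "(2 * r * A powr (r - 1)) * (- B) \<le> (2 * r * A powr (r - 1)) * \<bar>B\<bar>"
        using assms(4) by (intro mult_left_mono abs_ge_minus_self mult_nonneg_nonneg powr_ge_zero) linarith+
      then show ?thesis by (simp only: mult_minus_right)
    qed
    also have "\<dots> \<le> 2 * 1 * A powr (r - 1) * sqrt (A * H)"
      using assms(4,5) Bs by (intro mult_mono) auto
    also have "sqrt (A * H) = A powr (1/2) * H powr (1/2)"
      using 4 by (simp add: powr_half_sqrt real_sqrt_mult)
    also have "2 * 1 * A powr (r - 1) * (A powr (1/2) * H powr (1/2)) = 2 * (A powr (r - 1/2) * H powr (1/2))"
    proof -
      have "A powr (r - 1/2) = A powr (r - 1) * A powr (1/2)" unfolding powr_add[symmetric] by simp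
      then show ?thesis by simp
    qed
    also have "\<dots> \<le> 2 * (H powr (r - 1/2) * H powr (1/2))"
      using 4 assms(4) by (intro mult_left_mono mult_right_mono powr_mono2) auto
    also have "\<dots> = 2 * H powr r" using 4 by (simp add: powr_add[symmetric])
    finally have t2: "- (2*r * A powr (r - 1) * B) \<le> 2 * H powr r" .
    have "(A + 2*B + H) powr r - A powr r - 2*r * A powr (r - 1) * B \<le> 6 * H powr r"
      using t1 t2 powr_ge_zero[of A r] by linarith
    also have "H powr r = H * H powr (r - 1)" using 4 by (simp add: powr_mult_base)
    also have "6 * (H * H powr (r - 1)) \<le> 6 * (H * (2 * (A + H) powr (r - 1)))"
      using 4 assms(4,5) by (intro mult_left_mono powr_half_base_nonpos) auto
    finally show ?thesis by (simp add: mult_ac)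
  qed
qed

text \<open>On \<open>(0, M]\<close> the second derivative of the power is at least \<open>p (p - 1)\<close> times the value at \<open>M\<close> of the
  decreasing function \<open>t\<close> to the power \<open>p - 2\<close>, so subtracting the corresponding parabola leaves a
  convex function.\<close>
lemma powr_tangent_lower_pos:
  fixes p M t :: real
  assumes p: "1 < p" "p \<le> 2" and M: "1 \<le> M" and t: "0 < t" "t \<le> M"
  shows "1 + p * (t - 1) + p*(p-1)/2 * M powr (p - 2) * (t - 1)\<^sup>2 \<le> t powr p"
proof -
  define k where "k = p*(p-1)/2 * M powr (p - 2)"
  define C where "C = {0<..M}"
  have "(p * 1 powr (p - 1) - k * (2 * 1)) * (t - 1) \<le> (t powr p - k * t^2) - (1 powr p - k * 1^2)"
  proof (rule f''_imp_f'[where C = C and f = "\<lambda>t. t powr p - k * t^2"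
      and f' = "\<lambda>t. p * t powr (p - 1) - k * (2 * t)" and f'' = "\<lambda>t. p * ((p-1) * t powr (p - 2)) - k * 2"])
    show "convex C" "1 \<in> C" "t \<in> C" using M t by (simp_all add: C_def)
    show "((\<lambda>t. t powr p - k * t^2) has_real_derivative p * x powr (p - 1) - k * (2 * x)) (at x)" if "x \<in> C" for x
      using that by (auto simp: C_def intro!: derivative_eq_intros)
    show "((\<lambda>t. p * t powr (p - 1) - k * (2 * t)) has_real_derivative p * ((p-1) * x powr (p - 2)) - k * 2) (at x)" if "x \<in> C" for x
      using that by (auto simp: C_def intro!: derivative_eq_intros)
    show "0 \<le> p * ((p-1) * x powr (p - 2)) - k * 2" if "x \<in> C" for x
    proof -
      have "M powr (p - 2) \<le> x powr (p - 2)" using that p by (intro powr_mono2') (auto simp: C_def)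
      then have "p * (p-1) * M powr (p - 2) \<le> p * (p-1) * x powr (p - 2)"
        using p by (intro mult_left_mono) auto
      then show ?thesis by (simp add: k_def)
    qed
  qed
  then show ?thesis unfolding k_def[symmetric] by (simp add: power2_eq_square algebra_simps)
qed

text \<open>Reflection \<open>t \<mapsto> - t\<close> only lowers the parabola for negative \<open>t\<close>, because its leading coefficient is
  at most \<open>p / 2\<close>; so the inequality on the positive half of the interval extends to all of it.\<close>
lemma powr_tangent_lower:
  fixes p M t :: real
  assumes p: "1 < p" "p \<le> 2" and M: "1 \<le> M" and t: "\<bar>t\<bar> \<le> M"
  shows "1 + p * (t - 1) + p*(p-1)/2 * M powr (p - 2) * (t - 1)\<^sup>2 \<le> \<bar>t\<bar> powr p"
proof -
  define k where "k = p*(p-1)/2 * M powr (p - 2)"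
  have "M powr (p - 2) \<le> M powr 0" using p M by (intro powr_mono) auto
  then have M1: "M powr (p - 2) \<le> 1" using M by simp
  have pp: "0 \<le> p*(p-1)/2" using p by simp
  have k1: "k \<le> p*(p-1)/2" unfolding k_def using mult_left_mono[OF M1 pp] by simp
  have p2: "p * (p - 1) \<le> p * 1" using p by (intro mult_left_mono) auto
  have p3: "(p - 1) * (p - 2) \<le> 0" using p by (intro mult_nonneg_nonpos) auto
  consider "t > 0" | "t = 0" | "t < 0" by linarith
  then show ?thesis
  proof cases
    case 1 then show ?thesis using powr_tangent_lower_pos[OF p M 1] t by simp
  next
    case 2
    have "1 + p * (t - 1) + k * (t - 1)\<^sup>2 = 1 - p + k" using 2 by simp
    also have "\<dots> \<le> 0" using k1 p3 by (simp add: algebra_simps)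
    finally show ?thesis using 2 by (simp add: k_def)
  next
    case 3
    have "1 + p * (- t - 1) + k * (- t - 1)\<^sup>2 \<le> (- t) powr p"
      using powr_tangent_lower_pos[OF p M, of "- t"] 3 t by (simp add: k_def)
    moreover have "1 + p * (t - 1) + k * (t - 1)\<^sup>2 \<le> 1 + p * (- t - 1) + k * (- t - 1)\<^sup>2"
    proof -
      have "0 \<le> (2 * p - 4 * k) * (- t)" using 3 k1 p2 by (intro mult_nonneg_nonneg) auto
      then show ?thesis by (simp add: power2_eq_square algebra_simps)
    qed
    ultimately show ?thesis using 3 by (simp add: k_def)
  qed
qed

lemma square_powr_half: "(z\<^sup>2) powr (p / 2) = \<bar>z\<bar> powr (p::real)"
proof (cases "z = 0")
  case False
  then have "z\<^sup>2 = \<bar>z\<bar> powr 2" by simp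
  then show ?thesis by (simp only: powr_powr) simp
qed simp

text \<open>After normalizing \<open>A = 1\<close>, put \<open>H = y\<^sup>2\<close> and \<open>b = B\<close>. The value \<open>1 + 2 b + y\<^sup>2\<close> is a convex combination
  of the two extremal values \<open>(1 + y)\<^sup>2\<close> and \<open>(1 - y)\<^sup>2\<close>, where the vectors are parallel. There the claim
  is the one-dimensional inequality above, and concavity of the power \<open>p / 2\<close> transports it.\<close>
lemma bregman_lower:
  fixes A B H p :: real
  assumes "0 \<le> A" "0 \<le> H" "B\<^sup>2 \<le> A * H" and p: "1 < p" "p \<le> 2"
  shows "p*(p-1)/4 * (H * (A + H) powr (p/2 - 1))
    \<le> (A + 2*B + H) powr (p/2) - A powr (p/2) - p * A powr (p/2 - 1) * B"
proof (cases "A = 0")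
  case True
  then have B: "B = 0" using assms by simp
  have "p * (p - 1) \<le> 2 * 1" using p by (intro mult_mono) auto
  then have "p*(p-1)/4 * H powr (p/2) \<le> 1 * H powr (p/2)" by (intro mult_right_mono) auto
  then show ?thesis using True B assms by (simp add: powr_mult_base)
next
  case False
  define r y b where "r = p/2" and "y = sqrt (H/A)" and "b = B/A"
  have A: "A > 0" using False assms by simp
  have r: "1/2 < r" "r \<le> 1" using p by (auto simp: r_def)
  have y: "y \<ge> 0" "y\<^sup>2 = H/A" using A assms by (auto simp: y_def)
  have "b\<^sup>2 \<le> y\<^sup>2"
    using assms(3) A y by (simp add: b_def power_divide divide_le_eq power2_eq_square mult_ac)
  then have by': "\<bar>b\<bar> \<le> y" using y by (metis abs_le_square_iff abs_of_nonneg)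
  \<comment> \<open>the weight with \<open>b = l y + (1 - l) (- y)\<close>\<close>
  define l where "l = (if y = 0 then 0 else (b / y + 1) / 2)"
  have l: "0 \<le> l" "l \<le> 1" "b = l * y - (1 - l) * y"
  proof -
    have "l = 0 \<and> b = 0 \<and> y = 0 \<or> y > 0 \<and> l = (b / y + 1) / 2 \<and> - 1 \<le> b / y \<and> b / y \<le> 1"
      using by' y(1) by (auto simp: l_def abs_le_iff divide_le_eq le_divide_eq)
    then have "0 \<le> l \<and> l \<le> 1 \<and> b = l * y - (1 - l) * y"
    proof (elim disjE conjE)
      assume y0: "y > 0" and lb: "l = (b / y + 1) / 2" "- 1 \<le> b / y" "b / y \<le> 1"
      have 1: "0 \<le> l" "l \<le> 1" using lb by simp_all
      have "l * y - (1 - l) * y = (2 * l - 1) * y" by (simp add: algebra_simps)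
      also have "2 * l - 1 = b / y" using lb(1) by simp
      finally show ?thesis using y0 1 by simp
    qed auto
    then show "0 \<le> l" "l \<le> 1" "b = l * y - (1 - l) * y" by auto
  qed
  define k where "k = p*(p-1)/2 * (1 + y) powr (p - 2)"
  have t1: "1 + p * y + k * y\<^sup>2 \<le> ((1 + y)\<^sup>2) powr r"
    using powr_tangent_lower[OF p, of "1 + y" "1 + y"] y
    by (simp add: k_def r_def square_powr_half)
  have e: "\<bar>1 - y\<bar> powr p = ((1 - y)\<^sup>2) powr r"
    by (simp add: r_def square_powr_half)
  have t2: "1 - p * y + k * y\<^sup>2 \<le> ((1 - y)\<^sup>2) powr r"
    using powr_tangent_lower[OF p, of "1 + y" "1 - y"] y unfolding e
    by (simp add: k_def)
  have "1 + p * b + k * y\<^sup>2 = l * (1 + p * y + k * y\<^sup>2) + (1 - l) * (1 - p * y + k * y\<^sup>2)"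
    unfolding l(3) by (simp add: algebra_simps)
  also have "\<dots> \<le> l * ((1 + y)\<^sup>2) powr r + (1 - l) * ((1 - y)\<^sup>2) powr r"
    using t1 t2 l by (intro add_mono mult_left_mono) auto
  also have "\<dots> \<le> (l * (1 + y)\<^sup>2 + (1 - l) * (1 - y)\<^sup>2) powr r"
    using l r by (intro powr_concave_combination) auto
  also have "l * (1 + y)\<^sup>2 + (1 - l) * (1 - y)\<^sup>2 = 1 + 2 * b + y\<^sup>2"
    unfolding l(3) by (simp add: power2_eq_square algebra_simps)
  also have "\<dots> = (A + 2*B + H) / A" using A by (simp add: b_def y(2) add_divide_distrib)
  finally have main: "1 + p * b + k * y\<^sup>2 \<le> ((A + 2*B + H) / A) powr r" .
  have nn: "0 \<le> (A + 2*B + H) / A"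
  proof -
    have "0 \<le> (1 + b)\<^sup>2 + (y\<^sup>2 - b\<^sup>2)" using \<open>b\<^sup>2 \<le> y\<^sup>2\<close> by simp
    also have "\<dots> = (A + 2*B + H) / A"
      using A by (simp add: b_def y(2) add_divide_distrib power2_sum)
    finally show ?thesis .
  qed
  have k: "p*(p-1)/4 * ((A + H)/A) powr (r - 1) \<le> k"
  proof -
    have "(2 * (1 + y\<^sup>2)) powr (r - 1) \<le> ((1 + y)\<^sup>2) powr (r - 1)"
    proof (rule powr_mono2')
      show "r - 1 \<le> 0" using r by simp
      show "0 < (1 + y)\<^sup>2" using y(1) by simp
      show "(1 + y)\<^sup>2 \<le> 2 * (1 + y\<^sup>2)"
        using sum_squares_bound[of 1 y] by (simp add: power2_sum)
    qed
    also have "\<dots> = (1 + y) powr (p - 2)"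
      using y square_powr_half[of "1 + y" "p - 2"] by (simp add: r_def diff_divide_distrib)
    finally have "(2 * (1 + y\<^sup>2)) powr (r - 1) \<le> (1 + y) powr (p - 2)" .
    moreover have "(1/2) * (1 + y\<^sup>2) powr (r - 1) \<le> (2 * (1 + y\<^sup>2)) powr (r - 1)"
    proof -
      have "(2::real) powr (-1) \<le> 2 powr (r - 1)" using r by (intro powr_mono) auto
      then have "(1/2) * (1 + y\<^sup>2) powr (r - 1) \<le> 2 powr (r - 1) * (1 + y\<^sup>2) powr (r - 1)"
        by (intro mult_right_mono) (auto simp: powr_minus)
      also have "\<dots> = (2 * (1 + y\<^sup>2)) powr (r - 1)" by (rule powr_mult[symmetric])
      finally show ?thesis .
    qed
    ultimately have "(1/2) * (1 + y\<^sup>2) powr (r - 1) \<le> (1 + y) powr (p - 2)" by linarith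
    then have "p*(p-1)/2 * ((1/2) * (1 + y\<^sup>2) powr (r - 1)) \<le> k"
      unfolding k_def using p by (intro mult_left_mono) auto
    moreover have "1 + y\<^sup>2 = (A + H)/A" using A by (simp add: y(2) add_divide_distrib)
    ultimately show ?thesis by simp
  qed
  have "p*(p-1)/4 * (H * (A + H) powr (r - 1)) = A powr r * ((p*(p-1)/4 * ((A + H)/A) powr (r - 1)) * y\<^sup>2)"
  proof -
    have "A powr r = A * A powr (r - 1)" using A by (simp add: powr_mult_base)
    then show ?thesis using A assms by (simp add: powr_divide y(2))
  qed
  also have "\<dots> \<le> A powr r * (k * y\<^sup>2)"
    using k by (intro mult_left_mono mult_right_mono) auto
  also have "\<dots> \<le> A powr r * (((A + 2*B + H) / A) powr r - 1 - p * b)"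
    using main by (intro mult_left_mono) auto
  also have "\<dots> = (A + 2*B + H) powr r - A powr r - p * A powr (r - 1) * B"
  proof -
    have "A powr r * ((A + 2*B + H) / A) powr r = (A + 2*B + H) powr r"
      using A nn by (simp add: powr_mult[symmetric])
    moreover have "A powr r * b = A powr (r - 1) * B" using A by (simp add: b_def powr_diff)
    ultimately show ?thesis by (simp add: algebra_simps)
  qed
  finally show ?thesis by (simp add: r_def)
qed

section \<open>Square functions in weighted norms over a finite set\<close>

definition modulus :: "'i set \<Rightarrow> ('i \<Rightarrow> 'x \<Rightarrow> real) \<Rightarrow> 'x \<Rightarrow> real" where
  "modulus I F x = sqrt (\<Sum>i\<in>I. (F i x)\<^sup>2)"

definition wnorm :: "'x set \<Rightarrow> real \<Rightarrow> ('x \<Rightarrow> real) \<Rightarrow> ('x \<Rightarrow> real) \<Rightarrow> real" where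
  "wnorm X p s g = (\<Sum>x\<in>X. s x * \<bar>g x\<bar> powr p) powr (1/p)"

text \<open>The norm in \<open>L\<^sup>p(s; \<ell>\<^sup>2)\<close> of a finite family of functions on a finite set with point masses \<open>s\<close>.\<close>
definition vnorm :: "'x set \<Rightarrow> real \<Rightarrow> ('x \<Rightarrow> real) \<Rightarrow> 'i set \<Rightarrow> ('i \<Rightarrow> 'x \<Rightarrow> real) \<Rightarrow> real" where
  "vnorm X p s I F = wnorm X p s (modulus I F)"

lemma modulus_nonneg [simp]: "0 \<le> modulus I F x"
  by (simp add: modulus_def sum_nonneg)

lemma modulus_power2: "(modulus I F x)\<^sup>2 = (\<Sum>i\<in>I. (F i x)\<^sup>2)"
  by (simp add: modulus_def sum_nonneg)

lemma modulus_inner: "\<bar>\<Sum>i\<in>I. F i x * G i x\<bar> \<le> modulus I F x * modulus I G x"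
proof -
  have "\<bar>\<Sum>i\<in>I. F i x * G i x\<bar> = sqrt ((\<Sum>i\<in>I. F i x * G i x)\<^sup>2)" by simp
  also have "\<dots> \<le> sqrt ((\<Sum>i\<in>I. (F i x)\<^sup>2) * (\<Sum>i\<in>I. (G i x)\<^sup>2))"
    by (intro real_sqrt_le_mono Cauchy_Schwarz_ineq_sum)
  finally show ?thesis by (simp add: modulus_def real_sqrt_mult)
qed

lemma modulus_scale: "modulus I (\<lambda>i x. c x * F i x) x = \<bar>c x\<bar> * modulus I F x"
  by (simp add: modulus_def power_mult_distrib sum_distrib_left[symmetric] real_sqrt_mult)

lemma wnorm_nonneg [simp]: "0 \<le> wnorm X p s g"
  by (simp add: wnorm_def)

lemma vnorm_nonneg [simp]: "0 \<le> vnorm X p s I F"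
  by (simp add: vnorm_def)

lemma wnorm_powr:
  assumes "\<forall>x\<in>X. 0 \<le> s x" "p > 0"
  shows "wnorm X p s g powr p = (\<Sum>x\<in>X. s x * \<bar>g x\<bar> powr p)"
proof -
  have "0 \<le> (\<Sum>x\<in>X. s x * \<bar>g x\<bar> powr p)" using assms by (intro sum_nonneg) auto
  then show ?thesis using assms by (simp add: wnorm_def powr_powr)
qed

lemma wnorm_mono:
  assumes "\<forall>x\<in>X. 0 \<le> s x" "p > 0"
    and "\<And>x. x \<in> X \<Longrightarrow> 0 < s x \<Longrightarrow> \<bar>g x\<bar> \<le> \<bar>h x\<bar>"
  shows "wnorm X p s g \<le> wnorm X p s h"
  unfolding wnorm_def
proof (intro powr_mono2 sum_mono sum_nonneg)
  fix x assume x: "x \<in> X"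
  show "s x * \<bar>g x\<bar> powr p \<le> s x * \<bar>h x\<bar> powr p"
  proof (cases "s x = 0")
    case False
    then show ?thesis using assms x by (intro mult_left_mono powr_mono2) (auto simp: order_less_le)
  qed simp
qed (use assms in auto)

lemma wnorm_scale:
  assumes "p > 0" "\<forall>x\<in>X. 0 \<le> s x"
  shows "wnorm X p s (\<lambda>x. c * g x) = \<bar>c\<bar> * wnorm X p s g"
proof -
  have nn: "0 \<le> (\<Sum>x\<in>X. s x * \<bar>g x\<bar> powr p)" using assms by (intro sum_nonneg) auto
  have "(\<Sum>x\<in>X. s x * \<bar>c * g x\<bar> powr p) = \<bar>c\<bar> powr p * (\<Sum>x\<in>X. s x * \<bar>g x\<bar> powr p)"
    by (simp add: abs_mult powr_mult sum_distrib_left mult_ac)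
  then show ?thesis using assms nn by (simp add: wnorm_def powr_mult powr_powr)
qed

lemma vnorm_mono:
  assumes "\<forall>x\<in>X. 0 \<le> s x" "p > 0"
    and "\<And>x. x \<in> X \<Longrightarrow> 0 < s x \<Longrightarrow> (\<Sum>i\<in>I. (F i x)\<^sup>2) \<le> (\<Sum>j\<in>J. (G j x)\<^sup>2)"
  shows "vnorm X p s I F \<le> vnorm X p s J G"
  unfolding vnorm_def using assms by (intro wnorm_mono) (auto simp: modulus_def sum_nonneg)

lemma vnorm_scale:
  assumes "p > 0" "\<forall>x\<in>X. 0 \<le> s x"
  shows "vnorm X p s I (\<lambda>i x. c * F i x) = \<bar>c\<bar> * vnorm X p s I F"
proof -
  have "modulus I (\<lambda>i x. c * F i x) = (\<lambda>x. \<bar>c\<bar> * modulus I F x)"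
    using modulus_scale[of I "\<lambda>_. c" F] by auto
  then show ?thesis using wnorm_scale[OF assms, of "\<bar>c\<bar>" "modulus I F"] by (simp add: vnorm_def)
qed

lemma conj_exp_gt_1: "1 < p \<Longrightarrow> 1 < conj_exp p"
  by (simp add: conj_exp_def)

lemma conj_exp_conj_exp: "1 < p \<Longrightarrow> conj_exp (conj_exp p) = p"
  by (simp add: conj_exp_def field_simps)

lemma conj_exp_inverse: "1 < p \<Longrightarrow> 1/p + 1/conj_exp p = 1"
  by (simp add: conj_exp_def field_simps)

lemma conj_exp_mult: "1 < p \<Longrightarrow> (p - 1) * conj_exp p = p"
  by (simp add: conj_exp_def)

lemma conj_exp_le_2: "2 \<le> p \<Longrightarrow> conj_exp p \<le> 2"
  by (simp add: conj_exp_def field_simps)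

lemma weighted_Holder:
  assumes X: "finite X" and s: "\<forall>x\<in>X. 0 \<le> s x" and p: "1 < p"
  shows "(\<Sum>x\<in>X. s x * (\<bar>g x\<bar> * \<bar>h x\<bar>)) \<le> wnorm X p s g * wnorm X (conj_exp p) s h"
proof -
  define q where "q = conj_exp p"
  have q: "q > 1" "1/p + 1/q = 1" using p conj_exp_gt_1 conj_exp_inverse by (auto simp: q_def)
  define a b where "a = wnorm X p s g" and "b = wnorm X q s h"
  have ap: "a powr p = (\<Sum>x\<in>X. s x * \<bar>g x\<bar> powr p)" and bq: "b powr q = (\<Sum>x\<in>X. s x * \<bar>h x\<bar> powr q)"
    using wnorm_powr[OF s] p q by (simp_all add: a_def b_def)
  have ab0: "a \<ge> 0" "b \<ge> 0" by (auto simp: a_def b_def)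
  consider "a = 0" | "b = 0" | "a > 0" "b > 0" using ab0 by linarith
  then show ?thesis
  proof cases
    case 1
    then have "(\<Sum>x\<in>X. s x * \<bar>g x\<bar> powr p) = 0" using ap p by simp
    then have "\<forall>x\<in>X. s x * \<bar>g x\<bar> powr p = 0"
      by (subst (asm) sum_nonneg_eq_0_iff) (use X s in auto)
    then have "(\<Sum>x\<in>X. s x * (\<bar>g x\<bar> * \<bar>h x\<bar>)) = 0" by (intro sum.neutral) auto
    then show ?thesis by simp
  next
    case 2
    then have "(\<Sum>x\<in>X. s x * \<bar>h x\<bar> powr q) = 0" using bq q by simp
    then have "\<forall>x\<in>X. s x * \<bar>h x\<bar> powr q = 0"
      by (subst (asm) sum_nonneg_eq_0_iff) (use X s in auto)
    then have "(\<Sum>x\<in>X. s x * (\<bar>g x\<bar> * \<bar>h x\<bar>)) = 0" by (intro sum.neutral) auto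
    then show ?thesis by simp
  next
    case 3
    have "(\<Sum>x\<in>X. s x * (\<bar>g x\<bar>/a * (\<bar>h x\<bar>/b)))
      \<le> (\<Sum>x\<in>X. s x * ((\<bar>g x\<bar>/a) powr p / p + (\<bar>h x\<bar>/b) powr q / q))"
      using p q s 3 by (intro sum_mono mult_left_mono Youngs_inequality) auto
    also have "\<dots> = (\<Sum>x\<in>X. s x * \<bar>g x\<bar> powr p) / (a powr p) / p + (\<Sum>x\<in>X. s x * \<bar>h x\<bar> powr q) / (b powr q) / q"
      using 3 by (simp add: powr_divide sum.distrib sum_divide_distrib algebra_simps)
    also have "\<dots> = 1" using 3 q ap[symmetric] bq[symmetric] by simp
    finally have "(\<Sum>x\<in>X. s x * (\<bar>g x\<bar> * \<bar>h x\<bar>)) / (a * b) \<le> 1"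
      by (simp add: sum_divide_distrib)
    then show ?thesis using 3 by (simp add: a_def b_def q_def divide_le_eq)
  qed
qed

lemma vnorm_Holder:
  assumes X: "finite X" and s: "\<forall>x\<in>X. 0 \<le> s x" and p: "1 < p"
  shows "\<bar>\<Sum>x\<in>X. s x * (\<Sum>i\<in>I. F i x * G i x)\<bar> \<le> vnorm X p s I F * vnorm X (conj_exp p) s I G"
proof -
  have "\<bar>\<Sum>x\<in>X. s x * (\<Sum>i\<in>I. F i x * G i x)\<bar> \<le> (\<Sum>x\<in>X. \<bar>s x * (\<Sum>i\<in>I. F i x * G i x)\<bar>)"
    by (rule sum_abs)
  also have "\<dots> \<le> (\<Sum>x\<in>X. s x * (\<bar>modulus I F x\<bar> * \<bar>modulus I G x\<bar>))"
  proof (intro sum_mono)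
    fix x assume "x \<in> X"
    then show "\<bar>s x * (\<Sum>i\<in>I. F i x * G i x)\<bar> \<le> s x * (\<bar>modulus I F x\<bar> * \<bar>modulus I G x\<bar>)"
      using bspec[OF s, of x] modulus_inner[of F x G I] by (auto simp: abs_mult intro!: mult_left_mono)
  qed
  also have "\<dots> \<le> vnorm X p s I F * vnorm X (conj_exp p) s I G"
    unfolding vnorm_def by (rule weighted_Holder[OF X s p])
  finally show ?thesis .
qed

text \<open>The extremal function in the duality between \<open>L\<^sup>p(\<ell>\<^sup>2)\<close> and the space with conjugate exponents, up to
  normalization.\<close>
definition dual_element :: "real \<Rightarrow> 'i set \<Rightarrow> ('i \<Rightarrow> 'x \<Rightarrow> real) \<Rightarrow> 'i \<Rightarrow> 'x \<Rightarrow> real" where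
  "dual_element p I F i x = modulus I F x powr (p - 2) * F i x"

lemma modulus_dual_element: "modulus I (dual_element p I F) x = modulus I F x powr (p - 1)"
proof (cases "modulus I F x = 0")
  case True
  then show ?thesis unfolding dual_element_def
    using modulus_scale[of I "\<lambda>x. modulus I F x powr (p - 2)" F x] by simp
next
  case False
  then have "modulus I F x > 0" by (simp add: order_less_le)
  then have "modulus I F x powr (p - 2) * modulus I F x = modulus I F x powr (p - 1)"
    by (simp add: powr_mult_base mult.commute)
  then show ?thesis unfolding dual_element_def
    using modulus_scale[of I "\<lambda>x. modulus I F x powr (p - 2)" F x] by simp
qed

lemma inner_dual_element: "(\<Sum>i\<in>I. F i x * dual_element p I F i x) = modulus I F x powr p"
proof -
  have "(\<Sum>i\<in>I. F i x * dual_element p I F i x) = modulus I F x powr (p - 2) * (modulus I F x)\<^sup>2"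
    unfolding modulus_power2 by (simp add: dual_element_def sum_distrib_right power2_eq_square mult_ac)
  also have "\<dots> = modulus I F x powr p"
  proof (cases "modulus I F x = 0")
    case False
    then have "modulus I F x > 0" by (simp add: order_less_le)
    then have "(modulus I F x)\<^sup>2 = modulus I F x powr 2" by simp
    then show ?thesis by (simp only: powr_add[symmetric]) simp
  qed simp
  finally show ?thesis .
qed

lemma vnorm_dual_element:
  assumes "1 < p" and s: "\<forall>x\<in>X. 0 \<le> s x"
  shows "vnorm X (conj_exp p) s I (dual_element p I F) = vnorm X p s I F powr (p - 1)"
proof -
  have nn: "0 \<le> (\<Sum>x\<in>X. s x * modulus I F x powr p)" using s by (intro sum_nonneg) auto
  have "(p - 1) * conj_exp p = p" using assms by (rule_tac conj_exp_mult)
  moreover have "1 / conj_exp p = (p - 1) / p" using assms by (simp add: conj_exp_def)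
  ultimately show ?thesis
    using assms nn
    by (simp add: vnorm_def wnorm_def modulus_dual_element powr_powr)
qed

text \<open>Testing against the single extremal family suffices; it is quantified as \<open>G\<close> so that applications
  need not know its form.\<close>
lemma vnorm_le_by_duality:
  assumes p: "1 < p" and s: "\<forall>x\<in>X. 0 \<le> s x" and C: "0 \<le> C"
    and le: "\<And>G. G = dual_element p I F \<Longrightarrow>
      (\<Sum>x\<in>X. s x * (\<Sum>i\<in>I. F i x * G i x)) \<le> C * vnorm X (conj_exp p) s I G"
  shows "vnorm X p s I F \<le> C"
proof (cases "vnorm X p s I F = 0")
  case False
  define v where "v = vnorm X p s I F"
  have v: "v > 0" using False by (simp add: v_def order_less_le)
  have "v powr p = (\<Sum>x\<in>X. s x * (\<Sum>i\<in>I. F i x * dual_element p I F i x))"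
    using wnorm_powr[OF s, where p=p] p by (simp add: v_def vnorm_def inner_dual_element)
  also have "\<dots> \<le> C * vnorm X (conj_exp p) s I (dual_element p I F)" by (rule le) simp
  also have "\<dots> = C * v powr (p - 1)" using vnorm_dual_element[OF p s, of I F] by (simp add: v_def)
  finally have "v * v powr (p - 1) \<le> C * v powr (p - 1)" using v by (simp add: powr_mult_base)
  then show ?thesis using v by (simp add: v_def)
qed (use C in simp)

lemma vnorm_cong:
  assumes "\<And>x i. x \<in> X \<Longrightarrow> s x \<noteq> 0 \<Longrightarrow> i \<in> I \<Longrightarrow> (F i x)\<^sup>2 = (G i x)\<^sup>2"
  shows "vnorm X p s I F = vnorm X p s I G"
proof -
  have "s x * \<bar>modulus I F x\<bar> powr p = s x * \<bar>modulus I G x\<bar> powr p" if "x \<in> X" for x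
    using assms that by (cases "s x = 0") (auto simp: modulus_def intro!: arg_cong2[where f = "(powr)"] arg_cong[where f = sqrt] sum.cong)
  then have "(\<Sum>x\<in>X. s x * \<bar>modulus I F x\<bar> powr p) = (\<Sum>x\<in>X. s x * \<bar>modulus I G x\<bar> powr p)"
    by (rule sum.cong[OF refl])
  then show ?thesis by (simp only: vnorm_def wnorm_def)
qed

section \<open>Martingales on a finite tree of cells\<close>

text \<open>A filtration of a finite set by partitions: \<open>cell k x\<close> is the cell of generation \<open>k\<close> containing \<open>x\<close>.
  Generation \<open>n\<close> consists of the single points, and there may be several cells of generation 0.\<close>
locale cell_tree =
  fixes X :: "'x set" and cell :: "nat \<Rightarrow> 'x \<Rightarrow> 'x set" and n :: nat
  assumes finite_X [simp]: "finite X"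
    and cell_subset: "x \<in> X \<Longrightarrow> cell k x \<subseteq> X"
    and cell_self: "x \<in> X \<Longrightarrow> x \<in> cell k x"
    and cell_eq: "x \<in> X \<Longrightarrow> y \<in> cell k x \<Longrightarrow> cell k y = cell k x"
    and cell_Suc: "x \<in> X \<Longrightarrow> cell (Suc k) x \<subseteq> cell k x"
    and cell_bottom: "x \<in> X \<Longrightarrow> cell n x = {x}"
begin

lemma cell_mono: "j \<le> k \<Longrightarrow> x \<in> X \<Longrightarrow> cell k x \<subseteq> cell j x"
  by (induction k rule: dec_induct) (use cell_Suc in blast)+

lemma finite_cell [simp]: "x \<in> X \<Longrightarrow> finite (cell k x)"
  by (rule finite_subset[OF cell_subset finite_X])

lemma cell_in_X: "x \<in> X \<Longrightarrow> y \<in> cell k x \<Longrightarrow> y \<in> X"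
  using cell_subset by blast

lemma cell_sym: "x \<in> X \<Longrightarrow> y \<in> cell k x \<Longrightarrow> x \<in> cell k y"
  using cell_eq cell_self by blast

lemma sum_cell_swap: "(\<Sum>x\<in>X. \<Sum>y\<in>cell k x. g x y) = (\<Sum>y\<in>X. \<Sum>x\<in>cell k y. g x y)"
proof -
  have "(\<Sum>x\<in>X. \<Sum>y\<in>cell k x. g x y) = (\<Sum>x\<in>X. \<Sum>y | y \<in> X \<and> y \<in> cell k x. g x y)"
    by (intro sum.cong refl) (use cell_in_X in auto)
  also have "\<dots> = (\<Sum>y\<in>X. \<Sum>x | x \<in> X \<and> y \<in> cell k x. g x y)"
    by (intro sum.swap_restrict) auto
  also have "\<dots> = (\<Sum>y\<in>X. \<Sum>x\<in>cell k y. g x y)"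
    by (intro sum.cong refl) (use cell_in_X cell_sym in blast)
  finally show ?thesis .
qed

definition cell_const :: "nat \<Rightarrow> ('x \<Rightarrow> 'b) \<Rightarrow> bool" where
  "cell_const k f \<longleftrightarrow> (\<forall>x\<in>X. \<forall>y\<in>cell k x. f y = f x)"

lemma cell_constI: "(\<And>x y. x \<in> X \<Longrightarrow> y \<in> cell k x \<Longrightarrow> f y = f x) \<Longrightarrow> cell_const k f"
  by (auto simp: cell_const_def)

lemma cell_constD: "cell_const k f \<Longrightarrow> x \<in> X \<Longrightarrow> y \<in> cell k x \<Longrightarrow> f y = f x"
  by (auto simp: cell_const_def)

lemma cell_const_mono: "cell_const j f \<Longrightarrow> j \<le> k \<Longrightarrow> cell_const k f"
  unfolding cell_const_def using cell_mono by blast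

text \<open>A cell of mass zero gets the average 0. The cells of points of positive mass have positive mass, so
  this convention does not affect weighted sums.\<close>
definition avg :: "('x \<Rightarrow> real) \<Rightarrow> nat \<Rightarrow> ('x \<Rightarrow> real) \<Rightarrow> 'x \<Rightarrow> real" where
  "avg s k f x = (\<Sum>y\<in>cell k x. s y * f y) / (\<Sum>y\<in>cell k x. s y)"

text \<open>The convention at generation 0 makes the average over the top cells the first difference, so that
  all differences up to generation \<open>n\<close> add up to the function itself.\<close>
definition mdiff :: "('x \<Rightarrow> real) \<Rightarrow> nat \<Rightarrow> ('x \<Rightarrow> real) \<Rightarrow> 'x \<Rightarrow> real" where
  "mdiff s k f x = avg s k f x - (if k = 0 then 0 else avg s (k - 1) f x)"

lemma avg_const: "cell_const k (avg s k f)"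
  by (rule cell_constI) (simp add: avg_def cell_eq)

lemma mdiff_const: "cell_const k (mdiff s k f)"
proof (rule cell_constI)
  fix x y assume *: "x \<in> X" "y \<in> cell k x"
  have "avg s k f y = avg s k f x" using avg_const * by (rule cell_constD)
  moreover have "avg s (k - 1) f y = avg s (k - 1) f x"
    using avg_const cell_mono[of "k - 1" k x] * by (intro cell_constD[OF avg_const]) auto
  ultimately show "mdiff s k f y = mdiff s k f x" by (simp add: mdiff_def)
qed

lemma mdiff_0: "mdiff s 0 f x = avg s 0 f x"
  by (simp add: mdiff_def)

lemma mdiff_Suc: "mdiff s (Suc k) f x = avg s (Suc k) f x - avg s k f x"
  by (simp add: mdiff_def)

lemma sum_mdiff: "(\<Sum>l\<le>k. mdiff s l f x) = avg s k f x"
  by (induction k) (simp_all add: mdiff_def)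

lemma avg_sum: "avg s k (\<lambda>x. \<Sum>i\<in>I. f i x) x = (\<Sum>i\<in>I. avg s k (f i) x)"
proof -
  have "(\<Sum>y\<in>cell k x. s y * (\<Sum>i\<in>I. f i y)) = (\<Sum>i\<in>I. \<Sum>y\<in>cell k x. s y * f i y)"
    by (simp add: sum_distrib_left sum.swap[of _ I])
  then show ?thesis by (simp add: avg_def sum_divide_distrib)
qed

lemma mdiff_sum: "mdiff s k (\<lambda>x. \<Sum>i\<in>I. f i x) x = (\<Sum>i\<in>I. mdiff s k (f i) x)"
  by (simp add: mdiff_def avg_sum sum_subtractf)

context
  fixes s :: "'x \<Rightarrow> real"
  assumes s: "\<forall>x\<in>X. 0 \<le> s x"
begin

lemma cell_weight_pos: "x \<in> X \<Longrightarrow> 0 < s x \<Longrightarrow> 0 < (\<Sum>y\<in>cell k x. s y)"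
  using s cell_in_X cell_self by (intro sum_pos2[of _ x]) auto

lemma avg_self:
  assumes "cell_const k h" "x \<in> X" "0 < s x"
  shows "avg s k h x = h x"
proof -
  have "(\<Sum>y\<in>cell k x. s y * h y) = (\<Sum>y\<in>cell k x. s y) * h x"
    unfolding sum_distrib_right using assms by (intro sum.cong refl) (simp add: cell_constD)
  then show ?thesis using cell_weight_pos[OF assms(2,3), of k] by (simp add: avg_def)
qed

lemma avg_bottom: "x \<in> X \<Longrightarrow> 0 < s x \<Longrightarrow> avg s n f x = f x"
  by (simp add: avg_def cell_bottom)

lemma avg_abs_le: "x \<in> X \<Longrightarrow> \<bar>avg s k f x\<bar> \<le> avg s k (\<lambda>x. \<bar>f x\<bar>) x"
proof -
  assume x: "x \<in> X"
  have nn: "0 \<le> (\<Sum>y\<in>cell k x. s y)" using s cell_in_X[OF x] by (intro sum_nonneg) auto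
  have "\<bar>\<Sum>y\<in>cell k x. s y * f y\<bar> \<le> (\<Sum>y\<in>cell k x. \<bar>s y * f y\<bar>)" by (rule sum_abs)
  also have "\<dots> = (\<Sum>y\<in>cell k x. s y * \<bar>f y\<bar>)"
    using s cell_in_X[OF x] by (intro sum.cong refl) (auto simp: abs_mult)
  finally show ?thesis using nn by (simp add: avg_def abs_divide divide_right_mono)
qed

lemma avg_nonneg: "x \<in> X \<Longrightarrow> (\<And>y. y \<in> X \<Longrightarrow> 0 \<le> f y) \<Longrightarrow> 0 \<le> avg s k f x"
  unfolding avg_def using s cell_in_X by (intro divide_nonneg_nonneg sum_nonneg mult_nonneg_nonneg) auto

lemma sum_mult_avg:
  assumes a: "cell_const k a"
  shows "(\<Sum>x\<in>X. s x * (a x * avg s k f x)) = (\<Sum>x\<in>X. s x * (a x * f x))"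
proof -
  define S where "S x = (\<Sum>y\<in>cell k x. s y)" for x
  have S: "S y = S x" if "x \<in> X" "y \<in> cell k x" for x y
    using that by (simp add: S_def cell_eq)
  have "(\<Sum>x\<in>X. s x * (a x * avg s k f x)) = (\<Sum>x\<in>X. \<Sum>y\<in>cell k x. s x * a x * (s y * f y) / S x)"
    by (simp add: avg_def S_def sum_distrib_left sum_divide_distrib mult_ac)
  also have "\<dots> = (\<Sum>y\<in>X. \<Sum>x\<in>cell k y. s x * a x * (s y * f y) / S x)" by (rule sum_cell_swap)
  also have "\<dots> = (\<Sum>y\<in>X. \<Sum>x\<in>cell k y. s x * (s y * (a y * f y) / S y))"
    by (intro sum.cong refl) (simp add: cell_constD[OF a] S mult_ac)
  also have "\<dots> = (\<Sum>y\<in>X. S y * (s y * (a y * f y) / S y))"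
    by (simp add: S_def sum_distrib_right sum_divide_distrib)
  also have "\<dots> = (\<Sum>x\<in>X. s x * (a x * f x))"
  proof (intro sum.cong refl)
    fix y assume y: "y \<in> X"
    show "S y * (s y * (a y * f y) / S y) = s y * (a y * f y)"
    proof (cases "s y = 0")
      case False
      then have "S y > 0" using s y cell_weight_pos[of y k] by (force simp: S_def order_less_le)
      then show ?thesis by simp
    qed simp
  qed
  finally show ?thesis .
qed

lemma sum_mult_mdiff:
  assumes a: "cell_const k a" and kl: "k < l"
  shows "(\<Sum>x\<in>X. s x * (a x * mdiff s l f x)) = 0"
proof -
  have 1: "(\<Sum>x\<in>X. s x * (a x * avg s l f x)) = (\<Sum>x\<in>X. s x * (a x * f x))"
    using kl by (intro sum_mult_avg cell_const_mono[OF a]) auto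
  have 2: "(\<Sum>x\<in>X. s x * (a x * avg s (l - 1) f x)) = (\<Sum>x\<in>X. s x * (a x * f x))"
    using kl by (intro sum_mult_avg cell_const_mono[OF a]) auto
  show ?thesis using 1 2 kl by (simp add: mdiff_def right_diff_distrib sum_subtractf)
qed

lemma avg_mult_mdiff_lt:
  assumes a: "cell_const (k - 1) a" and x: "x \<in> X" and jk: "j < k"
  shows "avg s j (\<lambda>x. a x * mdiff s k f x) x = 0"
proof -
  have c: "cell_const (k - 1) (\<lambda>y. if y \<in> cell j x then a y else 0)"
  proof (rule cell_constI)
    fix u v assume uv: "u \<in> X" "v \<in> cell (k - 1) u"
    have "j \<le> k - 1" using jk by simp
    then have "v \<in> cell j u" using cell_mono[of j "k - 1" u] uv by blast
    then have "cell j v = cell j u" using cell_eq uv by auto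
    then have "v \<in> cell j x \<longleftrightarrow> u \<in> cell j x"
      using cell_self[of v j] cell_self[of u j] cell_eq[OF x] uv cell_in_X by metis
    then show "(if v \<in> cell j x then a v else 0) = (if u \<in> cell j x then a u else 0)"
      using cell_constD[OF a uv] by simp
  qed
  have "(\<Sum>y\<in>cell j x. s y * (a y * mdiff s k f y))
      = (\<Sum>y\<in>X. s y * ((if y \<in> cell j x then a y else 0) * mdiff s k f y))"
    using cell_subset[OF x] by (intro sum.mono_neutral_cong_left) auto
  also have "\<dots> = 0" using jk by (intro sum_mult_mdiff[OF c]) auto
  finally show ?thesis by (simp add: avg_def)
qed

lemma avg_mult_mdiff_ge:
  assumes a: "cell_const k a" and x: "x \<in> X" "0 < s x" and jk: "k \<le> j"
  shows "avg s j (\<lambda>x. a x * mdiff s k f x) x = a x * mdiff s k f x"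
proof (rule avg_self[OF _ x])
  have "cell_const k (\<lambda>x. a x * mdiff s k f x)"
    using cell_constD[OF a] cell_constD[OF mdiff_const] by (intro cell_constI) metis
  then show "cell_const j (\<lambda>x. a x * mdiff s k f x)" by (rule cell_const_mono[OF _ jk])
qed

text \<open>The average of a difference over any coarser cell vanishes, and a predictable factor is constant on
  those cells. Hence sums of differences with predictable factors are martingales whose
  differences are the individual summands.\<close>
lemma mdiff_mult_mdiff:
  assumes a: "cell_const (k - 1) a" and x: "x \<in> X" "0 < s x"
  shows "mdiff s l (\<lambda>x. a x * mdiff s k f x) x = (if l = k then a x * mdiff s k f x else 0)"
proof -
  have a': "cell_const k a" by (rule cell_const_mono[OF a]) simp
  note lt = avg_mult_mdiff_lt[OF a x(1), where f = f] and ge = avg_mult_mdiff_ge[OF a' x, where f = f]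
  consider "l < k" | "l = k" | "l > k" by linarith
  then show ?thesis
  proof cases
    case 1 then show ?thesis using lt[of l] lt[of "l - 1"] by (simp add: mdiff_def)
  next
    case 2
    then show ?thesis using ge[of k] lt[of "k - 1"] by (cases "k = 0") (simp_all add: mdiff_def)
  next
    case 3
    then show ?thesis using ge[of l] ge[of "l - 1"] by (simp add: mdiff_def)
  qed
qed

lemma martingale_expansion: "x \<in> X \<Longrightarrow> 0 < s x \<Longrightarrow> (\<Sum>k\<le>n. mdiff s k f x) = f x"
  by (simp add: sum_mdiff avg_bottom)

lemma parseval:
  "(\<Sum>x\<in>X. s x * (f x * g x)) = (\<Sum>k\<le>n. \<Sum>x\<in>X. s x * (mdiff s k f x * mdiff s k g x))"
proof -
  have "(\<Sum>x\<in>X. s x * (f x * g x))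
      = (\<Sum>x\<in>X. s x * ((\<Sum>k\<le>n. mdiff s k f x) * (\<Sum>l\<le>n. mdiff s l g x)))"
  proof (intro sum.cong refl)
    fix x assume "x \<in> X"
    then show "s x * (f x * g x) = s x * ((\<Sum>k\<le>n. mdiff s k f x) * (\<Sum>l\<le>n. mdiff s l g x))"
      using s martingale_expansion[of x] by (cases "s x = 0") (auto simp: order_less_le)
  qed
  also have "\<dots> = (\<Sum>x\<in>X. \<Sum>k\<le>n. \<Sum>l\<le>n. s x * (mdiff s k f x * mdiff s l g x))"
    by (intro sum.cong refl) (subst sum_product, simp only: sum_distrib_left)
  also have "\<dots> = (\<Sum>k\<le>n. \<Sum>l\<le>n. \<Sum>x\<in>X. s x * (mdiff s k f x * mdiff s l g x))"
    by (subst sum.swap, intro sum.cong refl, rule sum.swap)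
  also have "\<dots> = (\<Sum>k\<le>n. \<Sum>l\<le>n. if l = k then \<Sum>x\<in>X. s x * (mdiff s k f x * mdiff s k g x) else 0)"
  proof (intro sum.cong refl)
    fix k l :: nat
    consider "k < l" | "l < k" | "k = l" by linarith
    then show "(\<Sum>x\<in>X. s x * (mdiff s k f x * mdiff s l g x))
        = (if l = k then \<Sum>x\<in>X. s x * (mdiff s k f x * mdiff s k g x) else 0)"
    proof cases
      case 1 then show ?thesis using sum_mult_mdiff[OF mdiff_const 1] by simp
    next
      case 2 then show ?thesis using sum_mult_mdiff[OF mdiff_const 2, of s g f] by (simp add: mult_ac)
    qed simp
  qed
  also have "\<dots> = (\<Sum>k\<le>n. \<Sum>x\<in>X. s x * (mdiff s k f x * mdiff s k g x))"
    by (simp add: sum.delta)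
  finally show ?thesis .
qed

end

end

section \<open>Differential subordination\<close>

lemma sum_Plus_case:
  assumes "finite I" "finite J"
  shows "(\<Sum>k\<in>I <+> J. g (case k of Inl i \<Rightarrow> a i | Inr j \<Rightarrow> b j)) = (\<Sum>i\<in>I. g (a i)) + (\<Sum>j\<in>J. g (b j))"
  using assms by (simp add: sum.Plus)

context cell_tree
begin

context
  fixes s :: "'x \<Rightarrow> real"
  assumes s: "\<forall>x\<in>X. 0 \<le> s x"
begin

text \<open>The term of first order in a difference integrates to zero, because its coefficient is constant on the
  cells of the previous generation. Subtracting it turns the increments of the energy into Bregman
  distances, for which two-sided estimates are available if \<open>r\<close> lies between \<open>1 / 2\<close> and 1.\<close>
lemma energy_step:
  fixes f :: "'i \<Rightarrow> 'x \<Rightarrow> real" and I :: "'i set"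
  defines "A \<equiv> \<lambda>k x. \<Sum>i\<in>I. (avg s k (f i) x)\<^sup>2"
    and "B \<equiv> \<lambda>k x. \<Sum>i\<in>I. avg s k (f i) x * mdiff s (Suc k) (f i) x"
    and "H \<equiv> \<lambda>k x. \<Sum>i\<in>I. (mdiff s (Suc k) (f i) x)\<^sup>2"
  shows "(\<Sum>x\<in>X. s x * A m x powr r) = (\<Sum>x\<in>X. s x * A 0 x powr r)
    + (\<Sum>k<m. \<Sum>x\<in>X. s x * ((A k x + 2 * B k x + H k x) powr r - A k x powr r - 2 * r * A k x powr (r - 1) * B k x))"
proof (induction m)
  case (Suc m)
  have "A (Suc m) x = A m x + 2 * B m x + H m x" for x
  proof -
    have "(avg s (Suc m) (f i) x)\<^sup>2 = (avg s m (f i) x)\<^sup>2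
      + 2 * (avg s m (f i) x * mdiff s (Suc m) (f i) x) + (mdiff s (Suc m) (f i) x)\<^sup>2" for i
      by (simp add: mdiff_Suc power2_eq_square algebra_simps)
    then show ?thesis by (simp add: A_def B_def H_def sum.distrib sum_distrib_left)
  qed
  moreover have "(\<Sum>x\<in>X. s x * (2 * r * A m x powr (r - 1) * B m x)) = 0"
  proof -
    have "(\<Sum>x\<in>X. s x * ((2 * r * A m x powr (r - 1) * avg s m (f i) x) * mdiff s (Suc m) (f i) x)) = 0" for i
    proof (rule sum_mult_mdiff[OF s _ lessI], rule cell_constI)
      fix x y assume xy: "x \<in> X" "y \<in> cell m x"
      have "avg s m (f j) y = avg s m (f j) x" for j
        using cell_constD[OF avg_const xy] .
      then show "2 * r * A m y powr (r - 1) * avg s m (f i) y = 2 * r * A m x powr (r - 1) * avg s m (f i) x"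
        by (simp add: A_def)
    qed
    then have "(\<Sum>i\<in>I. \<Sum>x\<in>X. s x * ((2 * r * A m x powr (r - 1) * avg s m (f i) x) * mdiff s (Suc m) (f i) x)) = 0"
      by simp
    then show ?thesis by (subst (asm) sum.swap) (simp add: B_def sum_distrib_left mult_ac)
  qed
  ultimately have "(\<Sum>x\<in>X. s x * A (Suc m) x powr r) = (\<Sum>x\<in>X. s x * A m x powr r) +
     (\<Sum>x\<in>X. s x * ((A m x + 2 * B m x + H m x) powr r - A m x powr r - 2 * r * A m x powr (r - 1) * B m x))"
    by (simp add: right_diff_distrib sum_subtractf)
  then show ?case using Suc.IH by simp
qed simp

text \<open>The energy argument: both sides are sums of Bregman distances, bounded from above
  and from below by multiples of \<open>H\<close> times the power \<open>p / 2 - 1\<close> of \<open>A + H\<close>. This expression decreases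
  in \<open>A\<close>, so the subordinate family must have the larger energy \<open>A\<close>. That is arranged by joining
  \<open>f\<close> to \<open>g\<close>, which at most doubles the squared differences.\<close>
lemma differential_subordination_le_2:
  fixes f :: "'i \<Rightarrow> 'x \<Rightarrow> real" and g :: "'j \<Rightarrow> 'x \<Rightarrow> real"
  assumes p: "1 < p" "p \<le> 2" and I: "finite I" and J: "finite J"
    and sub: "\<And>k x. k \<le> n \<Longrightarrow> x \<in> X \<Longrightarrow> 0 < s x \<Longrightarrow>
        (\<Sum>j\<in>J. (mdiff s k (g j) x)\<^sup>2) \<le> (\<Sum>i\<in>I. (mdiff s k (f i) x)\<^sup>2)"
  shows "(\<Sum>x\<in>X. s x * (\<Sum>j\<in>J. (g j x)\<^sup>2) powr (p/2))
    \<le> 96/(p*(p-1)) * (\<Sum>x\<in>X. s x * (\<Sum>i\<in>I. (f i x)\<^sup>2) powr (p/2))"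
proof -
  define r where "r = p/2"
  define K where "K = 96/(p*(p-1))"
  have pp: "0 < p*(p-1)" "p*(p-1) \<le> 2" using p mult_mono[of p 2 "p-1" 1] by auto
  have K: "K \<ge> 2" using pp by (simp add: K_def le_divide_eq)
  have r: "1/2 \<le> r" "r \<le> 1" "r - 1 \<le> 0" using p by (auto simp: r_def)
  define A where "A = (\<lambda>k x. \<Sum>i\<in>I. (avg s k (f i) x)\<^sup>2)"
  define B where "B = (\<lambda>k x. \<Sum>i\<in>I. avg s k (f i) x * mdiff s (Suc k) (f i) x)"
  define H where "H = (\<lambda>k x. \<Sum>i\<in>I. (mdiff s (Suc k) (f i) x)\<^sup>2)"
  define D where "D = (\<lambda>k x. (A k x + 2 * B k x + H k x) powr r - A k x powr r - 2 * r * A k x powr (r - 1) * B k x)"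
  \<comment> \<open>the joined family, whose energy dominates that of \<open>f\<close>\<close>
  define h where "h = (\<lambda>k. case k of Inl i \<Rightarrow> f i | Inr j \<Rightarrow> g j)"
  define A' where "A' = (\<lambda>k x. \<Sum>i\<in>I <+> J. (avg s k (h i) x)\<^sup>2)"
  define B' where "B' = (\<lambda>k x. \<Sum>i\<in>I <+> J. avg s k (h i) x * mdiff s (Suc k) (h i) x)"
  define H' where "H' = (\<lambda>k x. \<Sum>i\<in>I <+> J. (mdiff s (Suc k) (h i) x)\<^sup>2)"
  define D' where "D' = (\<lambda>k x. (A' k x + 2 * B' k x + H' k x) powr r - A' k x powr r - 2 * r * A' k x powr (r - 1) * B' k x)"
  have eA: "A' k x = A k x + (\<Sum>j\<in>J. (avg s k (g j) x)\<^sup>2)" for k x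
    unfolding A'_def A_def h_def using sum_Plus_case[OF I J, of "\<lambda>u. (avg s k u x)\<^sup>2" f g] by simp
  have eH: "H' k x = H k x + (\<Sum>j\<in>J. (mdiff s (Suc k) (g j) x)\<^sup>2)" for k x
    unfolding H'_def H_def h_def using sum_Plus_case[OF I J, of "\<lambda>u. (mdiff s (Suc k) u x)\<^sup>2" f g] by simp
  have nn: "0 \<le> A k x" "0 \<le> H k x" "0 \<le> A' k x" "0 \<le> H' k x" for k x
    by (auto simp: A_def H_def A'_def H'_def intro!: sum_nonneg)
  have CS: "(B k x)\<^sup>2 \<le> A k x * H k x" "(B' k x)\<^sup>2 \<le> A' k x * H' k x" for k x
    unfolding A_def B_def H_def A'_def B'_def H'_def by (rule Cauchy_Schwarz_ineq_sum)+
  have en: "(\<Sum>x\<in>X. s x * A n x powr r) = (\<Sum>x\<in>X. s x * A 0 x powr r) + (\<Sum>k<n. \<Sum>x\<in>X. s x * D k x)"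
    unfolding A_def B_def H_def D_def by (rule energy_step)
  have en': "(\<Sum>x\<in>X. s x * A' n x powr r) = (\<Sum>x\<in>X. s x * A' 0 x powr r) + (\<Sum>k<n. \<Sum>x\<in>X. s x * D' k x)"
    unfolding A'_def B'_def H'_def D'_def by (rule energy_step)
  have D_le: "s x * D' k x \<le> K * (s x * D k x)" if kn: "k < n" and x: "x \<in> X" for k x
  proof (cases "s x = 0")
    case False
    then have sx: "s x > 0" using s x by (simp add: order_less_le)
    have HH: "H' k x \<le> 2 * H k x" "H k x \<le> H' k x"
      using sub[of "Suc k" x] kn x sx unfolding eH by (auto simp: H_def sum_nonneg)
    have AA: "A k x \<le> A' k x" unfolding eA by (simp add: sum_nonneg)
    have "D' k x \<le> 12 * (H' k x * (A' k x + H' k x) powr (r - 1))"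
      unfolding D'_def using nn CS r by (intro bregman_upper) auto
    also have "H' k x * (A' k x + H' k x) powr (r - 1) \<le> 2 * H k x * (A k x + H k x) powr (r - 1)"
    proof (cases "H k x = 0")
      case True then show ?thesis using HH by simp
    next
      case False
      then have "H k x > 0" using nn by (simp add: order_less_le)
      then show ?thesis using HH AA nn r by (intro mult_mono powr_mono2') (auto intro: add_nonneg_pos)
    qed
    finally have 1: "D' k x \<le> 24 * (H k x * (A k x + H k x) powr (r - 1))" by simp
    have 2: "p*(p-1)/4 * (H k x * (A k x + H k x) powr (r - 1)) \<le> D k x"
      using bregman_lower[of "A k x" "H k x" "B k x" p] nn CS p by (simp add: D_def r_def)
    have "24 * (H k x * (A k x + H k x) powr (r - 1)) = K * (p*(p-1)/4 * (H k x * (A k x + H k x) powr (r - 1)))"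
      using p by (simp add: K_def)
    also have "\<dots> \<le> K * D k x" using 2 K by (intro mult_left_mono) auto
    finally have "D' k x \<le> K * D k x" using 1 by simp
    then show ?thesis using sx by simp
  qed simp
  have A0: "s x * A' 0 x powr r \<le> K * (s x * A 0 x powr r)" if x: "x \<in> X" for x
  proof (cases "s x = 0")
    case False
    then have sx: "s x > 0" using s x by (simp add: order_less_le)
    have "A' 0 x \<le> 2 * A 0 x"
      using sub[of 0 x] x sx unfolding eA A_def by (simp add: mdiff_0)
    then have "A' 0 x powr r \<le> (2 * A 0 x) powr r" using nn r by (intro powr_mono2) auto
    also have "\<dots> = 2 powr r * A 0 x powr r" by (simp add: powr_mult)
    also have "\<dots> \<le> K * A 0 x powr r"
    proof (intro mult_right_mono)
      have "2 powr r \<le> 2 powr (1::real)" using r by (intro powr_mono) auto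
      then show "2 powr r \<le> K" using K by simp
    qed simp
    finally show ?thesis using sx by simp
  qed simp
  have end_f: "(\<Sum>x\<in>X. s x * A n x powr r) = (\<Sum>x\<in>X. s x * (\<Sum>i\<in>I. (f i x)\<^sup>2) powr r)"
  proof (intro sum.cong refl)
    fix x assume x: "x \<in> X"
    show "s x * A n x powr r = s x * (\<Sum>i\<in>I. (f i x)\<^sup>2) powr r"
      using s x avg_bottom[OF s x] by (cases "s x = 0") (auto simp: A_def order_less_le)
  qed
  have "(\<Sum>x\<in>X. s x * (\<Sum>j\<in>J. (g j x)\<^sup>2) powr r) \<le> (\<Sum>x\<in>X. s x * A' n x powr r)"
  proof (intro sum_mono)
    fix x assume x: "x \<in> X"
    show "s x * (\<Sum>j\<in>J. (g j x)\<^sup>2) powr r \<le> s x * A' n x powr r"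
    proof (cases "s x = 0")
      case False
      then have sx: "s x > 0" using s x by (simp add: order_less_le)
      have "(\<Sum>j\<in>J. (g j x)\<^sup>2) \<le> A' n x" unfolding eA using nn avg_bottom[OF s x sx] by simp
      then show ?thesis using sx r by (intro mult_left_mono powr_mono2) (auto intro: sum_nonneg)
    qed simp
  qed
  also have "\<dots> \<le> K * (\<Sum>x\<in>X. s x * A 0 x powr r) + K * (\<Sum>k<n. \<Sum>x\<in>X. s x * D k x)"
    unfolding en' sum_distrib_left by (intro add_mono sum_mono A0 D_le) auto
  also have "\<dots> = K * (\<Sum>x\<in>X. s x * A n x powr r)" by (simp add: en algebra_simps)
  finally show ?thesis unfolding end_f by (simp add: r_def K_def)
qed

end

end

lemma modulus_powr: "modulus I F x powr p = (\<Sum>i\<in>I. (F i x)\<^sup>2) powr (p/2)"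
  by (simp add: modulus_def powr_half_sqrt[symmetric] powr_powr sum_nonneg)

definition subordination_const_le_2 :: "real \<Rightarrow> real" where
  "subordination_const_le_2 p = (96/(p*(p-1))) powr (1/p)"

text \<open>For \<open>p > 2\<close> the estimate is obtained by duality, and the constant of the conjugate exponent enters
  once for each of the two square function estimates used.\<close>
definition subordination_const :: "real \<Rightarrow> real" where
  "subordination_const p = (if p \<le> 2 then subordination_const_le_2 p
     else (subordination_const_le_2 (conj_exp p))\<^sup>2)"

context cell_tree
begin

context
  fixes s :: "'x \<Rightarrow> real"
  assumes s: "\<forall>x\<in>X. 0 \<le> s x"
begin

lemma differential_subordination_le_2_vnorm:
  fixes f :: "'i \<Rightarrow> 'x \<Rightarrow> real" and g :: "'j \<Rightarrow> 'x \<Rightarrow> real"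
  assumes p: "1 < p" "p \<le> 2" and I: "finite I" and J: "finite J"
    and sub: "\<And>k x. k \<le> n \<Longrightarrow> x \<in> X \<Longrightarrow> 0 < s x \<Longrightarrow>
        (\<Sum>j\<in>J. (mdiff s k (g j) x)\<^sup>2) \<le> (\<Sum>i\<in>I. (mdiff s k (f i) x)\<^sup>2)"
  shows "vnorm X p s J g \<le> subordination_const_le_2 p * vnorm X p s I f"
proof -
  have "(\<Sum>x\<in>X. s x * modulus J g x powr p) \<le> 96/(p*(p-1)) * (\<Sum>x\<in>X. s x * modulus I f x powr p)"
    unfolding modulus_powr by (rule differential_subordination_le_2[OF s p I J sub])
  then have "vnorm X p s J g \<le> (96/(p*(p-1)) * (\<Sum>x\<in>X. s x * modulus I f x powr p)) powr (1/p)"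
    unfolding vnorm_def wnorm_def using p s by (intro powr_mono2) (auto intro!: sum_nonneg)
  then show ?thesis
    by (simp only: powr_mult subordination_const_le_2_def vnorm_def wnorm_def abs_of_nonneg modulus_nonneg)
qed

text \<open>The square function estimate below 2 dualises to the one above 2: the adjoint of
  the map taking a function to its differences sends a family to the sum of one difference
  of each of its members, which is differentially subordinate to the family.\<close>
lemma square_function_ge_2:
  fixes f :: "'i \<Rightarrow> 'x \<Rightarrow> real"
  assumes p: "2 \<le> p" and I: "finite I"
  shows "vnorm X p s ({..n} \<times> I) (\<lambda>(k,i). mdiff s k (f i))
    \<le> subordination_const_le_2 (conj_exp p) * vnorm X p s I f"
proof (rule vnorm_le_by_duality[OF _ s])
  show "1 < p" using p by simp
  have q: "1 < conj_exp p" "conj_exp p \<le> 2" using p conj_exp_gt_1 conj_exp_le_2 by auto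
  show "0 \<le> subordination_const_le_2 (conj_exp p) * vnorm X p s I f"
    by (simp add: subordination_const_le_2_def)
  fix G :: "nat \<times> 'i \<Rightarrow> 'x \<Rightarrow> real"
  \<comment> \<open>the adjoint of the square function map, applied to \<open>G\<close>\<close>
  define \<psi> where "\<psi> i x = (\<Sum>k\<le>n. mdiff s k (G (k,i)) x)" for i x
  have md: "mdiff s l (\<psi> i) x = mdiff s l (G (l,i)) x" if "l \<le> n" "x \<in> X" "0 < s x" for l i x
  proof -
    have "mdiff s l (\<psi> i) x = (\<Sum>k\<le>n. mdiff s l (\<lambda>x. mdiff s k (G (k,i)) x) x)"
      unfolding \<psi>_def[abs_def] by (rule mdiff_sum)
    also have "\<dots> = (\<Sum>k\<le>n. if l = k then mdiff s k (G (k,i)) x else 0)"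
      using mdiff_mult_mdiff[OF s _ that(2,3), of _ "\<lambda>_. 1" l] by (simp add: cell_const_def)
    finally show ?thesis using that by (simp add: sum.delta')
  qed
  have "(\<Sum>x\<in>X. s x * (\<Sum>ki\<in>{..n} \<times> I. (case ki of (k,i) \<Rightarrow> mdiff s k (f i)) x * G ki x))
      = (\<Sum>i\<in>I. \<Sum>k\<le>n. \<Sum>x\<in>X. s x * (mdiff s k (f i) x * G (k,i) x))"
  proof -
    have "(\<Sum>x\<in>X. s x * (\<Sum>ki\<in>{..n} \<times> I. (case ki of (k,i) \<Rightarrow> mdiff s k (f i)) x * G ki x))
      = (\<Sum>x\<in>X. \<Sum>k\<le>n. \<Sum>i\<in>I. s x * (mdiff s k (f i) x * G (k,i) x))"
      by (simp add: sum.cartesian_product sum_distrib_left case_prod_beta)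
    also have "\<dots> = (\<Sum>k\<le>n. \<Sum>i\<in>I. \<Sum>x\<in>X. s x * (mdiff s k (f i) x * G (k,i) x))"
      by (subst sum.swap, intro sum.cong refl, rule sum.swap)
    finally show ?thesis by (subst sum.swap)
  qed
  also have "\<dots> = (\<Sum>i\<in>I. \<Sum>x\<in>X. s x * (f i x * \<psi> i x))"
  proof (intro sum.cong refl)
    fix i
    have "(\<Sum>x\<in>X. s x * (mdiff s k (f i) x * G (k,i) x)) = (\<Sum>x\<in>X. s x * (mdiff s k (f i) x * mdiff s k (G (k,i)) x))"
      if "k \<le> n" for k
    proof -
      have "(\<Sum>x\<in>X. s x * (mdiff s k (f i) x * G (k,i) x)) = (\<Sum>x\<in>X. s x * (mdiff s k (f i) x * avg s k (G (k,i)) x))"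
        by (rule sum_mult_avg[OF s mdiff_const, symmetric])
      moreover have "k > 0 \<Longrightarrow> (\<Sum>x\<in>X. s x * (avg s (k-1) (G (k,i)) x * mdiff s k (f i) x)) = 0"
        by (rule sum_mult_mdiff[OF s avg_const]) simp
      ultimately show ?thesis
      proof (cases k)
        case (Suc m)
        then show ?thesis
          using \<open>k > 0 \<Longrightarrow> _\<close> \<open>(\<Sum>x\<in>X. s x * (mdiff s k (f i) x * G (k,i) x)) = _\<close>
          by (simp add: mdiff_Suc[of s m "G (Suc m,i)"] right_diff_distrib sum_subtractf mult_ac)
      qed (simp add: mdiff_0)
    qed
    then have "(\<Sum>k\<le>n. \<Sum>x\<in>X. s x * (mdiff s k (f i) x * G (k,i) x))
      = (\<Sum>k\<le>n. \<Sum>x\<in>X. s x * (mdiff s k (f i) x * mdiff s k (G (k,i)) x))" by simp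
    also have "\<dots> = (\<Sum>k\<le>n. \<Sum>x\<in>X. s x * (mdiff s k (f i) x * mdiff s k (\<psi> i) x))"
    proof (intro sum.cong refl)
      fix k x assume k: "k \<in> {..n}" and x: "x \<in> X"
      show "s x * (mdiff s k (f i) x * mdiff s k (G (k,i)) x) = s x * (mdiff s k (f i) x * mdiff s k (\<psi> i) x)"
        using md[of k x i] s x k by (cases "s x = 0") (auto simp: order_less_le)
    qed
    also have "\<dots> = (\<Sum>x\<in>X. s x * (f i x * \<psi> i x))" by (rule parseval[OF s, symmetric])
    finally show "(\<Sum>k\<le>n. \<Sum>x\<in>X. s x * (mdiff s k (f i) x * G (k,i) x)) = (\<Sum>x\<in>X. s x * (f i x * \<psi> i x))" .
  qed
  also have "\<dots> = (\<Sum>x\<in>X. s x * (\<Sum>i\<in>I. f i x * \<psi> i x))"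
    by (subst sum.swap) (simp add: sum_distrib_left)
  also have "\<dots> \<le> vnorm X p s I f * vnorm X (conj_exp p) s I \<psi>"
    using vnorm_Holder[OF finite_X s, where p = p and I = I and F = f and G = \<psi>] p by linarith
  also have "\<dots> \<le> vnorm X p s I f * (subordination_const_le_2 (conj_exp p) * vnorm X (conj_exp p) s ({..n} \<times> I) G)"
  proof (intro mult_left_mono differential_subordination_le_2_vnorm q I)
    fix l x assume lx: "l \<le> n" "x \<in> X" "0 < s x"
    have "(\<Sum>i\<in>I. (mdiff s l (\<psi> i) x)\<^sup>2) = (\<Sum>ki\<in>{l} \<times> I. (mdiff s l (G ki) x)\<^sup>2)"
      by (simp add: md[OF lx] sum.cartesian_product')
    also have "\<dots> \<le> (\<Sum>ki\<in>{..n} \<times> I. (mdiff s l (G ki) x)\<^sup>2)"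
      using lx I by (intro sum_mono2) auto
    finally show "(\<Sum>i\<in>I. (mdiff s l (\<psi> i) x)\<^sup>2) \<le> (\<Sum>ki\<in>{..n} \<times> I. (mdiff s l (G ki) x)\<^sup>2)" .
  qed (use I in auto)
  finally show "(\<Sum>x\<in>X. s x * (\<Sum>ki\<in>{..n} \<times> I. (case ki of (k,i) \<Rightarrow> mdiff s k (f i)) x * G ki x))
    \<le> subordination_const_le_2 (conj_exp p) * vnorm X p s I f * vnorm X (conj_exp p) s ({..n} \<times> I) G"
    by (simp add: mult_ac)
qed

lemma mdiff_differences:
  assumes "finite I" "l \<le> n" "x \<in> X" "0 < s x"
  shows "(\<Sum>ki\<in>{..n} \<times> I. (mdiff s l ((\<lambda>(k,i). mdiff s k (f i)) ki) x)\<^sup>2) = (\<Sum>i\<in>I. (mdiff s l (f i) x)\<^sup>2)"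
proof -
  have "mdiff s l (mdiff s k (f i)) x = (if l = k then mdiff s k (f i) x else 0)" for k i
    using mdiff_mult_mdiff[OF s _ assms(3,4), of k "\<lambda>_. 1" l "f i"] by (simp add: cell_const_def)
  then have "(\<Sum>ki\<in>{..n} \<times> I. (mdiff s l ((\<lambda>(k,i). mdiff s k (f i)) ki) x)\<^sup>2)
      = (\<Sum>k\<le>n. \<Sum>i\<in>I. if l = k then (mdiff s k (f i) x)\<^sup>2 else 0)"
    by (simp add: sum.cartesian_product case_prod_beta if_distrib[of "\<lambda>z. z\<^sup>2"] cong: if_cong)
  also have "\<dots> = (\<Sum>k\<le>n. if l = k then \<Sum>i\<in>I. (mdiff s k (f i) x)\<^sup>2 else 0)"
    by (intro sum.cong refl) auto
  finally show ?thesis using assms by (simp add: sum.delta')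
qed

lemma square_function_le_2:
  fixes f :: "'i \<Rightarrow> 'x \<Rightarrow> real"
  assumes p: "1 < p" "p \<le> 2" and I: "finite I"
  shows "vnorm X p s ({..n} \<times> I) (\<lambda>(k,i). mdiff s k (f i)) \<le> subordination_const_le_2 p * vnorm X p s I f"
proof (rule differential_subordination_le_2_vnorm[OF p I])
  show "finite ({..n} \<times> I)" using I by simp
qed (rule eq_refl[OF mdiff_differences[OF I]])

text \<open>For \<open>p > 2\<close>, expand the pairing with a dual family by Parseval's identity. The differences of \<open>g\<close> are
  pointwise dominated by those of \<open>f\<close>, to which the square function estimate above 2 applies, and those
  of the dual family are controlled by the square function estimate below 2.\<close>
theorem differential_subordination:
  fixes f :: "'i \<Rightarrow> 'x \<Rightarrow> real" and g :: "'j \<Rightarrow> 'x \<Rightarrow> real"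
  assumes p: "1 < p" and I: "finite I" and J: "finite J"
    and sub: "\<And>k x. k \<le> n \<Longrightarrow> x \<in> X \<Longrightarrow> 0 < s x \<Longrightarrow>
        (\<Sum>j\<in>J. (mdiff s k (g j) x)\<^sup>2) \<le> (\<Sum>i\<in>I. (mdiff s k (f i) x)\<^sup>2)"
  shows "vnorm X p s J g \<le> subordination_const p * vnorm X p s I f"
proof (cases "p \<le> 2")
  case True
  then show ?thesis
    using differential_subordination_le_2_vnorm[OF p True I J sub] by (simp add: subordination_const_def)
next
  case False
  define K where "K = subordination_const_le_2 (conj_exp p)"
  have K: "K \<ge> 0" by (simp add: K_def subordination_const_le_2_def)
  have q: "1 < conj_exp p" "conj_exp p \<le> 2" using False conj_exp_gt_1 conj_exp_le_2 by auto
  have "vnorm X p s J g \<le> K\<^sup>2 * vnorm X p s I f"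
  proof (rule vnorm_le_by_duality[OF p s])
    fix G :: "'j \<Rightarrow> 'x \<Rightarrow> real"
    have "(\<Sum>x\<in>X. s x * (\<Sum>j\<in>J. g j x * G j x)) = (\<Sum>j\<in>J. \<Sum>x\<in>X. s x * (g j x * G j x))"
      by (subst sum.swap) (simp add: sum_distrib_left)
    also have "\<dots> = (\<Sum>j\<in>J. \<Sum>k\<le>n. \<Sum>x\<in>X. s x * (mdiff s k (g j) x * mdiff s k (G j) x))"
      by (intro sum.cong refl) (rule parseval[OF s])
    also have "\<dots> = (\<Sum>x\<in>X. s x * (\<Sum>kj\<in>{..n} \<times> J. (case kj of (k,j) \<Rightarrow> mdiff s k (g j)) x * (case kj of (k,j) \<Rightarrow> mdiff s k (G j)) x))"
    proof -
      have "(\<Sum>j\<in>J. \<Sum>k\<le>n. \<Sum>x\<in>X. s x * (mdiff s k (g j) x * mdiff s k (G j) x))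
        = (\<Sum>k\<le>n. \<Sum>j\<in>J. \<Sum>x\<in>X. s x * (mdiff s k (g j) x * mdiff s k (G j) x))" by (rule sum.swap)
      also have "\<dots> = (\<Sum>kj\<in>{..n} \<times> J. \<Sum>x\<in>X. s x * ((case kj of (k,j) \<Rightarrow> mdiff s k (g j)) x * (case kj of (k,j) \<Rightarrow> mdiff s k (G j)) x))"
        by (simp add: sum.cartesian_product')
      also have "\<dots> = (\<Sum>x\<in>X. \<Sum>kj\<in>{..n} \<times> J. s x * ((case kj of (k,j) \<Rightarrow> mdiff s k (g j)) x * (case kj of (k,j) \<Rightarrow> mdiff s k (G j)) x))"
        by (rule sum.swap)
      finally show ?thesis by (simp only: sum_distrib_left)
    qed
    also have "\<dots> \<le> vnorm X p s ({..n} \<times> J) (\<lambda>(k,j). mdiff s k (g j))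
        * vnorm X (conj_exp p) s ({..n} \<times> J) (\<lambda>(k,j). mdiff s k (G j))"
      using vnorm_Holder[OF finite_X s p, where I = "{..n} \<times> J" and F = "\<lambda>(k,j). mdiff s k (g j)"
          and G = "\<lambda>(k,j). mdiff s k (G j)"] by linarith
    also have "\<dots> \<le> vnorm X p s ({..n} \<times> I) (\<lambda>(k,i). mdiff s k (f i)) * (K * vnorm X (conj_exp p) s J G)"
    proof (intro mult_mono)
      show "vnorm X p s ({..n} \<times> J) (\<lambda>(k,j). mdiff s k (g j)) \<le> vnorm X p s ({..n} \<times> I) (\<lambda>(k,i). mdiff s k (f i))"
      proof (rule vnorm_mono[OF s])
        fix x assume x: "x \<in> X" "0 < s x"
        have "(\<Sum>k\<le>n. \<Sum>j\<in>J. (mdiff s k (g j) x)\<^sup>2) \<le> (\<Sum>k\<le>n. \<Sum>i\<in>I. (mdiff s k (f i) x)\<^sup>2)"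
          using x by (intro sum_mono sub) auto
        then show "(\<Sum>i\<in>{..n} \<times> J. ((case i of (k, j) \<Rightarrow> mdiff s k (g j)) x)\<^sup>2)
          \<le> (\<Sum>j\<in>{..n} \<times> I. ((case j of (k, i) \<Rightarrow> mdiff s k (f i)) x)\<^sup>2)"
          by (simp add: sum.cartesian_product')
      qed (use p in auto)
      show "vnorm X (conj_exp p) s ({..n} \<times> J) (\<lambda>(k, j). mdiff s k (G j)) \<le> K * vnorm X (conj_exp p) s J G"
        unfolding K_def by (rule square_function_le_2[OF q J])
    qed auto
    also have "\<dots> \<le> (K * vnorm X p s I f) * (K * vnorm X (conj_exp p) s J G)"
      unfolding K_def using False
      by (intro mult_right_mono square_function_ge_2 I) (auto simp: subordination_const_le_2_def)
    finally show "(\<Sum>x\<in>X. s x * (\<Sum>j\<in>J. g j x * G j x)) \<le> K\<^sup>2 * vnorm X p s I f * vnorm X (conj_exp p) s J G"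
      by (simp add: power2_eq_square mult_ac)
  qed simp
  then show ?thesis using False by (simp add: subordination_const_def K_def)
qed

text \<open>The family of all differences of \<open>f\<close>, seen as a family of martingales, has the same squared
  differences as \<open>f\<close>.\<close>
corollary square_function:
  fixes f :: "'i \<Rightarrow> 'x \<Rightarrow> real"
  assumes p: "1 < p" and I: "finite I"
  shows "vnorm X p s ({..n} \<times> I) (\<lambda>(k,i). mdiff s k (f i)) \<le> subordination_const p * vnorm X p s I f"
proof (rule differential_subordination[OF p I])
  show "finite ({..n} \<times> I)" using I by simp
qed (rule eq_refl[OF mdiff_differences[OF I]])

end

end

lemma subordination_const_nonneg: "0 \<le> subordination_const p"
  by (simp add: subordination_const_def subordination_const_le_2_def)

section \<open>The vector-valued maximal inequality\<close>

lemma powr_diff_le: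
  fixes a b p :: real
  assumes p: "1 < p" and ab: "0 \<le> a" "a \<le> b"
  shows "(b powr p - a powr p) / conj_exp p \<le> b powr p - a powr (p - 1) * b"
proof -
  have "a powr (p - 1) * b \<le> (a powr (p - 1)) powr (conj_exp p) / conj_exp p + b powr p / p"
    using p ab conj_exp_gt_1[OF p] conj_exp_inverse[OF p] by (intro Youngs_inequality) auto
  also have "(a powr (p - 1)) powr (conj_exp p) = a powr p"
    using conj_exp_mult[OF p] by (simp add: powr_powr)
  finally have 1: "a powr (p - 1) * b \<le> a powr p / conj_exp p + b powr p / p" .
  have "b powr p = b powr p * (1/p + 1/conj_exp p)" using conj_exp_inverse[OF p] by simp
  also have "\<dots> = b powr p / p + b powr p / conj_exp p" by (simp add: distrib_left)
  finally show ?thesis using 1 by (simp add: diff_divide_distrib)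
qed

text \<open>Convexity of the power \<open>p / 2\<close>, applied to the squares.\<close>
lemma powr_diff_le_ge_2:
  fixes a b p :: real
  assumes p: "2 \<le> p" and ab: "0 \<le> a" "a \<le> b"
  shows "b powr p - a powr p \<le> p / 2 * (b powr (p - 2) * (b\<^sup>2 - a\<^sup>2))"
proof (cases "a = 0 \<or> b = 0")
  case True
  have "b powr (p - 2) * b\<^sup>2 = b powr p"
  proof (cases "b = 0")
    case False
    then have "b\<^sup>2 = b powr 2" using ab by simp
    then show ?thesis by (simp only: powr_add[symmetric]) simp
  qed simp
  moreover have "1 * b powr p \<le> p / 2 * b powr p" using p by (intro mult_right_mono) auto
  ultimately show ?thesis using True ab by auto
next
  case False
  then have pos: "a > 0" "b > 0" using ab by auto
  have e: "b powr (p - 2) * b\<^sup>2 = b powr p" 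
  proof -
    have "b\<^sup>2 = b powr 2" using pos by simp
    then show ?thesis by (simp only: powr_add[symmetric]) simp
  qed
  have "(a powr p) powr (2/p) * (b powr p) powr (1 - 2/p) \<le> 2/p * a powr p + (1 - 2/p) * b powr p"
    using pos p by (intro Youngs_inequality_0) auto
  moreover have "(a powr p) powr (2/p) = a\<^sup>2" using pos p by (simp add: powr_powr)
  moreover have "(b powr p) powr (1 - 2/p) = b powr (p - 2)"
    using p by (simp add: powr_powr right_diff_distrib)
  ultimately have "a\<^sup>2 * b powr (p - 2) \<le> 2/p * a powr p + (1 - 2/p) * b powr p" by simp
  then have "p/2 * (a\<^sup>2 * b powr (p - 2)) \<le> p/2 * (2/p * a powr p + (1 - 2/p) * b powr p)"
    using p by (intro mult_left_mono) auto
  also have "\<dots> = a powr p + (p/2 - 1) * b powr p" using p by (simp add: field_simps)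
  finally show ?thesis using e by (simp add: algebra_simps)
qed

definition maximal_const :: "real \<Rightarrow> real" where
  "maximal_const p = max p (conj_exp p)"

lemma maximal_const_ge_1: "1 < p \<Longrightarrow> 1 \<le> maximal_const p"
  by (simp add: maximal_const_def)

text \<open>The numbers \<open>m i\<close> are maxima of past averages and \<open>x i\<close> the new averages. The inequality bounds the growth
  of the vector norm by a pairing with \<open>x\<close>, in which \<open>x i\<close> can later be replaced by the function
  itself, since the coefficients are constant on cells. For \<open>p \<le> 2\<close> the coefficient of an index whose
  maximum does not grow is nonpositive, so \<open>x i\<close> may be replaced by \<open>m' i\<close>; for \<open>p > 2\<close> such indices contribute
  nonnegatively and may be dropped.\<close>
lemma maximal_increment:
  fixes m m' x :: "'i \<Rightarrow> real"
  assumes p: "1 < p" and I: "finite I"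
    and m: "\<And>i. i \<in> I \<Longrightarrow> 0 \<le> m i" and x: "\<And>i. i \<in> I \<Longrightarrow> 0 \<le> x i"
    and m': "\<And>i. i \<in> I \<Longrightarrow> m' i = max (m i) (x i)"
  defines "N \<equiv> sqrt (\<Sum>i\<in>I. (m i)\<^sup>2)" and "N' \<equiv> sqrt (\<Sum>i\<in>I. (m' i)\<^sup>2)"
  shows "N' powr p - N powr p \<le> maximal_const p * (\<Sum>i\<in>I. (N' powr (p - 2) * m' i - N powr (p - 2) * m i) * x i)"
proof -
  have mm: "m i \<le> m' i" "0 \<le> m' i" if "i \<in> I" for i using m[OF that] m'[OF that] by auto
  have NN: "N \<le> N'" unfolding N_def N'_def using mm m by (intro real_sqrt_le_mono sum_mono power_mono) auto
  have N0: "0 \<le> N" "0 \<le> N'" by (auto simp: N_def N'_def sum_nonneg)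
  have N2: "N\<^sup>2 = (\<Sum>i\<in>I. (m i)\<^sup>2)" "N'\<^sup>2 = (\<Sum>i\<in>I. (m' i)\<^sup>2)"
    by (auto simp: N_def N'_def sum_nonneg)
  have sq: "z powr (p - 2) * z\<^sup>2 = z powr p" if "0 \<le> z" for z :: real
  proof (cases "z = 0")
    case False
    then have "z\<^sup>2 = z powr 2" using that by simp
    then show ?thesis by (simp only: powr_add[symmetric]) simp
  qed simp
  define R where "R = (\<Sum>i\<in>I. (N' powr (p - 2) * m' i - N powr (p - 2) * m i) * x i)"
  have diff0: "0 \<le> N' powr p - N powr p" using NN N0 p by (simp add: powr_mono2)
  show ?thesis
  proof (cases "p \<le> 2")
    case True
    have "(\<Sum>i\<in>I. (N' powr (p - 2) * m' i - N powr (p - 2) * m i) * m' i) \<le> R"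
      unfolding R_def
    proof (intro sum_mono)
      fix i assume i: "i \<in> I"
      show "(N' powr (p - 2) * m' i - N powr (p - 2) * m i) * m' i
        \<le> (N' powr (p - 2) * m' i - N powr (p - 2) * m i) * x i"
      proof (cases "x i \<ge> m i")
        case True then show ?thesis using m'[OF i] by simp
      next
        case False
        then have e: "m' i = m i" "x i \<le> m' i" using m'[OF i] by auto
        have "m i > 0" using False x[OF i] by linarith
        then have "N\<^sup>2 > 0" unfolding N2 using I i by (intro sum_pos2[of _ i]) auto
        then have "N > 0" using N0 by (simp add: order_less_le)
        then have "N' powr (p - 2) \<le> N powr (p - 2)" using NN \<open>p \<le> 2\<close> by (intro powr_mono2') auto
        then have "N' powr (p - 2) * m' i - N powr (p - 2) * m i \<le> 0"
          unfolding e(1) using m[OF i] by (simp add: mult_right_mono)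
        then show ?thesis using e(2) by (rule mult_left_mono_neg[rotated])
      qed
    qed
    moreover have "(\<Sum>i\<in>I. (N' powr (p - 2) * m' i - N powr (p - 2) * m i) * m' i)
      = N' powr p - N powr (p - 2) * (\<Sum>i\<in>I. m i * m' i)"
    proof -
      have "(\<Sum>i\<in>I. (N' powr (p - 2) * m' i - N powr (p - 2) * m i) * m' i)
        = N' powr (p - 2) * N'\<^sup>2 - N powr (p - 2) * (\<Sum>i\<in>I. m i * m' i)"
        unfolding N2 by (simp add: left_diff_distrib right_diff_distrib sum_subtractf sum_distrib_left power2_eq_square mult_ac)
      then show ?thesis using sq[OF N0(2)] by simp
    qed
    moreover have "N powr (p - 2) * (\<Sum>i\<in>I. m i * m' i) \<le> N powr (p - 1) * N'"
    proof -
      have "(\<Sum>i\<in>I. m i * m' i) \<le> N * N'"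
        unfolding N_def N'_def real_sqrt_mult[symmetric]
        by (intro real_le_rsqrt Cauchy_Schwarz_ineq_sum)
      then have "N powr (p - 2) * (\<Sum>i\<in>I. m i * m' i) \<le> N powr (p - 2) * (N * N')"
        by (intro mult_left_mono) auto
      also have "\<dots> = N powr (p - 1) * N'"
        using N0 by (cases "N = 0") (auto simp: powr_mult_base mult_ac diff_diff_eq powr_diff power2_eq_square)
      finally show ?thesis .
    qed
    ultimately have "N' powr p - N powr (p - 1) * N' \<le> R" by linarith
    then have "(N' powr p - N powr p) / conj_exp p \<le> R" using powr_diff_le[OF p N0(1) NN] by linarith
    then have 1: "N' powr p - N powr p \<le> conj_exp p * R"
      using conj_exp_gt_1[OF p] by (simp add: divide_le_eq mult.commute)
    then have "0 \<le> R" using diff0 conj_exp_gt_1[OF p] by (smt (verit) mult_pos_neg)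
    then have "conj_exp p * R \<le> maximal_const p * R" by (intro mult_right_mono) (auto simp: maximal_const_def)
    then show ?thesis using 1 by (simp add: R_def)
  next
    case False
    have pw: "N powr (p - 2) \<le> N' powr (p - 2)" using NN N0 False by (intro powr_mono2) auto
    have "(\<Sum>i\<in>I. N' powr (p - 2) * (((m' i)\<^sup>2 - (m i)\<^sup>2) / 2)) \<le> R"
      unfolding R_def
    proof (intro sum_mono)
      fix i assume i: "i \<in> I"
      have a: "N powr (p - 2) * m i \<le> N' powr (p - 2) * m i" using pw m[OF i] by (intro mult_right_mono) auto
      show "N' powr (p - 2) * (((m' i)\<^sup>2 - (m i)\<^sup>2) / 2)
        \<le> (N' powr (p - 2) * m' i - N powr (p - 2) * m i) * x i"
      proof (cases "x i \<ge> m i")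
        case True
        then have e: "m' i = x i" using m'[OF i] by simp
        have "((m' i)\<^sup>2 - (m i)\<^sup>2) / 2 \<le> (m' i - m i) * x i"
        proof -
          have "0 \<le> (m' i - m i)\<^sup>2" by simp
          then have "(m' i)\<^sup>2 - (m i)\<^sup>2 \<le> 2 * ((m' i - m i) * x i)"
            unfolding e by (simp add: power2_eq_square algebra_simps)
          then show ?thesis by simp
        qed
        then have "N' powr (p - 2) * (((m' i)\<^sup>2 - (m i)\<^sup>2) / 2) \<le> N' powr (p - 2) * ((m' i - m i) * x i)"
          by (intro mult_left_mono) auto
        also have "\<dots> = (N' powr (p - 2) * m' i - N' powr (p - 2) * m i) * x i" by (simp add: algebra_simps)
        also have "\<dots> \<le> (N' powr (p - 2) * m' i - N powr (p - 2) * m i) * x i"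
          using a x[OF i] by (intro mult_right_mono) auto
        finally show ?thesis .
      next
        case False
        then have e: "m' i = m i" using m'[OF i] by simp
        have "0 \<le> (N' powr (p - 2) * m' i - N powr (p - 2) * m i) * x i"
          using a x[OF i] unfolding e by (intro mult_nonneg_nonneg) auto
        then show ?thesis by (simp add: e)
      qed
    qed
    moreover have "(\<Sum>i\<in>I. N' powr (p - 2) * (((m' i)\<^sup>2 - (m i)\<^sup>2) / 2)) = N' powr (p - 2) * (N'\<^sup>2 - N\<^sup>2) / 2"
      unfolding N2 by (simp add: sum_distrib_left[symmetric] sum_divide_distrib[symmetric] sum_subtractf)
    ultimately have R: "N' powr (p - 2) * (N'\<^sup>2 - N\<^sup>2) / 2 \<le> R" by simp
    have "N' powr p - N powr p \<le> p / 2 * (N' powr (p - 2) * (N'\<^sup>2 - N\<^sup>2))"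
      using False N0 NN by (intro powr_diff_le_ge_2) auto
    also have "\<dots> = p * (N' powr (p - 2) * (N'\<^sup>2 - N\<^sup>2) / 2)" by simp
    also have "\<dots> \<le> p * R" using R p by (intro mult_left_mono) auto
    finally have 1: "N' powr p - N powr p \<le> p * R" .
    then have "0 \<le> R" using diff0 p by (smt (verit) mult_pos_neg)
    then have "p * R \<le> maximal_const p * R" by (intro mult_right_mono) (auto simp: maximal_const_def)
    then show ?thesis using 1 by (simp add: R_def)
  qed
qed

context cell_tree
begin

primrec maximal :: "('x \<Rightarrow> real) \<Rightarrow> nat \<Rightarrow> ('x \<Rightarrow> real) \<Rightarrow> 'x \<Rightarrow> real" where
  "maximal s 0 f x = avg s 0 (\<lambda>x. \<bar>f x\<bar>) x"
| "maximal s (Suc k) f x = max (maximal s k f x) (avg s (Suc k) (\<lambda>x. \<bar>f x\<bar>) x)"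

lemma maximal_const: "cell_const k (maximal s k f)"
proof (induction k)
  case 0 then show ?case using avg_const[of 0 s "\<lambda>x. \<bar>f x\<bar>"] by (simp add: cell_const_def)
next
  case (Suc k)
  then have "cell_const (Suc k) (maximal s k f)" by (rule cell_const_mono) simp
  then show ?case using avg_const[of "Suc k" s "\<lambda>x. \<bar>f x\<bar>"] by (simp add: cell_const_def)
qed

lemma avg_le_maximal: "j \<le> k \<Longrightarrow> avg s j (\<lambda>x. \<bar>f x\<bar>) x \<le> maximal s k f x"
proof (induction k rule: dec_induct)
  case base then show ?case by (cases j) auto
next
  case (step k) then show ?case by simp
qed

lemma maximal_mono: "j \<le> k \<Longrightarrow> maximal s j f x \<le> maximal s k f x"
  by (induction k rule: dec_induct) auto

context
  fixes s :: "'x \<Rightarrow> real"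
  assumes s: "\<forall>x\<in>X. 0 \<le> s x"
begin

lemma maximal_nonneg: "x \<in> X \<Longrightarrow> 0 \<le> maximal s k f x"
  using avg_le_maximal[of 0 k s f x] avg_nonneg[OF s, of x "\<lambda>x. \<bar>f x\<bar>" 0] by auto

lemma abs_avg_le_maximal: "x \<in> X \<Longrightarrow> \<bar>avg s k f x\<bar> \<le> maximal s k f x"
  using avg_abs_le[OF s, of x k f] avg_le_maximal[of k k s f x] by simp

text \<open>This is Doob's argument in its vector-valued form. Summing the increments of the norm of the running
  maximum, the factors in front of the averages are constant on cells and telescope, so that the power of the
  norm of the maximal function is bounded by its pairing, through the extremal dual element,
  with the functions themselves. Hoelder's inequality finishes the proof.\<close>
theorem vector_maximal_inequality:
  fixes f :: "'i \<Rightarrow> 'x \<Rightarrow> real"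
  assumes p: "1 < p" and I: "finite I"
  shows "vnorm X p s I (\<lambda>i. maximal s m (f i)) \<le> maximal_const p * vnorm X p s I f"
proof -
  define M where "M k i = maximal s k (f i)" for k i
  define \<psi> where "\<psi> k i x = modulus I (M k) x powr (p - 2) * M k i x" for k i x
  have \<psi>_const: "cell_const k (\<psi> k i)" for k i
  proof (rule cell_constI)
    fix x y assume xy: "x \<in> X" "y \<in> cell k x"
    have "M k j y = M k j x" for j unfolding M_def by (rule cell_constD[OF maximal_const xy])
    then show "\<psi> k i y = \<psi> k i x" by (simp add: \<psi>_def modulus_def)
  qed
  have C: "1 \<le> maximal_const p" using p by (rule maximal_const_ge_1)
  have avg: "(\<Sum>x\<in>X. s x * (\<psi> j i x * avg s k (\<lambda>x. \<bar>f i x\<bar>) x)) = (\<Sum>x\<in>X. s x * (\<psi> j i x * \<bar>f i x\<bar>))"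
    if "j \<le> k" for j k i
    using that by (intro sum_mult_avg[OF s] cell_const_mono[OF \<psi>_const])
  have pw: "modulus I (M k) x powr p = (\<Sum>i\<in>I. \<psi> k i x * M k i x)" for k x
    using inner_dual_element[where F = "M k" and I = I and p = p and x = x]
    by (simp add: \<psi>_def dual_element_def mult.commute)
  have "(\<Sum>x\<in>X. s x * modulus I (M k) x powr p)
      \<le> maximal_const p * (\<Sum>i\<in>I. \<Sum>x\<in>X. s x * (\<psi> k i x * \<bar>f i x\<bar>))" for k
  proof (induction k)
    case 0
    have eq: "(\<Sum>x\<in>X. s x * modulus I (M 0) x powr p) = (\<Sum>i\<in>I. \<Sum>x\<in>X. s x * (\<psi> 0 i x * \<bar>f i x\<bar>))"
    proof -
      have "(\<Sum>x\<in>X. s x * modulus I (M 0) x powr p) = (\<Sum>i\<in>I. \<Sum>x\<in>X. s x * (\<psi> 0 i x * M 0 i x))"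
        unfolding pw sum_distrib_left by (rule sum.swap)
      then show ?thesis by (simp add: M_def avg)
    qed
    have "0 \<le> (\<Sum>x\<in>X. s x * modulus I (M 0) x powr p)" using s by (intro sum_nonneg) auto
    then show ?case unfolding eq using C mult_right_mono[of 1 "maximal_const p"] by fastforce
  next
    case (Suc k)
    let ?a = "\<lambda>i x. avg s (Suc k) (\<lambda>x. \<bar>f i x\<bar>) x"
    have "(\<Sum>x\<in>X. s x * modulus I (M (Suc k)) x powr p) - (\<Sum>x\<in>X. s x * modulus I (M k) x powr p)
      = (\<Sum>x\<in>X. s x * (modulus I (M (Suc k)) x powr p - modulus I (M k) x powr p))"
      by (simp add: right_diff_distrib sum_subtractf)
    also have "\<dots> \<le> (\<Sum>x\<in>X. s x * (maximal_const p * (\<Sum>i\<in>I. (\<psi> (Suc k) i x - \<psi> k i x) * ?a i x)))"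
    proof (intro sum_mono mult_left_mono)
      fix x assume x: "x \<in> X"
      have "sqrt (\<Sum>i\<in>I. (M (Suc k) i x)\<^sup>2) powr p - sqrt (\<Sum>i\<in>I. (M k i x)\<^sup>2) powr p
        \<le> maximal_const p * (\<Sum>i\<in>I. (sqrt (\<Sum>i\<in>I. (M (Suc k) i x)\<^sup>2) powr (p - 2) * M (Suc k) i x
              - sqrt (\<Sum>i\<in>I. (M k i x)\<^sup>2) powr (p - 2) * M k i x) * ?a i x)"
        using x maximal_nonneg[OF x] avg_nonneg[OF s x]
        by (intro maximal_increment[OF p I]) (auto simp: M_def)
      then show "modulus I (M (Suc k)) x powr p - modulus I (M k) x powr p
          \<le> maximal_const p * (\<Sum>i\<in>I. (\<psi> (Suc k) i x - \<psi> k i x) * ?a i x)"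
        by (simp add: \<psi>_def modulus_def)
    qed (use s in auto)
    also have "\<dots> = maximal_const p * (\<Sum>x\<in>X. \<Sum>i\<in>I. s x * ((\<psi> (Suc k) i x - \<psi> k i x) * ?a i x))"
      by (simp add: sum_distrib_left mult_ac)
    also have "(\<Sum>x\<in>X. \<Sum>i\<in>I. s x * ((\<psi> (Suc k) i x - \<psi> k i x) * ?a i x))
      = (\<Sum>i\<in>I. (\<Sum>x\<in>X. s x * (\<psi> (Suc k) i x * ?a i x)) - (\<Sum>x\<in>X. s x * (\<psi> k i x * ?a i x)))"
      by (subst sum.swap) (simp add: left_diff_distrib right_diff_distrib sum_subtractf)
    also have "\<dots> = (\<Sum>i\<in>I. \<Sum>x\<in>X. s x * (\<psi> (Suc k) i x * \<bar>f i x\<bar>)) - (\<Sum>i\<in>I. \<Sum>x\<in>X. s x * (\<psi> k i x * \<bar>f i x\<bar>))"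
      by (simp add: avg sum_subtractf)
    finally show ?case using Suc.IH by (simp add: right_diff_distrib)
  qed
  note main = this[of m]
  define v where "v = vnorm X p s I (M m)"
  have "v powr p = (\<Sum>x\<in>X. s x * modulus I (M m) x powr p)"
    using wnorm_powr[OF s, where p=p] p by (simp add: v_def vnorm_def)
  also note main
  also have "(\<Sum>i\<in>I. \<Sum>x\<in>X. s x * (\<psi> m i x * \<bar>f i x\<bar>)) = (\<Sum>x\<in>X. s x * (\<Sum>i\<in>I. \<bar>f i x\<bar> * dual_element p I (M m) i x))"
    by (subst sum.swap) (simp add: sum_distrib_left \<psi>_def dual_element_def mult_ac)
  also have "maximal_const p * \<dots> \<le> maximal_const p * (vnorm X p s I (\<lambda>i x. \<bar>f i x\<bar>) * vnorm X (conj_exp p) s I (dual_element p I (M m)))"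
    using vnorm_Holder[OF finite_X s p, where I = I and F = "\<lambda>i x. \<bar>f i x\<bar>" and G = "dual_element p I (M m)"] C
    by (intro mult_left_mono) linarith+
  also have "vnorm X p s I (\<lambda>i x. \<bar>f i x\<bar>) = vnorm X p s I f" by (rule vnorm_cong) simp
  also have "vnorm X (conj_exp p) s I (dual_element p I (M m)) = v powr (p - 1)"
    using vnorm_dual_element[OF p s] by (simp add: v_def)
  finally have le: "v powr p \<le> maximal_const p * vnorm X p s I f * v powr (p - 1)" by (simp add: mult_ac)
  have "v \<le> maximal_const p * vnorm X p s I f"
  proof (cases "v = 0")
    case False
    then have "v > 0" by (simp add: v_def order_less_le)
    moreover from this have "v * v powr (p - 1) \<le> maximal_const p * vnorm X p s I f * v powr (p - 1)"
      using le by (simp add: powr_mult_base)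
    ultimately show ?thesis by simp
  qed (use C in simp)
  moreover have "M m = (\<lambda>i. maximal s m (f i))" by (rule ext) (simp add: M_def)
  ultimately show ?thesis by (simp add: v_def)
qed

end

end

section \<open>Bilinear forms of kernels that are constant off the diagonal\<close>

context cell_tree
begin

lemma sum_cell_ring_swap:
  "(\<Sum>x\<in>X. \<Sum>y\<in>cell j x - cell (Suc j) x. g x y) = (\<Sum>y\<in>X. \<Sum>x\<in>cell j y - cell (Suc j) y. (g x y :: real))"
proof -
  have "(\<Sum>x\<in>X. \<Sum>y\<in>cell j x - cell (Suc j) x. g x y)
      = (\<Sum>x\<in>X. \<Sum>y\<in>cell j x. g x y) - (\<Sum>x\<in>X. \<Sum>y\<in>cell (Suc j) x. g x y)"
    using cell_Suc by (simp add: sum_diff sum_subtractf)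
  also have "\<dots> = (\<Sum>y\<in>X. \<Sum>x\<in>cell j y. g x y) - (\<Sum>y\<in>X. \<Sum>x\<in>cell (Suc j) y. g x y)"
    by (intro arg_cong2[where f = "(-)"] sum_cell_swap)
  also have "\<dots> = (\<Sum>y\<in>X. \<Sum>x\<in>cell j y - cell (Suc j) y. g x y)"
    using cell_Suc by (simp add: sum_diff sum_subtractf)
  finally show ?thesis .
qed

lemma sum_outside_cell:
  assumes x: "x \<in> X"
  shows "(\<Sum>y\<in>X - cell c x. h y) = (\<Sum>y\<in>X - cell 0 x. h y) + (\<Sum>j<c. \<Sum>y\<in>cell j x - cell (Suc j) x. (h y :: real))"
proof (induction c)
  case (Suc c)
  have "X - cell (Suc c) x = (X - cell c x) \<union> (cell c x - cell (Suc c) x)"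
    using cell_subset[OF x, of c] cell_Suc[OF x, of c] by blast
  moreover have "(\<Sum>y\<in>(X - cell c x) \<union> (cell c x - cell (Suc c) x). h y)
      = (\<Sum>y\<in>X - cell c x. h y) + (\<Sum>y\<in>cell c x - cell (Suc c) x. h y)"
    using x by (intro sum.union_disjoint) auto
  ultimately show ?case using Suc.IH by simp
qed simp

lemma cell_member_const:
  assumes x: "x \<in> X" and uv: "u \<in> X" "v \<in> cell k u" and jk: "j \<le> k"
  shows "v \<in> cell j x \<longleftrightarrow> u \<in> cell j x"
proof -
  have "v \<in> cell j u" using cell_mono[OF jk uv(1)] uv by blast
  then have "cell j v = cell j u" using cell_eq uv by auto
  then show ?thesis
    using cell_self[of v j] cell_self[of u j] cell_eq[OF x] uv cell_in_X by metis
qed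

end

text \<open>Summation over a band near the diagonal, along the parallels to the diagonal.\<close>
lemma sum_band:
  fixes h :: "nat \<Rightarrow> nat \<Rightarrow> real"
  shows "(\<Sum>d\<le>n. \<Sum>c\<le>n. if c + e0 \<le> d \<and> d \<le> c + K then h c d else 0)
    = (\<Sum>e=e0..K. \<Sum>c\<le>n. if c + e \<le> n then h c (c + e) else 0)"
proof -
  have "(if c + e0 \<le> d \<and> d \<le> c + K then h c d else 0) = (\<Sum>e=e0..K. if d = c + e then h c (c + e) else 0)" for c d
  proof (cases "c + e0 \<le> d \<and> d \<le> c + K")
    case True
    then have "(\<Sum>e=e0..K. if d = c + e then h c (c + e) else 0) = (\<Sum>e=e0..K. if e = d - c then h c d else 0)"
      by (intro sum.cong refl) auto
    also have "\<dots> = h c d" using True by (subst sum.delta) auto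
    finally show ?thesis using True by simp
  next
    case False
    then have "(\<Sum>e=e0..K. if d = c + e then h c (c + e) else 0) = 0" by (intro sum.neutral) auto
    then show ?thesis by (simp only: if_not_P[OF False])
  qed
  then have "(\<Sum>d\<le>n. \<Sum>c\<le>n. if c + e0 \<le> d \<and> d \<le> c + K then h c d else 0)
    = (\<Sum>d\<le>n. \<Sum>c\<le>n. \<Sum>e=e0..K. if d = c + e then h c (c + e) else 0)" by simp
  also have "\<dots> = (\<Sum>c\<le>n. \<Sum>d\<le>n. \<Sum>e=e0..K. if d = c + e then h c (c + e) else 0)" by (rule sum.swap)
  also have "\<dots> = (\<Sum>c\<le>n. \<Sum>e=e0..K. \<Sum>d\<le>n. if d = c + e then h c (c + e) else 0)"
    by (intro sum.cong refl sum.swap)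
  also have "\<dots> = (\<Sum>c\<le>n. \<Sum>e=e0..K. if c + e \<le> n then h c (c + e) else 0)"
    by (intro sum.cong refl) (simp add: sum.delta)
  also have "\<dots> = (\<Sum>e=e0..K. \<Sum>c\<le>n. if c + e \<le> n then h c (c + e) else 0)" by (rule sum.swap)
  finally show ?thesis .
qed

lemma sum_shift_le:
  fixes h :: "nat \<Rightarrow> real"
  assumes "finite A" "\<And>k. 0 \<le> h k"
  shows "(\<Sum>c\<in>A. if c + e \<le> n then h (c + e) else 0) \<le> (\<Sum>k\<le>n. h k)"
proof -
  have "(\<Sum>c\<in>A. if c + e \<le> n then h (c + e) else 0) = (\<Sum>c\<in>{c\<in>A. c + e \<le> n}. h (c + e))"
    using assms by (simp add: sum.inter_filter)
  also have "\<dots> = (\<Sum>k\<in>(\<lambda>c. c + e) ` {c\<in>A. c + e \<le> n}. h k)"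
    by (subst sum.reindex) (auto simp: inj_on_def)
  also have "\<dots> \<le> (\<Sum>k\<le>n. h k)" using assms by (intro sum_mono2) auto
  finally show ?thesis .
qed

text \<open>The three conditions on the kernels \<open>t u\<close> say that a cell \<open>Q\<close> not containing \<open>x\<close> sees
  \<open>t u x\<close> as a function that is constant on the cells \<open>\<kappa>\<close> generations below \<open>Q\<close>, the same with the variables
  exchanged, and that different top cells do not interact. Kernels of shifts of complexity \<open>\<kappa>\<close> have these properties.\<close>
locale kernel_family = cell_tree X cell n
  for X :: "'x set" and cell :: "nat \<Rightarrow> 'x \<Rightarrow> 'x set" and n :: nat +
  fixes s w :: "'x \<Rightarrow> real" and t :: "'u \<Rightarrow> 'x \<Rightarrow> 'x \<Rightarrow> real" and Us :: "'u set" and \<kappa> :: nat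
  assumes s: "\<forall>x\<in>X. 0 \<le> s x" and w: "\<forall>x\<in>X. 0 \<le> w x" and finite_Us [simp]: "finite Us"
    and kernel_right: "u \<in> Us \<Longrightarrow> x \<in> X \<Longrightarrow> y \<in> X \<Longrightarrow> y' \<in> cell (k + \<kappa>) y \<Longrightarrow> x \<notin> cell k y \<Longrightarrow> t u x y' = t u x y"
    and kernel_left: "u \<in> Us \<Longrightarrow> x \<in> X \<Longrightarrow> y \<in> X \<Longrightarrow> x' \<in> cell (k + \<kappa>) x \<Longrightarrow> y \<notin> cell k x \<Longrightarrow> t u x' y = t u x y"
    and kernel_top: "u \<in> Us \<Longrightarrow> x \<in> X \<Longrightarrow> y \<in> X \<Longrightarrow> y \<notin> cell 0 x \<Longrightarrow> t u x y = 0"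
begin

lemma transposed: "kernel_family X cell n w s (\<lambda>u x y. t u y x) Us \<kappa>"
proof unfold_locales
  fix u x y y' k assume *: "u \<in> Us" "x \<in> X" "y \<in> X" "y' \<in> cell (k + \<kappa>) y" "x \<notin> cell k y"
  then show "t u y' x = t u y x" by (intro kernel_left) auto
next
  fix u x y x' k assume *: "u \<in> Us" "x \<in> X" "y \<in> X" "x' \<in> cell (k + \<kappa>) x" "y \<notin> cell k x"
  then show "t u y x' = t u y x" by (intro kernel_right) auto
next
  fix u x y assume *: "u \<in> Us" "x \<in> X" "y \<in> X" "y \<notin> cell 0 x"
  then show "t u y x = 0" using cell_sym by (intro kernel_top) auto
qed (use s w in auto)

text \<open>On each cell \<open>Q\<close> of generation \<open>k\<close> this is \<open>1\<^sub>Q T 1\<^sub>Q\<close>.\<close>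
definition local_image :: "nat \<Rightarrow> 'u \<Rightarrow> 'x \<Rightarrow> real" where
  "local_image k u y = (\<Sum>x\<in>cell k y. s x * t u x y)"

definition form :: "'u \<Rightarrow> ('x \<Rightarrow> real) \<Rightarrow> ('x \<Rightarrow> real) \<Rightarrow> real" where
  "form u f g = (\<Sum>x\<in>X. \<Sum>y\<in>X. s x * w y * t u x y * (f x * g y))"

text \<open>The testing condition with the multiplicities of cubes absorbed: the coefficient of a cube \<open>Q\<close> of
  generation \<open>k\<close> paired with the index \<open>u\<close> is the value of \<open>\<alpha> k u\<close> on \<open>Q\<close>.\<close>
definition quadratic_testing :: "real \<Rightarrow> real \<Rightarrow> real \<Rightarrow> bool" where
  "quadratic_testing p q T \<longleftrightarrow> (\<forall>\<alpha>. (\<forall>k u. cell_const k (\<alpha> k u)) \<longrightarrow>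
     vnorm X q w ({..n} \<times> Us) (\<lambda>(k,u) y. \<alpha> k u y * local_image k u y)
       \<le> T * vnorm X p s ({..n} \<times> Us) (\<lambda>(k,u). \<alpha> k u))"

text \<open>The part of the form, with absolute values, in which \<open>x\<close> and \<open>y\<close> share a cell of generation \<open>j\<close> but lie in different
  children of it.\<close>
definition ring_form :: "nat \<Rightarrow> 'u \<Rightarrow> ('x \<Rightarrow> real) \<Rightarrow> ('x \<Rightarrow> real) \<Rightarrow> real" where
  "ring_form j u f g = (\<Sum>x\<in>X. \<Sum>y\<in>cell j x - cell (Suc j) x. s x * w y * \<bar>t u x y\<bar> * (\<bar>f x\<bar> * \<bar>g y\<bar>))"

definition ring_sum :: "('u \<Rightarrow> 'x \<Rightarrow> real) \<Rightarrow> ('u \<Rightarrow> 'x \<Rightarrow> real) \<Rightarrow> nat \<Rightarrow> nat \<Rightarrow> real" where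
  "ring_sum f g i i' = (\<Sum>u\<in>Us. \<Sum>j<n. if j + 1 + i \<le> n \<and> j + 1 + i' \<le> n
     then ring_form j u (mdiff s (j + 1 + i) (f u)) (mdiff w (j + 1 + i') (g u)) else 0)"

lemma ring_form_nonneg: "0 \<le> ring_form j u f g"
  unfolding ring_form_def using s w cell_in_X by (intro sum_nonneg mult_nonneg_nonneg) auto

lemma form_local_part:
  assumes a: "cell_const c a"
  shows "(\<Sum>x\<in>X. \<Sum>y\<in>cell c x. s x * w y * t u x y * (a x * b y)) = (\<Sum>y\<in>X. w y * (a y * local_image c u y * b y))"
proof -
  have "(\<Sum>x\<in>X. \<Sum>y\<in>cell c x. s x * w y * t u x y * (a x * b y))
      = (\<Sum>y\<in>X. \<Sum>x\<in>cell c y. s x * w y * t u x y * (a x * b y))" by (rule sum_cell_swap)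
  also have "\<dots> = (\<Sum>y\<in>X. \<Sum>x\<in>cell c y. w y * (a y * (s x * t u x y) * b y))"
    by (intro sum.cong refl) (simp add: cell_constD[OF a] mult_ac)
  also have "\<dots> = (\<Sum>y\<in>X. w y * (a y * local_image c u y * b y))"
    by (simp add: local_image_def sum_distrib_left sum_distrib_right mult_ac)
  finally show ?thesis .
qed

text \<open>For a function \<open>a\<close> that is constant on the cells of generation \<open>c\<close>, the form splits into the pairs in a
  common cell, where \<open>a\<close> comes out as a factor and \<open>1\<^sub>Q T 1\<^sub>Q\<close> appears, and the pairs in different cells.\<close>
lemma form_split:
  assumes a: "cell_const c a"
  shows "form u a b = (\<Sum>y\<in>X. w y * (a y * local_image c u y * b y))
    + (\<Sum>x\<in>X. \<Sum>y\<in>X - cell c x. s x * w y * t u x y * (a x * b y))"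
proof -
  have "form u a b = (\<Sum>x\<in>X. (\<Sum>y\<in>cell c x. s x * w y * t u x y * (a x * b y))
      + (\<Sum>y\<in>X - cell c x. s x * w y * t u x y * (a x * b y)))"
    unfolding form_def
  proof (intro sum.cong refl)
    fix x assume "x \<in> X"
    then show "(\<Sum>y\<in>X. s x * w y * t u x y * (a x * b y)) = (\<Sum>y\<in>cell c x. s x * w y * t u x y * (a x * b y))
      + (\<Sum>y\<in>X - cell c x. s x * w y * t u x y * (a x * b y))"
      using sum.subset_diff[OF cell_subset finite_X, of x "\<lambda>y. s x * w y * t u x y * (a x * b y)" c] by simp
  qed
  then show ?thesis by (simp add: sum.distrib form_local_part[OF a])
qed

text \<open>Seen from outside its cell of generation \<open>c\<close>, the kernel is constant on cells \<open>\<kappa>\<close> generations further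
  down, and these are annihilated by differences of later generations.\<close>
lemma nonlocal_far:
  assumes u: "u \<in> Us" and cd: "c + \<kappa> < d"
  shows "(\<Sum>x\<in>X. \<Sum>y\<in>X - cell c x. s x * w y * t u x y * (a x * mdiff w d g y)) = 0"
proof (rule sum.neutral, rule ballI)
  fix x assume x: "x \<in> X"
  \<comment> \<open>the kernel seen from \<open>x\<close>, cut off on the cell of \<open>x\<close>\<close>
  define h where "h y = (if y \<in> cell c x then 0 else t u x y)" for y
  have h: "cell_const (d - 1) h"
  proof (rule cell_constI)
    fix y y' assume y: "y \<in> X" "y' \<in> cell (d - 1) y"
    have mem: "y' \<in> cell c x \<longleftrightarrow> y \<in> cell c x" using cd by (intro cell_member_const[OF x y]) auto
    have "t u x y' = t u x y" if "y \<notin> cell c x"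
    proof (rule kernel_right[OF u x y(1)])
      show "y' \<in> cell (d - 1 - \<kappa> + \<kappa>) y" using y cd by simp
      have "x \<notin> cell c y" using that cell_sym x y by blast
      moreover have "cell (d - 1 - \<kappa>) y \<subseteq> cell c y" using cd y by (intro cell_mono) auto
      ultimately show "x \<notin> cell (d - 1 - \<kappa>) y" by blast
    qed
    then show "h y' = h y" using mem by (simp add: h_def)
  qed
  have "(\<Sum>y\<in>X - cell c x. s x * w y * t u x y * (a x * mdiff w d g y))
      = (\<Sum>y\<in>X - cell c x. s x * a x * (w y * (h y * mdiff w d g y)))"
    by (intro sum.cong refl) (simp add: h_def)
  also have "\<dots> = (\<Sum>y\<in>X. s x * a x * (w y * (h y * mdiff w d g y)))"
    by (intro sum.mono_neutral_left) (auto simp: h_def)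
  also have "\<dots> = s x * a x * (\<Sum>y\<in>X. w y * (h y * mdiff w d g y))" by (simp add: sum_distrib_left)
  also have "(\<Sum>y\<in>X. w y * (h y * mdiff w d g y)) = 0"
    using cd by (intro sum_mult_mdiff[OF w h]) auto
  finally show "(\<Sum>y\<in>X - cell c x. s x * w y * t u x y * (a x * mdiff w d g y)) = 0" by simp
qed

lemma nonlocal_ring_far:
  assumes u: "u \<in> Us" and jc: "j + 1 + \<kappa> < c"
  shows "(\<Sum>x\<in>X. \<Sum>y\<in>cell j x - cell (Suc j) x. s x * w y * t u x y * (mdiff s c f x * b y)) = 0"
proof -
  have "(\<Sum>x\<in>cell j y - cell (Suc j) y. s x * w y * t u x y * (mdiff s c f x * b y)) = 0" if y: "y \<in> X" for y
  proof -
    define h where "h x = (if x \<in> cell j y - cell (Suc j) y then t u x y else 0)" for x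
    have h: "cell_const (c - 1) h"
    proof (rule cell_constI)
      fix x x' assume x: "x \<in> X" "x' \<in> cell (c - 1) x"
      have mem: "x' \<in> cell j y \<longleftrightarrow> x \<in> cell j y" "x' \<in> cell (Suc j) y \<longleftrightarrow> x \<in> cell (Suc j) y"
        using jc by (auto intro!: cell_member_const[OF y x])
      have "t u x' y = t u x y" if "x \<notin> cell (Suc j) y"
      proof (rule kernel_left[OF u x(1) y])
        have "Suc j + \<kappa> \<le> c - 1" using jc by simp
        then show "x' \<in> cell (Suc j + \<kappa>) x" using x cell_mono[of "Suc j + \<kappa>" "c - 1" x] by blast
        show "y \<notin> cell (Suc j) x" using that cell_sym x y by blast
      qed
      then show "h x' = h x" using mem by (simp add: h_def)
    qed
    have "(\<Sum>x\<in>cell j y - cell (Suc j) y. s x * w y * t u x y * (mdiff s c f x * b y))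
        = (\<Sum>x\<in>cell j y - cell (Suc j) y. w y * b y * (s x * (h x * mdiff s c f x)))"
      by (intro sum.cong refl) (simp add: h_def)
    also have "\<dots> = (\<Sum>x\<in>X. w y * b y * (s x * (h x * mdiff s c f x)))"
      using cell_subset[OF y] by (intro sum.mono_neutral_left) (auto simp: h_def)
    also have "\<dots> = w y * b y * (\<Sum>x\<in>X. s x * (h x * mdiff s c f x))" by (simp add: sum_distrib_left)
    also have "(\<Sum>x\<in>X. s x * (h x * mdiff s c f x)) = 0"
      using jc by (intro sum_mult_mdiff[OF s h]) auto
    finally show ?thesis by simp
  qed
  then show ?thesis by (subst sum_cell_ring_swap) simp
qed

text \<open>The pairs in different cells of generation \<open>c\<close> are sorted by the last generation \<open>j < c\<close> of a common cell. If \<open>j\<close> is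
  more than \<open>\<kappa> + 1\<close> generations above \<open>c\<close>, the cancellation of the difference of \<open>f\<close> makes the ring
  vanish.\<close>
lemma nonlocal_near:
  assumes u: "u \<in> Us"
  shows "\<bar>\<Sum>x\<in>X. \<Sum>y\<in>X - cell c x. s x * w y * t u x y * (mdiff s c f x * b y)\<bar>
    \<le> (\<Sum>i\<le>\<kappa>. if i < c then ring_form (c - 1 - i) u (mdiff s c f) b else 0)"
proof -
  define R where "R j = (\<Sum>x\<in>X. \<Sum>y\<in>cell j x - cell (Suc j) x. s x * w y * t u x y * (mdiff s c f x * b y))" for j
  have R_le: "\<bar>R j\<bar> \<le> ring_form j u (mdiff s c f) b" for j
    unfolding R_def ring_form_def
  proof (intro order.trans[OF sum_abs] sum_mono)
    fix x y assume x: "x \<in> X" and y: "y \<in> cell j x - cell (Suc j) x"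
    have "0 \<le> s x" "0 \<le> w y" using s w x y cell_in_X by auto
    then show "\<bar>s x * w y * t u x y * (mdiff s c f x * b y)\<bar>
        \<le> s x * w y * \<bar>t u x y\<bar> * (\<bar>mdiff s c f x\<bar> * \<bar>b y\<bar>)"
      by (simp add: abs_mult mult_ac)
  qed
  have "(\<Sum>y\<in>X - cell c x. s x * w y * t u x y * (mdiff s c f x * b y))
      = (\<Sum>j<c. \<Sum>y\<in>cell j x - cell (Suc j) x. s x * w y * t u x y * (mdiff s c f x * b y))" if x: "x \<in> X" for x
  proof -
    have "(\<Sum>y\<in>X - cell 0 x. s x * w y * t u x y * (mdiff s c f x * b y)) = 0"
      using kernel_top[OF u x] by (intro sum.neutral) auto
    then show ?thesis by (subst sum_outside_cell[OF x]) simp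
  qed
  then have "(\<Sum>x\<in>X. \<Sum>y\<in>X - cell c x. s x * w y * t u x y * (mdiff s c f x * b y)) = (\<Sum>j<c. R j)"
    unfolding R_def by (subst sum.swap) simp
  also have "\<dots> = (\<Sum>i<c. R (c - 1 - i))" by (subst sum.nat_diff_reindex[symmetric]) simp
  also have "\<dots> = (\<Sum>i<c. if i \<le> \<kappa> then R (c - 1 - i) else 0)"
  proof (intro sum.cong refl)
    fix i assume i: "i \<in> {..<c}"
    have "R (c - 1 - i) = 0" if "\<not> i \<le> \<kappa>"
      unfolding R_def using i that by (intro nonlocal_ring_far[OF u]) auto
    then show "R (c - 1 - i) = (if i \<le> \<kappa> then R (c - 1 - i) else 0)" by simp
  qed
  also have "\<dots> = (\<Sum>i\<in>{i\<in>{..<c}. i \<le> \<kappa>}. R (c - 1 - i))" by (rule sum.inter_filter[symmetric]) simp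
  also have "{i\<in>{..<c}. i \<le> \<kappa>} = {i\<in>{..\<kappa>}. i < c}" by auto
  also have "(\<Sum>i\<in>{i\<in>{..\<kappa>}. i < c}. R (c - 1 - i)) = (\<Sum>i\<le>\<kappa>. if i < c then R (c - 1 - i) else 0)"
    by (rule sum.inter_filter) simp
  finally have "\<bar>\<Sum>x\<in>X. \<Sum>y\<in>X - cell c x. s x * w y * t u x y * (mdiff s c f x * b y)\<bar>
     \<le> (\<Sum>i\<le>\<kappa>. \<bar>if i < c then R (c - 1 - i) else 0\<bar>)" by (simp add: sum_abs)
  also have "\<dots> \<le> (\<Sum>i\<le>\<kappa>. if i < c then ring_form (c - 1 - i) u (mdiff s c f) b else 0)"
    using R_le by (intro sum_mono) auto
  finally show ?thesis .
qed

text \<open>A fixed distance \<open>e\<close> between the generations leaves one term for each cell, so testing with the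
  differences of \<open>f\<close> as coefficients and the square function estimates suffice.\<close>
lemma near_local_bound:
  assumes p: "1 < p" and q: "1 < q" and T: "quadratic_testing p q T" "0 \<le> T"
  shows "\<bar>\<Sum>u\<in>Us. \<Sum>c\<le>n. if c + e \<le> n
      then \<Sum>y\<in>X. w y * (mdiff s c (f u) y * local_image c u y * mdiff w (c + e) (g u) y) else 0\<bar>
    \<le> T * subordination_const p * subordination_const (conj_exp q)
        * (vnorm X p s Us f * vnorm X (conj_exp q) w Us g)"
proof -
  have q': "1 < conj_exp q" using q by (rule conj_exp_gt_1)
  define A where "A = (\<lambda>(c,u) y. mdiff s c (f u) y * local_image c u y)"
  define B where "B = (\<lambda>(c,u) y. if c + e \<le> n then mdiff w (c + e) (g u) y else 0)"
  have "(\<Sum>u\<in>Us. \<Sum>c\<le>n. if c + e \<le> n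
      then \<Sum>y\<in>X. w y * (mdiff s c (f u) y * local_image c u y * mdiff w (c + e) (g u) y) else 0)
    = (\<Sum>c\<le>n. \<Sum>u\<in>Us. \<Sum>y\<in>X. w y * (A (c,u) y * B (c,u) y))"
    by (subst sum.swap) (auto simp: A_def B_def intro!: sum.cong)
  also have "\<dots> = (\<Sum>cu\<in>{..n} \<times> Us. \<Sum>y\<in>X. w y * (A cu y * B cu y))"
    by (simp add: sum.cartesian_product')
  also have "\<dots> = (\<Sum>y\<in>X. w y * (\<Sum>cu\<in>{..n} \<times> Us. A cu y * B cu y))"
    by (subst sum.swap) (simp add: sum_distrib_left)
  also have "\<bar>\<dots>\<bar> \<le> vnorm X q w ({..n} \<times> Us) A * vnorm X (conj_exp q) w ({..n} \<times> Us) B"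
    by (rule vnorm_Holder[OF finite_X w q])
  also have "\<dots> \<le> (T * (subordination_const p * vnorm X p s Us f)) * (subordination_const (conj_exp q) * vnorm X (conj_exp q) w Us g)"
  proof (intro mult_mono)
    have "vnorm X q w ({..n} \<times> Us) A \<le> T * vnorm X p s ({..n} \<times> Us) (\<lambda>(c,u). mdiff s c (f u))"
      using T(1) mdiff_const unfolding quadratic_testing_def A_def by fast
    also have "\<dots> \<le> T * (subordination_const p * vnorm X p s Us f)"
      by (intro mult_left_mono square_function[OF s p finite_Us] T)
    finally show "vnorm X q w ({..n} \<times> Us) A \<le> T * (subordination_const p * vnorm X p s Us f)" .
    have "vnorm X (conj_exp q) w ({..n} \<times> Us) B \<le> vnorm X (conj_exp q) w ({..n} \<times> Us) (\<lambda>(c,u). mdiff w c (g u))"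
    proof (rule vnorm_mono[OF w])
      fix x
      have "(\<Sum>cu\<in>{..n} \<times> Us. (B cu x)\<^sup>2) = (\<Sum>u\<in>Us. \<Sum>c\<le>n. if c + e \<le> n then (mdiff w (c + e) (g u) x)\<^sup>2 else 0)"
        unfolding sum.cartesian_product' by (subst sum.swap) (auto simp: B_def intro!: sum.cong)
      also have "\<dots> \<le> (\<Sum>u\<in>Us. \<Sum>c\<le>n. (mdiff w c (g u) x)\<^sup>2)"
        by (intro sum_mono sum_shift_le) auto
      also have "\<dots> = (\<Sum>j\<in>{..n} \<times> Us. ((case j of (c, u) \<Rightarrow> mdiff w c (g u)) x)\<^sup>2)"
        unfolding sum.cartesian_product' by (subst sum.swap) simp
      finally show "(\<Sum>cu\<in>{..n} \<times> Us. (B cu x)\<^sup>2) \<le> (\<Sum>j\<in>{..n} \<times> Us. ((case j of (c, u) \<Rightarrow> mdiff w c (g u)) x)\<^sup>2)" .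
    qed (use q' in auto)
    also have "\<dots> \<le> subordination_const (conj_exp q) * vnorm X (conj_exp q) w Us g"
      by (rule square_function[OF w q' finite_Us])
    finally show "vnorm X (conj_exp q) w ({..n} \<times> Us) B \<le> subordination_const (conj_exp q) * vnorm X (conj_exp q) w Us g" .
  qed (use T subordination_const_nonneg[of p] in auto)
  finally show ?thesis by (simp add: mult_ac)
qed

text \<open>The two local images differ on a cell of generation \<open>k\<close> by the image of something living outside that
  cell, which is constant on the cells over which the difference of \<open>g\<close> averages to zero.\<close>
lemma local_image_switch:
  assumes u: "u \<in> Us" and a: "cell_const k a" and ck: "c \<le> k"
  shows "(\<Sum>y\<in>X. w y * (a y * local_image c u y * mdiff w (k + 1 + \<kappa>) g y))
    = (\<Sum>y\<in>X. w y * (a y * local_image k u y * mdiff w (k + 1 + \<kappa>) g y))"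
proof -
  define h where "h y = a y * (local_image c u y - local_image k u y)" for y
  have "cell_const (k + \<kappa>) h"
  proof (rule cell_constI)
    fix y y' assume y: "y \<in> X" "y' \<in> cell (k + \<kappa>) y"
    have yk: "y' \<in> cell k y" using cell_mono[of k "k + \<kappa>" y] y by auto
    then have yc: "y' \<in> cell c y" using cell_mono[OF ck y(1)] by auto
    have diff: "local_image c u z - local_image k u z = (\<Sum>x\<in>cell c z - cell k z. s x * t u x z)" if "z \<in> X" for z
      unfolding local_image_def using that cell_mono[OF ck that] by (simp add: sum_diff)
    have "y' \<in> X" using cell_in_X y by blast
    then have "local_image c u y' - local_image k u y' = (\<Sum>x\<in>cell c y - cell k y. s x * t u x y')"
      by (simp add: diff cell_eq[OF y(1) yk] cell_eq[OF y(1) yc])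
    also have "\<dots> = (\<Sum>x\<in>cell c y - cell k y. s x * t u x y)"
      using kernel_right[OF u _ y(1) y(2)] cell_in_X[OF y(1)] by (intro sum.cong refl) auto
    also have "\<dots> = local_image c u y - local_image k u y" by (simp add: diff y)
    finally show "h y' = h y" using cell_constD[OF a y(1) yk] by (simp add: h_def)
  qed
  then have "(\<Sum>y\<in>X. w y * (h y * mdiff w (k + 1 + \<kappa>) g y)) = 0"
    by (rule sum_mult_mdiff[OF w]) simp
  then show ?thesis by (simp add: h_def algebra_simps sum_subtractf)
qed

end

section \<open>The paraproduct\<close>

context cell_tree
begin

text \<open>The squares of the increments add up to the square of the maximal function. They serve as testing
  coefficients that are constant on cells and whose square function is controlled by the maximal function.\<close>
definition increment :: "('x \<Rightarrow> real) \<Rightarrow> nat \<Rightarrow> ('x \<Rightarrow> real) \<Rightarrow> 'x \<Rightarrow> real" where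
  "increment s k f x = sqrt ((maximal s k f x)\<^sup>2 - (if k = 0 then 0 else (maximal s (k - 1) f x)\<^sup>2))"

lemma increment_const: "cell_const k (increment s k f)"
proof (rule cell_constI)
  fix x y assume xy: "x \<in> X" "y \<in> cell k x"
  have "maximal s k f y = maximal s k f x" by (rule cell_constD[OF maximal_const xy])
  moreover have "maximal s (k - 1) f y = maximal s (k - 1) f x"
    using xy cell_mono[of "k - 1" k x] by (intro cell_constD[OF maximal_const]) auto
  ultimately show "increment s k f y = increment s k f x" by (simp add: increment_def)
qed

lemma sum_increment:
  assumes s: "\<forall>x\<in>X. 0 \<le> s x" and x: "x \<in> X"
  shows "(\<Sum>c\<le>k. (increment s c f x)\<^sup>2) = (maximal s k f x)\<^sup>2"
proof (induction k)
  case 0 then show ?case using maximal_nonneg[OF s x, of 0 f] by (simp add: increment_def)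
next
  case (Suc k)
  have "(maximal s k f x)\<^sup>2 \<le> (maximal s (Suc k) f x)\<^sup>2"
    using maximal_nonneg[OF s x] by (intro power_mono maximal_mono) auto
  then have "(increment s (Suc k) f x)\<^sup>2 = (maximal s (Suc k) f x)\<^sup>2 - (maximal s k f x)\<^sup>2"
    by (simp add: increment_def del: maximal.simps)
  then show ?case using Suc.IH by (simp del: maximal.simps)
qed

end

context kernel_family
begin

text \<open>When \<open>d > c + \<kappa>\<close>, the local images at generation \<open>c\<close> may be replaced by the one at generation
  \<open>k = d - 1 - \<kappa>\<close>, and the differences of \<open>f\<close> add up to its average there. This is the paraproduct, in which
  the averages of \<open>f\<close> cannot serve as testing coefficients, since their square sum over all generations is
  not controlled by \<open>f\<close>. Instead of a Carleson embedding, the average is distributed over the previous generations: it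
  is written as the sum of \<open>\<alpha> c\<close> times \<open>\<nu> k c\<close> with \<open>\<alpha> c\<close> the increment of the maximal function and \<open>\<nu>\<close> of
  square sum at most 1 in \<open>c\<close>. Now the local images are switched back to generation \<open>c\<close>, testing is applied with the
  coefficients \<open>\<alpha>\<close>, and the factors \<open>\<nu>\<close> are attached to the differences of \<open>g\<close>, where they produce a
  differentially subordinate family.\<close>
lemma paraproduct_bound:
  assumes p: "1 < p" and q: "1 < q" and T: "quadratic_testing p q T" "0 \<le> T"
  shows "\<bar>\<Sum>u\<in>Us. \<Sum>d\<le>n. \<Sum>c\<le>n. if c + \<kappa> < d
      then \<Sum>y\<in>X. w y * (mdiff s c (f u) y * local_image c u y * mdiff w d (g u) y) else 0\<bar>
    \<le> T * maximal_const p * subordination_const (conj_exp q)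
        * (vnorm X p s Us f * vnorm X (conj_exp q) w Us g)"
proof -
  have q': "1 < conj_exp q" using q by (rule conj_exp_gt_1)
  define m where "m k u = maximal s k (f u)" for k u
  define \<alpha> where "\<alpha> c u = increment s c (f u)" for c u
  \<comment> \<open>chosen so that \<open>\<alpha>\<close> times \<open>\<nu>\<close> adds up to the average; both vanish where the maximal function does\<close>
  define \<nu> where "\<nu> k c u y = \<alpha> c u y * avg s k (f u) y / (m k u y)\<^sup>2" for k c u y
  define A where "A = (\<lambda>(c,u) y. \<alpha> c u y * local_image c u y)"
  define G where "G = (\<lambda>(c,u) y. \<Sum>d\<le>n. (if c + \<kappa> < d then \<nu> (d - 1 - \<kappa>) c u y else 0) * mdiff w d (g u) y)"
  have \<nu>_const: "cell_const k (\<nu> k c u)" if "c \<le> k" for k c u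
  proof (rule cell_constI)
    fix x y assume xy: "x \<in> X" "y \<in> cell k x"
    have "\<alpha> c u y = \<alpha> c u x" unfolding \<alpha>_def
      using cell_constD[OF cell_const_mono[OF increment_const that] xy] .
    moreover have "avg s k (f u) y = avg s k (f u) x" by (rule cell_constD[OF avg_const xy])
    moreover have "m k u y = m k u x" unfolding m_def by (rule cell_constD[OF maximal_const xy])
    ultimately show "\<nu> k c u y = \<nu> k c u x" by (simp add: \<nu>_def)
  qed
  have sum\<alpha>: "(\<Sum>c\<le>k. (\<alpha> c u y)\<^sup>2) = (m k u y)\<^sup>2" if "y \<in> X" for k u y
    unfolding \<alpha>_def m_def by (rule sum_increment[OF s that])
  have avg_m: "(avg s k (f u) y)\<^sup>2 \<le> (m k u y)\<^sup>2" if "y \<in> X" for k u y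
    using abs_avg_le_maximal[OF s that, of k "f u"] unfolding m_def by (simp add: abs_le_square_iff[symmetric])
  have expand: "avg s k (f u) y = (\<Sum>c\<le>k. \<alpha> c u y * \<nu> k c u y)" if y: "y \<in> X" for k u y
  proof (cases "m k u y = 0")
    case True
    then have "avg s k (f u) y = 0" using avg_m[OF y, of k u] by simp
    then show ?thesis by (simp add: \<nu>_def)
  next
    case False
    have "(\<Sum>c\<le>k. \<alpha> c u y * \<nu> k c u y) = (\<Sum>c\<le>k. (\<alpha> c u y)\<^sup>2) * avg s k (f u) y / (m k u y)\<^sup>2"
      unfolding \<nu>_def sum_distrib_right sum_divide_distrib
      by (intro sum.cong refl) (simp add: power2_eq_square mult_ac)
    then show ?thesis using False by (simp add: sum\<alpha>[OF y])
  qed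
  have sum\<nu>: "(\<Sum>c\<le>k. (\<nu> k c u y)\<^sup>2) \<le> 1" if y: "y \<in> X" for k u y
  proof (cases "m k u y = 0")
    case False
    have "(\<Sum>c\<le>k. (\<nu> k c u y)\<^sup>2) = (\<Sum>c\<le>k. (\<alpha> c u y)\<^sup>2) * (avg s k (f u) y)\<^sup>2 / ((m k u y)\<^sup>2 * (m k u y)\<^sup>2)"
      unfolding \<nu>_def sum_distrib_right sum_divide_distrib
      by (intro sum.cong refl) (simp add: power_divide power_mult_distrib power2_eq_square mult_ac)
    also have "\<dots> = (avg s k (f u) y)\<^sup>2 / (m k u y)\<^sup>2"
      unfolding sum\<alpha>[OF y] using False by (intro nonzero_mult_divide_mult_cancel_left) simp
    also have "\<dots> \<le> 1" using avg_m[OF y] False by simp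
    finally show ?thesis .
  qed (simp add: \<nu>_def)
  have inner: "(\<Sum>c\<le>n. if c + \<kappa> < d
      then \<Sum>y\<in>X. w y * (mdiff s c (f u) y * local_image c u y * mdiff w d (g u) y) else 0)
    = (\<Sum>c\<le>n. \<Sum>y\<in>X. w y * (A (c,u) y * ((if c + \<kappa> < d then \<nu> (d - 1 - \<kappa>) c u y else 0) * mdiff w d (g u) y)))"
    if u: "u \<in> Us" and d: "d \<le> n" for u d
  proof (cases "\<kappa> < d")
    case False
    then show ?thesis by (intro sum.cong refl) auto
  next
    case True
    define k where "k = d - 1 - \<kappa>"
    have dk: "d = k + 1 + \<kappa>" using True by (simp add: k_def)
    have S: "{c \<in> {..n}. c + \<kappa> < d} = {..k}" using d dk by auto
    have "(\<Sum>c\<le>n. if c + \<kappa> < d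
        then \<Sum>y\<in>X. w y * (mdiff s c (f u) y * local_image c u y * mdiff w d (g u) y) else 0)
      = (\<Sum>c\<le>k. \<Sum>y\<in>X. w y * (mdiff s c (f u) y * local_image c u y * mdiff w d (g u) y))"
      unfolding S[symmetric] by (rule sum.inter_filter[symmetric]) simp
    also have "\<dots> = (\<Sum>c\<le>k. \<Sum>y\<in>X. w y * (mdiff s c (f u) y * local_image k u y * mdiff w d (g u) y))"
      unfolding dk by (rule sum.cong[OF refl], rule local_image_switch[OF u]) (auto intro: cell_const_mono[OF mdiff_const])
    also have "\<dots> = (\<Sum>y\<in>X. w y * (avg s k (f u) y * local_image k u y * mdiff w d (g u) y))"
      by (subst sum.swap) (simp add: sum_mdiff[symmetric] sum_distrib_left sum_distrib_right)
    also have "\<dots> = (\<Sum>c\<le>k. \<Sum>y\<in>X. w y * ((\<alpha> c u y * \<nu> k c u y) * local_image k u y * mdiff w d (g u) y))"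
      by (subst sum.swap) (simp add: expand sum_distrib_left sum_distrib_right)
    also have "\<dots> = (\<Sum>c\<le>k. \<Sum>y\<in>X. w y * ((\<alpha> c u y * \<nu> k c u y) * local_image c u y * mdiff w d (g u) y))"
    proof (rule sum.cong[OF refl])
      fix c assume c: "c \<in> {..k}"
      have "cell_const k (\<lambda>y. \<alpha> c u y * \<nu> k c u y)"
      proof (rule cell_constI)
        fix x y assume xy: "x \<in> X" "y \<in> cell k x"
        have "c \<le> k" using c by simp
        then have "\<alpha> c u y = \<alpha> c u x" "\<nu> k c u y = \<nu> k c u x"
          unfolding \<alpha>_def using cell_constD[OF cell_const_mono[OF increment_const] xy]
            cell_constD[OF \<nu>_const xy] by auto
        then show "\<alpha> c u y * \<nu> k c u y = \<alpha> c u x * \<nu> k c u x" by simp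
      qed
      from local_image_switch[OF u this, of c "g u"]
      show "(\<Sum>y\<in>X. w y * ((\<alpha> c u y * \<nu> k c u y) * local_image k u y * mdiff w d (g u) y))
        = (\<Sum>y\<in>X. w y * ((\<alpha> c u y * \<nu> k c u y) * local_image c u y * mdiff w d (g u) y))"
        using c by (simp add: dk)
    qed
    also have "\<dots> = (\<Sum>c\<in>{c \<in> {..n}. c + \<kappa> < d}. \<Sum>y\<in>X. w y * (A (c,u) y * (\<nu> k c u y * mdiff w d (g u) y)))"
      unfolding S by (simp add: A_def mult_ac)
    also have "\<dots> = (\<Sum>c\<le>n. if c + \<kappa> < d then \<Sum>y\<in>X. w y * (A (c,u) y * (\<nu> k c u y * mdiff w d (g u) y)) else 0)"
      by (rule sum.inter_filter) simp
    also have "\<dots> = (\<Sum>c\<le>n. \<Sum>y\<in>X. w y * (A (c,u) y * ((if c + \<kappa> < d then \<nu> k c u y else 0) * mdiff w d (g u) y)))"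
      by (intro sum.cong refl) auto
    finally show ?thesis by (simp only: k_def)
  qed
  have "(\<Sum>u\<in>Us. \<Sum>d\<le>n. \<Sum>c\<le>n. if c + \<kappa> < d
      then \<Sum>y\<in>X. w y * (mdiff s c (f u) y * local_image c u y * mdiff w d (g u) y) else 0)
    = (\<Sum>u\<in>Us. \<Sum>d\<le>n. \<Sum>c\<le>n. \<Sum>y\<in>X. w y * (A (c,u) y * ((if c + \<kappa> < d then \<nu> (d - 1 - \<kappa>) c u y else 0) * mdiff w d (g u) y)))"
    by (rule sum.cong[OF refl], rule sum.cong[OF refl], rule inner) auto
  also have "\<dots> = (\<Sum>u\<in>Us. \<Sum>c\<le>n. \<Sum>d\<le>n. \<Sum>y\<in>X. w y * (A (c,u) y * ((if c + \<kappa> < d then \<nu> (d - 1 - \<kappa>) c u y else 0) * mdiff w d (g u) y)))"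
    by (intro sum.cong refl sum.swap)
  also have "\<dots> = (\<Sum>u\<in>Us. \<Sum>c\<le>n. \<Sum>y\<in>X. w y * (A (c,u) y * G (c,u) y))"
  proof (intro sum.cong refl)
    fix u c
    show "(\<Sum>d\<le>n. \<Sum>y\<in>X. w y * (A (c,u) y * ((if c + \<kappa> < d then \<nu> (d - 1 - \<kappa>) c u y else 0) * mdiff w d (g u) y)))
      = (\<Sum>y\<in>X. w y * (A (c,u) y * G (c,u) y))"
      by (subst sum.swap) (simp add: G_def sum_distrib_left)
  qed
  also have "\<dots> = (\<Sum>c\<le>n. \<Sum>u\<in>Us. \<Sum>y\<in>X. w y * (A (c,u) y * G (c,u) y))" by (rule sum.swap)
  also have "\<dots> = (\<Sum>cu\<in>{..n} \<times> Us. \<Sum>y\<in>X. w y * (A cu y * G cu y))"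
    by (simp add: sum.cartesian_product')
  also have "\<dots> = (\<Sum>y\<in>X. w y * (\<Sum>cu\<in>{..n} \<times> Us. A cu y * G cu y))"
    by (subst sum.swap) (simp add: sum_distrib_left)
  also have "\<bar>\<dots>\<bar> \<le> vnorm X q w ({..n} \<times> Us) A * vnorm X (conj_exp q) w ({..n} \<times> Us) G"
    by (rule vnorm_Holder[OF finite_X w q])
  also have "\<dots> \<le> (T * (maximal_const p * vnorm X p s Us f)) * (subordination_const (conj_exp q) * vnorm X (conj_exp q) w Us g)"
  proof (intro mult_mono)
    have "vnorm X q w ({..n} \<times> Us) A \<le> T * vnorm X p s ({..n} \<times> Us) (\<lambda>(c,u). \<alpha> c u)"
      using T(1) increment_const unfolding quadratic_testing_def A_def \<alpha>_def by fast
    also have "vnorm X p s ({..n} \<times> Us) (\<lambda>(c,u). \<alpha> c u) \<le> vnorm X p s Us (m n)"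
    proof (rule vnorm_mono[OF s])
      fix x assume x: "x \<in> X"
      have "(\<Sum>i\<in>{..n} \<times> Us. ((case i of (c, u) \<Rightarrow> \<alpha> c u) x)\<^sup>2) = (\<Sum>u\<in>Us. \<Sum>c\<le>n. (\<alpha> c u x)\<^sup>2)"
        unfolding sum.cartesian_product' by (subst sum.swap) simp
      then show "(\<Sum>i\<in>{..n} \<times> Us. ((case i of (c, u) \<Rightarrow> \<alpha> c u) x)\<^sup>2) \<le> (\<Sum>u\<in>Us. (m n u x)\<^sup>2)"
        by (simp add: sum\<alpha>[OF x])
    qed (use p in auto)
    also have "m n = (\<lambda>u. maximal s n (f u))" by (rule ext) (simp add: m_def)
    also have "vnorm X p s Us (\<lambda>u. maximal s n (f u)) \<le> maximal_const p * vnorm X p s Us f"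
      by (rule vector_maximal_inequality[OF s p finite_Us])
    finally show "vnorm X q w ({..n} \<times> Us) A \<le> T * (maximal_const p * vnorm X p s Us f)"
      using T(2) by (simp add: mult_left_mono)
    show "vnorm X (conj_exp q) w ({..n} \<times> Us) G \<le> subordination_const (conj_exp q) * vnorm X (conj_exp q) w Us g"
    proof (rule differential_subordination[OF w q' finite_Us])
      fix l x assume l: "l \<le> n" and x: "x \<in> X" "0 < w x"
      have md: "mdiff w l (G (c,u)) x = (if c + \<kappa> < l then \<nu> (l - 1 - \<kappa>) c u x else 0) * mdiff w l (g u) x" for c u
      proof -
        define a where "a d y = (if c + \<kappa> < d then \<nu> (d - 1 - \<kappa>) c u y else 0)" for d y
        have a: "cell_const (d - 1) (a d)" for d
        proof (cases "c + \<kappa> < d")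
          case True
          then have "cell_const (d - 1) (\<nu> (d - 1 - \<kappa>) c u)"
            by (intro cell_const_mono[OF \<nu>_const]) auto
          then show ?thesis using True by (simp add: a_def[abs_def])
        qed (simp add: a_def[abs_def] cell_const_def)
        have "mdiff w l (G (c,u)) x = mdiff w l (\<lambda>y. \<Sum>d\<le>n. a d y * mdiff w d (g u) y) x"
          by (simp add: G_def a_def)
        also have "\<dots> = (\<Sum>d\<le>n. mdiff w l (\<lambda>y. a d y * mdiff w d (g u) y) x)" by (rule mdiff_sum)
        also have "\<dots> = (\<Sum>d\<le>n. if l = d then a d x * mdiff w d (g u) x else 0)"
          by (intro sum.cong refl mdiff_mult_mdiff[OF w a x])
        also have "\<dots> = a l x * mdiff w l (g u) x" using l by (simp add: sum.delta')
        finally show ?thesis by (simp add: a_def)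
      qed
      have "(\<Sum>cu\<in>{..n} \<times> Us. (mdiff w l (G cu) x)\<^sup>2)
        = (\<Sum>u\<in>Us. (\<Sum>c\<le>n. (if c + \<kappa> < l then \<nu> (l - 1 - \<kappa>) c u x else 0)\<^sup>2) * (mdiff w l (g u) x)\<^sup>2)"
        unfolding sum.cartesian_product' by (subst sum.swap) (simp only: md power_mult_distrib sum_distrib_right)
      also have "\<dots> \<le> (\<Sum>u\<in>Us. 1 * (mdiff w l (g u) x)\<^sup>2)"
      proof (intro sum_mono mult_right_mono)
        fix u
        show "(\<Sum>c\<le>n. (if c + \<kappa> < l then \<nu> (l - 1 - \<kappa>) c u x else 0)\<^sup>2) \<le> 1"
        proof (cases "\<kappa> < l")
          case True
          have "(\<Sum>c\<le>n. (if c + \<kappa> < l then \<nu> (l - 1 - \<kappa>) c u x else 0)\<^sup>2)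
            = (\<Sum>c\<le>n. if c + \<kappa> < l then (\<nu> (l - 1 - \<kappa>) c u x)\<^sup>2 else 0)"
            by (intro sum.cong refl) auto
          also have "\<dots> = (\<Sum>c\<in>{c\<in>{..n}. c + \<kappa> < l}. (\<nu> (l - 1 - \<kappa>) c u x)\<^sup>2)"
            by (rule sum.inter_filter[symmetric]) simp
          also have "{c\<in>{..n}. c + \<kappa> < l} = {..l - 1 - \<kappa>}" using True l by auto
          also have "(\<Sum>c\<le>l - 1 - \<kappa>. (\<nu> (l - 1 - \<kappa>) c u x)\<^sup>2) \<le> 1" by (rule sum\<nu>[OF x(1)])
          finally show ?thesis .
        next
          case False
          then have "(\<Sum>c\<le>n. (if c + \<kappa> < l then \<nu> (l - 1 - \<kappa>) c u x else 0)\<^sup>2) = 0" by simp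
          then show ?thesis by simp
        qed
      qed simp
      finally show "(\<Sum>cu\<in>{..n} \<times> Us. (mdiff w l (G cu) x)\<^sup>2) \<le> (\<Sum>u\<in>Us. (mdiff w l (g u) x)\<^sup>2)" by simp
    qed simp
  qed (use T p maximal_const_ge_1[OF p] in auto)
  finally show ?thesis by (simp add: mult_ac)
qed

text \<open>The pairs of generations with \<open>c \<le> d\<close>, or \<open>c < d\<close> according to \<open>e0\<close>: at most \<open>\<kappa> + 1\<close> distances
  \<open>d - c\<close> are near and each contributes a testing term, the remaining ones form the paraproduct, and the pairs of
  points in different cells contribute one ring sum for each of at most \<open>(\<kappa> + 1)\<^sup>2\<close> choices of the
  two distances to the common cell.\<close>
lemma half_form_bound:
  assumes p: "1 < p" and q: "1 < q" and T: "quadratic_testing p q T" "0 \<le> T"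
    and M: "\<And>i i'. ring_sum f g i i' \<le> M"
    and e0: "e0 \<le> \<kappa> + 1"
  shows "\<bar>\<Sum>u\<in>Us. \<Sum>d\<le>n. \<Sum>c\<le>n. if c + e0 \<le> d then form u (mdiff s c (f u)) (mdiff w d (g u)) else 0\<bar>
    \<le> (1 + real \<kappa>) * (T * (subordination_const p + maximal_const p) * subordination_const (conj_exp q)
        * (vnorm X p s Us f * vnorm X (conj_exp q) w Us g)) + (1 + real \<kappa>)\<^sup>2 * M"
proof -
  define FG where "FG = vnorm X p s Us f * vnorm X (conj_exp q) w Us g"
  have FG: "0 \<le> FG" by (simp add: FG_def)
  define L where "L u c d = (\<Sum>y\<in>X. w y * (mdiff s c (f u) y * local_image c u y * mdiff w d (g u) y))" for u c d
  define N where "N u c d = (\<Sum>x\<in>X. \<Sum>y\<in>X - cell c x. s x * w y * t u x y * (mdiff s c (f u) x * mdiff w d (g u) y))" for u c d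
  define near where "near c d \<longleftrightarrow> c + e0 \<le> d \<and> d \<le> c + \<kappa>" for c d
  have split: "(if c + e0 \<le> d then form u (mdiff s c (f u)) (mdiff w d (g u)) else 0)
    = (if near c d then L u c d else 0) + (if c + \<kappa> < d then L u c d else 0) + (if near c d then N u c d else 0)"
    if "u \<in> Us" for u c d
  proof -
    have "form u (mdiff s c (f u)) (mdiff w d (g u)) = L u c d + N u c d"
      unfolding L_def N_def by (rule form_split[OF mdiff_const])
    moreover have "c + \<kappa> < d \<Longrightarrow> N u c d = 0" unfolding N_def by (rule nonlocal_far[OF that])
    ultimately show ?thesis using e0 by (auto simp: near_def)
  qed
  have M0: "0 \<le> M"
  proof -
    have "0 \<le> ring_sum f g 0 0" unfolding ring_sum_def using ring_form_nonneg by (intro sum_nonneg) auto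
    then show ?thesis using M[of 0 0] by linarith
  qed
  have eq: "(\<Sum>u\<in>Us. \<Sum>d\<le>n. \<Sum>c\<le>n. if c + e0 \<le> d then form u (mdiff s c (f u)) (mdiff w d (g u)) else 0)
    = (\<Sum>u\<in>Us. \<Sum>d\<le>n. \<Sum>c\<le>n. if near c d then L u c d else 0)
      + (\<Sum>u\<in>Us. \<Sum>d\<le>n. \<Sum>c\<le>n. if c + \<kappa> < d then L u c d else 0)
      + (\<Sum>u\<in>Us. \<Sum>d\<le>n. \<Sum>c\<le>n. if near c d then N u c d else 0)"
    by (simp add: split sum.distrib)
  have b1: "\<bar>\<Sum>u\<in>Us. \<Sum>d\<le>n. \<Sum>c\<le>n. if near c d then L u c d else 0\<bar>
    \<le> (1 + real \<kappa>) * (T * subordination_const p * subordination_const (conj_exp q) * FG)"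
  proof -
    have "(\<Sum>u\<in>Us. \<Sum>d\<le>n. \<Sum>c\<le>n. if near c d then L u c d else 0)
      = (\<Sum>u\<in>Us. \<Sum>e=e0..\<kappa>. \<Sum>c\<le>n. if c + e \<le> n then L u c (c + e) else 0)"
      unfolding near_def by (intro sum.cong refl sum_band)
    also have "\<dots> = (\<Sum>e=e0..\<kappa>. \<Sum>u\<in>Us. \<Sum>c\<le>n. if c + e \<le> n then L u c (c + e) else 0)" by (rule sum.swap)
    also have "\<bar>\<dots>\<bar> \<le> (\<Sum>e=e0..\<kappa>. \<bar>\<Sum>u\<in>Us. \<Sum>c\<le>n. if c + e \<le> n then L u c (c + e) else 0\<bar>)" by (rule sum_abs)
    also have "\<dots> \<le> (\<Sum>e=e0..\<kappa>. T * subordination_const p * subordination_const (conj_exp q) * FG)"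
      unfolding L_def FG_def by (intro sum_mono near_local_bound p q T)
    also have "\<dots> \<le> (\<Sum>e=0..\<kappa>. T * subordination_const p * subordination_const (conj_exp q) * FG)"
      using T FG subordination_const_nonneg by (intro sum_mono2) auto
    finally show ?thesis by simp
  qed
  have b2: "\<bar>\<Sum>u\<in>Us. \<Sum>d\<le>n. \<Sum>c\<le>n. if c + \<kappa> < d then L u c d else 0\<bar>
    \<le> (1 + real \<kappa>) * (T * maximal_const p * subordination_const (conj_exp q) * FG)"
  proof -
    have "0 \<le> T * maximal_const p * subordination_const (conj_exp q) * FG"
      using T FG subordination_const_nonneg[of "conj_exp q"] maximal_const_ge_1[OF p] by simp
    then have "1 * (T * maximal_const p * subordination_const (conj_exp q) * FG)
      \<le> (1 + real \<kappa>) * (T * maximal_const p * subordination_const (conj_exp q) * FG)"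
      by (intro mult_right_mono) auto
    then show ?thesis using paraproduct_bound[OF p q T, of f g] unfolding L_def FG_def by linarith
  qed
  have b3: "\<bar>\<Sum>u\<in>Us. \<Sum>d\<le>n. \<Sum>c\<le>n. if near c d then N u c d else 0\<bar> \<le> (1 + real \<kappa>)\<^sup>2 * M"
  proof -
    have "(\<Sum>u\<in>Us. \<Sum>d\<le>n. \<Sum>c\<le>n. if near c d then N u c d else 0)
      = (\<Sum>u\<in>Us. \<Sum>e=e0..\<kappa>. \<Sum>c\<le>n. if c + e \<le> n then N u c (c + e) else 0)"
      unfolding near_def by (intro sum.cong refl sum_band)
    also have "\<dots> = (\<Sum>e=e0..\<kappa>. \<Sum>u\<in>Us. \<Sum>c\<le>n. if c + e \<le> n then N u c (c + e) else 0)" by (rule sum.swap)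
    also have "\<bar>\<dots>\<bar> \<le> (\<Sum>e=e0..\<kappa>. \<bar>\<Sum>u\<in>Us. \<Sum>c\<le>n. if c + e \<le> n then N u c (c + e) else 0\<bar>)" by (rule sum_abs)
    also have "\<dots> \<le> (\<Sum>e=e0..\<kappa>. (1 + real \<kappa>) * M)"
    proof (rule sum_mono)
      fix e
      define R where "R u j c = ring_form j u (mdiff s c (f u)) (mdiff w (c + e) (g u))" for u j c
      have R0: "0 \<le> R u j c" for u j c unfolding R_def by (rule ring_form_nonneg)
      have "\<bar>\<Sum>u\<in>Us. \<Sum>c\<le>n. if c + e \<le> n then N u c (c + e) else 0\<bar>
        \<le> (\<Sum>u\<in>Us. \<Sum>c\<le>n. \<bar>if c + e \<le> n then N u c (c + e) else 0\<bar>)"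
        by (intro order.trans[OF sum_abs] sum_mono sum_abs)
      also have "\<dots> \<le> (\<Sum>u\<in>Us. \<Sum>c\<le>n. \<Sum>i\<le>\<kappa>. if c + e \<le> n \<and> i < c then R u (c - 1 - i) c else 0)"
      proof (intro sum_mono)
        fix u c assume u: "u \<in> Us"
        show "\<bar>if c + e \<le> n then N u c (c + e) else 0\<bar> \<le> (\<Sum>i\<le>\<kappa>. if c + e \<le> n \<and> i < c then R u (c - 1 - i) c else 0)"
        proof (cases "c + e \<le> n")
          case True
          have "\<bar>N u c (c + e)\<bar> \<le> (\<Sum>i\<le>\<kappa>. if i < c then R u (c - 1 - i) c else 0)"
            unfolding N_def R_def by (rule nonlocal_near[OF u])
          then show ?thesis using True by simp
        qed simp
      qed
      also have "\<dots> = (\<Sum>i\<le>\<kappa>. \<Sum>u\<in>Us. \<Sum>c\<le>n. if c + e \<le> n \<and> i < c then R u (c - 1 - i) c else 0)"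
        by (subst sum.swap[of _ "{..\<kappa>}"], intro sum.cong refl sum.swap)
      also have "\<dots> \<le> (\<Sum>i\<le>\<kappa>. ring_sum f g i (i + e))"
        unfolding ring_sum_def
      proof (intro sum_mono)
        fix i u
        have "(\<Sum>c\<le>n. if c + e \<le> n \<and> i < c then R u (c - 1 - i) c else 0)
          = (\<Sum>c\<in>{c\<in>{..n}. c + e \<le> n \<and> i < c}. R u (c - 1 - i) c)" by (rule sum.inter_filter[symmetric]) simp
        also have "\<dots> = (\<Sum>j\<in>{j\<in>{..<n}. j + 1 + i \<le> n \<and> j + 1 + (i + e) \<le> n}. R u j (j + 1 + i))"
          by (rule sum.reindex_bij_witness[of _ "\<lambda>j. j + 1 + i" "\<lambda>c. c - 1 - i"]) auto
        also have "\<dots> = (\<Sum>j<n. if j + 1 + i \<le> n \<and> j + 1 + (i + e) \<le> n then R u j (j + 1 + i) else 0)"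
          by (rule sum.inter_filter) simp
        finally show "(\<Sum>c\<le>n. if c + e \<le> n \<and> i < c then R u (c - 1 - i) c else 0)
          \<le> (\<Sum>j<n. if j + 1 + i \<le> n \<and> j + 1 + (i + e) \<le> n
             then ring_form j u (mdiff s (j + 1 + i) (f u)) (mdiff w (j + 1 + (i + e)) (g u)) else 0)"
          by (simp only: R_def add.assoc order_refl)
      qed
      also have "\<dots> \<le> (\<Sum>i\<le>\<kappa>. M)" by (intro sum_mono M)
      finally show "\<bar>\<Sum>u\<in>Us. \<Sum>c\<le>n. if c + e \<le> n then N u c (c + e) else 0\<bar> \<le> (1 + real \<kappa>) * M" by simp
    qed
    also have "\<dots> \<le> (\<Sum>e=0..\<kappa>. (1 + real \<kappa>) * M)" using M0 by (intro sum_mono2) auto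
    finally show ?thesis by (simp add: power2_eq_square)
  qed
  show ?thesis
    unfolding eq using b1 b2 b3 unfolding FG_def[symmetric]
    by (simp add: algebra_simps)
qed

end

section \<open>The off-diagonal part and the square function estimate\<close>

lemma vnorm_pair:
  assumes "finite I" "finite J"
  shows "vnorm X p s (I \<times> J) F = vnorm X p s I (\<lambda>i x. modulus J (\<lambda>j. F (i,j)) x)"
proof -
  have "modulus (I \<times> J) F = modulus I (\<lambda>i x. modulus J (\<lambda>j. F (i,j)) x)"
    by (rule ext) (simp add: modulus_def sum.cartesian_product' sum_nonneg)
  then show ?thesis by (simp add: vnorm_def)
qed

text \<open>The children of a cell carry numbers; \<open>child (Suc j) x\<close> is the number of the cell of generation
  \<open>Suc j\<close> containing \<open>x\<close> within its parent, and \<open>V j\<close> stands for the reciprocal of the volume of that child.\<close>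
locale dyadic_kernel_family = kernel_family X cell n s w t Us \<kappa>
  for X :: "'x set" and cell :: "nat \<Rightarrow> 'x \<Rightarrow> 'x set" and n :: nat
    and s w :: "'x \<Rightarrow> real" and t :: "'u \<Rightarrow> 'x \<Rightarrow> 'x \<Rightarrow> real" and Us :: "'u set" and \<kappa> :: nat +
  fixes child :: "nat \<Rightarrow> 'x \<Rightarrow> nat" and Ch :: "nat set" and V :: "nat \<Rightarrow> real"
  assumes finite_Ch [simp]: "finite Ch"
    and child_in: "x \<in> X \<Longrightarrow> child j x \<in> Ch"
    and child_iff: "x \<in> X \<Longrightarrow> y \<in> cell j x \<Longrightarrow> y \<in> cell (Suc j) x \<longleftrightarrow> child (Suc j) y = child (Suc j) x"
    and kernel_size: "u \<in> Us \<Longrightarrow> x \<in> X \<Longrightarrow> y \<in> cell j x \<Longrightarrow> y \<notin> cell (Suc j) x \<Longrightarrow> \<bar>t u x y\<bar> \<le> 2 * V j"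
begin

text \<open>The child number \<open>k\<close> of the cell of generation \<open>j\<close> containing \<open>y\<close>.\<close>
definition part :: "nat \<Rightarrow> nat \<Rightarrow> 'x \<Rightarrow> 'x set" where
  "part k j y = {x \<in> cell j y. child (Suc j) x = k}"

definition off_diagonal :: "real \<Rightarrow> real \<Rightarrow> real \<Rightarrow> bool" where
  "off_diagonal p q A \<longleftrightarrow> (\<forall>k\<in>Ch. \<forall>l\<in>Ch. k \<noteq> l \<longrightarrow> (\<forall>a. (\<forall>j. cell_const j (a j)) \<longrightarrow>
     vnorm X q w {..<n} (\<lambda>j y. if child (Suc j) y = l then a j y * (V j * sum s (part k j y)) else 0)
       \<le> A * vnorm X p s {..<n} (\<lambda>j x. if child (Suc j) x = k then a j x else 0)))"

lemma part_subset: "y \<in> X \<Longrightarrow> part k j y \<subseteq> X"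
  using cell_subset by (auto simp: part_def)

lemma finite_part [simp]: "y \<in> X \<Longrightarrow> finite (part k j y)"
  by (rule finite_subset[OF part_subset finite_X])

lemma part_self: "x \<in> X \<Longrightarrow> child (Suc j) x = k \<Longrightarrow> part k j x = cell (Suc j) x"
  using child_iff cell_Suc by (fastforce simp: part_def)

lemma part_eq: "x \<in> X \<Longrightarrow> y \<in> cell j x \<Longrightarrow> part k j y = part k j x"
  by (simp add: part_def cell_eq)

lemma sum_ring_parts:
  assumes y: "y \<in> X"
  shows "(\<Sum>x\<in>cell j y - cell (Suc j) y. h x)
    = (\<Sum>k\<in>Ch. \<Sum>l\<in>Ch. if k \<noteq> l \<and> child (Suc j) y = l then (\<Sum>x\<in>part k j y. h x :: real) else 0)"
proof -
  let ?R = "cell j y - cell (Suc j) y"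
  have "(\<Sum>x\<in>?R. h x) = (\<Sum>k\<in>Ch. \<Sum>x\<in>{x \<in> ?R. child (Suc j) x = k}. h x)"
    using y child_in cell_in_X[OF y] by (intro sum.group[symmetric]) auto
  also have "\<dots> = (\<Sum>k\<in>Ch. if k \<noteq> child (Suc j) y then (\<Sum>x\<in>part k j y. h x) else 0)"
  proof (rule sum.cong[OF refl])
    fix k
    have "{x \<in> ?R. child (Suc j) x = k} = (if k \<noteq> child (Suc j) y then part k j y else {})"
      using child_iff[OF y] by (auto simp: part_def)
    then show "(\<Sum>x\<in>{x \<in> ?R. child (Suc j) x = k}. h x) = (if k \<noteq> child (Suc j) y then (\<Sum>x\<in>part k j y. h x) else 0)"
      by simp
  qed
  also have "\<dots> = (\<Sum>k\<in>Ch. \<Sum>l\<in>Ch. if k \<noteq> l \<and> child (Suc j) y = l then (\<Sum>x\<in>part k j y. h x) else 0)"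
  proof (rule sum.cong[OF refl])
    fix k
    have "(\<Sum>l\<in>Ch. if k \<noteq> l \<and> child (Suc j) y = l then (\<Sum>x\<in>part k j y. h x) else 0)
      = (\<Sum>l\<in>Ch. if l = child (Suc j) y then (if k \<noteq> l then (\<Sum>x\<in>part k j y. h x) else 0) else 0)"
      by (rule sum.cong) auto
    also have "\<dots> = (if k \<noteq> child (Suc j) y then (\<Sum>x\<in>part k j y. h x) else 0)"
      using child_in[OF y] by (subst sum.delta) auto
    finally show "(if k \<noteq> child (Suc j) y then (\<Sum>x\<in>part k j y. h x) else 0)
      = (\<Sum>l\<in>Ch. if k \<noteq> l \<and> child (Suc j) y = l then (\<Sum>x\<in>part k j y. h x) else 0)" by simp
  qed
  finally show ?thesis .
qed

lemma ring_form_le: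
  assumes u: "u \<in> Us"
  shows "ring_form j u f g \<le> (\<Sum>k\<in>Ch. \<Sum>l\<in>Ch. if k \<noteq> l then
    (\<Sum>y\<in>X. w y * (if child (Suc j) y = l then \<bar>g y\<bar> * (2 * V j * (\<Sum>x\<in>part k j y. s x * \<bar>f x\<bar>)) else 0)) else 0)"
proof -
  have "ring_form j u f g = (\<Sum>y\<in>X. \<Sum>x\<in>cell j y - cell (Suc j) y. s x * w y * \<bar>t u x y\<bar> * (\<bar>f x\<bar> * \<bar>g y\<bar>))"
    unfolding ring_form_def by (rule sum_cell_ring_swap)
  also have "\<dots> \<le> (\<Sum>y\<in>X. \<Sum>x\<in>cell j y - cell (Suc j) y. w y * (\<bar>g y\<bar> * (2 * V j * (s x * \<bar>f x\<bar>))))"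
  proof (intro sum_mono)
    fix y x assume y: "y \<in> X" and x: "x \<in> cell j y - cell (Suc j) y"
    have xX: "x \<in> X" using x cell_in_X[OF y] by blast
    have "y \<in> cell j x" "y \<notin> cell (Suc j) x" using x cell_sym y xX by blast+
    then have "\<bar>t u x y\<bar> \<le> 2 * V j" by (rule kernel_size[OF u xX])
    then have "s x * w y * (\<bar>f x\<bar> * \<bar>g y\<bar>) * \<bar>t u x y\<bar> \<le> s x * w y * (\<bar>f x\<bar> * \<bar>g y\<bar>) * (2 * V j)"
      using s w xX y by (intro mult_left_mono) auto
    then show "s x * w y * \<bar>t u x y\<bar> * (\<bar>f x\<bar> * \<bar>g y\<bar>) \<le> w y * (\<bar>g y\<bar> * (2 * V j * (s x * \<bar>f x\<bar>)))"
      by (simp add: mult_ac)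
  qed
  also have "\<dots> = (\<Sum>y\<in>X. \<Sum>k\<in>Ch. \<Sum>l\<in>Ch. if k \<noteq> l then
     w y * (if child (Suc j) y = l then \<bar>g y\<bar> * (2 * V j * (\<Sum>x\<in>part k j y. s x * \<bar>f x\<bar>)) else 0) else 0)"
  proof (rule sum.cong[OF refl])
    fix y assume y: "y \<in> X"
    show "(\<Sum>x\<in>cell j y - cell (Suc j) y. w y * (\<bar>g y\<bar> * (2 * V j * (s x * \<bar>f x\<bar>))))
      = (\<Sum>k\<in>Ch. \<Sum>l\<in>Ch. if k \<noteq> l then
     w y * (if child (Suc j) y = l then \<bar>g y\<bar> * (2 * V j * (\<Sum>x\<in>part k j y. s x * \<bar>f x\<bar>)) else 0) else 0)"
      unfolding sum_ring_parts[OF y]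
      by (intro sum.cong refl) (auto simp: sum_distrib_left)
  qed
  also have "\<dots> = (\<Sum>k\<in>Ch. \<Sum>l\<in>Ch. \<Sum>y\<in>X. if k \<noteq> l then
     w y * (if child (Suc j) y = l then \<bar>g y\<bar> * (2 * V j * (\<Sum>x\<in>part k j y. s x * \<bar>f x\<bar>)) else 0) else 0)"
    by (subst sum.swap, rule sum.cong[OF refl], rule sum.swap)
  also have "\<dots> = (\<Sum>k\<in>Ch. \<Sum>l\<in>Ch. if k \<noteq> l then
    (\<Sum>y\<in>X. w y * (if child (Suc j) y = l then \<bar>g y\<bar> * (2 * V j * (\<Sum>x\<in>part k j y. s x * \<bar>f x\<bar>)) else 0)) else 0)"
    by (rule sum.cong[OF refl], rule sum.cong[OF refl]) simp
  finally show ?thesis .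
qed

text \<open>For a fixed pair of children numbers, the averages of \<open>\<phi>\<close> over the child \<open>k\<close> are taken as coefficients in
  the quadratic condition, one square function over \<open>u\<close> for each cell. On the child \<open>k\<close> itself these averages are
  below the maximal function of \<open>\<phi>\<close>.\<close>
lemma part_pair_bound:
  fixes \<phi> \<gamma> :: "nat \<Rightarrow> 'u \<Rightarrow> 'x \<Rightarrow> real"
  assumes p: "1 < p" and q: "1 < q" and A: "off_diagonal p q A" "0 \<le> A"
    and kl: "k \<in> Ch" "l \<in> Ch" "k \<noteq> l"
  shows "(\<Sum>u\<in>Us. \<Sum>j<n. \<Sum>y\<in>X. w y * (if child (Suc j) y = l
      then \<bar>\<gamma> j u y\<bar> * (2 * V j * (\<Sum>x\<in>part k j y. s x * \<bar>\<phi> j u x\<bar>)) else 0))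
    \<le> 2 * A * maximal_const p * (vnorm X p s ({..<n} \<times> Us) (\<lambda>(j,u). \<phi> j u)
        * vnorm X (conj_exp q) w ({..<n} \<times> Us) (\<lambda>(j,u). \<gamma> j u))"
proof -
  have q': "1 < conj_exp q" using q by (rule conj_exp_gt_1)
  define S where "S j y = sum s (part k j y)" for j y
  define a where "a j u y = (\<Sum>x\<in>part k j y. s x * \<bar>\<phi> j u x\<bar>) / S j y" for j u y
  define a' where "a' j y = modulus Us (a j) y" for j y
  have aS: "a j u y * S j y = (\<Sum>x\<in>part k j y. s x * \<bar>\<phi> j u x\<bar>)" if y: "y \<in> X" for j u y
  proof (cases "S j y = 0")
    case True
    have "\<forall>x\<in>part k j y. s x = 0"
      using True s part_subset[OF y] unfolding S_def by (subst (asm) sum_nonneg_eq_0_iff) (use y in auto)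
    then show ?thesis using True by simp
  qed (simp add: a_def)
  define F where "F = (\<lambda>(j,u) y. if child (Suc j) y = l then a j u y * (V j * S j y) else 0)"
  define G where "G = (\<lambda>(j,u) y. 2 * \<bar>\<gamma> j u y\<bar>)"
  have "(\<Sum>u\<in>Us. \<Sum>j<n. \<Sum>y\<in>X. w y * (if child (Suc j) y = l
      then \<bar>\<gamma> j u y\<bar> * (2 * V j * (\<Sum>x\<in>part k j y. s x * \<bar>\<phi> j u x\<bar>)) else 0))
    = (\<Sum>u\<in>Us. \<Sum>j<n. \<Sum>y\<in>X. w y * (F (j,u) y * G (j,u) y))"
    by (intro sum.cong refl) (simp add: F_def G_def aS[symmetric] mult_ac)
  also have "\<dots> = (\<Sum>j<n. \<Sum>u\<in>Us. \<Sum>y\<in>X. w y * (F (j,u) y * G (j,u) y))" by (rule sum.swap)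
  also have "\<dots> = (\<Sum>ju\<in>{..<n} \<times> Us. \<Sum>y\<in>X. w y * (F ju y * G ju y))"
    by (simp add: sum.cartesian_product')
  also have "\<dots> = (\<Sum>y\<in>X. w y * (\<Sum>ju\<in>{..<n} \<times> Us. F ju y * G ju y))"
    by (subst sum.swap) (simp add: sum_distrib_left)
  also have "\<dots> \<le> vnorm X q w ({..<n} \<times> Us) F * vnorm X (conj_exp q) w ({..<n} \<times> Us) G"
    using vnorm_Holder[OF finite_X w q, where I = "{..<n} \<times> Us" and F = F and G = G] by linarith
  also have "\<dots> \<le> (A * (maximal_const p * vnorm X p s ({..<n} \<times> Us) (\<lambda>(j,u). \<phi> j u)))
      * (2 * vnorm X (conj_exp q) w ({..<n} \<times> Us) (\<lambda>(j,u). \<gamma> j u))"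
  proof (intro mult_mono)
    have "vnorm X q w ({..<n} \<times> Us) F
        = vnorm X q w {..<n} (\<lambda>j y. if child (Suc j) y = l then a' j y * (V j * sum s (part k j y)) else 0)"
    proof -
      have "modulus Us (\<lambda>u. F (j,u)) y = \<bar>if child (Suc j) y = l then a' j y * (V j * S j y) else 0\<bar>" for j y
      proof (cases "child (Suc j) y = l")
        case True
        have "modulus Us (\<lambda>u. F (j,u)) y = modulus Us (\<lambda>u y. V j * S j y * a j u y) y"
          using True by (simp add: modulus_def F_def mult_ac)
        also have "\<dots> = \<bar>V j * S j y\<bar> * a' j y" unfolding a'_def by (rule modulus_scale)
        finally show ?thesis using True by (simp add: abs_mult a'_def)
      qed (simp add: modulus_def F_def)
      then show ?thesis
        unfolding vnorm_pair[OF finite_lessThan finite_Us] S_def[symmetric]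
        by (intro vnorm_cong) simp
    qed
    also have "\<dots> \<le> A * vnorm X p s {..<n} (\<lambda>j x. if child (Suc j) x = k then a' j x else 0)"
    proof -
      have "cell_const j (a' j)" for j
        by (rule cell_constI) (simp add: a'_def a_def S_def modulus_def part_eq)
      then show ?thesis using A(1) kl unfolding off_diagonal_def by blast
    qed
    also have "vnorm X p s {..<n} (\<lambda>j x. if child (Suc j) x = k then a' j x else 0)
        \<le> vnorm X p s ({..<n} \<times> Us) (\<lambda>ju. maximal s n ((\<lambda>(j,u). \<phi> j u) ju))"
    proof (rule vnorm_mono[OF s])
      fix x assume x: "x \<in> X"
      have "(if child (Suc j) x = k then a' j x else 0)\<^sup>2 \<le> (\<Sum>u\<in>Us. (maximal s n (\<phi> j u) x)\<^sup>2)" if j: "j < n" for j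
      proof (cases "child (Suc j) x = k")
        case True
        have "a j u x = avg s (Suc j) (\<lambda>x. \<bar>\<phi> j u x\<bar>) x" for u
          by (simp add: a_def S_def avg_def part_self[OF x True])
        then have "0 \<le> a j u x" "a j u x \<le> maximal s n (\<phi> j u) x" for u
          using avg_le_maximal[of "Suc j" n s "\<phi> j u" x] j avg_nonneg[OF s x, of "\<lambda>x. \<bar>\<phi> j u x\<bar>" "Suc j"] by auto
        then have "(\<Sum>u\<in>Us. (a j u x)\<^sup>2) \<le> (\<Sum>u\<in>Us. (maximal s n (\<phi> j u) x)\<^sup>2)"
          by (intro sum_mono power_mono) auto
        then show ?thesis using True by (simp add: a'_def modulus_power2)
      qed (simp add: sum_nonneg)
      then have "(\<Sum>j<n. (if child (Suc j) x = k then a' j x else 0)\<^sup>2) \<le> (\<Sum>j<n. \<Sum>u\<in>Us. (maximal s n (\<phi> j u) x)\<^sup>2)"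
        by (intro sum_mono) auto
      then show "(\<Sum>j<n. (if child (Suc j) x = k then a' j x else 0)\<^sup>2)
        \<le> (\<Sum>ju\<in>{..<n} \<times> Us. (maximal s n ((\<lambda>(j,u). \<phi> j u) ju) x)\<^sup>2)"
        by (simp add: sum.cartesian_product')
    qed (use p in auto)
    also have "\<dots> \<le> maximal_const p * vnorm X p s ({..<n} \<times> Us) (\<lambda>(j,u). \<phi> j u)"
      by (rule vector_maximal_inequality[OF s p]) simp
    finally show "vnorm X q w ({..<n} \<times> Us) F \<le> A * (maximal_const p * vnorm X p s ({..<n} \<times> Us) (\<lambda>(j,u). \<phi> j u))"
      using A(2) by (simp add: mult_left_mono)
    have "vnorm X (conj_exp q) w ({..<n} \<times> Us) G = vnorm X (conj_exp q) w ({..<n} \<times> Us) (\<lambda>ju y. 2 * (\<lambda>(j,u). \<gamma> j u) ju y)"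
      by (rule vnorm_cong) (auto simp: G_def power_mult_distrib)
    also have "\<dots> = 2 * vnorm X (conj_exp q) w ({..<n} \<times> Us) (\<lambda>(j,u). \<gamma> j u)"
      using q' w by (subst vnorm_scale) auto
    finally show "vnorm X (conj_exp q) w ({..<n} \<times> Us) G \<le> 2 * vnorm X (conj_exp q) w ({..<n} \<times> Us) (\<lambda>(j,u). \<gamma> j u)" by simp
  qed (use A maximal_const_ge_1[OF p] in auto)
  finally show ?thesis by (simp add: mult_ac)
qed

lemma vnorm_shifted_differences:
  assumes r: "1 < r" and v: "\<forall>x\<in>X. 0 \<le> v x"
  shows "vnorm X r v ({..<n} \<times> Us) (\<lambda>(j,u). if j + 1 + i \<le> n then mdiff v (j + 1 + i) (f u) else (\<lambda>_. 0))
    \<le> subordination_const r * vnorm X r v Us f"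
proof -
  have "vnorm X r v ({..<n} \<times> Us) (\<lambda>(j,u). if j + 1 + i \<le> n then mdiff v (j + 1 + i) (f u) else (\<lambda>_. 0))
    \<le> vnorm X r v ({..n} \<times> Us) (\<lambda>(k,u). mdiff v k (f u))"
  proof (rule vnorm_mono[OF v])
    fix x
    have "(\<Sum>ju\<in>{..<n} \<times> Us. ((case ju of (j,u) \<Rightarrow> if j + 1 + i \<le> n then mdiff v (j + 1 + i) (f u) else (\<lambda>_. 0)) x)\<^sup>2)
      = (\<Sum>u\<in>Us. \<Sum>j<n. if j + (1 + i) \<le> n then (mdiff v (j + (1 + i)) (f u) x)\<^sup>2 else 0)"
      unfolding sum.cartesian_product' by (subst sum.swap) (auto intro!: sum.cong)
    also have "\<dots> \<le> (\<Sum>u\<in>Us. \<Sum>k\<le>n. (mdiff v k (f u) x)\<^sup>2)"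
      by (intro sum_mono sum_shift_le) auto
    also have "\<dots> = (\<Sum>ku\<in>{..n} \<times> Us. ((case ku of (k,u) \<Rightarrow> mdiff v k (f u)) x)\<^sup>2)"
      unfolding sum.cartesian_product' by (subst sum.swap) simp
    finally show "(\<Sum>ju\<in>{..<n} \<times> Us. ((case ju of (j,u) \<Rightarrow> if j + 1 + i \<le> n then mdiff v (j + 1 + i) (f u) else (\<lambda>_. 0)) x)\<^sup>2)
      \<le> (\<Sum>ku\<in>{..n} \<times> Us. ((case ku of (k,u) \<Rightarrow> mdiff v k (f u)) x)\<^sup>2)" .
  qed (use r in auto)
  also have "\<dots> \<le> subordination_const r * vnorm X r v Us f" by (rule square_function[OF v r finite_Us])
  finally show ?thesis .
qed

lemma ring_sum_bound:
  assumes p: "1 < p" and q: "1 < q" and A: "off_diagonal p q A" "0 \<le> A"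
  shows "ring_sum f g i i' \<le> (real (card Ch))\<^sup>2 * (2 * A * maximal_const p * subordination_const p * subordination_const (conj_exp q))
        * (vnorm X p s Us f * vnorm X (conj_exp q) w Us g)"
proof -
  have q': "1 < conj_exp q" using q by (rule conj_exp_gt_1)
  define \<phi> where "\<phi> j u = (if j + 1 + i \<le> n then mdiff s (j + 1 + i) (f u) else (\<lambda>_. 0))" for j u
  define \<gamma> where "\<gamma> j u = (if j + 1 + i' \<le> n then mdiff w (j + 1 + i') (g u) else (\<lambda>_. 0))" for j u
  define P where "P k l u j = (\<Sum>y\<in>X. w y * (if child (Suc j) y = l
      then \<bar>\<gamma> j u y\<bar> * (2 * V j * (\<Sum>x\<in>part k j y. s x * \<bar>\<phi> j u x\<bar>)) else 0))" for k l u j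
  define B where "B = 2 * A * maximal_const p * ((subordination_const p * vnorm X p s Us f) * (subordination_const (conj_exp q) * vnorm X (conj_exp q) w Us g))"
  have B: "0 \<le> B" unfolding B_def
    using A(2) maximal_const_ge_1[OF p] subordination_const_nonneg by (intro mult_nonneg_nonneg) auto
  have P_le: "(\<Sum>u\<in>Us. \<Sum>j<n. P k l u j) \<le> B" if "k \<in> Ch" "l \<in> Ch" "k \<noteq> l" for k l
  proof -
    have "(\<Sum>u\<in>Us. \<Sum>j<n. P k l u j) \<le> 2 * A * maximal_const p * (vnorm X p s ({..<n} \<times> Us) (\<lambda>(j,u). \<phi> j u)
        * vnorm X (conj_exp q) w ({..<n} \<times> Us) (\<lambda>(j,u). \<gamma> j u))"
      unfolding P_def by (rule part_pair_bound[OF p q A that])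
    also have "\<dots> \<le> B" unfolding B_def \<phi>_def \<gamma>_def
      using A(2) maximal_const_ge_1[OF p] subordination_const_nonneg
      by (intro mult_left_mono mult_mono vnorm_shifted_differences p q' s w mult_nonneg_nonneg) auto
    finally show ?thesis .
  qed
  have "ring_sum f g i i' = (\<Sum>u\<in>Us. \<Sum>j<n. ring_form j u (\<phi> j u) (\<gamma> j u))"
    unfolding ring_sum_def \<phi>_def \<gamma>_def by (intro sum.cong refl) (auto simp: ring_form_def)
  also have "\<dots> \<le> (\<Sum>u\<in>Us. \<Sum>j<n. \<Sum>k\<in>Ch. \<Sum>l\<in>Ch. if k \<noteq> l then P k l u j else 0)"
    unfolding P_def by (intro sum_mono ring_form_le)
  also have "\<dots> = (\<Sum>u\<in>Us. \<Sum>j<n. \<Sum>(k,l)\<in>Ch \<times> Ch. if k \<noteq> l then P k l u j else 0)"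
    by (simp add: sum.cartesian_product)
  also have "\<dots> = (\<Sum>u\<in>Us. \<Sum>(k,l)\<in>Ch \<times> Ch. \<Sum>j<n. if k \<noteq> l then P k l u j else 0)"
    unfolding case_prod_beta by (rule sum.cong[OF refl], rule sum.swap)
  also have "\<dots> = (\<Sum>(k,l)\<in>Ch \<times> Ch. \<Sum>u\<in>Us. \<Sum>j<n. if k \<noteq> l then P k l u j else 0)"
    unfolding case_prod_beta by (rule sum.swap)
  also have "\<dots> \<le> (\<Sum>(k,l)\<in>Ch \<times> Ch. B)"
  proof (rule sum_mono, clarify)
    fix k l assume kl: "k \<in> Ch" "l \<in> Ch"
    show "(\<Sum>u\<in>Us. \<Sum>j<n. if k \<noteq> l then P k l u j else 0) \<le> B"
      using P_le[OF kl] B by (cases "k = l") auto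
  qed
  also have "\<dots> = (real (card Ch))\<^sup>2 * B" by (simp add: card_cartesian_product power2_eq_square)
  finally show ?thesis by (simp add: B_def mult_ac)
qed

end

lemma (in kernel_family) form_expansion:
  "form u f g = (\<Sum>d\<le>n. \<Sum>c\<le>n. form u (mdiff s c f) (mdiff w d g))"
proof -
  have "form u f g = (\<Sum>x\<in>X. \<Sum>y\<in>X. \<Sum>d\<le>n. \<Sum>c\<le>n. s x * w y * t u x y * (mdiff s c f x * mdiff w d g y))"
    unfolding form_def
  proof (rule sum.cong[OF refl], rule sum.cong[OF refl])
    fix x y assume x: "x \<in> X" and y: "y \<in> X"
    show "s x * w y * t u x y * (f x * g y) = (\<Sum>d\<le>n. \<Sum>c\<le>n. s x * w y * t u x y * (mdiff s c f x * mdiff w d g y))"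
    proof (cases "s x = 0 \<or> w y = 0")
      case False
      then have "0 < s x" "0 < w y" using s w x y by (auto simp: order_less_le)
      then have e: "(\<Sum>c\<le>n. mdiff s c f x) = f x" "(\<Sum>d\<le>n. mdiff w d g y) = g y"
        using martingale_expansion[OF s x] martingale_expansion[OF w y] by auto
      have "(\<Sum>d\<le>n. \<Sum>c\<le>n. s x * w y * t u x y * (mdiff s c f x * mdiff w d g y))
        = s x * w y * t u x y * ((\<Sum>c\<le>n. mdiff s c f x) * (\<Sum>d\<le>n. mdiff w d g y))"
        by (subst sum_product, subst sum.swap) (simp only: sum_distrib_left)
      then show ?thesis by (simp only: e)
    qed auto
  qed
  also have "\<dots> = (\<Sum>x\<in>X. \<Sum>d\<le>n. \<Sum>y\<in>X. \<Sum>c\<le>n. s x * w y * t u x y * (mdiff s c f x * mdiff w d g y))"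
    by (rule sum.cong[OF refl], rule sum.swap)
  also have "\<dots> = (\<Sum>d\<le>n. \<Sum>x\<in>X. \<Sum>c\<le>n. \<Sum>y\<in>X. s x * w y * t u x y * (mdiff s c f x * mdiff w d g y))"
    by (subst sum.swap, rule sum.cong[OF refl], rule sum.cong[OF refl], rule sum.swap)
  also have "\<dots> = (\<Sum>d\<le>n. \<Sum>c\<le>n. form u (mdiff s c f) (mdiff w d g))"
    unfolding form_def by (rule sum.cong[OF refl], rule sum.swap)
  finally show ?thesis .
qed

text \<open>The first two summands come from testing \<open>T\<close> and its dual, the last one from the quadratic condition, with
  one term for each pair of children in either half of the form.\<close>
definition form_const :: "real \<Rightarrow> real \<Rightarrow> real \<Rightarrow> real" where
  "form_const p q N = (subordination_const p + maximal_const p) * subordination_const (conj_exp q)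
    + (subordination_const (conj_exp q) + maximal_const (conj_exp q)) * subordination_const p
    + 4 * N\<^sup>2 * maximal_const p * subordination_const p * subordination_const (conj_exp q)"

lemma form_const_nonneg:
  assumes "1 < p" "1 < q" "0 \<le> N"
  shows "0 \<le> form_const p q N"
  using subordination_const_nonneg maximal_const_ge_1[OF assms(1)] maximal_const_ge_1[OF conj_exp_gt_1[OF assms(2)]]
  unfolding form_const_def by (intro add_nonneg_nonneg mult_nonneg_nonneg) auto

context dyadic_kernel_family
begin

definition dual_quadratic_testing :: "real \<Rightarrow> real \<Rightarrow> real \<Rightarrow> bool" where
  "dual_quadratic_testing p q T \<longleftrightarrow>
    kernel_family.quadratic_testing X cell n w s (\<lambda>u x y. t u y x) Us (conj_exp q) (conj_exp p) T"

text \<open>The half with \<open>c \<le> d\<close> is estimated by direct testing; the half with \<open>d < c\<close> is the corresponding half for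
  the transposed kernels and is estimated by dual testing. The off-diagonal sums are symmetric, so the
  quadratic condition is needed in one direction only.\<close>
lemma form_bound:
  assumes p: "1 < p" and q: "1 < q" and T: "quadratic_testing p q T" "0 \<le> T"
    and T': "dual_quadratic_testing p q T'" "0 \<le> T'"
    and A: "off_diagonal p q A" "0 \<le> A"
  shows "\<bar>\<Sum>u\<in>Us. form u (f u) (g u)\<bar>
    \<le> form_const p q (real (card Ch)) * ((1 + real \<kappa>) * (T + T') + (1 + real \<kappa>)\<^sup>2 * A)
      * (vnorm X p s Us f * vnorm X (conj_exp q) w Us g)"
proof -
  interpret tr: kernel_family X cell n w s "\<lambda>u x y. t u y x" Us \<kappa> by (rule transposed)
  define K1 where "K1 = subordination_const p"
  define K2 where "K2 = subordination_const (conj_exp q)"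
  define FG where "FG = vnorm X p s Us f * vnorm X (conj_exp q) w Us g"
  define N where "N = (real (card Ch))\<^sup>2"
  define M where "M = N * (2 * A * maximal_const p * K1 * K2) * FG"
  have p': "1 < conj_exp p" and q': "1 < conj_exp q" using p q conj_exp_gt_1 by auto
  have nn: "0 \<le> K1" "0 \<le> K2" "0 \<le> FG" "1 \<le> maximal_const p" "1 \<le> maximal_const (conj_exp q)" "0 \<le> N"
    using subordination_const_nonneg maximal_const_ge_1 p q' by (auto simp: K1_def K2_def FG_def N_def)
  have M: "ring_sum f g i i' \<le> M" for i i'
    unfolding M_def N_def K1_def K2_def FG_def by (rule ring_sum_bound[OF p q A])
  have rf: "tr.ring_form j u b a = ring_form j u a b" for j u a b
    unfolding tr.ring_form_def ring_form_def by (subst sum_cell_ring_swap) (simp add: mult_ac)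
  have rs: "tr.ring_sum g f i i' = ring_sum f g i' i" for i i'
    unfolding tr.ring_sum_def ring_sum_def by (intro sum.cong refl) (auto simp: rf)
  have fm: "tr.form u b a = form u a b" for u a b
    unfolding tr.form_def form_def by (subst sum.swap) (simp add: mult_ac)
  have h1: "\<bar>\<Sum>u\<in>Us. \<Sum>d\<le>n. \<Sum>c\<le>n. if c + 0 \<le> d then form u (mdiff s c (f u)) (mdiff w d (g u)) else 0\<bar>
    \<le> (1 + real \<kappa>) * (T * (K1 + maximal_const p) * K2 * FG) + (1 + real \<kappa>)\<^sup>2 * M"
    unfolding K1_def K2_def FG_def by (rule half_form_bound[OF p q T M]) simp
  have h2: "\<bar>\<Sum>u\<in>Us. \<Sum>d\<le>n. \<Sum>c\<le>n. if c + 1 \<le> d then tr.form u (mdiff w c (g u)) (mdiff s d (f u)) else 0\<bar>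
    \<le> (1 + real \<kappa>) * (T' * (K2 + maximal_const (conj_exp q)) * K1 * FG) + (1 + real \<kappa>)\<^sup>2 * M"
    using tr.half_form_bound[OF q' p' _ T'(2), of g f M 1] T'(1) M
    by (simp add: dual_quadratic_testing_def rs conj_exp_conj_exp[OF p] K1_def K2_def FG_def mult_ac)
  have "(\<Sum>u\<in>Us. form u (f u) (g u))
    = (\<Sum>u\<in>Us. \<Sum>d\<le>n. \<Sum>c\<le>n. if c + 0 \<le> d then form u (mdiff s c (f u)) (mdiff w d (g u)) else 0)
     + (\<Sum>u\<in>Us. \<Sum>d\<le>n. \<Sum>c\<le>n. if d + 1 \<le> c then form u (mdiff s c (f u)) (mdiff w d (g u)) else 0)"
    unfolding sum.distrib[symmetric]
    by (rule sum.cong[OF refl], subst form_expansion, rule sum.cong[OF refl], rule sum.cong[OF refl]) auto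
  also have "(\<Sum>u\<in>Us. \<Sum>d\<le>n. \<Sum>c\<le>n. if d + 1 \<le> c then form u (mdiff s c (f u)) (mdiff w d (g u)) else 0)
    = (\<Sum>u\<in>Us. \<Sum>d\<le>n. \<Sum>c\<le>n. if c + 1 \<le> d then tr.form u (mdiff w c (g u)) (mdiff s d (f u)) else 0)"
    unfolding fm by (rule sum.cong[OF refl], rule sum.swap)
  finally have "\<bar>\<Sum>u\<in>Us. form u (f u) (g u)\<bar>
    \<le> (1 + real \<kappa>) * (T * ((K1 + maximal_const p) * K2) + T' * ((K2 + maximal_const (conj_exp q)) * K1)) * FG
      + (1 + real \<kappa>)\<^sup>2 * (2 * M)"
    using h1 h2 by (simp add: algebra_simps)
  also have "\<dots> \<le> (1 + real \<kappa>) * ((T + T') * form_const p q (real (card Ch))) * FG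
      + (1 + real \<kappa>)\<^sup>2 * (A * form_const p q (real (card Ch)) * FG)"
  proof (intro add_mono mult_right_mono mult_left_mono)
    have c: "(K1 + maximal_const p) * K2 \<le> form_const p q (real (card Ch))"
      "(K2 + maximal_const (conj_exp q)) * K1 \<le> form_const p q (real (card Ch))"
      "4 * N * maximal_const p * K1 * K2 \<le> form_const p q (real (card Ch))"
      using nn unfolding form_const_def K1_def[symmetric] K2_def[symmetric] N_def[symmetric] by auto
    show "T * ((K1 + maximal_const p) * K2) + T' * ((K2 + maximal_const (conj_exp q)) * K1)
      \<le> (T + T') * form_const p q (real (card Ch))"
      unfolding distrib_right[of T T'] using T(2) T'(2) c(1,2) by (intro add_mono mult_left_mono)
    have "2 * M = A * (4 * N * maximal_const p * K1 * K2) * FG" by (simp add: M_def)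
    also have "\<dots> \<le> A * form_const p q (real (card Ch)) * FG"
      using A c nn by (intro mult_right_mono mult_left_mono) auto
    finally show "2 * M \<le> A * form_const p q (real (card Ch)) * FG" .
  qed (use nn in auto)
  finally show ?thesis by (simp add: FG_def algebra_simps)
qed

definition image :: "'u \<Rightarrow> ('x \<Rightarrow> real) \<Rightarrow> 'x \<Rightarrow> real" where
  "image u f y = (\<Sum>x\<in>X. s x * t u x y * f x)"

theorem square_function_estimate:
  assumes p: "1 < p" and q: "1 < q" and T: "quadratic_testing p q T" "0 \<le> T"
    and T': "dual_quadratic_testing p q T'" "0 \<le> T'"
    and A: "off_diagonal p q A" "0 \<le> A"
  shows "vnorm X q w Us (\<lambda>u. image u (f u))
    \<le> form_const p q (real (card Ch)) * ((1 + real \<kappa>) * (T + T') + (1 + real \<kappa>)\<^sup>2 * A) * vnorm X p s Us f"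
proof (rule vnorm_le_by_duality[OF q w])
  have "0 \<le> form_const p q (real (card Ch))" by (rule form_const_nonneg[OF p q]) simp
  then show "0 \<le> form_const p q (real (card Ch)) * ((1 + real \<kappa>) * (T + T') + (1 + real \<kappa>)\<^sup>2 * A) * vnorm X p s Us f"
    using T T' A by (intro mult_nonneg_nonneg add_nonneg_nonneg) auto
  fix G
  have "(\<Sum>y\<in>X. w y * (\<Sum>u\<in>Us. image u (f u) y * G u y)) = (\<Sum>u\<in>Us. \<Sum>y\<in>X. \<Sum>x\<in>X. s x * w y * t u x y * (f u x * G u y))"
    by (subst sum.swap) (simp add: image_def sum_distrib_left sum_distrib_right mult_ac)
  also have "\<dots> = (\<Sum>u\<in>Us. form u (f u) (G u))"
    unfolding form_def by (rule sum.cong[OF refl], rule sum.swap)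
  also have "\<dots> \<le> form_const p q (real (card Ch)) * ((1 + real \<kappa>) * (T + T') + (1 + real \<kappa>)\<^sup>2 * A)
      * (vnorm X p s Us f * vnorm X (conj_exp q) w Us G)"
    using form_bound[OF p q T T' A, of f G] by linarith
  finally show "(\<Sum>y\<in>X. w y * (\<Sum>u\<in>Us. image u (f u) y * G u y))
    \<le> form_const p q (real (card Ch)) * ((1 + real \<kappa>) * (T + T') + (1 + real \<kappa>)\<^sup>2 * A) * vnorm X p s Us f
      * vnorm X (conj_exp q) w Us G" by (simp add: mult_ac)
qed

end

section \<open>Random signs\<close>

lemma average_exp_le: "(exp t + exp (- t)) / 2 \<le> exp (t\<^sup>2 / 2)" for t :: real
proof -
  have pos: "(exp t + exp (- t)) / 2 \<le> exp (t\<^sup>2 / 2)" if t: "0 \<le> t" for t :: real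
  proof -
    have "ln ((exp t + exp (- t)) / 2) = - (2 * t) * (1/2) + ln (1 + 1/2 * (exp (2 * t) - 1))"
    proof -
      have "(exp t + exp (- t)) / 2 = exp (- t) * (1 + 1/2 * (exp (2 * t) - 1))"
        by (simp add: field_simps exp_add[symmetric])
      moreover have "0 < 1 + 1/2 * (exp (2 * t) - 1)"
        by (simp add: field_simps add_pos_pos)
      ultimately show ?thesis by (simp add: ln_mult)
    qed
    also have "\<dots> \<le> (2 * t)\<^sup>2 / 8" using t by (intro Hoeffdings_lemma_aux) auto
    finally have "ln ((exp t + exp (- t)) / 2) \<le> t\<^sup>2 / 2" by (simp add: power_mult_distrib)
    moreover have "0 < (exp t + exp (- t)) / 2" by (simp add: add_pos_pos)
    ultimately show ?thesis by (metis exp_le_cancel_iff exp_ln)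
  qed
  show ?thesis using pos[of t] pos[of "- t"] by (cases "0 \<le> t") (auto simp: add.commute)
qed

definition signs :: "nat \<Rightarrow> (nat \<Rightarrow> real) set" where
  "signs U = PiE_dflt {1..U} 0 (\<lambda>_. {-1, 1})"

definition sign_mean :: "nat \<Rightarrow> ((nat \<Rightarrow> real) \<Rightarrow> real) \<Rightarrow> real" where
  "sign_mean U F = (\<Sum>\<epsilon>\<in>signs U. F \<epsilon>) / real (card (signs U))"

definition sign_sum :: "nat \<Rightarrow> (nat \<Rightarrow> real) \<Rightarrow> (nat \<Rightarrow> real) \<Rightarrow> real" where
  "sign_sum U a \<epsilon> = (\<Sum>u=1..U. \<epsilon> u * a u)"

lemma finite_signs [simp]: "finite (signs U)"
  unfolding signs_def by (rule finite_PiE_dflt) auto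

lemma card_signs: "card (signs U) = 2 ^ U"
  unfolding signs_def by (subst card_PiE_dflt) (auto simp: numeral_2_eq_2)

lemma signs_nonempty [simp]: "signs U \<noteq> {}"
  by (simp add: signs_def)

definition sign_values :: "nat \<Rightarrow> nat \<Rightarrow> real set" where
  "sign_values U u = (if 1 \<le> u \<and> u \<le> U then {-1, 1} else {0})"

lemma signsD: "\<epsilon> \<in> signs U \<Longrightarrow> \<epsilon> u \<in> sign_values U u"
  unfolding signs_def PiE_dflt_def sign_values_def by simp

lemma signsI:
  assumes A: "\<And>u. \<epsilon> u \<in> sign_values U u"
  shows "\<epsilon> \<in> signs U"
  unfolding signs_def PiE_dflt_def
proof (intro CollectI allI)
  fix u
  show "(u \<in> {1..U} \<longrightarrow> \<epsilon> u \<in> {- 1, 1}) \<and> (u \<notin> {1..U} \<longrightarrow> \<epsilon> u = 0)"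
    using A[of u] by (auto simp: sign_values_def split: if_splits)
qed

lemma random_signs_eq: "random_signs U = pmf_of_set (signs U)"
  unfolding random_signs_def signs_def by (intro Pi_pmf_of_set) auto

lemma nn_integral_random_signs:
  assumes "\<And>\<epsilon>. \<epsilon> \<in> signs U \<Longrightarrow> 0 \<le> F \<epsilon>"
  shows "(\<integral>\<^sup>+\<epsilon>. ennreal (F \<epsilon>) \<partial>measure_pmf (random_signs U)) = ennreal (sign_mean U F)"
proof -
  have "(\<integral>\<^sup>+\<epsilon>. ennreal (F \<epsilon>) \<partial>measure_pmf (random_signs U)) = (\<Sum>\<epsilon>\<in>signs U. ennreal (F \<epsilon>)) / card (signs U)"
    unfolding random_signs_eq by (intro nn_integral_pmf_of_set) auto
  also have "(\<Sum>\<epsilon>\<in>signs U. ennreal (F \<epsilon>)) = ennreal (\<Sum>\<epsilon>\<in>signs U. F \<epsilon>)"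
    by (rule sum_ennreal) (rule assms)
  also have "ennreal (\<Sum>\<epsilon>\<in>signs U. F \<epsilon>) / card (signs U) = ennreal (sign_mean U F)"
    unfolding sign_mean_def
    by (subst divide_ennreal[symmetric]) (auto simp: card_signs sum_nonneg assms ennreal_of_nat_eq_real_of_nat)
  finally show ?thesis .
qed

lemma sum_signs_Suc: "(\<Sum>\<epsilon>\<in>signs (Suc U). F \<epsilon>) = (\<Sum>\<epsilon>\<in>signs U. F (\<epsilon>(Suc U := 1)) + F (\<epsilon>(Suc U := - 1)))"
  for F :: "(nat \<Rightarrow> real) \<Rightarrow> real"
proof -
  have "(\<Sum>\<epsilon>\<in>signs (Suc U). F \<epsilon>) = (\<Sum>(\<epsilon>,c)\<in>signs U \<times> {1,-1::real}. F (\<epsilon>(Suc U := c)))"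
  proof (rule sum.reindex_bij_witness[of _ "\<lambda>(\<epsilon>,c). \<epsilon>(Suc U := c)" "\<lambda>\<epsilon>. (\<epsilon>(Suc U := 0), \<epsilon> (Suc U))"])
    fix \<epsilon> assume \<epsilon>: "\<epsilon> \<in> signs (Suc U)"
    have "(\<epsilon>(Suc U := 0)) u \<in> sign_values U u" for u
      using signsD[OF \<epsilon>, of u] by (cases "u = Suc U") (auto simp: sign_values_def le_Suc_eq split: if_splits)
    then have "\<epsilon>(Suc U := 0) \<in> signs U" by (rule signsI)
    moreover have "\<epsilon> (Suc U) \<in> {1, - 1}"
      using signsD[OF \<epsilon>, of "Suc U"] by (auto simp: sign_values_def)
    ultimately show "(\<epsilon>(Suc U := 0), \<epsilon> (Suc U)) \<in> signs U \<times> {1, - 1}" by blast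
  next
    fix x :: "(nat \<Rightarrow> real) \<times> real" assume x: "x \<in> signs U \<times> {1, - 1}"
    obtain \<epsilon> c where xc: "x = (\<epsilon>, c)" by (cases x)
    have \<epsilon>: "\<epsilon> \<in> signs U" and c: "c = 1 \<or> c = - 1" using x xc by auto
    have "(\<epsilon>(Suc U := c)) u \<in> sign_values (Suc U) u" for u
      using signsD[OF \<epsilon>, of u] c by (cases "u = Suc U") (auto simp: sign_values_def le_Suc_eq split: if_splits)
    then show "(case x of (\<epsilon>, c) \<Rightarrow> \<epsilon>(Suc U := c)) \<in> signs (Suc U)" using xc signsI by simp
    have "\<epsilon> (Suc U) = 0" using signsD[OF \<epsilon>, of "Suc U"] by (simp add: sign_values_def)
    then show "((case x of (\<epsilon>, c) \<Rightarrow> \<epsilon>(Suc U := c))(Suc U := 0), (case x of (\<epsilon>, c) \<Rightarrow> \<epsilon>(Suc U := c)) (Suc U)) = x"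
      using xc by (simp add: fun_upd_idem)
  qed auto
  also have "\<dots> = (\<Sum>\<epsilon>\<in>signs U. \<Sum>c\<in>{1,-1::real}. F (\<epsilon>(Suc U := c)))"
    by (simp only: sum.cartesian_product)
  finally show ?thesis by simp
qed

lemma sign_mean_Suc: "sign_mean (Suc U) F = sign_mean U (\<lambda>\<epsilon>. (F (\<epsilon>(Suc U := 1)) + F (\<epsilon>(Suc U := - 1))) / 2)"
  by (simp add: sign_mean_def sum_signs_Suc card_signs sum_divide_distrib)

lemma sign_sum_Suc: "sign_sum (Suc U) a (\<epsilon>(Suc U := c)) = sign_sum U a \<epsilon> + c * a (Suc U)"
  by (simp add: sign_sum_def)

lemma sign_mean_mono: "(\<And>\<epsilon>. \<epsilon> \<in> signs U \<Longrightarrow> F \<epsilon> \<le> G \<epsilon>) \<Longrightarrow> sign_mean U F \<le> sign_mean U G"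
  by (simp add: sign_mean_def divide_right_mono sum_mono)

lemma sign_mean_const: "sign_mean U (\<lambda>_. c) = c"
  by (simp add: sign_mean_def card_signs)

lemma sign_mean_cmult: "sign_mean U (\<lambda>\<epsilon>. c * F \<epsilon>) = c * sign_mean U F"
  by (simp add: sign_mean_def sum_distrib_left)

lemma sign_mean_add: "sign_mean U (\<lambda>\<epsilon>. F \<epsilon> + G \<epsilon>) = sign_mean U F + sign_mean U G"
  by (simp add: sign_mean_def sum.distrib add_divide_distrib)

lemma sign_mean_sum: "sign_mean U (\<lambda>\<epsilon>. \<Sum>x\<in>X. F x \<epsilon>) = (\<Sum>x\<in>X. sign_mean U (F x))"
  by (simp add: sign_mean_def sum_divide_distrib) (rule sum.swap)

lemma sign_mean_nonneg: "(\<And>\<epsilon>. \<epsilon> \<in> signs U \<Longrightarrow> 0 \<le> F \<epsilon>) \<Longrightarrow> 0 \<le> sign_mean U F"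
  by (simp add: sign_mean_def sum_nonneg)

lemma sign_second_moment: "sign_mean U (\<lambda>\<epsilon>. (c + sign_sum U a \<epsilon>)\<^sup>2) = c\<^sup>2 + (\<Sum>u=1..U. (a u)\<^sup>2)"
proof (induction U)
  case 0 then show ?case by (simp add: sign_sum_def sign_mean_const)
next
  case (Suc U)
  have e: "((c + (z + 1 * a (Suc U)))\<^sup>2 + (c + (z + - 1 * a (Suc U)))\<^sup>2) / 2 = (c + z)\<^sup>2 + (a (Suc U))\<^sup>2" for z
    by (simp add: power2_eq_square field_simps)
  show ?case
    unfolding sign_mean_Suc sign_sum_Suc e sign_mean_add sign_mean_const Suc.IH by simp
qed

text \<open>Independence factorizes the exponential moment, and each factor is subgaussian.\<close>
lemma sign_exp_moment: "sign_mean U (\<lambda>\<epsilon>. exp (c + sign_sum U a \<epsilon>)) \<le> exp (c + (\<Sum>u=1..U. (a u)\<^sup>2) / 2)"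
proof (induction U arbitrary: c)
  case 0 then show ?case by (simp add: sign_sum_def sign_mean_const)
next
  case (Suc U)
  let ?b = "a (Suc U)"
  have "sign_mean (Suc U) (\<lambda>\<epsilon>. exp (c + sign_sum (Suc U) a \<epsilon>))
    = sign_mean U (\<lambda>\<epsilon>. ((exp ?b + exp (- ?b)) / 2) * exp (c + sign_sum U a \<epsilon>))"
    by (simp add: sign_mean_Suc sign_sum_Suc exp_add exp_diff exp_minus field_simps)
  also have "\<dots> = ((exp ?b + exp (- ?b)) / 2) * sign_mean U (\<lambda>\<epsilon>. exp (c + sign_sum U a \<epsilon>))"
    by (rule sign_mean_cmult)
  also have "\<dots> \<le> exp (?b\<^sup>2 / 2) * exp (c + (\<Sum>u=1..U. (a u)\<^sup>2) / 2)"
    using Suc.IH average_exp_le[of ?b] by (intro mult_mono sign_mean_nonneg) auto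
  also have "\<dots> = exp (c + (\<Sum>u=1..Suc U. (a u)\<^sup>2) / 2)"
    by (simp add: exp_add[symmetric] add_divide_distrib add_ac)
  finally show ?case .
qed

lemma powr_le_exp:
  fixes x q :: real
  assumes "0 \<le> x" "0 < q"
  shows "x powr q \<le> q powr q * exp x"
proof (cases "x = 0")
  case False
  have "x / q \<le> exp (x / q)" using exp_ge_add_one_self[of "x/q"] by linarith
  then have "(x / q) powr q \<le> exp (x / q) powr q" using assms by (intro powr_mono2) auto
  also have "exp (x / q) powr q = exp x" using assms by (simp add: powr_def)
  finally have "(x / q) powr q \<le> exp x" .
  then show ?thesis using assms False by (simp add: powr_divide divide_le_eq mult.commute)
qed (use assms in simp)

definition khintchine_const :: "real \<Rightarrow> real" where
  "khintchine_const q = 2 * q powr q * exp (1/2)"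

lemma khintchine_const_pos: "0 < q \<Longrightarrow> 0 < khintchine_const q"
  by (simp add: khintchine_const_def)

lemma sign_sum_scale: "sign_sum U (\<lambda>u. c * a u) \<epsilon> = c * sign_sum U a \<epsilon>"
  by (simp add: sign_sum_def sum_distrib_left mult_ac)

text \<open>After normalizing the square sum, the power is dominated by the exponentials of the sum and of its
  negative.\<close>
lemma khintchine_upper:
  assumes q: "0 < q"
  shows "sign_mean U (\<lambda>\<epsilon>. \<bar>sign_sum U a \<epsilon>\<bar> powr q) \<le> khintchine_const q * sqrt (\<Sum>u=1..U. (a u)\<^sup>2) powr q"
proof (cases "(\<Sum>u=1..U. (a u)\<^sup>2) = 0")
  case True
  then have "\<forall>u\<in>{1..U}. (a u)\<^sup>2 = 0" by (subst (asm) sum_nonneg_eq_0_iff) auto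
  then have "sign_sum U a \<epsilon> = 0" for \<epsilon> by (simp add: sign_sum_def)
  then have "sign_mean U (\<lambda>\<epsilon>. \<bar>sign_sum U a \<epsilon>\<bar> powr q) = 0" by (simp add: sign_mean_const)
  then show ?thesis using khintchine_const_pos[OF q] by simp
next
  case False
  define v where "v = sqrt (\<Sum>u=1..U. (a u)\<^sup>2)"
  have v: "v > 0" using False by (simp add: v_def sum_nonneg order_less_le)
  define b where "b u = (1 / v) * a u" for u
  have sb: "(\<Sum>u=1..U. (b u)\<^sup>2) = 1"
  proof -
    have "(\<Sum>u=1..U. (b u)\<^sup>2) = (1/v)\<^sup>2 * (\<Sum>u=1..U. (a u)\<^sup>2)"
      by (simp only: b_def power_mult_distrib sum_distrib_left)
    also have "(\<Sum>u=1..U. (a u)\<^sup>2) = v\<^sup>2" by (simp add: v_def sum_nonneg)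
    finally show ?thesis using v by (simp add: power_divide)
  qed
  have "sign_mean U (\<lambda>\<epsilon>. \<bar>sign_sum U b \<epsilon>\<bar> powr q)
    \<le> sign_mean U (\<lambda>\<epsilon>. q powr q * (exp (0 + sign_sum U b \<epsilon>) + exp (0 + sign_sum U (\<lambda>u. (-1) * b u) \<epsilon>)))"
  proof (rule sign_mean_mono)
    fix \<epsilon>
    have "\<bar>sign_sum U b \<epsilon>\<bar> powr q \<le> q powr q * exp \<bar>sign_sum U b \<epsilon>\<bar>" using q by (intro powr_le_exp) auto
    also have "exp \<bar>sign_sum U b \<epsilon>\<bar> \<le> exp (sign_sum U b \<epsilon>) + exp (- sign_sum U b \<epsilon>)" by (simp add: abs_if)
    finally show "\<bar>sign_sum U b \<epsilon>\<bar> powr q \<le> q powr q * (exp (0 + sign_sum U b \<epsilon>) + exp (0 + sign_sum U (\<lambda>u. (-1) * b u) \<epsilon>))"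
      unfolding sign_sum_scale by (simp add: mult_left_mono)
  qed
  also have "\<dots> \<le> q powr q * (exp (0 + (\<Sum>u=1..U. (b u)\<^sup>2) / 2) + exp (0 + (\<Sum>u=1..U. ((-1) * b u)\<^sup>2) / 2))"
    unfolding sign_mean_cmult sign_mean_add by (intro mult_left_mono add_mono sign_exp_moment) auto
  also have "\<dots> = khintchine_const q" by (simp add: sb[unfolded One_nat_def] khintchine_const_def)
  finally have main: "sign_mean U (\<lambda>\<epsilon>. \<bar>sign_sum U b \<epsilon>\<bar> powr q) \<le> khintchine_const q" .
  have "\<bar>sign_sum U a \<epsilon>\<bar> powr q = v powr q * \<bar>sign_sum U b \<epsilon>\<bar> powr q" for \<epsilon>
  proof -
    have "b = (\<lambda>u. (1 / v) * a u)" by (rule ext) (simp add: b_def)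
    then have "sign_sum U a \<epsilon> = v * sign_sum U b \<epsilon>" using v by (simp only: sign_sum_scale) simp
    then show ?thesis using v by (simp add: abs_mult powr_mult)
  qed
  then have "sign_mean U (\<lambda>\<epsilon>. \<bar>sign_sum U a \<epsilon>\<bar> powr q) = v powr q * sign_mean U (\<lambda>\<epsilon>. \<bar>sign_sum U b \<epsilon>\<bar> powr q)"
    by (simp add: sign_mean_cmult)
  also have "\<dots> \<le> v powr q * khintchine_const q" using main by (intro mult_left_mono) auto
  finally show ?thesis by (simp add: v_def mult.commute)
qed

definition khintchine_lower_const :: real where
  "khintchine_lower_const = 2 * sqrt (2 * khintchine_const 4)"

lemma khintchine_lower_const_pos: "0 < khintchine_lower_const"
  using khintchine_const_pos[of 4] by (simp add: khintchine_lower_const_def)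

text \<open>The second moment is interpolated between the first and the fourth moment: large values of the sum
  contribute at most half of the second moment.\<close>
lemma khintchine_lower:
  "sqrt (\<Sum>u=1..U. (a u)\<^sup>2) \<le> khintchine_lower_const * sign_mean U (\<lambda>\<epsilon>. \<bar>sign_sum U a \<epsilon>\<bar>)"
proof (cases "(\<Sum>u=1..U. (a u)\<^sup>2) = 0")
  case True
  then show ?thesis using khintchine_lower_const_pos by (simp add: sign_mean_nonneg)
next
  case False
  define v where "v = sqrt (\<Sum>u=1..U. (a u)\<^sup>2)"
  define K where "K = khintchine_const 4"
  have K: "K > 0" by (simp add: K_def khintchine_const_pos)
  have v: "v > 0" using False by (simp add: v_def sum_nonneg order_less_le)
  have v2: "v\<^sup>2 = (\<Sum>u=1..U. (a u)\<^sup>2)" by (simp add: v_def sum_nonneg)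
  \<comment> \<open>the threshold \<open>sqrt (2 K) v\<close> makes the fourth moment term at most half of the second moment\<close>
  have pt: "z\<^sup>2 \<le> sqrt (2*K) * v * \<bar>z\<bar> + \<bar>z\<bar> powr 4 / (2 * K * v\<^sup>2)" for z :: real
  proof (cases "\<bar>z\<bar> \<le> sqrt (2*K) * v")
    case True
    have "z\<^sup>2 = \<bar>z\<bar> * \<bar>z\<bar>" by (simp add: power2_eq_square)
    also have "\<dots> \<le> sqrt (2*K) * v * \<bar>z\<bar>" using True by (intro mult_right_mono) auto
    also have "\<dots> \<le> sqrt (2*K) * v * \<bar>z\<bar> + \<bar>z\<bar> powr 4 / (2 * K * v\<^sup>2)" using K by simp
    finally show ?thesis .
  next
    case False
    have sqK: "0 \<le> sqrt (2*K) * v" using K v by simp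
    then have z: "\<bar>z\<bar> > 0" using False by linarith
    have "(sqrt (2*K) * v)\<^sup>2 \<le> \<bar>z\<bar>\<^sup>2" using False sqK by (intro power_mono) auto
    then have "2 * K * v\<^sup>2 \<le> z\<^sup>2" using K by (simp add: power_mult_distrib)
    then have "z\<^sup>2 * (2 * K * v\<^sup>2) \<le> z\<^sup>2 * z\<^sup>2" by (intro mult_left_mono) auto
    also have "z\<^sup>2 * z\<^sup>2 = \<bar>z\<bar> powr 4" using z by (simp add: power2_eq_square power4_eq_xxxx abs_if)
    finally have "z\<^sup>2 \<le> \<bar>z\<bar> powr 4 / (2 * K * v\<^sup>2)" using K v by (simp add: le_divide_eq)
    moreover have "0 \<le> sqrt (2*K) * v * \<bar>z\<bar>" using sqK by simp
    ultimately show ?thesis by linarith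
  qed
  have "v\<^sup>2 = sign_mean U (\<lambda>\<epsilon>. (sign_sum U a \<epsilon>)\<^sup>2)" using sign_second_moment[where U = U and c = 0 and a = a] v2 by simp
  also have "\<dots> \<le> sign_mean U (\<lambda>\<epsilon>. (sqrt (2*K) * v) * \<bar>sign_sum U a \<epsilon>\<bar> + (1 / (2 * K * v\<^sup>2)) * \<bar>sign_sum U a \<epsilon>\<bar> powr 4)"
    using pt by (intro sign_mean_mono) simp
  also have "\<dots> = sqrt (2*K) * v * sign_mean U (\<lambda>\<epsilon>. \<bar>sign_sum U a \<epsilon>\<bar>) + (1 / (2 * K * v\<^sup>2)) * sign_mean U (\<lambda>\<epsilon>. \<bar>sign_sum U a \<epsilon>\<bar> powr 4)"
    by (simp only: sign_mean_add sign_mean_cmult)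
  also have "\<dots> \<le> sqrt (2*K) * v * sign_mean U (\<lambda>\<epsilon>. \<bar>sign_sum U a \<epsilon>\<bar>) + (1 / (2 * K * v\<^sup>2)) * (K * v powr 4)"
    using khintchine_upper[where q = 4 and U = U and a = a] K by (intro add_left_mono mult_left_mono) (auto simp: K_def v_def)
  also have "(1 / (2 * K * v\<^sup>2)) * (K * v powr 4) = v\<^sup>2 / 2"
    using K v by (simp add: power2_eq_square power4_eq_xxxx)
  finally have "v * (v / 2) \<le> v * (sqrt (2*K) * sign_mean U (\<lambda>\<epsilon>. \<bar>sign_sum U a \<epsilon>\<bar>))"
    by (simp add: power2_eq_square mult_ac)
  then have "v / 2 \<le> sqrt (2*K) * sign_mean U (\<lambda>\<epsilon>. \<bar>sign_sum U a \<epsilon>\<bar>)" using v by simp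
  then show ?thesis by (simp add: v_def khintchine_lower_const_def K_def)
qed

lemma sign_mean_wnorm_le_vnorm:
  assumes w: "\<forall>x\<in>X. 0 \<le> w x" and q: "1 < q"
  shows "sign_mean U (\<lambda>\<epsilon>. wnorm X q w (\<lambda>x. \<Sum>u=1..U. \<epsilon> u * F u x))
    \<le> khintchine_const q powr (1/q) * vnorm X q w {1..U} F"
proof -
  define N where "N \<epsilon> = wnorm X q w (\<lambda>x. \<Sum>u=1..U. \<epsilon> u * F u x)" for \<epsilon>
  define c where "c = 1 / real (card (signs U))"
  have c: "c > 0" by (simp add: c_def card_signs)
  have q': "1 < conj_exp q" using q by (rule conj_exp_gt_1)
  have sm: "sign_mean U G = (\<Sum>\<epsilon>\<in>signs U. c * G \<epsilon>)" for G
    by (simp add: sign_mean_def c_def sum_divide_distrib)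
  have "sign_mean U N = (\<Sum>\<epsilon>\<in>signs U. c * (\<bar>N \<epsilon>\<bar> * \<bar>1\<bar>))" by (simp add: sm N_def)
  also have "\<dots> \<le> wnorm (signs U) q (\<lambda>_. c) N * wnorm (signs U) (conj_exp q) (\<lambda>_. c) (\<lambda>_. 1)"
    using c q by (intro weighted_Holder) auto
  also have "wnorm (signs U) (conj_exp q) (\<lambda>_. c) (\<lambda>_. 1) = 1"
    by (simp add: wnorm_def c_def card_signs)
  also have "wnorm (signs U) q (\<lambda>_. c) N = (sign_mean U (\<lambda>\<epsilon>. N \<epsilon> powr q)) powr (1/q)"
    by (simp add: wnorm_def sm N_def)
  also have "sign_mean U (\<lambda>\<epsilon>. N \<epsilon> powr q) = (\<Sum>x\<in>X. w x * sign_mean U (\<lambda>\<epsilon>. \<bar>sign_sum U (\<lambda>u. F u x) \<epsilon>\<bar> powr q))"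
    using q by (simp add: N_def wnorm_powr[OF w] sign_mean_sum sign_mean_cmult sign_sum_def)
  finally have "sign_mean U N \<le> (\<Sum>x\<in>X. w x * sign_mean U (\<lambda>\<epsilon>. \<bar>sign_sum U (\<lambda>u. F u x) \<epsilon>\<bar> powr q)) powr (1/q)"
    by simp
  also have "\<dots> \<le> (\<Sum>x\<in>X. w x * (khintchine_const q * modulus {1..U} F x powr q)) powr (1/q)"
    using w q unfolding modulus_def
    by (intro powr_mono2 sum_mono mult_left_mono khintchine_upper sum_nonneg mult_nonneg_nonneg sign_mean_nonneg) auto
  also have "(\<Sum>x\<in>X. w x * (khintchine_const q * modulus {1..U} F x powr q))
    = khintchine_const q * (\<Sum>x\<in>X. w x * \<bar>modulus {1..U} F x\<bar> powr q)"
    by (simp add: sum_distrib_left mult_ac)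
  finally show ?thesis by (simp add: powr_mult N_def vnorm_def wnorm_def)
qed

text \<open>The lower inequality holds with the first moment at each point; duality exchanges the mean and the norm.\<close>
lemma vnorm_le_sign_mean_wnorm:
  assumes X: "finite X" and s: "\<forall>x\<in>X. 0 \<le> s x" and p: "1 < p"
  shows "vnorm X p s {1..U} F
    \<le> khintchine_lower_const * sign_mean U (\<lambda>\<epsilon>. wnorm X p s (\<lambda>x. \<Sum>u=1..U. \<epsilon> u * F u x))"
proof -
  define L where "L = khintchine_lower_const"
  have L: "L > 0" by (simp add: L_def khintchine_lower_const_pos)
  define N where "N = sign_mean U (\<lambda>\<epsilon>. wnorm X p s (\<lambda>x. \<Sum>u=1..U. \<epsilon> u * F u x))"
  have N0: "0 \<le> N" unfolding N_def by (intro sign_mean_nonneg) simp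
  define h where "h x = L * sign_mean U (\<lambda>\<epsilon>. \<bar>\<Sum>u=1..U. \<epsilon> u * F u x\<bar>)" for x
  have h: "modulus {1..U} F x \<le> h x" for x
    using khintchine_lower[where U = U and a = "\<lambda>u. F u x"] by (simp add: modulus_def h_def L_def sign_sum_def)
  have h0: "0 \<le> h x" for x by (rule order.trans[OF modulus_nonneg h])
  have "vnorm X p s {1..U} F \<le> vnorm X p s {()} (\<lambda>_. h)"
    using p h h0 unfolding vnorm_def
    by (intro wnorm_mono[OF s]) (auto simp: modulus_def[of "{()}"])
  also have "\<dots> \<le> L * N"
  proof (rule vnorm_le_by_duality[OF p s])
    fix G :: "unit \<Rightarrow> 'a \<Rightarrow> real"
    have "(\<Sum>x\<in>X. s x * (\<Sum>i\<in>{()}. h x * G i x)) \<le> (\<Sum>x\<in>X. s x * (h x * \<bar>G () x\<bar>))"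
      using s h0 by (auto intro!: sum_mono mult_left_mono)
    also have "\<dots> = sign_mean U (\<lambda>\<epsilon>. \<Sum>x\<in>X. (L * s x * \<bar>G () x\<bar>) * \<bar>\<Sum>u=1..U. \<epsilon> u * F u x\<bar>)"
      by (simp add: sign_mean_sum sign_mean_cmult h_def mult_ac)
    also have "\<dots> = sign_mean U (\<lambda>\<epsilon>. L * (\<Sum>x\<in>X. s x * (\<bar>\<Sum>u=1..U. \<epsilon> u * F u x\<bar> * \<bar>G () x\<bar>)))"
      by (simp add: sum_distrib_left mult_ac)
    also have "\<dots> \<le> sign_mean U (\<lambda>\<epsilon>. L * (wnorm X p s (\<lambda>x. \<Sum>u=1..U. \<epsilon> u * F u x) * wnorm X (conj_exp p) s (G ())))"
      using L by (intro sign_mean_mono mult_left_mono weighted_Holder X s p) auto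
    also have "\<dots> = sign_mean U (\<lambda>\<epsilon>. (L * wnorm X (conj_exp p) s (G ())) * wnorm X p s (\<lambda>x. \<Sum>u=1..U. \<epsilon> u * F u x))"
      by (simp add: mult_ac)
    also have "\<dots> = L * N * wnorm X (conj_exp p) s (G ())"
      unfolding sign_mean_cmult N_def by (simp add: mult_ac)
    also have "wnorm X (conj_exp p) s (G ()) = vnorm X (conj_exp p) s {()} G"
      by (simp add: vnorm_def wnorm_def modulus_def)
    finally show "(\<Sum>x\<in>X. s x * (\<Sum>i\<in>{()}. h x * G i x)) \<le> L * N * vnorm X (conj_exp p) s {()} G" .
  qed (use L N0 in auto)
  finally show ?thesis by (simp add: L_def N_def)
qed

section \<open>Dyadic cubes and Haar functions\<close>

lemma cube_memI: "(\<And>i. x $ i \<le> y $ i) \<Longrightarrow> (\<And>i. y $ i < x $ i + l) \<Longrightarrow> y \<in> cube x l"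
  by (simp add: cube_def)

lemma cube_memD: "y \<in> cube x l \<Longrightarrow> x $ i \<le> y $ i \<and> y $ i < x $ i + l"
  by (simp add: cube_def)

lemma cube_corner: "0 < l \<Longrightarrow> x \<in> cube x l"
  by (simp add: cube_def)

lemma cube_inject:
  fixes a b :: "real ^ 'n::finite"
  assumes eq: "cube a l = cube b m" and lm: "0 < l" "0 < m"
  shows "a = b \<and> l = m"
proof -
  have "a \<in> cube b m" "b \<in> cube a l" using cube_corner lm eq by auto
  then have ab: "a = b" by (simp add: vec_eq_iff cube_def order_antisym)
  have le: "l' \<le> m'" if "cube a l' = cube a m'" "0 < l'" for l' m'
  proof (rule ccontr)
    assume "\<not> l' \<le> m'"
    then have ml: "m' < l'" by simp
    have "0 < m'"
    proof -
      have "a \<in> cube a m'" using cube_corner[OF that(2)] that(1) by auto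
      then show ?thesis using cube_memD[of a a m' undefined] by simp
    qed
    then have "(\<chi> i. a $ i + m') \<in> cube a l'" using ml by (simp add: cube_def)
    then have "(\<chi> i. a $ i + m') \<in> cube a m'" using that by simp
    then show False using cube_memD[of "\<chi> i. a $ i + m'" a m' undefined] by simp
  qed
  show ?thesis using le[of l m] le[of m l] eq lm ab by auto
qed

lemma cube_bounds: "box a (\<chi> i. a $ i + l) \<subseteq> cube a l" "cube a l \<subseteq> cbox a (\<chi> i. a $ i + l)"
  by (auto simp: cube_def mem_box_cart less_imp_le)

lemma sets_cube [measurable]: "cube (a :: real ^ 'n::finite) l \<in> sets borel"
proof -
  have "cube a l = (\<Inter>i\<in>UNIV. {y. a $ i \<le> y $ i} \<inter> {y. y $ i < a $ i + l})"
    by (auto simp: cube_def)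
  moreover have "closed {y :: real ^ 'n. a $ i \<le> y $ i}" "open {y :: real ^ 'n. y $ i < a $ i + l}" for i
    by (auto intro!: closed_Collect_le open_Collect_less continuous_intros)
  ultimately show ?thesis by (auto intro!: sets.finite_INT borel_closed borel_open)
qed

lemma vol_cube:
  fixes a :: "real ^ 'n::finite"
  assumes l: "0 < l"
  shows "vol (cube a l) = l ^ CARD('n)"
proof -
  let ?b = "\<chi> i. a $ i + l"
  have c: "measure lborel (cbox a ?b) = l ^ CARD('n)"
    using l content_cbox_cart[of a ?b] by (simp add: interval_ne_empty_cart less_imp_le)
  have e: "emeasure lborel (box a ?b) = emeasure lborel (cbox a ?b)"
    by (simp add: emeasure_lborel_box_eq emeasure_lborel_cbox_eq)
  have "emeasure lborel (box a ?b) \<le> emeasure lborel (cube a l)"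
    using cube_bounds(1) by (intro emeasure_mono) auto
  moreover have "emeasure lborel (cube a l) \<le> emeasure lborel (cbox a ?b)"
    using cube_bounds(2) by (intro emeasure_mono) auto
  ultimately have "emeasure lborel (cube a l) = emeasure lborel (cbox a ?b)" using e by simp
  then show ?thesis using c by (simp add: measure_def)
qed

lemma haar1_outside: "0 < l \<Longrightarrow> \<not> (a \<le> t \<and> t < a + l) \<Longrightarrow> haar1 e a l t = 0"
  by (auto simp: haar1_def indicator_def)

lemma abs_haar1_le: "0 < l \<Longrightarrow> \<bar>haar1 e a l t\<bar> \<le> 1 / sqrt l"
  by (auto simp: haar1_def indicator_def abs_divide)

lemma haar1_cong:
  assumes "a \<le> t \<longleftrightarrow> a \<le> t'" "a + l / 2 \<le> t \<longleftrightarrow> a + l / 2 \<le> t'" "a + l \<le> t \<longleftrightarrow> a + l \<le> t'"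
  shows "haar1 e a l t = haar1 e a l t'"
  using assms by (auto simp: haar1_def indicator_def not_le[symmetric])

lemma haar_outside: "0 < l \<Longrightarrow> y \<notin> cube a l \<Longrightarrow> haar \<eta> a l y = 0"
  unfolding haar_def by (rule prod_zero) (auto simp: cube_def intro!: haar1_outside)

lemma abs_haar_le:
  fixes a :: "real ^ 'n::finite"
  assumes "0 < l"
  shows "\<bar>haar \<eta> a l y\<bar> \<le> 1 / sqrt (vol (cube a l))"
proof -
  have "\<bar>haar \<eta> a l y\<bar> = (\<Prod>i\<in>UNIV. \<bar>haar1 (\<eta> i) (a $ i) l (y $ i)\<bar>)" by (simp add: haar_def abs_prod)
  also have "\<dots> \<le> (\<Prod>i\<in>(UNIV :: 'n set). 1 / sqrt l)" using assms by (intro prod_mono) (auto intro: abs_haar1_le)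
  also have "\<dots> = 1 / sqrt (l ^ CARD('n))" by (simp add: power_divide real_sqrt_power)
  finally show ?thesis using assms by (simp add: vol_cube)
qed

lemma haar_related_outside: "haar_related Q h \<Longrightarrow> y \<notin> Q \<Longrightarrow> h y = 0"
  by (auto simp: haar_related_def intro: haar_outside)

lemma abs_haar_related_le: "haar_related Q h \<Longrightarrow> \<bar>h y\<bar> \<le> 1 / sqrt (vol Q)"
  by (auto simp: haar_related_def intro: abs_haar_le)

locale dyadic =
  fixes D :: "'n::finite lattice"
  assumes D: "dyadic_lattice D"
begin

definition gcell :: "int \<Rightarrow> real ^ 'n \<Rightarrow> 'n point_set" where
  "gcell k x = (THE Q. Q \<in> D k \<and> x \<in> Q)"

lemma partition: "partition_on UNIV (D k)"
  using D by (simp add: dyadic_lattice_def)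

lemma gcell_unique: "Q \<in> D k \<Longrightarrow> x \<in> Q \<Longrightarrow> gcell k x = Q"
  unfolding gcell_def
proof (rule the_equality)
  fix R assume "Q \<in> D k" "x \<in> Q" "R \<in> D k \<and> x \<in> R"
  then show "R = Q" using partition_onD2[OF partition[of k]] by (auto simp: disjoint_def)
qed simp

lemma gcell_in [simp]: "gcell k x \<in> D k" and gcell_self [simp]: "x \<in> gcell k x"
proof -
  obtain Q where "Q \<in> D k" "x \<in> Q" using partition_onD1[OF partition[of k]] by blast
  then show "gcell k x \<in> D k" "x \<in> gcell k x" using gcell_unique by auto
qed

lemma gcell_eq: "y \<in> gcell k x \<Longrightarrow> gcell k y = gcell k x"
  by (rule gcell_unique) auto

lemma D_nonempty: "Q \<in> D k \<Longrightarrow> \<exists>x. Q = gcell k x"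
  using partition_onD3[OF partition[of k]] gcell_unique by (metis all_not_in_conv)

lemma D_cube: "Q \<in> D k \<Longrightarrow> \<exists>a. Q = cube a (2 powi (- k))"
  using D by (simp add: dyadic_lattice_def)

lemma D_children:
  assumes "Q \<in> D k"
  obtains F where "F \<subseteq> D (k + 1)" "finite F" "Q = \<Union>F"
proof -
  have "\<exists>F\<subseteq>D (k + 1). card F = 2 ^ CARD('n) \<and> Q = \<Union>F"
    using D assms by (simp add: dyadic_lattice_def)
  then obtain F where F: "F \<subseteq> D (k + 1)" "card F = 2 ^ CARD('n)" "Q = \<Union>F" by auto
  have "finite F" by (rule card_ge_0_finite) (simp add: F(2))
  then show ?thesis using that F by simp
qed

lemma gcell_Suc: "gcell (k + 1) x \<subseteq> gcell k x"
proof -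
  obtain F where F: "F \<subseteq> D (k + 1)" "gcell k x = \<Union>F" using D_children[OF gcell_in] by metis
  then obtain R where "R \<in> F" "x \<in> R" using gcell_self[of x k] by blast
  then have "gcell (k + 1) x = R" using F by (intro gcell_unique) auto
  then show ?thesis using F \<open>R \<in> F\<close> by blast
qed

lemma gcell_mono:
  assumes "k \<le> l"
  shows "gcell l x \<subseteq> gcell k x"
  using assms
proof (induction l rule: int_ge_induct)
  case (step l)
  show ?case by (rule order.trans[OF gcell_Suc step.IH])
qed simp

lemma generation_unique: "Q \<in> D j \<Longrightarrow> Q \<in> D k \<Longrightarrow> j = k"
proof -
  assume Q: "Q \<in> D j" "Q \<in> D k"
  obtain a where a: "Q = cube a (2 powi (- j))" using D_cube[OF Q(1)] by blast
  obtain b where b: "Q = cube b (2 powi (- k))" using D_cube[OF Q(2)] by blast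
  have "(2::real) powi (- j) = 2 powi (- k)"
    using cube_inject[of a "2 powi (- j)" b "2 powi (- k)"] a b by simp
  moreover have "(2::real) powi (- j) < 2 powi (- k)" if "k < j"
    using that by (intro power_int_strict_increasing) auto
  moreover have "(2::real) powi (- k) < 2 powi (- j)" if "j < k"
    using that by (intro power_int_strict_increasing) auto
  ultimately show "j = k" by (metis linorder_neqE less_irrefl)
qed

lemma vol_gcell: "Q \<in> D k \<Longrightarrow> vol Q = (2 powi (- k)) ^ CARD('n)"
  using D_cube[of Q k] vol_cube[of "2 powi (- k)"] by auto

lemma ancestor_eq:
  assumes "Q \<in> D k" "x \<in> Q"
  shows "ancestor D r Q = gcell (k - int r) x"
  unfolding ancestor_def
proof (rule the_equality)
  have "Q = gcell k x" using gcell_unique assms by simp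
  then show "\<exists>l. Q \<in> D l \<and> gcell (k - int r) x \<in> D (l - int r) \<and> Q \<subseteq> gcell (k - int r) x"
    using assms gcell_mono[of "k - int r" k x] by (intro exI[of _ k]) simp
next
  fix R assume "\<exists>l. Q \<in> D l \<and> R \<in> D (l - int r) \<and> Q \<subseteq> R"
  then obtain l where "Q \<in> D l" "R \<in> D (l - int r)" "Q \<subseteq> R" by blast
  then have "l = k" "x \<in> R" using generation_unique[of Q l k] assms by auto
  then show "R = gcell (k - int r) x" using gcell_unique[of R "k - int r" x] \<open>R \<in> D (l - int r)\<close> by simp
qed

lemma children_eq: "children D (gcell k x) = gcell (k + 1) ` gcell k x"
proof (intro equalityI subsetI)
  fix R assume "R \<in> children D (gcell k x)"
  then obtain l where l: "gcell k x \<in> D l" "R \<in> D (l + 1)" "R \<subseteq> gcell k x" by (auto simp: children_def)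
  then have "l = k" using generation_unique gcell_in by blast
  moreover obtain y where y: "R = gcell (l + 1) y" using D_nonempty l by blast
  moreover have "y \<in> gcell k x" using l(3) y gcell_self by blast
  ultimately show "R \<in> gcell (k + 1) ` gcell k x" by blast
next
  fix R assume "R \<in> gcell (k + 1) ` gcell k x"
  then obtain y where y: "y \<in> gcell k x" "R = gcell (k + 1) y" by blast
  then have "R \<subseteq> gcell k x" using gcell_Suc[of k y] gcell_eq[OF y(1)] by simp
  then show "R \<in> children D (gcell k x)" unfolding children_def y(2) by (intro CollectI exI[of _ k]) simp
qed

lemma finite_subcells:
  assumes "k \<le> l"
  shows "finite (gcell l ` gcell k x)"
  using assms
proof (induction l rule: int_ge_induct)
  case base
  have "gcell k ` gcell k x \<subseteq> {gcell k x}" using gcell_eq by blast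
  then show ?case by (rule finite_subset) simp
next
  case (step l)
  have "gcell (l + 1) ` gcell k x \<subseteq> (\<Union>R\<in>gcell l ` gcell k x. gcell (l + 1) ` R)"
    using gcell_self by blast
  moreover have "finite (gcell (l + 1) ` gcell l y)" for y
  proof -
    obtain F where F: "F \<subseteq> D (l + 1)" "finite F" "gcell l y = \<Union>F" using D_children[OF gcell_in] by metis
    have "gcell (l + 1) ` gcell l y \<subseteq> F" using F gcell_unique by auto
    then show ?thesis using F finite_subset by blast
  qed
  then have "finite (\<Union>R\<in>gcell l ` gcell k x. gcell (l + 1) ` R)"
    by (intro finite_UN_I step.IH) (elim imageE, simp)
  ultimately show ?case by (rule finite_subset)
qed

lemma sets_gcell: "Q \<in> D k \<Longrightarrow> Q \<in> sets borel"
  using D_cube[of Q k] sets_cube by auto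

lemma bounded_gcell:
  assumes "Q \<in> D k"
  shows "\<exists>C. compact C \<and> Q \<subseteq> C"
proof -
  obtain a where "Q = cube a (2 powi (- k))" using D_cube[OF assms] by blast
  then show ?thesis using cube_bounds(2)[of a "2 powi (- k)"] compact_cbox by blast
qed

text \<open>The children of a cube are its half-sized translates in standard position: on a line
  through a child in a coordinate direction, the parent is cut into half-open intervals of
  half its length, and the first of them starts at the face of the parent.\<close>
lemma child_position:
  assumes Q: "Q \<in> D k" "Q = cube a l" "0 < l" and R: "R \<in> D (k + 1)" "R = cube b (l / 2)" "R \<subseteq> Q"
  shows "b $ i = a $ i \<or> b $ i = a $ i + l / 2"
proof -
  have bQ: "b \<in> Q" using R cube_corner[of "l/2" b] Q by auto
  have up: "b $ i \<le> a $ i + l / 2"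
  proof (rule ccontr)
    assume c: "\<not> b $ i \<le> a $ i + l / 2"
    define z where "z = (\<chi> j. if j = i then a $ i + l else b $ j)"
    have "b $ i < a $ i + l" using bQ Q cube_memD by blast
    then have "z \<in> R" unfolding R(2) using c Q by (intro cube_memI) (auto simp: z_def)
    then have "z \<in> cube a l" using R Q by auto
    then show False using cube_memD[of z a l i] by (simp add: z_def)
  qed
  have lo: "a $ i \<le> b $ i" using bQ Q cube_memD by blast
  show ?thesis
  proof (cases "b $ i < a $ i + l / 2 \<and> a $ i < b $ i")
    case False
    then show ?thesis using up lo by linarith
  next
    case True
    define z where "z = (\<chi> j. if j = i then a $ i else b $ j)"
    have z: "z \<in> Q"
      unfolding Q(2) using bQ Q cube_memD[of b a l] by (intro cube_memI) (auto simp: z_def)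
    obtain b' where b': "gcell (k + 1) z = cube b' (2 powi (- (k + 1)))" using D_cube[OF gcell_in] by blast
    obtain a' where "Q = cube a' (2 powi (- k))" using D_cube[OF Q(1)] by blast
    then have l: "l = 2 powi (- k)" using cube_inject[of a l a' "2 powi (- k)"] Q by simp
    have e: "(2::real) powi (- (k + 1)) = l / 2" unfolding l by (simp add: power_int_diff)
    have b'': "gcell (k + 1) z = cube b' (l / 2)" using b' unfolding e .
    have "gcell (k + 1) z \<subseteq> Q" using gcell_Suc[of k z] gcell_unique[OF Q(1) z] by simp
    then have "b' \<in> cube a l" using cube_corner[of "l/2" b'] b'' Q by auto
    then have "a $ i \<le> b' $ i" using cube_memD by blast
    moreover have zb: "b' $ j \<le> z $ j \<and> z $ j < b' $ j + l / 2" for j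
      using gcell_self[of z "k + 1"] unfolding b'' by (rule cube_memD)
    ultimately have b'i: "b' $ i = a $ i" using zb[of i] by (simp add: z_def)
    have "b \<in> gcell (k + 1) z"
      unfolding b''
    proof (rule cube_memI)
      fix j
      show "b' $ j \<le> b $ j" using zb[of j] True b'i by (cases "j = i") (auto simp: z_def)
      show "b $ j < b' $ j + l / 2" using zb[of j] True b'i by (cases "j = i") (auto simp: z_def)
    qed
    moreover have "b \<in> R" using R cube_corner[of "l/2" b] Q by auto
    ultimately have "R = gcell (k + 1) z"
      using gcell_unique[OF R(1)] gcell_eq by metis
    then have "b = b'" using cube_inject[of b "l/2" b' "l/2"] R b'' Q by auto
    then show ?thesis using b'i by simp
  qed
qed

text \<open>A Haar function is constant on the children of its cube, which by the previous lemma lie on one side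
  of each hyperplane bisecting the cube.\<close>
lemma haar_related_const:
  assumes Q: "Q \<in> D k" and h: "haar_related Q h" and y: "y' \<in> gcell (k + 1) y"
  shows "h y' = h y"
proof (cases "y \<in> Q")
  case False
  have "y' \<in> gcell k y" using gcell_Suc y by blast
  then have "y' \<notin> Q" using False gcell_unique[OF Q] gcell_eq gcell_self by metis
  then show ?thesis using haar_related_outside[OF h] False by simp
next
  case True
  obtain a l \<eta> where al: "l > 0" "Q = cube a l" "h = haar \<eta> a l" using h by (auto simp: haar_related_def)
  obtain a' where "Q = cube a' (2 powi (- k))" using D_cube[OF Q] by blast
  then have l: "l = 2 powi (- k)" using cube_inject[of a l a' "2 powi (- k)"] al by simp
  obtain b where b': "gcell (k + 1) y = cube b (2 powi (- (k + 1)))" using D_cube[OF gcell_in] by blast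
  have e: "(2::real) powi (- (k + 1)) = l / 2" unfolding l by (simp add: power_int_diff)
  have b: "gcell (k + 1) y = cube b (l / 2)" using b' unfolding e .
  have "gcell (k + 1) y \<subseteq> Q" using gcell_Suc[of k y] gcell_unique[OF Q True] by simp
  then have pos: "b $ i = a $ i \<or> b $ i = a $ i + l / 2" for i
    using child_position[OF Q al(2,1) gcell_in b] by blast
  have "haar1 (\<eta> i) (a $ i) l (y' $ i) = haar1 (\<eta> i) (a $ i) l (y $ i)" for i
  proof -
    have "b $ i \<le> y $ i \<and> y $ i < b $ i + l / 2" using gcell_self[of y "k + 1"] unfolding b by (rule cube_memD)
    moreover have "b $ i \<le> y' $ i \<and> y' $ i < b $ i + l / 2" using y unfolding b by (rule cube_memD)
    ultimately show ?thesis using pos[of i] al(1) by (intro haar1_cong) auto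
  qed
  then show ?thesis by (simp add: al haar_def)
qed

end

section \<open>The kernel of a dyadic shift\<close>

context dyadic
begin

definition support :: "'n shift_data \<Rightarrow> 'n point_set set" where
  "support S = {K\<in>cubes D. \<exists>(I, J)\<in>shift_pairs D S K. coef S I J K \<noteq> 0}"

definition kernel_part :: "'n shift_data \<Rightarrow> 'n point_set \<Rightarrow> real ^ 'n \<Rightarrow> real ^ 'n \<Rightarrow> real" where
  "kernel_part S K x y = (\<Sum>(I, J)\<in>shift_pairs D S K. coef S I J K * haar_in S I J x * haar_out S I J y)"

definition kernel :: "'n shift_data \<Rightarrow> real ^ 'n \<Rightarrow> real ^ 'n \<Rightarrow> real" where
  "kernel S x y = (\<Sum>K\<in>support S. kernel_part S K x y)"

text \<open>The shift data of the formal adjoint.\<close>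
definition flip :: "'n shift_data \<Rightarrow> 'n shift_data" where
  "flip S = \<lparr>par_m = par_n S, par_n = par_m S, coef = (\<lambda>I J. coef S J I),
     haar_in = (\<lambda>I J. haar_out S J I), haar_out = (\<lambda>I J. haar_in S J I)\<rparr>"

lemma flip_simps [simp]:
  "par_m (flip S) = par_n S" "par_n (flip S) = par_m S" "coef (flip S) I J K = coef S J I K"
  "haar_in (flip S) I J = haar_out S J I" "haar_out (flip S) I J = haar_in S J I"
  "complexity (flip S) = complexity S"
  by (simp_all add: flip_def complexity_def max.commute)

lemma shift_pairs_flip: "(I, J) \<in> shift_pairs D (flip S) K \<longleftrightarrow> (J, I) \<in> shift_pairs D S K"
  by (auto simp: shift_pairs_def)

lemma sum_shift_pairs_flip:
  "(\<Sum>(I, J)\<in>shift_pairs D (flip S) K. g I J) = (\<Sum>(I, J)\<in>shift_pairs D S K. g J I)"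
  by (rule sum.reindex_bij_witness[of _ "\<lambda>(I,J). (J,I)" "\<lambda>(I,J). (J,I)"])
     (auto simp: shift_pairs_flip)

lemma support_flip: "support (flip S) = support S"
proof -
  have "(\<exists>(I, J)\<in>shift_pairs D (flip S) K. coef S J I K \<noteq> 0) \<longleftrightarrow> (\<exists>(I, J)\<in>shift_pairs D S K. coef S I J K \<noteq> 0)" for K
    using shift_pairs_flip by fastforce
  then show ?thesis by (simp add: support_def)
qed

lemma dyadic_shift_flip:
  assumes "dyadic_shift D S"
  shows "dyadic_shift D (flip S)"
proof -
  have "haar_related I (haar_in (flip S) I J) \<and> haar_related J (haar_out (flip S) I J) \<and>
        \<bar>coef (flip S) I J K\<bar> \<le> sqrt (vol I * vol J) / vol K"
    if "K \<in> cubes D" "(I, J) \<in> shift_pairs D (flip S) K" for I J K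
  proof -
    have "(J, I) \<in> shift_pairs D S K" using that shift_pairs_flip by blast
    then show ?thesis using assms that(1) unfolding dyadic_shift_def by (fastforce simp: mult.commute)
  qed
  moreover have "finite (support (flip S))"
    using assms unfolding support_flip by (simp add: dyadic_shift_def support_def)
  ultimately show ?thesis unfolding dyadic_shift_def support_def by blast
qed

lemma shift_adj_eq: "shift_adj D w S = shift_op D w (flip S)"
  by (intro ext) (simp add: shift_adj_def shift_op_def sum_shift_pairs_flip)

lemma kernel_flip: "kernel (flip S) x y = kernel S y x"
  unfolding kernel_def support_flip kernel_part_def sum_shift_pairs_flip
  by (simp add: mult_ac)

lemma shift_pairs_generation:
  assumes K: "K \<in> D k" and IJ: "(I, J) \<in> shift_pairs D S K"
  shows "I \<in> D (k + int (par_m S))" "J \<in> D (k + int (par_n S))" "I \<subseteq> K" "J \<subseteq> K"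
proof -
  have gen: "L \<in> D (k + int r) \<and> L \<subseteq> K" if "L \<in> cubes D" "ancestor D r L = K" for L r
  proof -
    obtain l where l: "L \<in> D l" using \<open>L \<in> cubes D\<close> by (auto simp: cubes_def)
    obtain x where x: "L = gcell l x" using D_nonempty l by blast
    then have "K = gcell (l - int r) x" using ancestor_eq[OF l, of x r] that(2) by simp
    then have "l - int r = k" using generation_unique[OF gcell_in, of "l - int r" x k] K by simp
    then have "l = k + int r" by simp
    moreover have "L \<subseteq> K" using x \<open>K = gcell (l - int r) x\<close> gcell_mono[of "l - int r" l x] by simp
    ultimately show ?thesis using l by simp
  qed
  show "I \<in> D (k + int (par_m S))" "J \<in> D (k + int (par_n S))" "I \<subseteq> K" "J \<subseteq> K"
    using gen[of I "par_m S"] gen[of J "par_n S"] IJ by (auto simp: shift_pairs_def)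
qed

lemma shift_op_eq_sum:
  assumes S: "dyadic_shift D S"
  shows "shift_op D \<sigma> S f y = (\<Sum>K\<in>support S. \<Sum>(I, J)\<in>shift_pairs D S K.
        coef S I J K * pairing \<sigma> f (haar_in S I J) * haar_out S I J y)"
proof -
  have fin: "finite (support S)" using S by (simp add: dyadic_shift_def support_def)
  have "(\<Sum>(I, J)\<in>shift_pairs D S K. coef S I J K * pairing \<sigma> f (haar_in S I J) * haar_out S I J y) = 0"
    if "K \<in> cubes D - support S" for K
    using that by (intro sum.neutral) (auto simp: support_def)
  moreover have "support S \<subseteq> cubes D" by (auto simp: support_def)
  ultimately have "shift_op D \<sigma> S f y = (\<Sum>\<^sub>\<infinity>K\<in>support S. \<Sum>(I, J)\<in>shift_pairs D S K.
        coef S I J K * pairing \<sigma> f (haar_in S I J) * haar_out S I J y)"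
    unfolding shift_op_def by (intro infsum_cong_neutral) auto
  then show ?thesis using fin by simp
qed

context
  fixes S k K
  assumes S: "dyadic_shift D S" and K: "K \<in> D k"
begin

lemma K_cube: "K \<in> cubes D"
  using K by (auto simp: cubes_def)

lemma shift_haar:
  assumes "(I, J) \<in> shift_pairs D S K"
  shows "haar_related I (haar_in S I J)" "haar_related J (haar_out S I J)"
    "\<bar>coef S I J K\<bar> \<le> sqrt (vol I * vol J) / vol K"
  using S K_cube assms by (auto simp: dyadic_shift_def)

lemma kernel_part_const_right:
  assumes "y' \<in> gcell (k + int (par_n S) + 1) y"
  shows "kernel_part S K x y' = kernel_part S K x y"
  unfolding kernel_part_def
proof (rule sum.cong[OF refl], clarify)
  fix I J assume IJ: "(I, J) \<in> shift_pairs D S K"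
  have "haar_out S I J y' = haar_out S I J y"
    by (rule haar_related_const[OF shift_pairs_generation(2)[OF K IJ] shift_haar(2)[OF IJ] assms])
  then show "coef S I J K * haar_in S I J x * haar_out S I J y' = coef S I J K * haar_in S I J x * haar_out S I J y"
    by simp
qed

lemma kernel_part_outside:
  assumes "x \<notin> K \<or> y \<notin> K"
  shows "kernel_part S K x y = 0"
  unfolding kernel_part_def
proof (rule sum.neutral, clarify)
  fix I J assume IJ: "(I, J) \<in> shift_pairs D S K"
  have "haar_in S I J x = 0 \<or> haar_out S I J y = 0"
    using haar_related_outside[OF shift_haar(1)[OF IJ], of x] haar_related_outside[OF shift_haar(2)[OF IJ], of y]
      shift_pairs_generation(3,4)[OF K IJ] assms by blast
  then show "coef S I J K * haar_in S I J x * haar_out S I J y = 0" by auto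
qed

text \<open>At a given point only the pair of the cubes containing its two coordinates contributes.\<close>
lemma abs_kernel_part_le: "\<bar>kernel_part S K x y\<bar> \<le> 1 / vol K"
proof -
  define g where "g = (\<lambda>(I, J). coef S I J K * haar_in S I J x * haar_out S I J y)"
  define e where "e = (gcell (k + int (par_m S)) x, gcell (k + int (par_n S)) y)"
  have volK: "0 < vol K" using vol_gcell[OF K] by simp
  have nz: "IJ = e" if "IJ \<in> shift_pairs D S K" "g IJ \<noteq> 0" for IJ
  proof -
    obtain I J where IJ: "IJ = (I, J)" by (cases IJ)
    have "x \<in> I" "y \<in> J"
      using that haar_related_outside[OF shift_haar(1)] haar_related_outside[OF shift_haar(2)]
      unfolding IJ g_def by fastforce+
    then show ?thesis
      using shift_pairs_generation(1,2)[OF K, of I J S] that(1) gcell_unique unfolding IJ e_def by auto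
  qed
  have bound: "\<bar>g IJ\<bar> \<le> 1 / vol K" if IJ': "IJ \<in> shift_pairs D S K" for IJ
  proof -
    obtain I J where IJe: "IJ = (I, J)" by (cases IJ)
    note IJ = IJ'[unfolded IJe]
    have vI: "0 < vol I" "0 < vol J"
      using vol_gcell shift_pairs_generation(1,2)[OF K IJ] by auto
    have "\<bar>g IJ\<bar> = \<bar>coef S I J K\<bar> * (\<bar>haar_in S I J x\<bar> * \<bar>haar_out S I J y\<bar>)"
      by (simp add: g_def IJe abs_mult)
    also have "\<dots> \<le> (sqrt (vol I * vol J) / vol K) * ((1 / sqrt (vol I)) * (1 / sqrt (vol J)))"
      using shift_haar(3)[OF IJ] abs_haar_related_le[OF shift_haar(1)[OF IJ]] abs_haar_related_le[OF shift_haar(2)[OF IJ]] volK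
      by (intro mult_mono) auto
    also have "\<dots> = 1 / vol K" using vI by (simp add: real_sqrt_mult)
    finally show ?thesis .
  qed
  have "kernel_part S K x y = sum g (shift_pairs D S K)"
    by (simp add: kernel_part_def g_def)
  also have "\<bar>\<dots>\<bar> \<le> 1 / vol K"
  proof (cases "finite (shift_pairs D S K) \<and> e \<in> shift_pairs D S K")
    case True
    then have "sum g (shift_pairs D S K) = sum g {e}"
      using nz by (intro sum.mono_neutral_right) auto
    then show ?thesis using bound True by simp
  next
    case False
    have "sum g (shift_pairs D S K) = 0"
      using False nz by (cases "finite (shift_pairs D S K)") (auto intro!: sum.neutral)
    then show ?thesis using volK by simp
  qed
  finally show ?thesis .
qed

end

lemma sum_inverse_volumes:
  assumes "k1 \<le> g"
  shows "(\<Sum>k\<in>{k1..g}. 1 / vol (gcell k x)) \<le> 2 / vol (gcell g x)"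
proof -
  have v: "1 / vol (gcell k x) = (2 powi k) ^ CARD('n)" for k
    by (simp add: vol_gcell[OF gcell_in] power_int_minus power_divide inverse_eq_divide)
  have "(\<Sum>k\<in>{k1..g}. ((2::real) powi k) ^ CARD('n)) \<le> 2 * (2 powi g) ^ CARD('n)"
    using assms
  proof (induction g rule: int_ge_induct)
    case base then show ?case by simp
  next
    case (step g)
    have N: "CARD('n) \<ge> 1" by (simp add: Suc_le_eq)
    have "{k1..g + 1} = insert (g + 1) {k1..g}" using step.hyps by auto
    then have "(\<Sum>k\<in>{k1..g + 1}. ((2::real) powi k) ^ CARD('n)) = (2 powi (g + 1)) ^ CARD('n) + (\<Sum>k\<in>{k1..g}. (2 powi k) ^ CARD('n))"
      by simp
    also have "\<dots> \<le> (2 powi (g + 1)) ^ CARD('n) + 2 * (2 powi g) ^ CARD('n)" using step.IH by simp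
    also have "2 * ((2::real) powi g) ^ CARD('n) \<le> 2 ^ CARD('n) * (2 powi g) ^ CARD('n)"
      using power_increasing[OF N, of "2::real"] by (intro mult_right_mono) auto
    also have "\<dots> = (2 powi (g + 1)) ^ CARD('n)" by (simp add: power_int_add power_mult_distrib mult.commute)
    finally show ?case by simp
  qed
  then show ?thesis using v by (simp add: divide_inverse[of 2] inverse_eq_divide)
qed

text \<open>Only cubes containing both points contribute. They are ancestors of the last common one, and their
  reciprocal volumes form a geometric series.\<close>
lemma abs_kernel_le:
  assumes S: "dyadic_shift D S" and k1: "\<And>K. K \<in> support S \<Longrightarrow> \<exists>k\<ge>k1. K \<in> D k"
    and g: "k1 \<le> g" and y: "y \<notin> gcell (g + 1) x"
  shows "\<bar>kernel S x y\<bar> \<le> 2 / vol (gcell g x)"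
proof -
  have fin: "finite (support S)" using S by (simp add: dyadic_shift_def support_def)
  define C where "C = {K \<in> support S. x \<in> K \<and> y \<in> K}"
  have sub: "C \<subseteq> (\<lambda>k. gcell k x) ` {k1..g}"
  proof
    fix K assume K: "K \<in> C"
    then obtain k where k: "k1 \<le> k" "K \<in> D k" using k1 by (auto simp: C_def)
    then have Kx: "K = gcell k x" using K gcell_unique by (auto simp: C_def)
    have "k \<le> g"
    proof (rule ccontr)
      assume "\<not> k \<le> g"
      then have "gcell k x \<subseteq> gcell (g + 1) x" by (intro gcell_mono) auto
      then show False using y K Kx by (auto simp: C_def)
    qed
    then show "K \<in> (\<lambda>k. gcell k x) ` {k1..g}" using k Kx by auto
  qed
  have "\<bar>kernel S x y\<bar> \<le> (\<Sum>K\<in>support S. \<bar>kernel_part S K x y\<bar>)"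
    unfolding kernel_def by (rule sum_abs)
  also have "\<dots> = (\<Sum>K\<in>C. \<bar>kernel_part S K x y\<bar>)"
  proof (rule sum.mono_neutral_right[OF fin])
    show "\<forall>K\<in>support S - C. \<bar>kernel_part S K x y\<bar> = 0"
      using k1 kernel_part_outside[OF S] by (fastforce simp: C_def)
  qed (auto simp: C_def)
  also have "\<dots> \<le> (\<Sum>K\<in>C. 1 / vol K)"
  proof (rule sum_mono)
    fix K assume "K \<in> C"
    then obtain k where "K \<in> D k" using k1 by (auto simp: C_def)
    then show "\<bar>kernel_part S K x y\<bar> \<le> 1 / vol K" by (rule abs_kernel_part_le[OF S])
  qed
  also have "\<dots> \<le> (\<Sum>K\<in>(\<lambda>k. gcell k x) ` {k1..g}. 1 / vol K)"
    using sub by (intro sum_mono2) auto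
  also have "\<dots> = (\<Sum>k\<in>{k1..g}. 1 / vol (gcell k x))"
  proof (subst sum.reindex)
    show "inj_on (\<lambda>k. gcell k x) {k1..g}"
      by (rule inj_onI) (metis gcell_in generation_unique)
  qed simp
  also have "\<dots> \<le> 2 / vol (gcell g x)" by (rule sum_inverse_volumes[OF g])
  finally show ?thesis .
qed

text \<open>Summands of cubes of generation \<open>\<ge> g\<close> vanish, as such a cube cannot contain both points. Those of larger
  cubes have Haar functions that are constant \<open>\<kappa> + 1\<close> generations below the cube.\<close>
lemma kernel_const_right:
  assumes S: "dyadic_shift D S" "complexity S \<le> \<kappa>" and K: "support S \<subseteq> cubes D"
    and y: "y' \<in> gcell (g + int \<kappa>) y" and x: "x \<notin> gcell g y"
  shows "kernel S x y' = kernel S x y"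
  unfolding kernel_def
proof (rule sum.cong[OF refl])
  fix K assume "K \<in> support S"
  then obtain k where k: "K \<in> D k" using K by (auto simp: cubes_def)
  have y'g: "y' \<in> gcell g y" using y gcell_mono[of g "g + int \<kappa>" y] by auto
  show "kernel_part S K x y' = kernel_part S K x y"
  proof (cases "k < g")
    case True
    then have "gcell (g + int \<kappa>) y \<subseteq> gcell (k + int (par_n S) + 1) y"
      using S(2) by (intro gcell_mono) (auto simp: complexity_def)
    then show ?thesis using y by (intro kernel_part_const_right[OF S(1) k]) auto
  next
    case False
    have out: "\<not> (x \<in> K \<and> z \<in> K)" if "gcell g z = gcell g y" for z
    proof
      assume "x \<in> K \<and> z \<in> K"
      then have "x \<in> gcell k z" using gcell_unique[OF k] by metis
      then have "x \<in> gcell g z" using gcell_mono[of g k z] False by auto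
      then show False using x that by simp
    qed
    show ?thesis
      using kernel_part_outside[OF S(1) k] out[of y] out[of y'] gcell_eq[OF y'g] by metis
  qed
qed

lemma kernel_const_left:
  assumes S: "dyadic_shift D S" "complexity S \<le> \<kappa>" and K: "support S \<subseteq> cubes D"
    and x: "x' \<in> gcell (g + int \<kappa>) x" and y: "y \<notin> gcell g x"
  shows "kernel S x' y = kernel S x y"
  using kernel_const_right[of "flip S" \<kappa> x' g x y] S K x y dyadic_shift_flip
  by (simp add: kernel_flip support_flip)

end

section \<open>Discretization of a measure\<close>

lemma epowr_ennreal: "0 \<le> a \<Longrightarrow> epowr (ennreal a) r = ennreal (a powr r)"
  by (simp add: epowr_def)

lemma (in dyadic) emeasure_gcell_finite:
  assumes "radon_measure \<mu>" "Q \<in> D k"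
  shows "emeasure \<mu> Q < \<infinity>"
proof -
  obtain C where C: "compact C" "Q \<subseteq> C" using bounded_gcell[OF assms(2)] by blast
  have "emeasure \<mu> Q \<le> emeasure \<mu> C"
    using C assms(1) by (intro emeasure_mono) (auto simp: radon_measure_def compact_imp_closed)
  also have "\<dots> < \<infinity>" using C assms(1) by (simp add: radon_measure_def)
  finally show ?thesis .
qed

text \<open>Finitely many top cubes of generation \<open>k1\<close> and their descendants of the next \<open>n\<close> generations. The
  smallest of these cubes, the atoms, are represented by points \<open>X\<close>, on which the descendants
  induce a tree of cells.\<close>
locale discretization = dyadic D for D :: "'n::finite lattice" +
  fixes k1 :: int and n :: nat and Tops :: "'n point_set set"
  assumes Tops: "Tops \<subseteq> D k1" and finite_Tops: "finite Tops"
begin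

abbreviation "atom \<equiv> gcell (k1 + int n)"

definition rep :: "'n point_set \<Rightarrow> real ^ 'n" where
  "rep Q = (SOME x. x \<in> Q)"

definition X :: "(real ^ 'n) set" where
  "X = rep ` (\<Union>T\<in>Tops. atom ` T)"

definition cell :: "nat \<Rightarrow> real ^ 'n \<Rightarrow> (real ^ 'n) set" where
  "cell k x = X \<inter> gcell (k1 + int k) x"

lemma rep_in: "rep (gcell k x) \<in> gcell k x"
  unfolding rep_def by (rule someI[of _ x]) simp

lemma Top_gcell: "T \<in> Tops \<Longrightarrow> x \<in> T \<Longrightarrow> T = gcell k1 x"
  using Tops gcell_unique[of T k1 x] by auto

lemma atom_subset_Top: "T \<in> Tops \<Longrightarrow> x \<in> T \<Longrightarrow> atom x \<subseteq> T"
  using gcell_mono[of k1 "k1 + int n" x] Top_gcell by auto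

lemma finite_X: "finite X"
proof -
  have "finite (atom ` T)" if T: "T \<in> Tops" for T
  proof -
    obtain x where "T = gcell k1 x" using D_nonempty[of T k1] T Tops by blast
    then show ?thesis using finite_subcells[of k1 "k1 + int n" x] by simp
  qed
  then show ?thesis using finite_Tops by (simp add: X_def)
qed

lemma X_in_Top: "x \<in> X \<Longrightarrow> \<exists>T\<in>Tops. x \<in> T"
proof -
  assume "x \<in> X"
  then obtain T z where T: "T \<in> Tops" "z \<in> T" "x = rep (atom z)" by (auto simp: X_def)
  then have "x \<in> atom z" using rep_in by simp
  then show ?thesis using atom_subset_Top[OF T(1,2)] T(1) by blast
qed

lemma rep_atom: "x \<in> X \<Longrightarrow> rep (atom x) = x"
proof -
  assume "x \<in> X"
  then obtain T z where T: "T \<in> Tops" "z \<in> T" "x = rep (atom z)" by (auto simp: X_def)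
  then have "atom x = atom z" using gcell_eq rep_in by simp
  then show ?thesis using T by simp
qed

lemma atom_inj:
  assumes "x \<in> X" "y \<in> X" "y \<in> atom x"
  shows "y = x"
  using gcell_eq[OF assms(3)] rep_atom[OF assms(1)] rep_atom[OF assms(2)] by simp

lemma rep_in_X: "T \<in> Tops \<Longrightarrow> z \<in> T \<Longrightarrow> rep (atom z) \<in> X"
  unfolding X_def by (intro imageI UN_I)

lemma atom_rep: "atom (rep (atom z)) = atom z"
  by (rule gcell_eq[OF rep_in])

sublocale tree: cell_tree X cell n
proof unfold_locales
  show "finite X" by (rule finite_X)
  show "cell k x \<subseteq> X" if "x \<in> X" for k x by (simp add: cell_def)
  show "x \<in> cell k x" if "x \<in> X" for k x using that by (simp add: cell_def)
  show "cell k y = cell k x" if "x \<in> X" "y \<in> cell k x" for k x y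
    using that gcell_eq[of y "k1 + int k" x] by (simp add: cell_def)
  show "cell (Suc k) x \<subseteq> cell k x" if "x \<in> X" for k x
    using gcell_mono[of "k1 + int k" "k1 + int (Suc k)" x] by (auto simp: cell_def)
  show "cell n x = {x}" if "x \<in> X" for x
    using that atom_inj by (auto simp: cell_def)
qed

text \<open>The functions of the form \<open>\<Sum>x\<in>X. c x * indicator (atom x) z\<close>.\<close>
definition atomic :: "(real ^ 'n \<Rightarrow> 'b::zero) \<Rightarrow> bool" where
  "atomic F \<longleftrightarrow> (\<forall>x. \<forall>z\<in>atom x. F z = F x) \<and> (\<forall>z. z \<notin> \<Union>Tops \<longrightarrow> F z = 0)"

lemma atomicI: "(\<And>x z. z \<in> atom x \<Longrightarrow> F z = F x) \<Longrightarrow> (\<And>z. z \<notin> \<Union>Tops \<Longrightarrow> F z = 0) \<Longrightarrow> atomic F"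
  by (auto simp: atomic_def)

lemma atomic_expand:
  fixes F :: "real ^ 'n \<Rightarrow> 'b::semiring_1"
  assumes "atomic F"
  shows "F z = (\<Sum>x\<in>X. F x * indicator (atom x) z)"
proof (cases "z \<in> \<Union>Tops")
  case False
  have "z \<notin> atom x" if x: "x \<in> X" for x
  proof -
    obtain T where "T \<in> Tops" "x \<in> T" using X_in_Top[OF x] by blast
    then show ?thesis using atom_subset_Top False by blast
  qed
  then show ?thesis using False assms by (simp add: atomic_def)
next
  case True
  then obtain T where T: "T \<in> Tops" "z \<in> T" by blast
  define x0 where "x0 = rep (atom z)"
  have x0: "x0 \<in> X" unfolding x0_def by (rule rep_in_X[OF T])
  have z: "z \<in> atom x0" unfolding x0_def atom_rep by simp
  have "indicator (atom x) z = (if x = x0 then 1 else 0 :: 'b)" if "x \<in> X" for x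
  proof (cases "z \<in> atom x")
    case True
    then have "atom x = atom x0" using gcell_eq[OF z] gcell_eq[of z "k1 + int n" x] by simp
    then have "x = x0" using rep_atom[OF that] rep_atom[OF x0] by metis
    then show ?thesis using True by simp
  qed (use z in auto)
  then have "(\<Sum>x\<in>X. F x * indicator (atom x) z) = (\<Sum>x\<in>X. if x = x0 then F x else 0)"
    by (intro sum.cong refl) auto
  also have "\<dots> = F x0" using x0 finite_X by simp
  also have "\<dots> = F z" using assms z by (simp add: atomic_def)
  finally show ?thesis by simp
qed

lemma atomic_comp: "atomic F \<Longrightarrow> g 0 = 0 \<Longrightarrow> atomic (\<lambda>z. g (F z))"
  by (simp add: atomic_def)

definition weight :: "(real ^ 'n) measure \<Rightarrow> real ^ 'n \<Rightarrow> real" where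
  "weight \<mu> x = measure \<mu> (atom x)"

lemma weight_nonneg: "\<forall>x\<in>X. 0 \<le> weight \<mu> x"
  by (simp add: weight_def)

definition local_mean :: "(real ^ 'n) measure \<Rightarrow> (real ^ 'n \<Rightarrow> real) \<Rightarrow> real ^ 'n \<Rightarrow> real" where
  "local_mean \<mu> f x = (LINT z|\<mu>. f z * indicator (atom x) z) / weight \<mu> x"

context
  fixes \<mu> :: "(real ^ 'n) measure"
  assumes \<mu>: "radon_measure \<mu>"
begin

lemma sets_\<mu>: "sets \<mu> = sets borel"
  using \<mu> by (simp add: radon_measure_def)

lemma atom_sets [measurable]: "gcell k x \<in> sets \<mu>"
  using sets_gcell[OF gcell_in] by (simp add: sets_\<mu>)

lemma emeasure_atom: "emeasure \<mu> (atom x) = ennreal (weight \<mu> x)"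
  using emeasure_gcell_finite[OF \<mu> gcell_in, of "k1 + int n" x]
  unfolding weight_def by (intro emeasure_eq_ennreal_measure) simp

lemma nn_integral_atomic:
  fixes F :: "real ^ 'n \<Rightarrow> ennreal"
  assumes "atomic F"
  shows "(\<integral>\<^sup>+z. F z \<partial>\<mu>) = (\<Sum>x\<in>X. F x * ennreal (weight \<mu> x))"
proof -
  have "(\<integral>\<^sup>+z. F z \<partial>\<mu>) = (\<integral>\<^sup>+z. (\<Sum>x\<in>X. F x * indicator (atom x) z) \<partial>\<mu>)"
    by (intro nn_integral_cong atomic_expand[OF assms])
  also have "\<dots> = (\<Sum>x\<in>X. \<integral>\<^sup>+z. F x * indicator (atom x) z \<partial>\<mu>)"
    by (intro nn_integral_sum) auto
  also have "\<dots> = (\<Sum>x\<in>X. F x * ennreal (weight \<mu> x))"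
    by (simp add: nn_integral_cmult_indicator emeasure_atom)
  finally show ?thesis .
qed

lemma Lp_norm_atomic:
  assumes F: "atomic F" and p: "0 < p"
  shows "Lp_norm p \<mu> F = ennreal (wnorm X p (weight \<mu>) F)"
proof -
  have "(\<integral>\<^sup>+z. epowr (ennreal \<bar>F z\<bar>) p \<partial>\<mu>) = (\<integral>\<^sup>+z. ennreal (\<bar>F z\<bar> powr p) \<partial>\<mu>)"
    by (simp add: epowr_ennreal)
  also have "\<dots> = (\<Sum>x\<in>X. ennreal (\<bar>F x\<bar> powr p) * ennreal (weight \<mu> x))"
    by (intro nn_integral_atomic atomic_comp[OF F, of "\<lambda>a. ennreal (\<bar>a\<bar> powr p)"]) simp
  also have "\<dots> = ennreal (\<Sum>x\<in>X. weight \<mu> x * \<bar>F x\<bar> powr p)"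
    using weight_nonneg by (simp add: ennreal_mult[symmetric] mult.commute)
  finally have "(\<integral>\<^sup>+z. epowr (ennreal \<bar>F z\<bar>) p \<partial>\<mu>) = ennreal (\<Sum>x\<in>X. weight \<mu> x * \<bar>F x\<bar> powr p)" .
  moreover have "0 \<le> (\<Sum>x\<in>X. weight \<mu> x * \<bar>F x\<bar> powr p)" using weight_nonneg by (intro sum_nonneg) auto
  ultimately show ?thesis by (simp add: Lp_norm_def eLp_norm_def epowr_ennreal wnorm_def)
qed

lemma atomic_measurable:
  fixes F :: "real ^ 'n \<Rightarrow> real"
  assumes "atomic F"
  shows "F \<in> borel_measurable \<mu>"
proof -
  have "F = (\<lambda>z. \<Sum>x\<in>X. F x * indicator (atom x) z)" by (rule ext) (rule atomic_expand[OF assms])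
  moreover have "(\<lambda>z. \<Sum>x\<in>X. F x * indicator (atom x) z) \<in> borel_measurable \<mu>" by measurable
  ultimately show ?thesis by simp
qed

lemma atomic_Lp_space:
  assumes "atomic F" "0 < p"
  shows "F \<in> Lp_space p \<mu>"
  using assms by (simp add: Lp_space_def atomic_measurable Lp_norm_atomic)

lemma Lp_space_nn_integral:
  assumes f: "f \<in> Lp_space p \<mu>" and p: "0 < p"
  shows "(\<integral>\<^sup>+z. ennreal (\<bar>f z\<bar> powr p) \<partial>\<mu>) < \<infinity>"
    and "Lp_norm p \<mu> f = ennreal (enn2real (\<integral>\<^sup>+z. ennreal (\<bar>f z\<bar> powr p) \<partial>\<mu>) powr (1/p))"
proof -
  have e: "Lp_norm p \<mu> f = epowr (\<integral>\<^sup>+z. ennreal (\<bar>f z\<bar> powr p) \<partial>\<mu>) (1/p)"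
    by (simp add: Lp_norm_def eLp_norm_def epowr_ennreal)
  show 1: "(\<integral>\<^sup>+z. ennreal (\<bar>f z\<bar> powr p) \<partial>\<mu>) < \<infinity>"
  proof -
    have "Lp_norm p \<mu> f < \<infinity>" using f by (simp add: Lp_space_def)
    then show ?thesis unfolding e by (auto simp: epowr_def less_top[symmetric] split: if_splits)
  qed
  show "Lp_norm p \<mu> f = ennreal (enn2real (\<integral>\<^sup>+z. ennreal (\<bar>f z\<bar> powr p) \<partial>\<mu>) powr (1/p))"
    using 1 unfolding e by (auto simp: epowr_def)
qed

lemma Lp_space_powr_integrable:
  assumes f: "f \<in> Lp_space p \<mu>" and p: "0 < p"
  shows "integrable \<mu> (\<lambda>z. \<bar>f z\<bar> powr p)"
proof (rule integrableI_bounded)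
  show "(\<lambda>z. \<bar>f z\<bar> powr p) \<in> borel_measurable \<mu>" using f by (auto simp: Lp_space_def)
  show "(\<integral>\<^sup>+z. ennreal (norm (\<bar>f z\<bar> powr p)) \<partial>\<mu>) < \<infinity>"
    using Lp_space_nn_integral(1)[OF f p] by simp
qed

lemma indicator_atom_integrable [simp]: "integrable \<mu> (\<lambda>z. indicator (atom x) z :: real)"
  by (intro integrable_real_indicator atom_sets) (simp add: emeasure_atom)

lemma le_one_plus_powr: "1 \<le> p \<Longrightarrow> 0 \<le> t \<Longrightarrow> t \<le> 1 + t powr p" for t p :: real
proof (cases "t \<le> 1")
  case False
  assume "1 \<le> p"
  then have "t powr 1 \<le> t powr p" using False by (intro powr_mono) auto
  then show ?thesis using False powr_ge_zero[of t p] by simp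
next
  case True
  then show ?thesis using powr_ge_zero[of t p] by linarith
qed

lemma Lp_space_atom_integrable:
  assumes f: "f \<in> Lp_space p \<mu>" and p: "1 \<le> p"
  shows "integrable \<mu> (\<lambda>z. f z * indicator (atom x) z)"
proof (rule Bochner_Integration.integrable_bound)
  have p0: "0 < p" using p by simp
  show "integrable \<mu> (\<lambda>z. indicator (atom x) z + \<bar>f z\<bar> powr p)"
    using Lp_space_powr_integrable[OF f p0] by (intro Bochner_Integration.integrable_add) auto
  have [measurable]: "f \<in> borel_measurable \<mu>" using f by (simp add: Lp_space_def)
  show "(\<lambda>z. f z * indicator (atom x) z) \<in> borel_measurable \<mu>" by measurable
  show "AE z in \<mu>. norm (f z * indicator (atom x) z) \<le> norm (indicator (atom x) z + \<bar>f z\<bar> powr p)"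
  proof (rule AE_I2)
    fix z
    show "norm (f z * indicator (atom x) z) \<le> norm (indicator (atom x) z + \<bar>f z\<bar> powr p)"
      using le_one_plus_powr[OF p, of "\<bar>f z\<bar>"] by (auto simp: indicator_def)
  qed
qed

lemma pairing_atomic:
  assumes f: "f \<in> Lp_space p \<mu>" and p: "1 \<le> p" and h: "atomic h"
  shows "pairing \<mu> f h = (\<Sum>x\<in>X. weight \<mu> x * local_mean \<mu> f x * h x)"
proof -
  have "pairing \<mu> f h = (LINT z|\<mu>. (\<Sum>x\<in>X. h x * (f z * indicator (atom x) z)))"
    unfolding pairing_def
  proof (rule Bochner_Integration.integral_cong[OF refl])
    fix z
    show "f z * h z = (\<Sum>x\<in>X. h x * (f z * indicator (atom x) z))"
      unfolding atomic_expand[OF h, of z] sum_distrib_left by (intro sum.cong refl) (simp only: mult_ac)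
  qed
  also have "\<dots> = (\<Sum>x\<in>X. h x * (LINT z|\<mu>. f z * indicator (atom x) z))"
    using Lp_space_atom_integrable[OF f p] by simp
  also have "\<dots> = (\<Sum>x\<in>X. weight \<mu> x * local_mean \<mu> f x * h x)"
  proof (rule sum.cong[OF refl])
    fix x
    show "h x * (LINT z|\<mu>. f z * indicator (atom x) z) = weight \<mu> x * local_mean \<mu> f x * h x"
    proof (cases "weight \<mu> x = 0")
      case True
      then have "emeasure \<mu> (atom x) = 0" by (simp add: emeasure_atom)
      then have "AE z in \<mu>. z \<notin> atom x" by (intro AE_not_in) (auto simp: null_sets_def atom_sets)
      then have "AE z in \<mu>. f z * indicator (atom x) z = 0" by eventually_elim simp
      then have "(LINT z|\<mu>. f z * indicator (atom x) z) = 0" by (rule integral_eq_zero_AE)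
      then show ?thesis using True by simp
    qed (simp add: local_mean_def)
  qed
  finally show ?thesis .
qed

lemma local_mean_atomic:
  assumes F: "atomic F" and x: "x \<in> X" "weight \<mu> x \<noteq> 0"
  shows "local_mean \<mu> F x = F x"
proof -
  have "(LINT z|\<mu>. F z * indicator (atom x) z) = (LINT z|\<mu>. F x * indicator (atom x) z)"
    using F by (intro Bochner_Integration.integral_cong) (auto simp: atomic_def indicator_def)
  also have "\<dots> = F x * weight \<mu> x"
    using sets.sets_into_space[OF atom_sets] by (simp add: weight_def Int_absorb2)
  finally show ?thesis using x by (simp add: local_mean_def)
qed

lemma local_mean_sum:
  assumes f: "\<And>u. u \<in> Us \<Longrightarrow> f u \<in> Lp_space p \<mu>" and p: "1 \<le> p"
  shows "local_mean \<mu> (\<lambda>z. \<Sum>u\<in>Us. e u * f u z) x = (\<Sum>u\<in>Us. e u * local_mean \<mu> (f u) x)"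
proof -
  have "(LINT z|\<mu>. (\<Sum>u\<in>Us. e u * f u z) * indicator (atom x) z)
    = (LINT z|\<mu>. (\<Sum>u\<in>Us. e u * (f u z * indicator (atom x) z)))"
    by (simp add: sum_distrib_right mult_ac)
  also have "\<dots> = (\<Sum>u\<in>Us. e u * (LINT z|\<mu>. f u z * indicator (atom x) z))"
    using Lp_space_atom_integrable[OF f p] by (subst Bochner_Integration.integral_sum) auto
  finally show ?thesis by (simp add: local_mean_def sum_divide_distrib)
qed

lemma powr_tangent_convex:
  fixes t c p :: real
  assumes p: "1 < p" and c: "0 \<le> c" and t: "0 \<le> t"
  shows "c powr p + p * c powr (p - 1) * (t - c) \<le> t powr p"
proof -
  have "c powr (p - 1) * t \<le> (c powr (p - 1)) powr (conj_exp p) / conj_exp p + t powr p / p"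
    using p c t conj_exp_gt_1[OF p] conj_exp_inverse[OF p] by (intro Youngs_inequality) auto
  also have "(c powr (p - 1)) powr (conj_exp p) = c powr p" using conj_exp_mult[OF p] by (simp add: powr_powr)
  finally have "p * (c powr (p - 1) * t) \<le> p * (c powr p / conj_exp p + t powr p / p)"
    using p by (intro mult_left_mono) auto
  also have "\<dots> = (p - 1) * c powr p + t powr p" using p by (simp add: conj_exp_def field_simps)
  finally have "p * (c powr (p - 1) * t) \<le> (p - 1) * c powr p + t powr p" .
  moreover have "c powr (p - 1) * c = c powr p" using c by (cases "c = 0") (auto simp: powr_mult_base mult.commute)
  ultimately show ?thesis by (simp add: algebra_simps)
qed

text \<open>Jensen's inequality on each atom.\<close>
lemma wnorm_local_mean_le:
  assumes f: "f \<in> Lp_space p \<mu>" and p: "1 < p"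
  shows "ennreal (wnorm X p (weight \<mu>) (local_mean \<mu> f)) \<le> Lp_norm p \<mu> f"
proof -
  have p0: "0 < p" "1 \<le> p" using p by auto
  have int: "integrable \<mu> (\<lambda>z. f z * indicator (atom x) z)" for x
    by (rule Lp_space_atom_integrable[OF f p0(2)])
  have intp: "integrable \<mu> (\<lambda>z. \<bar>f z\<bar> powr p)" by (rule Lp_space_powr_integrable[OF f p0(1)])
  have intpa: "integrable \<mu> (\<lambda>z. \<bar>f z\<bar> powr p * indicator (atom x) z)" for x
    by (rule integrable_real_mult_indicator[OF atom_sets intp])
  have cell: "weight \<mu> x * \<bar>local_mean \<mu> f x\<bar> powr p \<le> (LINT z|\<mu>. \<bar>f z\<bar> powr p * indicator (atom x) z)" for x
  proof (cases "weight \<mu> x = 0")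
    case False
    then have wx: "weight \<mu> x > 0" by (simp add: weight_def order_less_le)
    define c where "c = \<bar>local_mean \<mu> f x\<bar>"
    have "\<bar>LINT z|\<mu>. f z * indicator (atom x) z\<bar> \<le> (LINT z|\<mu>. \<bar>f z * indicator (atom x) z\<bar>)"
      by (rule integral_abs_bound)
    then have cw: "c * weight \<mu> x \<le> (LINT z|\<mu>. \<bar>f z * indicator (atom x) z\<bar>)"
      using wx by (simp add: c_def local_mean_def abs_divide)
    have lin: "integrable \<mu> (\<lambda>z. (c powr p - p * c powr (p - 1) * c) * indicator (atom x) z + p * c powr (p - 1) * \<bar>f z * indicator (atom x) z\<bar>)"
      using int by (intro Bochner_Integration.integrable_add integrable_mult_right) auto
    have "weight \<mu> x * c powr p \<le> (c powr p - p * c powr (p - 1) * c) * weight \<mu> x + p * c powr (p - 1) * (c * weight \<mu> x)"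
      by (simp add: algebra_simps)
    also have "\<dots> \<le> (c powr p - p * c powr (p - 1) * c) * weight \<mu> x + p * c powr (p - 1) * (LINT z|\<mu>. \<bar>f z * indicator (atom x) z\<bar>)"
      using cw p by (intro add_left_mono mult_left_mono) auto
    also have "\<dots> = (LINT z|\<mu>. (c powr p - p * c powr (p - 1) * c) * indicator (atom x) z + p * c powr (p - 1) * \<bar>f z * indicator (atom x) z\<bar>)"
      using int sets.sets_into_space[OF atom_sets]
      by (subst Bochner_Integration.integral_add) (auto simp: weight_def Int_absorb2)
    also have "\<dots> \<le> (LINT z|\<mu>. \<bar>f z\<bar> powr p * indicator (atom x) z)"
    proof (rule integral_mono[OF lin intpa])
      fix z
      show "(c powr p - p * c powr (p - 1) * c) * indicator (atom x) z + p * c powr (p - 1) * \<bar>f z * indicator (atom x) z\<bar>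
        \<le> \<bar>f z\<bar> powr p * indicator (atom x) z"
        using powr_tangent_convex[OF p, of c "\<bar>f z\<bar>"] by (auto simp: c_def indicator_def algebra_simps)
    qed
    finally show ?thesis by (simp add: c_def)
  qed (auto intro!: integral_nonneg_AE)
  have "(\<Sum>x\<in>X. weight \<mu> x * \<bar>local_mean \<mu> f x\<bar> powr p) \<le> (\<Sum>x\<in>X. LINT z|\<mu>. \<bar>f z\<bar> powr p * indicator (atom x) z)"
    by (intro sum_mono cell)
  also have "\<dots> = (LINT z|\<mu>. (\<Sum>x\<in>X. \<bar>f z\<bar> powr p * indicator (atom x) z))"
    by (rule Bochner_Integration.integral_sum[symmetric]) (rule intpa)
  also have "\<dots> \<le> (LINT z|\<mu>. \<bar>f z\<bar> powr p)"
  proof (rule integral_mono[OF _ intp])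
    show "integrable \<mu> (\<lambda>z. \<Sum>x\<in>X. \<bar>f z\<bar> powr p * indicator (atom x) z)"
      by (rule Bochner_Integration.integrable_sum) (rule intpa)
    fix z
    define ind where "ind = (\<lambda>z. if z \<in> \<Union>Tops then 1 else 0 :: real)"
    have "atomic ind"
    proof (rule atomicI)
      fix x z assume "z \<in> atom x"
      then have "z \<in> gcell k1 x" using gcell_mono[of k1 "k1 + int n" x] by auto
      then have "z \<in> T \<longleftrightarrow> x \<in> T" if "T \<in> Tops" for T using Top_gcell[OF that] gcell_eq gcell_self by metis
      then show "ind z = ind x" by (auto simp: ind_def)
    qed (simp add: ind_def)
    have i1: "ind x = 1" if "x \<in> X" for x using X_in_Top[OF that] by (auto simp: ind_def)
    have "ind z = (\<Sum>x\<in>X. ind x * indicator (atom x) z)" by (rule atomic_expand) fact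
    then have "(\<Sum>x\<in>X. indicator (atom x) z) = ind z" using i1 by simp
    then have e: "(\<Sum>x\<in>X. \<bar>f z\<bar> powr p * indicator (atom x) z) = \<bar>f z\<bar> powr p * ind z"
      by (simp only: sum_distrib_left[symmetric])
    show "(\<Sum>x\<in>X. \<bar>f z\<bar> powr p * indicator (atom x) z) \<le> \<bar>f z\<bar> powr p"
      unfolding e by (simp add: ind_def)
  qed
  also have "\<dots> = enn2real (\<integral>\<^sup>+z. ennreal (\<bar>f z\<bar> powr p) \<partial>\<mu>)"
    using f by (intro integral_eq_nn_integral) (auto simp: Lp_space_def)
  finally have "wnorm X p (weight \<mu>) (local_mean \<mu> f) \<le> enn2real (\<integral>\<^sup>+z. ennreal (\<bar>f z\<bar> powr p) \<partial>\<mu>) powr (1/p)"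
    unfolding wnorm_def using p weight_nonneg by (intro powr_mono2) (auto intro!: sum_nonneg)
  then show ?thesis unfolding Lp_space_nn_integral(2)[OF f p0(1)] by (rule ennreal_leI)
qed

end

end

section \<open>Dyadic shifts as kernels on the tree of cells\<close>

lemma ennreal_le_mult_real:
  assumes "ennreal a \<le> C * ennreal b" "C < \<infinity>" "0 \<le> b"
  shows "a \<le> enn2real C * b"
proof -
  have C: "C = ennreal (enn2real C)" using assms by simp
  have "ennreal a \<le> ennreal (enn2real C * b)"
    using assms(1,3) by (subst (asm) C) (simp add: ennreal_mult)
  then show ?thesis using assms(3) by (subst (asm) ennreal_le_iff) auto
qed

lemma (in dyadic) inverse_vol_gcell: "1 / vol (gcell k x) = (2 powi k) ^ CARD('n)"
  by (simp add: vol_gcell[OF gcell_in] power_int_minus power_divide inverse_eq_divide)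

text \<open>A discretization that is fine enough for a finite family of shifts: their cubes \<open>K\<close> lie in the top cubes and
  at least \<open>\<kappa> + 1\<close> generations above the atoms, so that the Haar functions involved are constant on
  atoms.\<close>
locale shift_discretization = discretization D k1 n Tops
  for D :: "'n::finite lattice" and k1 :: int and n :: nat and Tops :: "'n point_set set" +
  fixes \<sigma> w :: "(real ^ 'n) measure" and S :: "nat \<Rightarrow> 'n shift_data" and Us :: "nat set" and \<kappa> :: nat
    and ch :: "'n point_set \<Rightarrow> nat \<Rightarrow> 'n point_set"
  assumes \<sigma>: "radon_measure \<sigma>" and w: "radon_measure w" and finite_Us: "finite Us"
    and shift: "u \<in> Us \<Longrightarrow> dyadic_shift D (S u)" and complexity: "u \<in> Us \<Longrightarrow> complexity (S u) \<le> \<kappa>"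
    and admissible: "u \<in> Us \<Longrightarrow> K \<in> support (S u) \<Longrightarrow>
      \<exists>k. K \<in> D k \<and> k1 \<le> k \<and> k + int \<kappa> + 1 \<le> k1 + int n \<and> (\<exists>T\<in>Tops. K \<subseteq> T)"
    and ch: "child_enumeration D ch"
begin

lemma flipped: "shift_discretization D k1 n Tops w \<sigma> (\<lambda>u. flip (S u)) Us \<kappa> ch"
  by unfold_locales
     (use \<sigma> w finite_Us shift complexity admissible ch dyadic_shift_flip in \<open>auto simp: support_flip\<close>)

lemma support_cubes: "support (S u) \<subseteq> cubes D"
  by (auto simp: support_def)

lemma haar_atomic:
  assumes u: "u \<in> Us" and K: "K \<in> support (S u)" and IJ: "(I, J) \<in> shift_pairs D (S u) K"
  shows "atomic (haar_in (S u) I J)" "atomic (haar_out (S u) I J)"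
proof -
  obtain k T where k: "K \<in> D k" "k1 \<le> k" "k + int \<kappa> + 1 \<le> k1 + int n" and T: "T \<in> Tops" "K \<subseteq> T"
    using admissible[OF u K] by blast
  note gen = shift_pairs_generation[OF k(1) IJ] and hr = shift_haar[OF shift[OF u] k(1) IJ]
  have at: "atomic h" if h: "haar_related L h" and L: "L \<in> D (k + int r)" "L \<subseteq> K" "r \<le> \<kappa>" for L h r
  proof (rule atomicI)
    fix x z assume "z \<in> atom x"
    then have "z \<in> gcell (k + int r + 1) x"
      using gcell_mono[of "k + int r + 1" "k1 + int n" x] k L(3) by auto
    then show "h z = h x" by (rule haar_related_const[OF L(1) h])
  next
    fix z assume "z \<notin> \<Union>Tops"
    then show "h z = 0" using haar_related_outside[OF h] L T by blast
  qed
  show "atomic (haar_in (S u) I J)"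
    using at[OF hr(1) gen(1,3)] complexity[OF u] by (simp add: complexity_def)
  show "atomic (haar_out (S u) I J)"
    using at[OF hr(2) gen(2,4)] complexity[OF u] by (simp add: complexity_def)
qed

text \<open>The Haar functions being constant on atoms, a shift acts on a function only through its means over
  the atoms, as an integral operator on \<open>X\<close>.\<close>
lemma shift_op_atoms:
  assumes u: "u \<in> Us" and f: "f \<in> Lp_space r \<sigma>" and r: "1 \<le> r"
  shows "shift_op D \<sigma> (S u) f y = (\<Sum>x\<in>X. weight \<sigma> x * kernel (S u) x y * local_mean \<sigma> f x)"
proof -
  have "shift_op D \<sigma> (S u) f y = (\<Sum>K\<in>support (S u). \<Sum>(I, J)\<in>shift_pairs D (S u) K.
        coef (S u) I J K * pairing \<sigma> f (haar_in (S u) I J) * haar_out (S u) I J y)"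
    by (rule shift_op_eq_sum[OF shift[OF u]])
  also have "\<dots> = (\<Sum>K\<in>support (S u). \<Sum>(I, J)\<in>shift_pairs D (S u) K. \<Sum>x\<in>X.
        weight \<sigma> x * local_mean \<sigma> f x * (coef (S u) I J K * haar_in (S u) I J x * haar_out (S u) I J y))"
  proof (rule sum.cong[OF refl], rule sum.cong[OF refl], clarify)
    fix K I J assume "K \<in> support (S u)" "(I, J) \<in> shift_pairs D (S u) K"
    then have "atomic (haar_in (S u) I J)" using haar_atomic[OF u] by blast
    then show "coef (S u) I J K * pairing \<sigma> f (haar_in (S u) I J) * haar_out (S u) I J y
      = (\<Sum>x\<in>X. weight \<sigma> x * local_mean \<sigma> f x * (coef (S u) I J K * haar_in (S u) I J x * haar_out (S u) I J y))"
      by (simp add: pairing_atomic[OF \<sigma> f r] sum_distrib_left sum_distrib_right mult_ac)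
  qed
  also have "\<dots> = (\<Sum>K\<in>support (S u). \<Sum>x\<in>X. \<Sum>(I, J)\<in>shift_pairs D (S u) K.
        weight \<sigma> x * local_mean \<sigma> f x * (coef (S u) I J K * haar_in (S u) I J x * haar_out (S u) I J y))"
    unfolding case_prod_beta by (rule sum.cong[OF refl], rule sum.swap)
  also have "\<dots> = (\<Sum>x\<in>X. \<Sum>K\<in>support (S u). \<Sum>(I, J)\<in>shift_pairs D (S u) K.
        weight \<sigma> x * local_mean \<sigma> f x * (coef (S u) I J K * haar_in (S u) I J x * haar_out (S u) I J y))"
    by (rule sum.swap)
  also have "\<dots> = (\<Sum>x\<in>X. weight \<sigma> x * kernel (S u) x y * local_mean \<sigma> f x)"
  proof (rule sum.cong[OF refl])
    fix x
    have "(\<Sum>K\<in>support (S u). \<Sum>(I, J)\<in>shift_pairs D (S u) K.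
        weight \<sigma> x * local_mean \<sigma> f x * (coef (S u) I J K * haar_in (S u) I J x * haar_out (S u) I J y))
      = weight \<sigma> x * local_mean \<sigma> f x * kernel (S u) x y"
      by (simp add: kernel_def kernel_part_def sum_distrib_left case_prod_beta)
    then show "(\<Sum>K\<in>support (S u). \<Sum>(I, J)\<in>shift_pairs D (S u) K.
        weight \<sigma> x * local_mean \<sigma> f x * (coef (S u) I J K * haar_in (S u) I J x * haar_out (S u) I J y))
      = weight \<sigma> x * kernel (S u) x y * local_mean \<sigma> f x" by (simp add: mult_ac)
  qed
  finally show ?thesis .
qed

lemma shift_op_atomic:
  assumes u: "u \<in> Us"
  shows "atomic (shift_op D \<sigma> (S u) f)"
proof (rule atomicI)
  fix x z assume z: "z \<in> atom x"
  have "haar_out (S u) I J z = haar_out (S u) I J x"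
    if "K \<in> support (S u)" "(I, J) \<in> shift_pairs D (S u) K" for K I J
    using haar_atomic(2)[OF u that] z by (simp add: atomic_def)
  then show "shift_op D \<sigma> (S u) f z = shift_op D \<sigma> (S u) f x"
    unfolding shift_op_eq_sum[OF shift[OF u]] by (intro sum.cong refl) auto
next
  fix z assume z: "z \<notin> \<Union>Tops"
  show "shift_op D \<sigma> (S u) f z = 0"
    unfolding shift_op_eq_sum[OF shift[OF u]]
  proof (rule sum.neutral, rule ballI, rule sum.neutral, clarify)
    fix K I J assume "K \<in> support (S u)" "(I, J) \<in> shift_pairs D (S u) K"
    then have "haar_out (S u) I J z = 0" using haar_atomic(2)[OF u] z by (simp add: atomic_def)
    then show "coef (S u) I J K * pairing \<sigma> f (haar_in (S u) I J) * haar_out (S u) I J z = 0" by simp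
  qed
qed

definition child_index :: "nat \<Rightarrow> real ^ 'n \<Rightarrow> nat" where
  "child_index j x = inv_into {1..2 ^ CARD('n)} (ch (gcell (k1 + int j - 1) x)) (gcell (k1 + int j) x)"

definition child_volume_inverse :: "nat \<Rightarrow> real" where
  "child_volume_inverse j = (2 powi (k1 + int j + 1)) ^ CARD('n)"

lemma ch_bij: "bij_betw (ch (gcell k x)) {1..2 ^ CARD('n)} (gcell (k + 1) ` gcell k x)"
proof -
  have "gcell k x \<in> cubes D" unfolding cubes_def using gcell_in by blast
  then have "bij_betw (ch (gcell k x)) {1..2 ^ CARD('n)} (children D (gcell k x))"
    using ch unfolding child_enumeration_def by blast
  then show ?thesis by (simp only: children_eq)
qed

lemma child_index_in: "child_index j x \<in> {1..2 ^ CARD('n)}"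
  and ch_child_index: "ch (gcell (k1 + int j - 1) x) (child_index j x) = gcell (k1 + int j) x"
proof -
  have img: "gcell (k1 + int j) x \<in> ch (gcell (k1 + int j - 1) x) ` {1..2 ^ CARD('n)}"
    using bij_betw_imp_surj_on[OF ch_bij[of "k1 + int j - 1" x]] gcell_self[of x "k1 + int j - 1"] by auto
  show "child_index j x \<in> {1..2 ^ CARD('n)}" unfolding child_index_def by (rule inv_into_into[OF img])
  show "ch (gcell (k1 + int j - 1) x) (child_index j x) = gcell (k1 + int j) x"
    unfolding child_index_def by (rule f_inv_into_f[OF img])
qed

lemma child_index_iff:
  assumes "l \<in> {1..2 ^ CARD('n)}"
  shows "child_index (Suc j) y = l \<longleftrightarrow> y \<in> ch (gcell (k1 + int j) y) l"
proof
  assume "child_index (Suc j) y = l"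
  then have "ch (gcell (k1 + int j) y) l = gcell (k1 + int (Suc j)) y" using ch_child_index[of "Suc j" y] by auto
  then show "y \<in> ch (gcell (k1 + int j) y) l" by simp
next
  assume y: "y \<in> ch (gcell (k1 + int j) y) l"
  have "ch (gcell (k1 + int j) y) l \<in> gcell (k1 + int j + 1) ` gcell (k1 + int j) y"
    using bij_betw_imp_surj_on[OF ch_bij[of "k1 + int j" y]] assms by blast
  then have "ch (gcell (k1 + int j) y) l = gcell (k1 + int j + 1) y" using y gcell_eq by auto
  also have "\<dots> = ch (gcell (k1 + int j) y) (child_index (Suc j) y)" using ch_child_index[of "Suc j" y] by (simp add: add_ac)
  finally show "child_index (Suc j) y = l"
    using bij_betw_imp_inj_on[OF ch_bij[of "k1 + int j" y]] assms child_index_in[of "Suc j" y]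
    by (auto simp: inj_on_def)
qed

text \<open>The top cells do not interact because every cube of the shifts lies in a single top cube. The size bound
  at a pair of points separated at generation \<open>j + 1\<close> comes from the geometric series of reciprocal volumes.\<close>
sublocale kernels: dyadic_kernel_family X cell n "weight \<sigma>" "weight w" "\<lambda>u. kernel (S u)" Us \<kappa>
  child_index "{1..2 ^ CARD('n)}" child_volume_inverse
proof unfold_locales
  show "\<forall>x\<in>X. 0 \<le> weight \<sigma> x" "\<forall>x\<in>X. 0 \<le> weight w x" by (rule weight_nonneg)+
  show "finite Us" by (rule finite_Us)
  show "finite {1..2 ^ CARD('n) :: nat}" by simp
  show "child_index j x \<in> {1..2 ^ CARD('n)}" for j x by (rule child_index_in)
next
  fix u x y y' k
  assume "u \<in> Us" "x \<in> X" "y \<in> X" "y' \<in> cell (k + \<kappa>) y" "x \<notin> cell k y"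
  then show "kernel (S u) x y' = kernel (S u) x y"
    by (intro kernel_const_right[OF shift complexity support_cubes, where g = "k1 + int k"]) (auto simp: cell_def add_ac)
next
  fix u x y x' k
  assume "u \<in> Us" "x \<in> X" "y \<in> X" "x' \<in> cell (k + \<kappa>) x" "y \<notin> cell k x"
  then show "kernel (S u) x' y = kernel (S u) x y"
    by (intro kernel_const_left[OF shift complexity support_cubes, where g = "k1 + int k"]) (auto simp: cell_def add_ac)
next
  fix u x y
  assume u: "u \<in> Us" and xy: "x \<in> X" "y \<in> X" "y \<notin> cell 0 x"
  show "kernel (S u) x y = 0"
    unfolding kernel_def
  proof (rule sum.neutral, rule ballI)
    fix K assume K: "K \<in> support (S u)"
    obtain k T where k: "K \<in> D k" and T: "T \<in> Tops" "K \<subseteq> T" using admissible[OF u K] by blast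
    have "\<not> (x \<in> K \<and> y \<in> K)"
    proof
      assume "x \<in> K \<and> y \<in> K"
      then have "y \<in> gcell k1 x" using Top_gcell[OF T(1), of x] T(2) by blast
      then show False using xy by (simp add: cell_def)
    qed
    then show "kernel_part (S u) K x y = 0" using kernel_part_outside[OF shift[OF u] k] by blast
  qed
next
  fix x y j assume x: "x \<in> X" and y: "y \<in> cell j x"
  have e: "gcell (k1 + int j) y = gcell (k1 + int j) x" using y gcell_eq by (simp add: cell_def)
  have "child_index (Suc j) y = child_index (Suc j) x \<longleftrightarrow> y \<in> ch (gcell (k1 + int j) x) (child_index (Suc j) x)"
    using child_index_iff[OF child_index_in[of "Suc j" x], of j y] e by simp
  also have "ch (gcell (k1 + int j) x) (child_index (Suc j) x) = gcell (k1 + int (Suc j)) x"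
    using ch_child_index[of "Suc j" x] by simp
  finally show "y \<in> cell (Suc j) x \<longleftrightarrow> child_index (Suc j) y = child_index (Suc j) x"
    using y by (auto simp: cell_def)
next
  fix u x y j
  assume u: "u \<in> Us" and x: "x \<in> X" and y: "y \<in> cell j x" "y \<notin> cell (Suc j) x"
  have "\<bar>kernel (S u) x y\<bar> \<le> 2 / vol (gcell (k1 + int j) x)"
  proof (rule abs_kernel_le[OF shift[OF u]])
    show "\<exists>k\<ge>k1. K \<in> D k" if "K \<in> support (S u)" for K using admissible[OF u that] by blast
    show "y \<notin> gcell (k1 + int j + 1) x" using y by (auto simp: cell_def add_ac)
  qed simp
  also have "\<dots> = 2 * (2 powi (k1 + int j)) ^ CARD('n)"
    using inverse_vol_gcell[of "k1 + int j" x] by (simp add: divide_inverse[of 2] inverse_eq_divide)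
  also have "\<dots> \<le> 2 * child_volume_inverse j"
    unfolding child_volume_inverse_def by (intro mult_left_mono power_mono power_int_increasing) auto
  finally show "\<bar>kernel (S u) x y\<bar> \<le> 2 * child_volume_inverse j" .
qed

lemma shift_op_image:
  assumes "u \<in> Us" "f \<in> Lp_space r \<sigma>" "1 \<le> r"
  shows "shift_op D \<sigma> (S u) f y = kernels.image u (local_mean \<sigma> f) y"
  by (simp add: shift_op_atoms[OF assms] kernels.image_def)

lemma indicator_gcell_atomic:
  assumes "k \<le> n" "x \<in> X"
  shows "atomic (indicator (gcell (k1 + int k) x) :: real ^ 'n \<Rightarrow> real)"
proof (rule atomicI)
  fix y z assume "z \<in> atom y"
  then have "z \<in> gcell (k1 + int k) y" using gcell_mono[of "k1 + int k" "k1 + int n" y] assms by auto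
  then have "z \<in> gcell (k1 + int k) x \<longleftrightarrow> y \<in> gcell (k1 + int k) x" using gcell_eq gcell_self by metis
  then show "(indicator (gcell (k1 + int k) x) z :: real) = indicator (gcell (k1 + int k) x) y"
    by (simp add: indicator_def)
next
  fix z assume z: "z \<notin> \<Union>Tops"
  obtain T where "T \<in> Tops" "x \<in> T" using X_in_Top[OF assms(2)] by blast
  then have "gcell (k1 + int k) x \<subseteq> T" using Top_gcell gcell_mono[of k1 "k1 + int k" x] by auto
  then show "(indicator (gcell (k1 + int k) x) z :: real) = 0"
    using z \<open>T \<in> Tops\<close> by (intro indicator_simps(2)) blast
qed

lemma image_local_mean_atomic:
  assumes "atomic F"
  shows "kernels.image u (local_mean \<sigma> F) y = kernels.image u F y"
  unfolding kernels.image_def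
proof (rule sum.cong[OF refl])
  fix x assume "x \<in> X"
  then show "weight \<sigma> x * kernel (S u) x y * local_mean \<sigma> F x = weight \<sigma> x * kernel (S u) x y * F x"
    using local_mean_atomic[OF \<sigma> assms] by (cases "weight \<sigma> x = 0") auto
qed

lemma shift_op_indicator_gcell:
  assumes u: "u \<in> Us" and k: "k \<le> n" and y: "y \<in> X"
  shows "shift_op D \<sigma> (S u) (indicator (gcell (k1 + int k) y)) y = kernels.local_image k u y"
proof -
  have at: "atomic (indicator (gcell (k1 + int k) y) :: real ^ 'n \<Rightarrow> real)" by (rule indicator_gcell_atomic[OF k y])
  have "shift_op D \<sigma> (S u) (indicator (gcell (k1 + int k) y)) y
      = kernels.image u (indicator (gcell (k1 + int k) y)) y"
    using shift_op_image[OF u atomic_Lp_space[OF \<sigma> at, of 1]] image_local_mean_atomic[OF at] by simp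
  also have "\<dots> = (\<Sum>x\<in>X. if x \<in> gcell (k1 + int k) y then weight \<sigma> x * kernel (S u) x y else 0)"
    unfolding kernels.image_def by (rule sum.cong[OF refl]) (simp add: indicator_def)
  also have "\<dots> = kernels.local_image k u y"
    unfolding kernels.local_image_def cell_def by (rule sum.inter_restrict[OF finite_X, symmetric])
  finally show ?thesis .
qed

text \<open>A coefficient function that is constant on cells is a choice of one number for each pair of a cube and an
  index \<open>u\<close>. Enumerating these pairs gives an instance of the testing condition. The operator \<open>opr\<close> is left
  open so that the dual condition is covered by applying the lemma to the flipped shifts.\<close>
lemma testing_transfer:
  assumes T: "testing_bound D p \<sigma> q w opr \<Q> C" "C < \<infinity>" and pq: "1 < p" "1 < q"
    and R: "\<And>u. u \<in> Us \<Longrightarrow> R u \<in> \<Q> \<and> opr (R u) = shift_op D \<sigma> (S u)"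
  shows "kernels.quadratic_testing p q (enn2real C)"
  unfolding kernels.quadratic_testing_def
proof (intro allI impI)
  fix \<alpha> :: "nat \<Rightarrow> nat \<Rightarrow> real ^ 'n \<Rightarrow> real"
  assume \<alpha>: "\<forall>k u. tree.cell_const k (\<alpha> k u)"
  let ?L = "vnorm X q (weight w) ({..n} \<times> Us) (\<lambda>(k, u) y. \<alpha> k u y * kernels.local_image k u y)"
  let ?R = "vnorm X p (weight \<sigma>) ({..n} \<times> Us) (\<lambda>(k, u). \<alpha> k u)"
  define Idx where "Idx = (SIGMA ku : {..n} \<times> Us. gcell (k1 + int (fst ku)) ` X)"
  have fin: "finite Idx" unfolding Idx_def using finite_X finite_Us by auto
  obtain e where e: "bij_betw e {1..card Idx} Idx" using ex_bij_betw_nat_finite_1[OF fin] by blast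
  define pick where "pick Q = (SOME x. x \<in> X \<and> x \<in> Q)" for Q :: "'n point_set"
  have pick: "pick (gcell k x) \<in> X \<and> pick (gcell k x) \<in> gcell k x" if "x \<in> X" for k x
    unfolding pick_def by (rule someI[of _ x]) (simp add: that)
  define a where "a i = (case e i of (ku, Q) \<Rightarrow> \<alpha> (fst ku) (snd ku) (pick Q))" for i
  define U where "U i = snd (fst (e i))" for i
  define Q where "Q i = snd (e i)" for i
  have ei: "U i \<in> Us \<and> (\<exists>k x. k \<le> n \<and> x \<in> X \<and> Q i = gcell (k1 + int k) x)" if "i \<in> {1..card Idx}" for i
    using bij_betwE[OF e] that unfolding U_def Q_def Idx_def by fastforce
  define FL where "FL z = sqrt (\<Sum>i=1..card Idx. (a i * indicator (Q i) z * opr (R (U i)) (indicator (Q i)) z)\<^sup>2)" for z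
  define FR where "FR z = sqrt (\<Sum>i=1..card Idx. (a i)\<^sup>2 * indicator (Q i) z)" for z
  show "?L \<le> enn2real C * ?R"
  proof (cases "Idx = {}")
    case True
    then have "X = {} \<or> Us = {}" by (auto simp: Idx_def)
    then have "?L = 0" by (auto simp: vnorm_def wnorm_def modulus_def)
    then show ?thesis by simp
  next
    case False
    then have card: "1 \<le> card Idx" using fin by (simp add: Suc_le_eq card_gt_0_iff)
    have ind: "atomic (indicator (Q i) :: real ^ 'n \<Rightarrow> real)" if "i \<in> {1..card Idx}" for i
      using ei[OF that] indicator_gcell_atomic by force
    have FL: "atomic FL"
    proof (rule atomicI)
      fix x z assume z: "z \<in> atom x"
      have "indicator (Q i) z = (indicator (Q i) x :: real) \<and> opr (R (U i)) (indicator (Q i)) z = opr (R (U i)) (indicator (Q i)) x"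
        if i: "i \<in> {1..card Idx}" for i
        using ind[OF i] ei[OF i] R shift_op_atomic[of "U i" "indicator (Q i)"] z by (simp add: atomic_def)
      then show "FL z = FL x" unfolding FL_def by (intro arg_cong[where f = sqrt] sum.cong refl) simp
    next
      fix z assume "z \<notin> \<Union>Tops"
      then have "indicator (Q i) z = (0 :: real)" if i: "i \<in> {1..card Idx}" for i
        using ind[OF i] by (simp add: atomic_def)
      then show "FL z = 0" unfolding FL_def by (simp add: sum.neutral)
    qed
    have FR: "atomic FR"
    proof (rule atomicI)
      fix x z assume z: "z \<in> atom x"
      have "indicator (Q i) z = (indicator (Q i) x :: real)"
        if i: "i \<in> {1..card Idx}" for i
        using ind[OF i] z by (simp add: atomic_def)
      then show "FR z = FR x" unfolding FR_def by (intro arg_cong[where f = sqrt] sum.cong refl) simp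
    next
      fix z assume "z \<notin> \<Union>Tops"
      then have "indicator (Q i) z = (0 :: real)" if i: "i \<in> {1..card Idx}" for i
        using ind[OF i] by (simp add: atomic_def)
      then show "FR z = 0" unfolding FR_def by (simp add: sum.neutral)
    qed
    have collect: "(\<Sum>i=1..card Idx. h (e i)) = (\<Sum>ku\<in>{..n} \<times> Us. h (ku, gcell (k1 + int (fst ku)) y))"
      if y: "y \<in> X" and h: "\<And>ku Q. y \<notin> Q \<Longrightarrow> h (ku, Q) = 0" for h :: "(nat \<times> nat) \<times> 'n point_set \<Rightarrow> real" and y
    proof -
      have "(\<Sum>i=1..card Idx. h (e i)) = sum h Idx" by (rule sum.reindex_bij_betw[OF e])
      also have "\<dots> = (\<Sum>ku\<in>{..n} \<times> Us. \<Sum>Q\<in>gcell (k1 + int (fst ku)) ` X. h (ku, Q))"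
        unfolding Idx_def using finite_X finite_Us by (subst sum.Sigma) auto
      also have "\<dots> = (\<Sum>ku\<in>{..n} \<times> Us. h (ku, gcell (k1 + int (fst ku)) y))"
      proof (rule sum.cong[OF refl])
        fix ku
        have "(\<Sum>Q\<in>gcell (k1 + int (fst ku)) ` X. h (ku, Q)) = (\<Sum>Q\<in>{gcell (k1 + int (fst ku)) y}. h (ku, Q))"
        proof (rule sum.mono_neutral_right)
          show "\<forall>Q\<in>gcell (k1 + int (fst ku)) ` X - {gcell (k1 + int (fst ku)) y}. h (ku, Q) = 0"
            using h gcell_eq by (metis DiffE imageE insertCI)
        qed (use y finite_X in auto)
        then show "(\<Sum>Q\<in>gcell (k1 + int (fst ku)) ` X. h (ku, Q)) = h (ku, gcell (k1 + int (fst ku)) y)" by simp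
      qed
      finally show ?thesis .
    qed
    have pick_\<alpha>: "\<alpha> k u (pick (gcell (k1 + int k) y)) = \<alpha> k u y" if y: "y \<in> X" for k u y
      using pick[OF y, of "k1 + int k"] \<alpha> y by (intro tree.cell_constD[of k "\<alpha> k u" y]) (auto simp: cell_def)
    have FLy: "FL y = modulus ({..n} \<times> Us) (\<lambda>(k, u) y. \<alpha> k u y * kernels.local_image k u y) y" if y: "y \<in> X" for y
    proof -
      define h where "h = (\<lambda>(ku, Q). (\<alpha> (fst ku) (snd ku) (pick Q) * indicator Q y * opr (R (snd ku)) (indicator Q) y)\<^sup>2)"
      have "(\<Sum>i=1..card Idx. (a i * indicator (Q i) y * opr (R (U i)) (indicator (Q i)) y)\<^sup>2) = (\<Sum>i=1..card Idx. h (e i))"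
        by (simp add: h_def a_def Q_def U_def case_prod_beta)
      also have "\<dots> = (\<Sum>ku\<in>{..n} \<times> Us. h (ku, gcell (k1 + int (fst ku)) y))"
        by (rule collect[OF y]) (simp add: h_def)
      also have "\<dots> = (\<Sum>ku\<in>{..n} \<times> Us. ((\<lambda>(k, u) y. \<alpha> k u y * kernels.local_image k u y) ku y)\<^sup>2)"
      proof (rule sum.cong[OF refl])
        fix ku assume ku: "ku \<in> {..n} \<times> Us"
        obtain k u where kue: "ku = (k, u)" by (cases ku)
        then show "h (ku, gcell (k1 + int (fst ku)) y) = ((\<lambda>(k, u) y. \<alpha> k u y * kernels.local_image k u y) ku y)\<^sup>2"
          using shift_op_indicator_gcell[of u k y] y R ku by (simp add: h_def pick_\<alpha>)
      qed
      finally show ?thesis by (simp add: FL_def modulus_def)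
    qed
    have FRy: "FR y = modulus ({..n} \<times> Us) (\<lambda>(k, u). \<alpha> k u) y" if y: "y \<in> X" for y
    proof -
      define h where "h = (\<lambda>(ku, Q). (\<alpha> (fst ku) (snd ku) (pick Q))\<^sup>2 * indicator Q y)"
      have "(\<Sum>i=1..card Idx. (a i)\<^sup>2 * indicator (Q i) y) = (\<Sum>i=1..card Idx. h (e i))"
        by (simp add: h_def a_def Q_def case_prod_beta)
      also have "\<dots> = (\<Sum>ku\<in>{..n} \<times> Us. h (ku, gcell (k1 + int (fst ku)) y))"
        by (rule collect[OF y]) (simp add: h_def)
      also have "\<dots> = (\<Sum>ku\<in>{..n} \<times> Us. ((\<lambda>(k, u). \<alpha> k u) ku y)\<^sup>2)"
        by (rule sum.cong[OF refl]) (auto simp: h_def pick_\<alpha> y)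
      finally show ?thesis by (simp add: FR_def modulus_def)
    qed
    have "Lp_norm q w FL \<le> C * Lp_norm p \<sigma> FR"
    proof -
      have "\<forall>i\<in>{1..card Idx}. R (U i) \<in> \<Q> \<and> Q i \<in> cubes D"
      proof
        fix i assume "i \<in> {1..card Idx}"
        from ei[OF this] obtain k x where "U i \<in> Us" "Q i = gcell (k1 + int k) x" by blast
        moreover have "gcell (k1 + int k) x \<in> cubes D" unfolding cubes_def using gcell_in by blast
        ultimately show "R (U i) \<in> \<Q> \<and> Q i \<in> cubes D" using R by simp
      qed
      from T(1)[unfolded testing_bound_def, THEN spec, THEN mp, OF card, THEN spec[of _ a],
          THEN spec[of _ "\<lambda>i. R (U i)"], THEN spec[of _ Q], THEN mp, OF this]
      show ?thesis unfolding FL_def[abs_def] FR_def[abs_def] .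
    qed
    then have "ennreal (wnorm X q (weight w) FL) \<le> C * ennreal (wnorm X p (weight \<sigma>) FR)"
      using Lp_norm_atomic[OF w FL, of q] Lp_norm_atomic[OF \<sigma> FR, of p] pq by simp
    then have "wnorm X q (weight w) FL \<le> enn2real C * wnorm X p (weight \<sigma>) FR"
      by (intro ennreal_le_mult_real T) auto
    moreover have "wnorm X q (weight w) FL = ?L" unfolding vnorm_def wnorm_def by (simp add: FLy)
    moreover have "wnorm X p (weight \<sigma>) FR = ?R" unfolding vnorm_def wnorm_def by (simp add: FRy)
    ultimately show ?thesis by simp
  qed
qed

end

section \<open>The quadratic condition and the random sums on the tree\<close>

context shift_discretization
begin

lemma indicator_subcell_atomic:
  assumes "k \<le> n" "z \<in> \<Union>Tops"
  shows "atomic (indicator (gcell (k1 + int k) z) :: real ^ 'n \<Rightarrow> real)"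
proof -
  obtain T where T: "T \<in> Tops" "z \<in> T" using assms by blast
  have "rep (atom z) \<in> gcell (k1 + int k) z"
    using rep_in[of "k1 + int n" z] gcell_mono[of "k1 + int k" "k1 + int n" z] assms(1) by auto
  then have "gcell (k1 + int k) z = gcell (k1 + int k) (rep (atom z))" using gcell_eq by metis
  then show ?thesis using indicator_gcell_atomic[OF assms(1) rep_in_X[OF T]] by simp
qed

lemma measure_subcell:
  assumes \<mu>: "radon_measure \<mu>" and "k \<le> n" "z \<in> \<Union>Tops"
  shows "measure \<mu> (gcell (k1 + int k) z) = (\<Sum>x\<in>X \<inter> gcell (k1 + int k) z. weight \<mu> x)"
proof -
  let ?G = "gcell (k1 + int k) z"
  have "atomic (\<lambda>y. ennreal (indicator ?G y))"
    by (rule atomic_comp[OF indicator_subcell_atomic[OF assms(2,3)]]) simp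
  then have at: "atomic (indicator ?G :: _ \<Rightarrow> ennreal)" by (simp add: ennreal_indicator)
  have "emeasure \<mu> ?G = (\<integral>\<^sup>+y. indicator ?G y \<partial>\<mu>)"
    by (rule nn_integral_indicator[symmetric]) (rule atom_sets[OF \<mu>])
  also have "\<dots> = (\<Sum>x\<in>X. indicator ?G x * ennreal (weight \<mu> x))" by (rule nn_integral_atomic[OF \<mu> at])
  also have "\<dots> = (\<Sum>x\<in>X. ennreal (if x \<in> ?G then weight \<mu> x else 0))"
    by (rule sum.cong[OF refl]) (simp add: indicator_def)
  also have "\<dots> = ennreal (\<Sum>x\<in>X. if x \<in> ?G then weight \<mu> x else 0)"
    using weight_nonneg by (intro sum_ennreal) auto
  also have "(\<Sum>x\<in>X. if x \<in> ?G then weight \<mu> x else 0) = (\<Sum>x\<in>X \<inter> ?G. weight \<mu> x)"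
    by (rule sum.inter_restrict[OF finite_X, symmetric])
  finally have "emeasure \<mu> ?G = ennreal (\<Sum>x\<in>X \<inter> ?G. weight \<mu> x)" .
  moreover have "0 \<le> (\<Sum>x\<in>X \<inter> ?G. weight \<mu> x)" using weight_nonneg by (intro sum_nonneg) auto
  ultimately show ?thesis by (simp add: measure_def)
qed

lemma ch_gcell:
  assumes "l \<in> {1..2 ^ CARD('n)}"
  shows "\<exists>z\<in>gcell k x. ch (gcell k x) l = gcell (k + 1) z"
  using bij_betw_imp_surj_on[OF ch_bij[of k x]] assms by blast

lemma subcell_in_Tops:
  assumes "x \<in> X" "z \<in> gcell (k1 + int j) x"
  shows "z \<in> \<Union>Tops"
proof -
  obtain T where T: "T \<in> Tops" "x \<in> T" using X_in_Top[OF assms(1)] by blast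
  then show ?thesis using assms(2) gcell_mono[of k1 "k1 + int j" x] Top_gcell[OF T] by auto
qed

text \<open>Functions that are constant on the cells of generation \<open>j\<close> encode coefficients of the cubes of
  this generation; all other cubes get the coefficient 0, which makes the infinite sums over cubes finite.\<close>
lemma off_diagonal_transfer:
  assumes A: "quad_Astar_bound D ch p q \<sigma> w C" "C < \<infinity>" and pq: "1 < p" "1 < q"
  shows "kernels.off_diagonal p q (enn2real C)"
  unfolding kernels.off_diagonal_def
proof (intro ballI impI allI)
  fix k l :: nat and a :: "nat \<Rightarrow> real ^ 'n \<Rightarrow> real"
  assume k: "k \<in> {1..2 ^ CARD('n)}" and l: "l \<in> {1..2 ^ CARD('n)}" and kl: "k \<noteq> l"
    and a: "\<forall>j. tree.cell_const j (a j)"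
  let ?L = "vnorm X q (weight w) {..<n} (\<lambda>j y. if child_index (Suc j) y = l
      then a j y * (child_volume_inverse j * sum (weight \<sigma>) (kernels.part k j y)) else 0)"
  let ?R = "vnorm X p (weight \<sigma>) {..<n} (\<lambda>j x. if child_index (Suc j) x = k then a j x else 0)"
  define Cells where "Cells = (\<Union>j<n. gcell (k1 + int j) ` X)"
  define pick where "pick Q = (SOME x. x \<in> X \<and> x \<in> Q)" for Q :: "'n point_set"
  define gen where "gen Q = (THE j. Q \<in> D (k1 + int j))" for Q
  define b where "b Q = (if Q \<in> Cells then a (gen Q) (pick Q) else 0)" for Q
  define c where "c Q = measure \<sigma> (ch Q k) / vol (ch Q k)" for Q
  have finC: "finite Cells" unfolding Cells_def using finite_X by auto
  have b_eq: "b (gcell (k1 + int j) y) = a j y" if y: "y \<in> X" and j: "j < n" for j y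
  proof -
    let ?Q = "gcell (k1 + int j) y"
    have "gen ?Q = j" unfolding gen_def
    proof (rule the_equality)
      fix i assume "?Q \<in> D (k1 + int i)"
      from generation_unique[OF this gcell_in] show "i = j" by simp
    qed simp
    moreover have "pick ?Q \<in> X \<and> pick ?Q \<in> ?Q" unfolding pick_def by (rule someI[of _ y]) (simp add: y)
    then have "a j (pick ?Q) = a j y" using a y by (intro tree.cell_constD[of j "a j" y]) (auto simp: cell_def)
    moreover have "?Q \<in> Cells" using y j by (auto simp: Cells_def)
    ultimately show ?thesis by (simp add: b_def)
  qed
  have ind: "atomic (indicator (ch Q m) :: real ^ 'n \<Rightarrow> real)" if Q: "Q \<in> Cells" and m: "m \<in> {1..2 ^ CARD('n)}" for Q m
  proof -
    obtain j x where j: "j < n" "x \<in> X" "Q = gcell (k1 + int j) x" using Q by (auto simp: Cells_def)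
    obtain z where z: "z \<in> Q" "ch Q m = gcell (k1 + int (Suc j)) z"
      using ch_gcell[OF m, of "k1 + int j" x] j(3) by (auto simp: add_ac)
    have "z \<in> \<Union>Tops" using subcell_in_Tops[OF j(2)] z j by simp
    then show ?thesis unfolding z(2) using j by (intro indicator_subcell_atomic) auto
  qed
  have collect: "(\<Sum>Q\<in>Cells. h Q * indicator (ch Q m) y)
      = (\<Sum>j<n. if child_index (Suc j) y = m then h (gcell (k1 + int j) y) else 0)"
    if y: "y \<in> X" and m: "m \<in> {1..2 ^ CARD('n)}" for h :: "'n point_set \<Rightarrow> real" and m y
  proof -
    have "(\<Sum>Q\<in>Cells. h Q * indicator (ch Q m) y) = (\<Sum>Q\<in>(\<lambda>j. gcell (k1 + int j) y) ` {..<n}. h Q * indicator (ch Q m) y)"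
    proof (rule sum.mono_neutral_right[OF finC])
      show "(\<lambda>j. gcell (k1 + int j) y) ` {..<n} \<subseteq> Cells" using y by (auto simp: Cells_def)
      show "\<forall>Q\<in>Cells - (\<lambda>j. gcell (k1 + int j) y) ` {..<n}. h Q * indicator (ch Q m) y = 0"
      proof
        fix Q assume Q: "Q \<in> Cells - (\<lambda>j. gcell (k1 + int j) y) ` {..<n}"
        then obtain j x where j: "j < n" "x \<in> X" "Q = gcell (k1 + int j) x" by (auto simp: Cells_def)
        have "y \<notin> Q" using Q j gcell_eq by blast
        moreover obtain z where "z \<in> Q" "ch Q m = gcell (k1 + int j + 1) z" using ch_gcell[OF m] j by metis
        ultimately have "y \<notin> ch Q m" using gcell_Suc[of "k1 + int j" z] gcell_eq[of z "k1 + int j" x] j by auto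
        then show "h Q * indicator (ch Q m) y = 0" by simp
      qed
    qed
    also have "\<dots> = (\<Sum>j<n. h (gcell (k1 + int j) y) * indicator (ch (gcell (k1 + int j) y) m) y)"
    proof (subst sum.reindex)
      show "inj_on (\<lambda>j. gcell (k1 + int j) y) {..<n}"
      proof (rule inj_onI)
        fix i j assume "gcell (k1 + int i) y = gcell (k1 + int j) y"
        then have "k1 + int i = k1 + int j" using generation_unique gcell_in by metis
        then show "i = j" by simp
      qed
    qed simp
    also have "\<dots> = (\<Sum>j<n. if child_index (Suc j) y = m then h (gcell (k1 + int j) y) else 0)"
      by (rule sum.cong[OF refl]) (simp add: child_index_iff[OF m])
    finally show ?thesis .
  qed
  have inner: "epowr (\<Sum>\<^sub>\<infinity>Q\<in>cubes D. ennreal (h Q * indicator (ch Q m) z)) (1 / 2)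
      = ennreal (sqrt (\<Sum>Q\<in>Cells. h Q * indicator (ch Q m) z))"
    if h: "\<And>Q. Q \<notin> Cells \<Longrightarrow> h Q = 0" "\<And>Q. 0 \<le> h Q" for h :: "'n point_set \<Rightarrow> real" and m z
  proof -
    have "(\<Sum>\<^sub>\<infinity>Q\<in>cubes D. ennreal (h Q * indicator (ch Q m) z)) = (\<Sum>\<^sub>\<infinity>Q\<in>Cells. ennreal (h Q * indicator (ch Q m) z))"
    proof (rule infsum_cong_neutral)
      have "Cells \<subseteq> cubes D" unfolding Cells_def cubes_def using gcell_in by blast
      then show "ennreal (h Q * indicator (ch Q m) z) = 0" if "Q \<in> Cells - cubes D" for Q
        using that by blast
      show "ennreal (h Q * indicator (ch Q m) z) = 0" if "Q \<in> cubes D - Cells" for Q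
        using that h by simp
    qed simp
    also have "\<dots> = ennreal (\<Sum>Q\<in>Cells. h Q * indicator (ch Q m) z)"
      using h finC by (simp add: sum_ennreal)
    finally show ?thesis using h by (simp add: epowr_ennreal sum_nonneg powr_half_sqrt)
  qed
  have atF: "atomic (\<lambda>z. sqrt (\<Sum>Q\<in>Cells. h Q * indicator (ch Q m) z))"
    if m: "m \<in> {1..2 ^ CARD('n)}" for h :: "'n point_set \<Rightarrow> real" and m
  proof (rule atomicI)
    fix x z assume "z \<in> atom x"
    then have "indicator (ch Q m) z = (indicator (ch Q m) x :: real)" if "Q \<in> Cells" for Q
      using ind[OF that m] by (simp add: atomic_def)
    then show "sqrt (\<Sum>Q\<in>Cells. h Q * indicator (ch Q m) z) = sqrt (\<Sum>Q\<in>Cells. h Q * indicator (ch Q m) x)"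
      by (intro arg_cong[where f = sqrt] sum.cong refl) simp
  next
    fix z assume "z \<notin> \<Union>Tops"
    then have "indicator (ch Q m) z = (0 :: real)" if "Q \<in> Cells" for Q
      using ind[OF that m] by (simp add: atomic_def)
    then have "(\<Sum>Q\<in>Cells. h Q * indicator (ch Q m) z) = 0" by (intro sum.neutral) simp
    then show "sqrt (\<Sum>Q\<in>Cells. h Q * indicator (ch Q m) z) = 0" by simp
  qed
  define FL where "FL z = sqrt (\<Sum>Q\<in>Cells. (b Q * c Q)\<^sup>2 * indicator (ch Q l) z)" for z
  define FR where "FR z = sqrt (\<Sum>Q\<in>Cells. (b Q)\<^sup>2 * indicator (ch Q k) z)" for z
  have FL: "atomic FL" "\<And>z. 0 \<le> FL z" and FR: "atomic FR" "\<And>z. 0 \<le> FR z"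
    unfolding FL_def[abs_def] FR_def[abs_def] using atF[OF l] atF[OF k] by (auto intro!: sum_nonneg)
  have "eLp_norm q w (\<lambda>z. ennreal (FL z)) \<le> C * eLp_norm p \<sigma> (\<lambda>z. ennreal (FR z))"
  proof -
    have 1: "(\<lambda>x. epowr (\<Sum>\<^sub>\<infinity>Q\<in>cubes D. ennreal ((b Q * (measure \<sigma> (ch Q k) / vol (ch Q k)))\<^sup>2 * indicator (ch Q l) x)) (1 / 2))
      = (\<lambda>z. ennreal (FL z))"
      unfolding FL_def[abs_def] c_def by (rule ext, rule inner) (auto simp: b_def)
    have 2: "(\<lambda>x. epowr (\<Sum>\<^sub>\<infinity>Q\<in>cubes D. ennreal ((b Q)\<^sup>2 * indicator (ch Q k) x)) (1 / 2)) = (\<lambda>z. ennreal (FR z))"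
      unfolding FR_def[abs_def] by (rule ext, rule inner) (auto simp: b_def)
    have "eLp_norm q w (\<lambda>x. epowr (\<Sum>\<^sub>\<infinity>Q\<in>cubes D. ennreal ((b Q * (measure \<sigma> (ch Q k) / vol (ch Q k)))\<^sup>2 * indicator (ch Q l) x)) (1 / 2))
      \<le> C * eLp_norm p \<sigma> (\<lambda>x. epowr (\<Sum>\<^sub>\<infinity>Q\<in>cubes D. ennreal ((b Q)\<^sup>2 * indicator (ch Q k) x)) (1 / 2))"
      using A(1) k l kl unfolding quad_Astar_bound_def by blast
    then show ?thesis unfolding 1 2 .
  qed
  moreover have "eLp_norm r \<mu> (\<lambda>z. ennreal (F z)) = ennreal (wnorm X r (weight \<mu>) F)"
    if "atomic F" "\<And>z. 0 \<le> F z" "radon_measure \<mu>" "1 < r" for r \<mu> and F :: "real ^ 'n \<Rightarrow> real"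
    using Lp_norm_atomic[OF that(3,1), of r] that by (simp add: Lp_norm_def)
  ultimately have "ennreal (wnorm X q (weight w) FL) \<le> C * ennreal (wnorm X p (weight \<sigma>) FR)"
    using FL FR pq \<sigma> w by simp
  then have "wnorm X q (weight w) FL \<le> enn2real C * wnorm X p (weight \<sigma>) FR"
    by (intro ennreal_le_mult_real A) auto
  moreover have "wnorm X q (weight w) FL = ?L"
  proof -
    have cy: "c (gcell (k1 + int j) y) = child_volume_inverse j * sum (weight \<sigma>) (kernels.part k j y)"
      if y: "y \<in> X" and j: "j < n" for j y
    proof -
      let ?Q = "gcell (k1 + int j) y"
      obtain z where z: "z \<in> ?Q" "ch ?Q k = gcell (k1 + int j + 1) z" using ch_gcell[OF k] by blast
      have zT: "z \<in> \<Union>Tops" using subcell_in_Tops[OF y z(1)] .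
      have z2: "ch ?Q k = gcell (k1 + int (Suc j)) z" using z(2) by (simp add: add_ac)
      have sub: "ch ?Q k \<subseteq> ?Q" using z gcell_Suc[of "k1 + int j" z] gcell_eq[OF z(1)] by simp
      have p1: "kernels.part k j y = X \<inter> ch ?Q k"
      proof -
        have "child_index (Suc j) x = k \<longleftrightarrow> x \<in> ch ?Q k" if "x \<in> ?Q" for x
          using child_index_iff[OF k, of j x] gcell_eq[OF that] by simp
        then show ?thesis using sub by (auto simp: kernels.part_def cell_def)
      qed
      have p2: "measure \<sigma> (ch ?Q k) = sum (weight \<sigma>) (X \<inter> ch ?Q k)"
        unfolding z2 using j zT by (intro measure_subcell \<sigma>) auto
      have p3: "1 / vol (ch ?Q k) = child_volume_inverse j"
        unfolding z(2) child_volume_inverse_def by (rule inverse_vol_gcell)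
      have "c ?Q = (1 / vol (ch ?Q k)) * measure \<sigma> (ch ?Q k)" unfolding c_def by simp
      then show ?thesis unfolding p1 p2 p3 .
    qed
    have "FL y = modulus {..<n} (\<lambda>j y. if child_index (Suc j) y = l
      then a j y * (child_volume_inverse j * sum (weight \<sigma>) (kernels.part k j y)) else 0) y" if y: "y \<in> X" for y
    proof -
      have "(\<Sum>Q\<in>Cells. (b Q * c Q)\<^sup>2 * indicator (ch Q l) y)
        = (\<Sum>j<n. if child_index (Suc j) y = l then (b (gcell (k1 + int j) y) * c (gcell (k1 + int j) y))\<^sup>2 else 0)"
        by (rule collect[OF y l])
      also have "\<dots> = (\<Sum>j<n. (if child_index (Suc j) y = l
        then a j y * (child_volume_inverse j * sum (weight \<sigma>) (kernels.part k j y)) else 0)\<^sup>2)"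
        by (rule sum.cong[OF refl]) (auto simp: b_eq[OF y] cy[OF y])
      finally show ?thesis by (simp add: FL_def modulus_def)
    qed
    then show ?thesis unfolding vnorm_def wnorm_def by simp
  qed
  moreover have "wnorm X p (weight \<sigma>) FR = ?R"
  proof -
    have "FR y = modulus {..<n} (\<lambda>j x. if child_index (Suc j) x = k then a j x else 0) y" if y: "y \<in> X" for y
    proof -
      have "(\<Sum>Q\<in>Cells. (b Q)\<^sup>2 * indicator (ch Q k) y)
        = (\<Sum>j<n. if child_index (Suc j) y = k then (b (gcell (k1 + int j) y))\<^sup>2 else 0)"
        by (rule collect[OF y k])
      also have "\<dots> = (\<Sum>j<n. (if child_index (Suc j) y = k then a j y else 0)\<^sup>2)"
        by (rule sum.cong[OF refl]) (auto simp: b_eq[OF y])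
      finally show ?thesis by (simp add: FR_def modulus_def)
    qed
    then show ?thesis unfolding vnorm_def wnorm_def by simp
  qed
  ultimately show "?L \<le> enn2real C * ?R" by simp
qed

definition square_bound :: "real \<Rightarrow> real \<Rightarrow> real \<Rightarrow> bool" where
  "square_bound p q r \<longleftrightarrow> (\<forall>F. vnorm X q (weight w) Us (\<lambda>u. kernels.image u (F u)) \<le> r * vnorm X p (weight \<sigma>) Us F)"

lemma shift_sum_atomic:
  assumes "Us = {1..U}"
  shows "atomic (\<lambda>z. \<Sum>u=1..U. \<epsilon> u * shift_op D \<sigma> (S u) (f u) z)"
proof (rule atomicI)
  fix x z assume z: "z \<in> atom x"
  have "shift_op D \<sigma> (S u) (f u) z = shift_op D \<sigma> (S u) (f u) x" if "u \<in> {1..U}" for u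
    using shift_op_atomic[of u "f u"] that assms z by (simp add: atomic_def)
  then show "(\<Sum>u=1..U. \<epsilon> u * shift_op D \<sigma> (S u) (f u) z) = (\<Sum>u=1..U. \<epsilon> u * shift_op D \<sigma> (S u) (f u) x)"
    by (intro sum.cong refl) simp
next
  fix z assume z: "z \<notin> \<Union>Tops"
  have "shift_op D \<sigma> (S u) (f u) z = 0" if "u \<in> {1..U}" for u
    using shift_op_atomic[of u "f u"] that assms z by (simp add: atomic_def)
  then show "(\<Sum>u=1..U. \<epsilon> u * shift_op D \<sigma> (S u) (f u) z) = 0" by (intro sum.neutral) auto
qed

lemma Lp_norm_shift_sum:
  assumes Us: "Us = {1..U}" and f: "\<And>u. u \<in> {1..U} \<Longrightarrow> f u \<in> Lp_space p \<sigma>" and pq: "1 < p" "1 < q"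
  shows "Lp_norm q w (\<lambda>z. \<Sum>u=1..U. \<epsilon> u * shift_op D \<sigma> (S u) (f u) z)
    = ennreal (wnorm X q (weight w) (\<lambda>x. \<Sum>u=1..U. \<epsilon> u * kernels.image u (local_mean \<sigma> (f u)) x))"
proof -
  have "(\<Sum>u=1..U. \<epsilon> u * shift_op D \<sigma> (S u) (f u) x) = (\<Sum>u=1..U. \<epsilon> u * kernels.image u (local_mean \<sigma> (f u)) x)" for x
    using shift_op_image[of _ _ p x] f Us pq by (intro sum.cong refl) auto
  then show ?thesis
    using Lp_norm_atomic[OF w shift_sum_atomic[OF Us], of q \<epsilon> f] pq by simp
qed

text \<open>Khintchine's inequalities pass from random sums to square functions and back. The functions may be replaced
  by their means over the atoms, as this does not change the left-hand side and does not increase the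
  right-hand side.\<close>
lemma R_inequality:
  assumes Us: "Us = {1..U}" and f: "\<And>u. u \<in> {1..U} \<Longrightarrow> f u \<in> Lp_space p \<sigma>" and pq: "1 < p" "1 < q"
    and r: "square_bound p q r" "0 \<le> r"
  shows "(\<integral>\<^sup>+\<epsilon>. Lp_norm q w (\<lambda>x. \<Sum>u=1..U. \<epsilon> u * shift_op D \<sigma> (S u) (f u) x) \<partial>measure_pmf (random_signs U))
    \<le> ennreal (khintchine_const q powr (1/q) * khintchine_lower_const * r)
       * (\<integral>\<^sup>+\<epsilon>. Lp_norm p \<sigma> (\<lambda>x. \<Sum>u=1..U. \<epsilon> u * f u x) \<partial>measure_pmf (random_signs U))"
proof -
  define F where "F u = local_mean \<sigma> (f u)" for u
  define W where "W \<epsilon> = wnorm X p (weight \<sigma>) (\<lambda>x. \<Sum>u=1..U. \<epsilon> u * F u x)" for \<epsilon>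
  have kq: "0 \<le> khintchine_const q powr (1/q)" by simp
  have "(\<integral>\<^sup>+\<epsilon>. Lp_norm q w (\<lambda>x. \<Sum>u=1..U. \<epsilon> u * shift_op D \<sigma> (S u) (f u) x) \<partial>measure_pmf (random_signs U))
    = ennreal (sign_mean U (\<lambda>\<epsilon>. wnorm X q (weight w) (\<lambda>x. \<Sum>u=1..U. \<epsilon> u * kernels.image u (F u) x)))"
  proof -
    have "Lp_norm q w (\<lambda>x. \<Sum>u=1..U. \<epsilon> u * shift_op D \<sigma> (S u) (f u) x)
      = ennreal (wnorm X q (weight w) (\<lambda>x. \<Sum>u=1..U. \<epsilon> u * kernels.image u (F u) x))" for \<epsilon>
      unfolding F_def by (rule Lp_norm_shift_sum[OF Us _ pq]) (rule f)
    then show ?thesis by (simp only:) (rule nn_integral_random_signs, simp)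
  qed
  also have "\<dots> \<le> ennreal (khintchine_const q powr (1/q) * khintchine_lower_const * r * sign_mean U W)"
  proof (rule ennreal_leI)
    have 1: "vnorm X q (weight w) {1..U} (\<lambda>u. kernels.image u (F u)) \<le> r * vnorm X p (weight \<sigma>) {1..U} F"
      using r(1) Us unfolding square_bound_def by blast
    have 2: "vnorm X p (weight \<sigma>) {1..U} F \<le> khintchine_lower_const * sign_mean U W"
      unfolding W_def by (rule vnorm_le_sign_mean_wnorm[OF finite_X weight_nonneg pq(1)])
    have "sign_mean U (\<lambda>\<epsilon>. wnorm X q (weight w) (\<lambda>x. \<Sum>u=1..U. \<epsilon> u * kernels.image u (F u) x))
      \<le> khintchine_const q powr (1/q) * vnorm X q (weight w) {1..U} (\<lambda>u. kernels.image u (F u))"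
      by (rule sign_mean_wnorm_le_vnorm[OF weight_nonneg pq(2)])
    also have "\<dots> \<le> khintchine_const q powr (1/q) * (r * (khintchine_lower_const * sign_mean U W))"
      by (rule mult_left_mono[OF order.trans[OF 1 mult_left_mono[OF 2 r(2)]] kq])
    also have "\<dots> = khintchine_const q powr (1/q) * khintchine_lower_const * r * sign_mean U W"
      by (simp only: mult_ac)
    finally show "sign_mean U (\<lambda>\<epsilon>. wnorm X q (weight w) (\<lambda>x. \<Sum>u=1..U. \<epsilon> u * kernels.image u (F u) x))
      \<le> khintchine_const q powr (1/q) * khintchine_lower_const * r * sign_mean U W" .
  qed
  also have "\<dots> = ennreal (khintchine_const q powr (1/q) * khintchine_lower_const * r) * ennreal (sign_mean U W)"
    using r(2) khintchine_lower_const_pos by (intro ennreal_mult) (auto simp: W_def intro!: sign_mean_nonneg)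
  also have "ennreal (sign_mean U W) = (\<integral>\<^sup>+\<epsilon>. ennreal (W \<epsilon>) \<partial>measure_pmf (random_signs U))"
    by (rule nn_integral_random_signs[symmetric]) (simp add: W_def)
  also have "\<dots> \<le> (\<integral>\<^sup>+\<epsilon>. Lp_norm p \<sigma> (\<lambda>x. \<Sum>u=1..U. \<epsilon> u * f u x) \<partial>measure_pmf (random_signs U))"
  proof (intro nn_integral_mono)
    fix \<epsilon> :: "nat \<Rightarrow> real"
    let ?g = "\<lambda>x. \<Sum>u=1..U. \<epsilon> u * f u x"
    have meas: "?g \<in> borel_measurable \<sigma>" using f by (intro borel_measurable_sum borel_measurable_times) (auto simp: Lp_space_def)
    have W: "W \<epsilon> = wnorm X p (weight \<sigma>) (local_mean \<sigma> ?g)"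
    proof -
      have "local_mean \<sigma> ?g x = (\<Sum>u=1..U. \<epsilon> u * F u x)" for x
        unfolding F_def by (rule local_mean_sum[OF \<sigma> f]) (use pq in auto)
      then have "local_mean \<sigma> ?g = (\<lambda>x. \<Sum>u=1..U. \<epsilon> u * F u x)" by (rule ext)
      then show ?thesis by (simp only: W_def)
    qed
    show "ennreal (W \<epsilon>) \<le> Lp_norm p \<sigma> ?g"
    proof (cases "Lp_norm p \<sigma> ?g < \<infinity>")
      case True
      then have "?g \<in> Lp_space p \<sigma>" using meas by (simp add: Lp_space_def)
      then show ?thesis unfolding W by (rule wnorm_local_mean_le[OF \<sigma> _ pq(1)])
    next
      case False
      then have "Lp_norm p \<sigma> ?g = top" by (simp add: not_less top_unique)
      then show ?thesis by simp
    qed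
  qed
  finally show ?thesis by (simp add: mult_left_mono)
qed

definition extend :: "(real ^ 'n \<Rightarrow> real) \<Rightarrow> real ^ 'n \<Rightarrow> real" where
  "extend F z = (if z \<in> \<Union>Tops then F (rep (atom z)) else 0)"

lemma extend_atomic: "atomic (extend F)"
proof (rule atomicI)
  fix x z assume z: "z \<in> atom x"
  then have "z \<in> gcell k1 x" using gcell_mono[of k1 "k1 + int n" x] by auto
  then have "z \<in> T \<longleftrightarrow> x \<in> T" if "T \<in> Tops" for T using Top_gcell[OF that] gcell_eq gcell_self by metis
  then show "extend F z = extend F x" using gcell_eq[OF z] by (auto simp: extend_def)
qed (simp add: extend_def)

lemma extend_eq: "x \<in> X \<Longrightarrow> extend F x = F x"
  using X_in_Top[of x] rep_atom[of x] by (auto simp: extend_def)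

lemma square_bound_of_R_bound:
  assumes Us: "Us = {1..U}" "1 \<le> U" and R: "R_bound p \<sigma> q w \<T> C" "C < \<infinity>"
    and T: "\<And>u. u \<in> {1..U} \<Longrightarrow> shift_op D \<sigma> (S u) \<in> \<T>" and pq: "1 < p" "1 < q"
  shows "square_bound p q (khintchine_lower_const * enn2real C * (khintchine_const p powr (1/p)))"
  unfolding square_bound_def
proof (intro allI)
  fix F :: "nat \<Rightarrow> real ^ 'n \<Rightarrow> real"
  define f where "f u = extend (F u)" for u
  have f: "f u \<in> Lp_space p \<sigma>" for u
    unfolding f_def using pq by (intro atomic_Lp_space[OF \<sigma> extend_atomic]) auto
  have im: "kernels.image u (local_mean \<sigma> (f u)) y = kernels.image u (F u) y" for u y
  proof -
    have "kernels.image u (local_mean \<sigma> (f u)) y = kernels.image u (extend (F u)) y"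
      unfolding f_def by (rule image_local_mean_atomic[OF extend_atomic])
    also have "\<dots> = kernels.image u (F u) y"
      unfolding kernels.image_def by (intro sum.cong refl) (simp add: extend_eq)
    finally show ?thesis .
  qed
  define NL where "NL \<epsilon> = wnorm X q (weight w) (\<lambda>x. \<Sum>u=1..U. \<epsilon> u * kernels.image u (F u) x)" for \<epsilon>
  define NR where "NR \<epsilon> = wnorm X p (weight \<sigma>) (\<lambda>x. \<Sum>u=1..U. \<epsilon> u * F u x)" for \<epsilon>
  have L: "Lp_norm q w (\<lambda>x. \<Sum>u=1..U. \<epsilon> u * shift_op D \<sigma> (S u) (f u) x) = ennreal (NL \<epsilon>)" for \<epsilon>
    using Lp_norm_shift_sum[OF Us(1) f pq, of \<epsilon>] by (simp add: NL_def im)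
  have Rn: "Lp_norm p \<sigma> (\<lambda>x. \<Sum>u=1..U. \<epsilon> u * f u x) = ennreal (NR \<epsilon>)" for \<epsilon>
  proof -
    have "atomic (\<lambda>x. \<Sum>u=1..U. \<epsilon> u * f u x)"
      using extend_atomic unfolding atomic_def f_def by (auto intro!: sum.cong)
    then have "Lp_norm p \<sigma> (\<lambda>x. \<Sum>u=1..U. \<epsilon> u * f u x) = ennreal (wnorm X p (weight \<sigma>) (\<lambda>x. \<Sum>u=1..U. \<epsilon> u * f u x))"
      using pq by (intro Lp_norm_atomic[OF \<sigma>]) auto
    also have "wnorm X p (weight \<sigma>) (\<lambda>x. \<Sum>u=1..U. \<epsilon> u * f u x) = NR \<epsilon>"
      by (simp add: NR_def wnorm_def f_def extend_eq)
    finally show ?thesis .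
  qed
  have "(\<integral>\<^sup>+\<epsilon>. Lp_norm q w (\<lambda>x. \<Sum>u=1..U. \<epsilon> u * shift_op D \<sigma> (S u) (f u) x) \<partial>measure_pmf (random_signs U))
    \<le> C * (\<integral>\<^sup>+\<epsilon>. Lp_norm p \<sigma> (\<lambda>x. \<Sum>u=1..U. \<epsilon> u * f u x) \<partial>measure_pmf (random_signs U))"
    using R(1)[unfolded R_bound_def, THEN spec, THEN mp, OF Us(2), THEN spec[of _ "\<lambda>u. shift_op D \<sigma> (S u)"], THEN spec[of _ f]]
      T f by simp
  then have "ennreal (sign_mean U NL) \<le> C * ennreal (sign_mean U NR)"
    unfolding L Rn by (subst (asm) (1 2) nn_integral_random_signs) (simp_all add: NL_def NR_def)
  then have le: "sign_mean U NL \<le> enn2real C * sign_mean U NR"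
    by (intro ennreal_le_mult_real R) (auto simp: NR_def intro!: sign_mean_nonneg)
  have "vnorm X q (weight w) {1..U} (\<lambda>u. kernels.image u (F u)) \<le> khintchine_lower_const * sign_mean U NL"
    unfolding NL_def by (rule vnorm_le_sign_mean_wnorm[OF finite_X weight_nonneg pq(2)])
  also have "\<dots> \<le> khintchine_lower_const * (enn2real C * sign_mean U NR)"
    using le khintchine_lower_const_pos by (intro mult_left_mono) auto
  also have "\<dots> \<le> khintchine_lower_const * (enn2real C * (khintchine_const p powr (1/p) * vnorm X p (weight \<sigma>) {1..U} F))"
    unfolding NR_def using khintchine_lower_const_pos
    by (intro mult_left_mono sign_mean_wnorm_le_vnorm[OF weight_nonneg pq(1)]) auto
  finally show "vnorm X q (weight w) Us (\<lambda>u. kernels.image u (F u))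
    \<le> khintchine_lower_const * enn2real C * (khintchine_const p powr (1/p)) * vnorm X p (weight \<sigma>) Us F"
    by (simp add: Us mult_ac)
qed

lemma square_bound_testing:
  assumes Us: "Us = {1..U}" and r: "square_bound p q r" "0 \<le> r" and pq: "1 < p" "1 < q"
    and Q: "\<And>u. u \<in> {1..U} \<Longrightarrow> atomic (indicator (Q u) :: real ^ 'n \<Rightarrow> real)"
  shows "Lp_norm q w (\<lambda>x. sqrt (\<Sum>u=1..U. (a u * indicator (Q u) x * shift_op D \<sigma> (S u) (indicator (Q u)) x)\<^sup>2))
    \<le> ennreal r * Lp_norm p \<sigma> (\<lambda>x. sqrt (\<Sum>u=1..U. (a u)\<^sup>2 * indicator (Q u) x))"
proof -
  define F where "F u x = a u * indicator (Q u) x" for u and x :: "real ^ 'n"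
  let ?L = "\<lambda>x. sqrt (\<Sum>u=1..U. (a u * indicator (Q u) x * shift_op D \<sigma> (S u) (indicator (Q u)) x)\<^sup>2)"
  let ?R = "\<lambda>x. sqrt (\<Sum>u=1..U. (a u)\<^sup>2 * indicator (Q u) x)"
  have opa: "atomic (shift_op D \<sigma> (S u) f)" if "u \<in> {1..U}" for u f
    using shift_op_atomic[of u f] that Us by simp
  have at: "atomic ?L" "atomic ?R"
    using Q opa unfolding atomic_def by (auto intro!: sum.cong sum.neutral)
  have L: "\<bar>?L x\<bar> \<le> \<bar>modulus {1..U} (\<lambda>u. kernels.image u (F u)) x\<bar>" for x
  proof -
    have "(a u * indicator (Q u) x * shift_op D \<sigma> (S u) (indicator (Q u)) x)\<^sup>2 \<le> (kernels.image u (F u) x)\<^sup>2"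
      if u: "u \<in> {1..U}" for u
    proof -
      have "shift_op D \<sigma> (S u) (indicator (Q u)) x = kernels.image u (indicator (Q u)) x"
        using shift_op_image[of u "indicator (Q u)" 1 x] u Us atomic_Lp_space[OF \<sigma> Q[OF u], of 1]
          image_local_mean_atomic[OF Q[OF u], of u x] by simp
      moreover have "kernels.image u (F u) x = a u * kernels.image u (indicator (Q u)) x"
        unfolding kernels.image_def F_def sum_distrib_left by (intro sum.cong refl) (simp only: mult_ac)
      ultimately have "kernels.image u (F u) x = a u * shift_op D \<sigma> (S u) (indicator (Q u)) x" by simp
      then show ?thesis by (simp add: indicator_def)
    qed
    then have "?L x \<le> modulus {1..U} (\<lambda>u. kernels.image u (F u)) x"
      unfolding modulus_def by (intro real_sqrt_le_mono sum_mono) auto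
    moreover have "0 \<le> ?L x" by (simp add: sum_nonneg)
    ultimately show ?thesis by simp
  qed
  have R: "?R x = modulus {1..U} F x" for x
    unfolding modulus_def F_def by (intro arg_cong[where f = sqrt] sum.cong refl) (simp add: indicator_def power_mult_distrib)
  have "wnorm X q (weight w) ?L \<le> vnorm X q (weight w) {1..U} (\<lambda>u. kernels.image u (F u))"
    unfolding vnorm_def using L pq by (intro wnorm_mono[OF weight_nonneg]) auto
  also have "\<dots> \<le> r * vnorm X p (weight \<sigma>) {1..U} F"
    using r(1) Us unfolding square_bound_def by blast
  also have "vnorm X p (weight \<sigma>) {1..U} F = wnorm X p (weight \<sigma>) ?R"
    unfolding vnorm_def by (simp only: R)
  finally have "ennreal (wnorm X q (weight w) ?L) \<le> ennreal r * ennreal (wnorm X p (weight \<sigma>) ?R)"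
    using r(2) by (simp add: ennreal_mult[symmetric] ennreal_leI)
  then show ?thesis
    using Lp_norm_atomic[OF w at(1), of q] Lp_norm_atomic[OF \<sigma> at(2), of p] pq by simp
qed

text \<open>The adjoint of a bounded operator on \<open>L\<^sup>p(\<ell>\<^sup>2)\<close> is bounded with the same constant.\<close>
lemma square_bound_dual:
  assumes r: "square_bound p q r" "0 \<le> r" and pq: "1 < p" "1 < q"
  shows "shift_discretization.square_bound D k1 n Tops w \<sigma> (\<lambda>u. flip (S u)) Us (conj_exp q) (conj_exp p) r"
proof -
  interpret fl: shift_discretization D k1 n Tops w \<sigma> "\<lambda>u. flip (S u)" Us \<kappa> ch by (rule flipped)
  have p': "1 < conj_exp p" "conj_exp (conj_exp p) = p" using pq conj_exp_gt_1 conj_exp_conj_exp by auto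
  show ?thesis
    unfolding fl.square_bound_def
  proof (intro allI, rule vnorm_le_by_duality[OF p'(1) weight_nonneg])
    fix G :: "nat \<Rightarrow> real ^ 'n \<Rightarrow> real" and F :: "nat \<Rightarrow> real ^ 'n \<Rightarrow> real"
    show "0 \<le> r * vnorm X (conj_exp q) (weight w) Us G" using r by simp
    have "(\<Sum>x\<in>X. weight \<sigma> x * (\<Sum>u\<in>Us. fl.kernels.image u (G u) x * F u x))
      = (\<Sum>x\<in>X. \<Sum>u\<in>Us. \<Sum>y\<in>X. weight \<sigma> x * weight w y * kernel (S u) x y * F u x * G u y)"
      by (simp add: fl.kernels.image_def kernel_flip sum_distrib_left sum_distrib_right mult_ac)
    also have "\<dots> = (\<Sum>u\<in>Us. \<Sum>y\<in>X. \<Sum>x\<in>X. weight \<sigma> x * weight w y * kernel (S u) x y * F u x * G u y)"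
      by (subst sum.swap, rule sum.cong[OF refl], rule sum.swap)
    also have "\<dots> = (\<Sum>y\<in>X. weight w y * (\<Sum>u\<in>Us. kernels.image u (F u) y * G u y))"
      by (subst sum.swap) (simp add: kernels.image_def sum_distrib_left sum_distrib_right mult_ac)
    also have "\<dots> \<le> vnorm X q (weight w) Us (\<lambda>u. kernels.image u (F u)) * vnorm X (conj_exp q) (weight w) Us G"
      using vnorm_Holder[OF finite_X weight_nonneg[of w] pq(2), where I = Us and F = "\<lambda>u. kernels.image u (F u)" and G = G] by linarith
    also have "\<dots> \<le> (r * vnorm X p (weight \<sigma>) Us F) * vnorm X (conj_exp q) (weight w) Us G"
      using r(1) unfolding square_bound_def by (intro mult_right_mono) auto
    finally show "(\<Sum>x\<in>X. weight \<sigma> x * (\<Sum>u\<in>Us. fl.kernels.image u (G u) x * F u x))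
      \<le> r * vnorm X (conj_exp q) (weight w) Us G * vnorm X (conj_exp (conj_exp p)) (weight \<sigma>) Us F"
      by (simp add: p'(2) mult_ac)
  qed
qed

end

section \<open>R-boundedness and quadratic testing\<close>

lemma (in dyadic) discretization_exists:
  assumes fin: "finite \<C>" and sub: "\<C> \<subseteq> cubes D"
  obtains k1 n Tops where "discretization D k1 Tops"
    "\<And>K. K \<in> \<C> \<Longrightarrow> \<exists>k. K \<in> D k \<and> k1 \<le> k \<and> k + int \<kappa> + 1 \<le> k1 + int n \<and> (\<exists>T\<in>Tops. K \<subseteq> T)"
proof -
  define g where "g K = (SOME k. K \<in> D k)" for K
  have g: "K \<in> D (g K)" if "K \<in> \<C>" for K
    unfolding g_def using sub that by (intro someI_ex[of "\<lambda>k. K \<in> D k"]) (auto simp: cubes_def)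
  define k1 where "k1 = Min (insert 0 (g ` \<C>))"
  define k2 where "k2 = Max (insert 0 (g ` \<C>))"
  \<comment> \<open>deep enough for the atoms to resolve Haar functions \<open>\<kappa>\<close> generations below the smallest cube\<close>
  define n where "n = nat (k2 - k1 + int \<kappa> + 1)"
  define pick where "pick K = (SOME x. x \<in> K)" for K :: "'n point_set"
  define Tops where "Tops = (\<lambda>K. gcell k1 (pick K)) ` \<C>"
  have k: "k1 \<le> 0" "0 \<le> k2" unfolding k1_def k2_def by (rule Min_le Max_ge, use fin in simp, simp)+
  have gk: "k1 \<le> g K" "g K \<le> k2" if "K \<in> \<C>" for K
    unfolding k1_def k2_def by (rule Min_le Max_ge, use fin in simp, use that in simp)+
  have n: "k1 + int n = k2 + int \<kappa> + 1" using k by (simp add: n_def)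
  have "discretization D k1 Tops"
    by unfold_locales (use fin in \<open>auto simp: Tops_def\<close>)
  then show thesis
  proof (rule that)
    fix K assume K: "K \<in> \<C>"
    obtain x where "K = gcell (g K) x" using D_nonempty[OF g[OF K]] by blast
    then have "x \<in> K" using gcell_self by metis
    then have "pick K \<in> K" unfolding pick_def by (rule someI)
    then have "K = gcell (g K) (pick K)" using gcell_unique[OF g[OF K]] by simp
    then have "K \<subseteq> gcell k1 (pick K)" using gcell_mono[OF gk(1)[OF K], of "pick K"] by simp
    then have "\<exists>T\<in>Tops. K \<subseteq> T" unfolding Tops_def using K by blast
    moreover have "k1 \<le> g K" "g K + int \<kappa> + 1 \<le> k1 + int n" using gk[OF K] n by auto
    ultimately show "\<exists>k. K \<in> D k \<and> k1 \<le> k \<and> k + int \<kappa> + 1 \<le> k1 + int n \<and> (\<exists>T\<in>Tops. K \<subseteq> T)"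
      using g[OF K] by blast
  qed
qed

locale shift_family = dyadic D for D :: "'n::finite lattice" +
  fixes ch :: "'n point_set \<Rightarrow> nat \<Rightarrow> 'n point_set" and \<sigma> w :: "(real ^ 'n) measure"
    and p q :: real and \<S> :: "'n shift_data set" and \<kappa> :: nat
  assumes enum: "child_enumeration D ch"
    and radon: "radon_measure \<sigma>" "radon_measure w"
    and exponents: "1 < p" "1 < q"
    and shifts: "S \<in> \<S> \<Longrightarrow> dyadic_shift D S" "S \<in> \<S> \<Longrightarrow> complexity S \<le> \<kappa>"
begin

lemma finite_support: "S \<in> \<S> \<Longrightarrow> finite (support S)"
  using shifts(1)[of S] by (simp add: dyadic_shift_def support_def)

text \<open>The cubes \<open>Q u\<close> are those on which the shifts are to be tested.\<close>
lemma common_discretization: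
  assumes S: "\<And>u. u \<in> {1..U} \<Longrightarrow> S u \<in> \<S>" and Q: "\<And>u. u \<in> {1..U} \<Longrightarrow> Q u \<in> cubes D"
  obtains k1 n Tops where "shift_discretization D k1 n Tops \<sigma> w S {1..U::nat} \<kappa> ch"
    "\<And>u. u \<in> {1..U} \<Longrightarrow> \<exists>j z. j \<le> n \<and> z \<in> \<Union>Tops \<and> Q u = gcell (k1 + int j) z"
proof -
  \<comment> \<open>all cubes that have to be visible in the discretization\<close>
  define \<C> where "\<C> = (\<Union>u\<in>{1..U}. support (S u)) \<union> Q ` {1..U}"
  have fin: "finite \<C>" using finite_support S by (auto simp: \<C>_def)
  have sub: "\<C> \<subseteq> cubes D" using Q by (auto simp: \<C>_def support_def)
  obtain k1 n Tops where disc: "discretization D k1 Tops"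
    and ad: "\<And>K. K \<in> \<C> \<Longrightarrow> \<exists>k. K \<in> D k \<and> k1 \<le> k \<and> k + int \<kappa> + 1 \<le> k1 + int n \<and> (\<exists>T\<in>Tops. K \<subseteq> T)"
    by (rule discretization_exists[OF fin sub, where \<kappa> = \<kappa>]) (rule that)
  have 1: "shift_discretization D k1 n Tops \<sigma> w S {1..U} \<kappa> ch"
  proof (intro shift_discretization.intro disc shift_discretization_axioms.intro)
    fix u K assume "u \<in> {1..U}" "K \<in> support (S u)"
    then have "K \<in> \<C>" unfolding \<C>_def by blast
    then show "\<exists>k. K \<in> D k \<and> k1 \<le> k \<and> k + int \<kappa> + 1 \<le> k1 + int n \<and> (\<exists>T\<in>Tops. K \<subseteq> T)" by (rule ad)
  qed (use radon enum S shifts in auto)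
  have 2: "\<exists>j z. j \<le> n \<and> z \<in> \<Union>Tops \<and> Q u = gcell (k1 + int j) z" if u: "u \<in> {1..U}" for u
  proof -
    have "Q u \<in> \<C>" unfolding \<C>_def using u by blast
    then obtain k T where k: "Q u \<in> D k" "k1 \<le> k" "k + int \<kappa> + 1 \<le> k1 + int n" "T \<in> Tops" "Q u \<subseteq> T"
      using ad by blast
    obtain z where z: "Q u = gcell k z" using D_nonempty[OF k(1)] by blast
    then have "z \<in> \<Union>Tops" using gcell_self[of z k] k(4,5) by blast
    moreover have n: "nat (k - k1) \<le> n" and e: "k1 + int (nat (k - k1)) = k" using k by auto
    ultimately have "nat (k - k1) \<le> n \<and> z \<in> \<Union>Tops \<and> Q u = gcell (k1 + int (nat (k - k1))) z"
      unfolding e using z by blast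
    then show ?thesis by (intro exI)
  qed
  show thesis by (rule that[OF 1 2])
qed

text \<open>The discretization depends on the shifts chosen, but the constants of the estimate on it do not.\<close>
lemma R_bound_of_testing:
  assumes T: "direct_testing_bound D p q \<sigma> w \<S> C1" "C1 < \<infinity>"
    and T': "dual_testing_bound D p q \<sigma> w \<S> C2" "C2 < \<infinity>"
    and A: "quad_Astar_bound D ch p q \<sigma> w C3" "C3 < \<infinity>"
  shows "R_bound p \<sigma> q w (shift_op D \<sigma> ` \<S>)
    (ennreal (khintchine_const q powr (1/q) * khintchine_lower_const * form_const p q (2 ^ CARD('n)))
     * ((1 + of_nat \<kappa>) * (C1 + C2) + (1 + of_nat \<kappa>)\<^sup>2 * C3))"
  unfolding R_bound_def
proof (intro allI impI)
  fix U :: nat and T f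
  assume "\<forall>u\<in>{1..U}. T u \<in> shift_op D \<sigma> ` \<S> \<and> f u \<in> Lp_space p \<sigma>"
  then have f: "\<And>u. u \<in> {1..U} \<Longrightarrow> f u \<in> Lp_space p \<sigma>"
    and "\<forall>u\<in>{1..U}. \<exists>S. S \<in> \<S> \<and> T u = shift_op D \<sigma> S" by auto
  then obtain S where S: "\<And>u. u \<in> {1..U} \<Longrightarrow> S u \<in> \<S>" and TS: "\<And>u. u \<in> {1..U} \<Longrightarrow> T u = shift_op D \<sigma> (S u)"
    by metis
  \<comment> \<open>no cube has to be tested, so an arbitrary one is supplied\<close>
  have cub: "gcell 0 0 \<in> cubes D" unfolding cubes_def using gcell_in by blast
  obtain k1 n Tops where disc: "shift_discretization D k1 n Tops \<sigma> w S {1..U} \<kappa> ch"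
    by (rule common_discretization[where S = S and U = U and Q = "\<lambda>_. gcell 0 0", OF S cub])
  interpret d: shift_discretization D k1 n Tops \<sigma> w S "{1..U}" \<kappa> ch by (rule disc)
  interpret fl: shift_discretization D k1 n Tops w \<sigma> "\<lambda>u. flip (S u)" "{1..U}" \<kappa> ch by (rule d.flipped)
  let ?M = "(1 + real \<kappa>) * (enn2real C1 + enn2real C2) + (1 + real \<kappa>)\<^sup>2 * enn2real C3"
  have conj: "1 < conj_exp p" "1 < conj_exp q" using exponents conj_exp_gt_1 by auto
  have t1: "d.kernels.quadratic_testing p q (enn2real C1)"
    by (rule d.testing_transfer[OF T exponents, of S]) (simp add: S)
  have "fl.kernels.quadratic_testing (conj_exp q) (conj_exp p) (enn2real C2)"
    by (rule fl.testing_transfer[OF T' conj(2,1), of S]) (simp add: S shift_adj_eq)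
  moreover have "(\<lambda>u. kernel (flip (S u))) = (\<lambda>u x y. kernel (S u) y x)"
    by (intro ext) (rule kernel_flip)
  ultimately have t2: "d.kernels.dual_quadratic_testing p q (enn2real C2)"
    unfolding d.kernels.dual_quadratic_testing_def by (simp only:)
  have t3: "d.kernels.off_diagonal p q (enn2real C3)"
    by (rule d.off_diagonal_transfer[OF A exponents])
  have fc: "0 \<le> form_const p q (2 ^ CARD('n))" using form_const_nonneg exponents by simp
  have M: "0 \<le> ?M" by (intro add_nonneg_nonneg mult_nonneg_nonneg) auto
  have sb: "d.square_bound p q (form_const p q (2 ^ CARD('n)) * ?M)"
  proof -
    have "real (card {1..2 ^ CARD('n) :: nat}) = 2 ^ CARD('n)" by simp
    note estimate = d.kernels.square_function_estimate[OF exponents t1 enn2real_nonneg t2 enn2real_nonneg t3 enn2real_nonneg, unfolded this]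
    show ?thesis unfolding d.square_bound_def by (rule allI) (rule estimate)
  qed
  have "(\<integral>\<^sup>+\<epsilon>. Lp_norm q w (\<lambda>x. \<Sum>u=1..U. \<epsilon> u * T u (f u) x) \<partial>measure_pmf (random_signs U))
    = (\<integral>\<^sup>+\<epsilon>. Lp_norm q w (\<lambda>x. \<Sum>u=1..U. \<epsilon> u * shift_op D \<sigma> (S u) (f u) x) \<partial>measure_pmf (random_signs U))"
    by (simp add: TS)
  also have "\<dots> \<le> ennreal (khintchine_const q powr (1/q) * khintchine_lower_const * (form_const p q (2 ^ CARD('n)) * ?M))
       * (\<integral>\<^sup>+\<epsilon>. Lp_norm p \<sigma> (\<lambda>x. \<Sum>u=1..U. \<epsilon> u * f u x) \<partial>measure_pmf (random_signs U))"
    by (rule d.R_inequality[OF refl f exponents sb mult_nonneg_nonneg[OF fc M]])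
  also have "ennreal (khintchine_const q powr (1/q) * khintchine_lower_const * (form_const p q (2 ^ CARD('n)) * ?M))
    = ennreal (khintchine_const q powr (1/q) * khintchine_lower_const * form_const p q (2 ^ CARD('n))) * ennreal ?M"
  proof (subst ennreal_mult[symmetric])
    show "0 \<le> khintchine_const q powr (1/q) * khintchine_lower_const * form_const p q (2 ^ CARD('n))"
      using fc khintchine_lower_const_pos by (intro mult_nonneg_nonneg) auto
  qed (simp_all only: mult.assoc M)
  also have "ennreal ?M = (1 + of_nat \<kappa>) * (C1 + C2) + (1 + of_nat \<kappa>)\<^sup>2 * C3"
  proof -
    have \<kappa>: "ennreal (1 + real \<kappa>) = 1 + of_nat \<kappa>" by (simp only: ennreal_plus ennreal_1 zero_le_one of_nat_0_le_iff ennreal_of_nat_eq_real_of_nat)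
    have C: "ennreal (enn2real C1) = C1" "ennreal (enn2real C2) = C2" "ennreal (enn2real C3) = C3"
      using T T' A by simp_all
    have "ennreal ?M = ennreal (1 + real \<kappa>) * (ennreal (enn2real C1) + ennreal (enn2real C2))
      + (ennreal (1 + real \<kappa>))\<^sup>2 * ennreal (enn2real C3)"
      by (subst ennreal_plus, simp, simp, subst ennreal_mult, simp, simp, subst ennreal_mult, simp, simp,
          subst ennreal_plus, simp, simp, subst ennreal_power[symmetric], simp, rule refl)
    then show ?thesis unfolding \<kappa> C .
  qed
  finally show "(\<integral>\<^sup>+\<epsilon>. Lp_norm q w (\<lambda>x. \<Sum>u=1..U. \<epsilon> u * T u (f u) x) \<partial>measure_pmf (random_signs U))
    \<le> ennreal (khintchine_const q powr (1/q) * khintchine_lower_const * form_const p q (2 ^ CARD('n)))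
     * ((1 + of_nat \<kappa>) * (C1 + C2) + (1 + of_nat \<kappa>)\<^sup>2 * C3)
     * (\<integral>\<^sup>+\<epsilon>. Lp_norm p \<sigma> (\<lambda>x. \<Sum>u=1..U. \<epsilon> u * f u x) \<partial>measure_pmf (random_signs U))" .
qed

text \<open>R-boundedness is the square function estimate, which applied to multiples of indicators of cubes gives direct
  testing; its dual estimate gives dual testing.\<close>
lemma testing_of_R_bound:
  assumes R: "R_bound p \<sigma> q w (shift_op D \<sigma> ` \<S>) C" "C < \<infinity>"
  defines "r \<equiv> khintchine_lower_const * enn2real C * (khintchine_const p powr (1/p))"
  shows "direct_testing_bound D p q \<sigma> w \<S> (ennreal r)" "dual_testing_bound D p q \<sigma> w \<S> (ennreal r)"
proof -
  have r: "0 \<le> r" unfolding r_def using khintchine_lower_const_pos by simp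
  have conj: "1 < conj_exp p" "1 < conj_exp q" using exponents conj_exp_gt_1 by auto
  have *: "Lp_norm q w (\<lambda>x. sqrt (\<Sum>u=1..U. (a u * indicator (Q u) x * shift_op D \<sigma> (S u) (indicator (Q u)) x)\<^sup>2))
        \<le> ennreal r * Lp_norm p \<sigma> (\<lambda>x. sqrt (\<Sum>u=1..U. (a u)\<^sup>2 * indicator (Q u) x)) \<and>
      Lp_norm (conj_exp p) \<sigma> (\<lambda>x. sqrt (\<Sum>u=1..U. (a u * indicator (Q u) x * shift_adj D w (S u) (indicator (Q u)) x)\<^sup>2))
        \<le> ennreal r * Lp_norm (conj_exp q) w (\<lambda>x. sqrt (\<Sum>u=1..U. (a u)\<^sup>2 * indicator (Q u) x))"
    if U: "1 \<le> U" and SQ: "\<forall>u\<in>{1..U}. S u \<in> \<S> \<and> Q u \<in> cubes D" for U S Q and a :: "nat \<Rightarrow> real"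
  proof -
    have S: "\<And>u. u \<in> {1..U} \<Longrightarrow> S u \<in> \<S>" and Q: "\<And>u. u \<in> {1..U} \<Longrightarrow> Q u \<in> cubes D" using SQ by auto
    obtain k1 n Tops where d: "shift_discretization D k1 n Tops \<sigma> w S {1..U} \<kappa> ch"
      and Qz: "\<And>u. u \<in> {1..U} \<Longrightarrow> \<exists>j z. j \<le> n \<and> z \<in> \<Union>Tops \<and> Q u = gcell (k1 + int j) z"
      using common_discretization[where S = S and Q = Q and U = U, OF S Q] by metis
    interpret d: shift_discretization D k1 n Tops \<sigma> w S "{1..U}" \<kappa> ch by (rule d)
    interpret fl: shift_discretization D k1 n Tops w \<sigma> "\<lambda>u. flip (S u)" "{1..U}" \<kappa> ch by (rule d.flipped)
    have at: "d.atomic (indicator (Q u) :: real ^ 'n \<Rightarrow> real)" if u: "u \<in> {1..U}" for u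
    proof -
      obtain j z where "j \<le> n" "z \<in> \<Union>Tops" "Q u = gcell (k1 + int j) z" using Qz[OF u] by blast
      then show ?thesis using d.indicator_subcell_atomic[of j z] by simp
    qed
    have sb: "d.square_bound p q r"
      unfolding r_def by (rule d.square_bound_of_R_bound[OF refl U R imageI[OF S] exponents])
    note sb' = d.square_bound_dual[OF sb r exponents]
    show ?thesis
      unfolding shift_adj_eq
      by (rule conjI[OF d.square_bound_testing[where Q = Q, OF refl sb r exponents at]
        fl.square_bound_testing[where Q = Q, OF refl sb' r conj(2,1) at]])
  qed
  show "direct_testing_bound D p q \<sigma> w \<S> (ennreal r)" "dual_testing_bound D p q \<sigma> w \<S> (ennreal r)"
    unfolding testing_bound_def using * by blast+
qed

end

text \<open>Continuity of the combination, with the three constants approaching their infima simultaneously.\<close>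
lemma le_Inf_combination:
  fixes K a b x :: ennreal
  assumes K: "K < \<infinity>" and a: "a < \<infinity>" and b: "b < \<infinity>"
    and fin: "Inf A1 < \<infinity>" "Inf A2 < \<infinity>" "Inf A3 < \<infinity>"
    and le: "\<And>c1 c2 c3. c1 \<in> A1 \<Longrightarrow> c2 \<in> A2 \<Longrightarrow> c3 \<in> A3 \<Longrightarrow> c1 < \<infinity> \<Longrightarrow> c2 < \<infinity> \<Longrightarrow> c3 < \<infinity> \<Longrightarrow>
      x \<le> K * (a * (c1 + c2) + b * c3)"
  shows "x \<le> K * (a * (Inf A1 + Inf A2) + b * Inf A3)"
proof (rule ennreal_le_epsilon)
  fix e :: real assume e: "0 < e"
  let ?G = "K * (a + a + b)"
  \<comment> \<open>\<open>?G\<close> is the total weight of the three errors \<open>\<delta>\<close>\<close>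
  define \<delta> where "\<delta> = e / (enn2real ?G + 1)"
  have G: "?G < \<infinity>" using K a b by (simp add: ennreal_mult_less_top)
  have d: "0 < \<delta>" unfolding \<delta>_def using e by (intro divide_pos_pos) (auto intro: add_nonneg_pos)
  have ex: "\<exists>c\<in>A. c < Inf A + ennreal \<delta>" if "Inf A < \<infinity>" for A :: "ennreal set"
  proof -
    have "Inf A < Inf A + ennreal \<delta>" using that d by (cases "Inf A") (auto simp: ennreal_plus[symmetric] ennreal_less_iff simp del: ennreal_plus)
    then show ?thesis by (simp add: Inf_less_iff)
  qed
  obtain c1 c2 c3 where c: "c1 \<in> A1" "c1 < Inf A1 + ennreal \<delta>" "c2 \<in> A2" "c2 < Inf A2 + ennreal \<delta>"
    "c3 \<in> A3" "c3 < Inf A3 + ennreal \<delta>"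
    using ex[OF fin(1)] ex[OF fin(2)] ex[OF fin(3)] by blast
  have cf: "c1 < \<infinity>" "c2 < \<infinity>" "c3 < \<infinity>" using c(2,4,6) by (auto intro: less_le_trans)
  have "x \<le> K * (a * (c1 + c2) + b * c3)" by (rule le[OF c(1,3,5) cf])
  also have "\<dots> \<le> K * (a * ((Inf A1 + ennreal \<delta>) + (Inf A2 + ennreal \<delta>)) + b * (Inf A3 + ennreal \<delta>))"
    using c by (intro mult_left_mono add_mono) (auto intro: less_imp_le)
  also have "\<dots> = K * (a * (Inf A1 + Inf A2) + b * Inf A3) + ?G * ennreal \<delta>"
    by (simp only: distrib_left distrib_right add_ac mult.assoc)
  also have "?G * ennreal \<delta> \<le> ennreal e"
  proof -
    have "?G * ennreal \<delta> = ennreal (enn2real ?G) * ennreal \<delta>" using G by simp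
    also have "\<dots> = ennreal (enn2real ?G * \<delta>)" using d by (intro ennreal_mult[symmetric]) auto
    also have "enn2real ?G * \<delta> \<le> e"
    proof -
      have "t * (e / (t + 1)) \<le> e" if "0 \<le> t" for t
        using that e by (simp add: pos_divide_le_eq distrib_left)
      from this[OF enn2real_nonneg] show ?thesis unfolding \<delta>_def .
    qed
    finally show ?thesis by (simp add: ennreal_leI)
  qed
  finally show "x \<le> K * (a * (Inf A1 + Inf A2) + b * Inf A3) + ennreal e" by (simp add: add_left_mono)
qed

theorem theorem5p4:
  fixes p q :: real
  assumes "1 < p" and "1 < q"
  shows "\<exists>C::real. 0 < C \<and>
    (\<forall>(D :: 'n::finite lattice) ch \<sigma> w (\<S> :: 'n shift_data set) (\<kappa> :: nat).
       dyadic_lattice D \<longrightarrow> child_enumeration D ch \<longrightarrow>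
       radon_measure \<sigma> \<longrightarrow> radon_measure w \<longrightarrow>
       quad_Astar D ch p q \<sigma> w < \<infinity> \<longrightarrow>
       (\<forall>S\<in>\<S>. dyadic_shift D S \<and> join_form D S \<and> complexity S \<le> \<kappa>) \<longrightarrow>
       (R_bounded p \<sigma> q w (shift_op D \<sigma> ` \<S>) \<longleftrightarrow>
          (\<exists>C1<\<infinity>. direct_testing_bound D p q \<sigma> w \<S> C1) \<and>
          (\<exists>C2<\<infinity>. dual_testing_bound D p q \<sigma> w \<S> C2)) \<and>
       (R_bounded p \<sigma> q w (shift_op D \<sigma> ` \<S>) \<longrightarrow>
          R_const p \<sigma> q w (shift_op D \<sigma> ` \<S>)
            \<le> ennreal C *
              ((1 + of_nat \<kappa>) *
                 (direct_testing_const D p q \<sigma> w \<S> + dual_testing_const D p q \<sigma> w \<S>)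
               + (1 + of_nat \<kappa>)\<^sup>2 * quad_Astar D ch p q \<sigma> w)))"
proof -
  \<comment> \<open>adding 1 below makes the constant positive\<close>
  define K where "K = khintchine_const q powr (1/q) * khintchine_lower_const * form_const p q (2 ^ CARD('n))"
  have K: "0 \<le> K"
    unfolding K_def using khintchine_lower_const_pos form_const_nonneg[of p q "2 ^ CARD('n)"] assms by (auto intro!: mult_nonneg_nonneg)
  have main: "(R_bounded p \<sigma> q w (shift_op D \<sigma> ` \<S>) \<longleftrightarrow>
          (\<exists>C1<\<infinity>. direct_testing_bound D p q \<sigma> w \<S> C1) \<and>
          (\<exists>C2<\<infinity>. dual_testing_bound D p q \<sigma> w \<S> C2)) \<and>
       (R_bounded p \<sigma> q w (shift_op D \<sigma> ` \<S>) \<longrightarrow>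
          R_const p \<sigma> q w (shift_op D \<sigma> ` \<S>)
            \<le> ennreal (K + 1) *
              ((1 + of_nat \<kappa>) *
                 (direct_testing_const D p q \<sigma> w \<S> + dual_testing_const D p q \<sigma> w \<S>)
               + (1 + of_nat \<kappa>)\<^sup>2 * quad_Astar D ch p q \<sigma> w))"
    if "dyadic_lattice D" "child_enumeration D ch" "radon_measure \<sigma>" "radon_measure w"
      and A: "quad_Astar D ch p q \<sigma> w < \<infinity>"
      and shifts: "\<forall>S\<in>\<S>. dyadic_shift D S \<and> join_form D S \<and> complexity S \<le> \<kappa>"
    for D :: "'n lattice" and ch \<sigma> w \<S> \<kappa>
  proof -
    interpret shift_family D ch \<sigma> w p q \<S> \<kappa>
      by unfold_locales (use that assms in auto)
    let ?R = "R_bound p \<sigma> q w (shift_op D \<sigma> ` \<S>)"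
    let ?c1 = "{C. direct_testing_bound D p q \<sigma> w \<S> C}" and ?c2 = "{C. dual_testing_bound D p q \<sigma> w \<S> C}"
      and ?c3 = "{C. quad_Astar_bound D ch p q \<sigma> w C}"
    let ?a = "1 + of_nat \<kappa> :: ennreal"
    have fin: "?a < \<infinity>" "?a\<^sup>2 < \<infinity>" by (simp_all add: power2_eq_square ennreal_mult_less_top of_nat_less_top)
    have nec: "\<exists>C1<\<infinity>. direct_testing_bound D p q \<sigma> w \<S> C1" "\<exists>C2<\<infinity>. dual_testing_bound D p q \<sigma> w \<S> C2"
      if R: "R_bounded p \<sigma> q w (shift_op D \<sigma> ` \<S>)"
    proof -
      obtain C where C: "?R C" "C < \<infinity>" using R unfolding R_bounded_def by blast
      show "\<exists>C1<\<infinity>. direct_testing_bound D p q \<sigma> w \<S> C1" "\<exists>C2<\<infinity>. dual_testing_bound D p q \<sigma> w \<S> C2"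
        by (rule exI, rule conjI[OF _ testing_of_R_bound(1)[OF C]], simp)
           (rule exI, rule conjI[OF _ testing_of_R_bound(2)[OF C]], simp)
    qed
    obtain C3 where C3: "quad_Astar_bound D ch p q \<sigma> w C3" "C3 < \<infinity>"
      using A unfolding quad_Astar_def Inf_less_iff by auto
    have suf: "R_bounded p \<sigma> q w (shift_op D \<sigma> ` \<S>)"
      if "C1 < \<infinity>" "direct_testing_bound D p q \<sigma> w \<S> C1" "C2 < \<infinity>" "dual_testing_bound D p q \<sigma> w \<S> C2" for C1 C2
    proof -
      have "ennreal K * (?a * (C1 + C2) + ?a\<^sup>2 * C3) < \<infinity>"
        using that C3 fin by (simp add: ennreal_mult_less_top)
      then show ?thesis
        using R_bound_of_testing[OF that(2,1,4,3) C3, folded K_def] unfolding R_bounded_def by (intro exI conjI)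
    qed
    have "R_const p \<sigma> q w (shift_op D \<sigma> ` \<S>) \<le> ennreal (K + 1) * (?a * (Inf ?c1 + Inf ?c2) + ?a\<^sup>2 * Inf ?c3)"
      if R: "R_bounded p \<sigma> q w (shift_op D \<sigma> ` \<S>)"
    proof (rule le_Inf_combination)
      show "Inf ?c1 < \<infinity>" "Inf ?c2 < \<infinity>" using nec[OF R] unfolding Inf_less_iff by auto
      show "Inf ?c3 < \<infinity>" using A unfolding quad_Astar_def .
      fix c1 c2 c3
      assume c: "c1 \<in> ?c1" "c2 \<in> ?c2" "c3 \<in> ?c3" "c1 < \<infinity>" "c2 < \<infinity>" "c3 < \<infinity>"
      have "?R (ennreal K * (?a * (c1 + c2) + ?a\<^sup>2 * c3))"
        unfolding K_def using c by (intro R_bound_of_testing) auto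
      then have "R_const p \<sigma> q w (shift_op D \<sigma> ` \<S>) \<le> ennreal K * (?a * (c1 + c2) + ?a\<^sup>2 * c3)"
        unfolding R_const_def by (intro Inf_lower) simp
      also have "\<dots> \<le> ennreal (K + 1) * (?a * (c1 + c2) + ?a\<^sup>2 * c3)"
        by (intro mult_right_mono ennreal_leI) auto
      finally show "R_const p \<sigma> q w (shift_op D \<sigma> ` \<S>) \<le> ennreal (K + 1) * (?a * (c1 + c2) + ?a\<^sup>2 * c3)" .
    qed (use fin in auto)
    then show ?thesis
      unfolding direct_testing_const_def dual_testing_const_def quad_Astar_def
      by (intro conjI iffI impI) (use nec suf in blast)+
  qed
  show ?thesis
  proof (rule exI[of _ "K + 1"], rule conjI)
    show "0 < K + 1" using K by simp
  qed (intro allI impI, rule main)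
qed

end
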